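(* For $\theta\in(0,\pi)$ and $\nu\in(0,1)$ let $T_\theta^{(\nu)}$ be the self-adjoint realization of the Bessel expression and $\xi\big(\cdot;T_\theta^{(\nu)},T_0^{(\nu)}\big)$ the spectral shift function, as in the context. Define $$e_{\theta,\nu}=-\left[\frac{\Gamma(1+\nu)2^{2\nu+1}\nu|\cot(\theta)|}{\Gamma(1-\nu)}\right]^{1/\nu}\ (\nu\in(0,1)),\qquad \lambda_{\theta,\nu}=\left[\frac{\Gamma(1+\nu)2^{2\nu+1}\nu|\cot(\theta)|}{\Gamma(1-\nu)|\cos(\nu\pi)|}\right]^{1/\nu}\ (\nu\in(0,1)\setminus\{\tfrac12\}),$$ and, for $(\theta,\nu)\ne(\frac\pi2,\frac12)$ and $\lambda\in\mathbb R$, with $D_{\theta,\nu}(\lambda)=\Gamma(1+\nu)2^{2\nu+1}\nu\cot(\theta)+\Gamma(1-\nu)\cos(\nu\pi)|\lambda|^\nu$, let $\Xi_{\theta,\nu}(\lambda)=0$ if $D_{\theta,\nu}(\lambda)=0$ and $$\Xi_{\theta,\nu}(\lambda)=-\frac1\pi\arctan\left(\frac{\Gamma(1-\nu)\sin(\nu\pi)|\lambda|^\nu}{D_{\theta,\nu}(\lambda)}\right)\quad\text{otherwise}.$$ Then the following hold ($\chi_S$ denotes the characteristic function of $S$). (i) If $\theta\in(0,\frac\pi2]$, $\nu\in(0,\frac12]$ and $(\theta,\nu)\neq(\frac\pi2,\frac12)$, then $\xi\big(\lambda;T_\theta^{(\nu)},T_0^{(\nu)}\big)=\chi_{(0,\infty)}(\lambda)\,\Xi_{\theta,\nu}(\lambda)$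 for a.e. $\lambda\in\mathbb R$. In particular, $T_\theta^{(\nu)}$ has no negative eigenvalues. (ii) If $\theta\in(0,\frac\pi2]$ and $\nu\in(\frac12,1)$, then $\xi\big(\lambda;T_\theta^{(\nu)},T_0^{(\nu)}\big)=-\chi_{(\lambda_{\theta,\nu},\infty)}(\lambda)+\chi_{(0,\infty)}(\lambda)\,\Xi_{\theta,\nu}(\lambda)$ for a.e. $\lambda\in\mathbb R$. In particular, $T_\theta^{(\nu)}$ has no negative eigenvalues. (iii) If $\theta\in(\frac\pi2,\pi)$ and $\nu\in(0,\frac12)$, then $\xi\big(\lambda;T_\theta^{(\nu)},T_0^{(\nu)}\big)=-\chi_{(e_{\theta,\nu},\lambda_{\theta,\nu})}(\lambda)+\chi_{(0,\infty)}(\lambda)\,\Xi_{\theta,\nu}(\lambda)$ for a.e. $\lambda\in\mathbb R$. In particular, $T_\theta^{(\nu)}$ has a single negative eigenvalue $e_{\theta,\nu}$ of multiplicity one. (iv) If $\theta\in(\frac\pi2,\pi)$ and $\nu\in[\frac12,1)$, then $\xi\big(\lambda;T_\theta^{(\nu)},T_0^{(\nu)}\big)=-\chi_{(e_{\theta,\nu},\infty)}(\lambda)+\chi_{(0,\infty)}(\lambda)\,\Xi_{\theta,\nu}(\lambda)$ for a.e. $\lambda\in\mathbb R$. In particular, $T_\theta^{(\nu)}$ has a single negative eigenvalue $e_{\theta,\nu}$ of multiplicity one. (v) If $\theta=\frac\pi2$ and $\nu=\frac12$, then $\xi\big(\lambda;T_{\pi/2}^{(1/2)},T_0^{(1/2)}\big)=-\frac12\chi_{(0,\infty)}(\lambda)$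 for a.e. $\lambda\in\mathbb R$. In particular, $T_{\pi/2}^{(1/2)}$ has no negative eigenvalues.
   Context: $I$ is the identity in $L^2((0,\infty);dx)$ and $\operatorname{tr}$ the trace on trace class operators there. $\mathfrak D(0,\infty)$ is the set of $f\in AC_{\mathrm{loc}}(0,\infty)$ with $f'\in AC_{\mathrm{loc}}(0,\infty)$, and $\tau_\nu f=-f''+\frac{\nu^2-1/4}{x^2}f$. The maximal operator $T_{\max}^{(\nu)}$ acts as $\tau_\nu$ on $\{g\in\mathfrak D(0,\infty): g,\tau_\nu g\in L^2((0,\infty);dx)\}$, and $T_{\min}^{(\nu)}=(T_{\max}^{(\nu)})^*$. Write $[f,g](x)=f(x)\overline{g'(x)}-f'(x)\overline{g(x)}$ and $[f,g](0)=\lim_{x\downarrow0}[f,g](x)$, which exists for $f,g\in\operatorname{dom}(T_{\max}^{(\nu)})$. For $\nu\in(0,1)$ fix real-valued $\phi_{0,\nu},\psi_{0,\nu}\in\operatorname{dom}(T_{\max}^{(\nu)})$ vanishing in a neighborhood of $\infty$ with $\phi_{0,\nu}(x)=x^{\frac12+\nu}$ and $\psi_{0,\nu}(x)=\frac1{2\nu}x^{\frac12-\nu}$ for $x\in(0,1)$. For $\theta\in[0,\pi)$, $T_\theta^{(\nu)}$ is the restriction of $T_{\max}^{(\nu)}$ to $$\{g\in\operatorname{dom}(T_{\max}^{(\nu)}):\cos(\theta)[g,\phi_{0,\nu}](0)+\sin(\theta)[g,\psi_{0,\nu}](0)=0\}.$$ These are known to be exactly the self-adjoint extensions of $T_{\min}^{(\nu)}$;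 they are bounded from below, $T_0^{(\nu)}$ is the Friedrichs extension, and $\sigma(T_0^{(\nu)})=[0,\infty)$. Spectral shift function: for self-adjoint operators $S,S_0$ bounded from below such that $(S-zI)^{-1}-(S_0-zI)^{-1}$ is trace class for $z\in\mathbb C\setminus\mathbb R$ (as is the case for $S=T_\theta^{(\nu)}$, $S_0=T_0^{(\nu)}$), $\xi(\cdot;S,S_0)$ is the unique (up to a.e. equality) real-valued function in $L^1(\mathbb R;(1+\lambda^2)^{-1}d\lambda)$ such that $\xi(\lambda;S,S_0)=0$ for $\lambda<\min[\sigma(S)\cup\sigma(S_0)]$ and $$\operatorname{tr}\big((S-zI)^{-1}-(S_0-zI)^{-1}\big)=-\int_{\mathbb R}\frac{\xi(\lambda;S,S_0)}{(\lambda-z)^2}\,d\lambda,\qquad z\in\mathbb C\setminus\mathbb R.$$ *)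

theory Defs
  imports "HOL-Analysis.Analysis"
begin

section \<open>The Hilbert space of square integrable functions on the half-line\<close>

abbreviation halfline :: "real measure" where
  "halfline \<equiv> lebesgue_on {0<..}"

definition sq_integrable :: "(real \<Rightarrow> complex) set" where
  "sq_integrable =
     {f \<in> borel_measurable halfline. integrable halfline (\<lambda>x. (cmod (f x))\<^sup>2)}"

definition L2_eq :: "(real \<Rightarrow> complex) \<Rightarrow> (real \<Rightarrow> complex) \<Rightarrow> bool" where
  "L2_eq f g \<longleftrightarrow>
     f \<in> sq_integrable \<and> g \<in> sq_integrable \<and> (AE x in halfline. f x = g x)"

lemma sq_integrable_add:
  assumes "f \<in> sq_integrable" "g \<in> sq_integrable"
  shows "(\<lambda>x. f x + g x) \<in> sq_integrable"
proof -
  have m: "f \<in> borel_measurable halfline" "g \<in> borel_measurable halfline"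
    and i: "integrable halfline (\<lambda>x. (cmod (f x))\<^sup>2)" "integrable halfline (\<lambda>x. (cmod (g x))\<^sup>2)"
    using assms by (auto simp: sq_integrable_def)
  have "integrable halfline (\<lambda>x. 2 * (cmod (f x))\<^sup>2 + 2 * (cmod (g x))\<^sup>2)"
    using i by auto
  then have "integrable halfline (\<lambda>x. (cmod (f x + g x))\<^sup>2)"
  proof (rule Bochner_Integration.integrable_bound)
    show "(\<lambda>x. (cmod (f x + g x))\<^sup>2) \<in> borel_measurable halfline"
      using m by measurable
    have "(cmod (a + b))\<^sup>2 \<le> 2 * (cmod a)\<^sup>2 + 2 * (cmod b)\<^sup>2" for a b
    proof -
      have "(cmod (a + b))\<^sup>2 \<le> (cmod a + cmod b)\<^sup>2"
        by (intro power_mono norm_triangle_ineq) simp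
      also have "\<dots> \<le> 2 * (cmod a)\<^sup>2 + 2 * (cmod b)\<^sup>2"
        using zero_le_power2[of "cmod a - cmod b"] by (simp add: power2_eq_square algebra_simps)
      finally show ?thesis .
    qed
    then show "AE x in halfline. norm ((cmod (f x + g x))\<^sup>2)
        \<le> norm (2 * (cmod (f x))\<^sup>2 + 2 * (cmod (g x))\<^sup>2)"
      by simp
  qed
  with m show ?thesis by (simp add: sq_integrable_def)
qed

lemma sq_integrable_scale:
  assumes "f \<in> sq_integrable"
  shows "(\<lambda>x. c * f x) \<in> sq_integrable"
  using assms by (auto simp: sq_integrable_def norm_mult power_mult_distrib)

lemma sq_integrable_zero: "(\<lambda>x. 0) \<in> sq_integrable"
  by (simp add: sq_integrable_def)

lemma integrable_mult_cnj:
  assumes "f \<in> sq_integrable" "g \<in> sq_integrable"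
  shows "integrable halfline (\<lambda>x. f x * cnj (g x))"
proof -
  have m: "f \<in> borel_measurable halfline" "g \<in> borel_measurable halfline"
    and i: "integrable halfline (\<lambda>x. (cmod (f x))\<^sup>2)" "integrable halfline (\<lambda>x. (cmod (g x))\<^sup>2)"
    using assms by (auto simp: sq_integrable_def)
  have "integrable halfline (\<lambda>x. (cmod (f x))\<^sup>2 + (cmod (g x))\<^sup>2)"
    using i by auto
  then show ?thesis
  proof (rule Bochner_Integration.integrable_bound)
    have "(\<lambda>x. cnj (g x)) \<in> borel_measurable halfline"
      using m(2) by (rule borel_measurable_continuous_on[OF continuous_on_cnj[OF continuous_on_id]])
    then show "(\<lambda>x. f x * cnj (g x)) \<in> borel_measurable halfline"
      using m(1) by measurable
    have "cmod (a * cnj b) \<le> (cmod a)\<^sup>2 + (cmod b)\<^sup>2" for a b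
    proof -
      have "2 * (cmod a * cmod b) \<le> (cmod a)\<^sup>2 + (cmod b)\<^sup>2"
        using zero_le_power2[of "cmod a - cmod b"] by (simp add: power2_diff)
      moreover have "0 \<le> cmod a * cmod b" by simp
      ultimately have "cmod a * cmod b \<le> (cmod a)\<^sup>2 + (cmod b)\<^sup>2" by linarith
      then show ?thesis by (simp add: norm_mult)
    qed
    then show "AE x in halfline. norm (f x * cnj (g x))
        \<le> norm ((cmod (f x))\<^sup>2 + (cmod (g x))\<^sup>2)"
      by simp
  qed
qed

lemma L2_eq_refl_iff: "L2_eq f f \<longleftrightarrow> f \<in> sq_integrable"
  by (simp add: L2_eq_def)

quotient_type L2 = "real \<Rightarrow> complex" / partial: L2_eq
proof (rule part_equivpI)
  show "\<exists>f. L2_eq f f"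
    using sq_integrable_zero by (auto simp: L2_eq_refl_iff)
  show "symp L2_eq"
    by (auto simp: symp_def L2_eq_def elim: AE_mp)
  show "transp L2_eq"
  proof (rule transpI)
    fix f g h assume a: "L2_eq f g" "L2_eq g h"
    then have "AE x in halfline. f x = g x" "AE x in halfline. g x = h x"
      by (auto simp: L2_eq_def)
    then have "AE x in halfline. f x = h x" by eventually_elim simp
    with a show "L2_eq f h" by (simp add: L2_eq_def)
  qed
qed

text \<open>For \<^term>\<open>f \<in> sq_integrable\<close>, the element of \<^typ>\<open>L2\<close> represented by \<^term>\<open>f\<close> is
  \<^term>\<open>abs_L2 f\<close>.\<close>

lift_definition scaleC :: "complex \<Rightarrow> L2 \<Rightarrow> L2" (infixr \<open>*\<^sub>C\<close> 75)
  is "\<lambda>c f x. c * f x"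
  by (auto simp: L2_eq_def intro: sq_integrable_scale elim: AE_mp)

lift_definition cinner :: "L2 \<Rightarrow> L2 \<Rightarrow> complex"
  is "\<lambda>f g. integral\<^sup>L halfline (\<lambda>x. f x * cnj (g x))"
proof -
  fix f f' g g' assume a: "L2_eq f f'" "L2_eq g g'"
  then have "AE x in halfline. f x = f' x" "AE x in halfline. g x = g' x"
    by (auto simp: L2_eq_def)
  then have "AE x in halfline. f x * cnj (g x) = f' x * cnj (g' x)"
    by eventually_elim simp
  moreover have "integrable halfline (\<lambda>x. f x * cnj (g x))"
    "integrable halfline (\<lambda>x. f' x * cnj (g' x))"
    using a by (auto simp: L2_eq_def intro: integrable_mult_cnj)
  ultimately show "integral\<^sup>L halfline (\<lambda>x. f x * cnj (g x)) =
      integral\<^sup>L halfline (\<lambda>x. f' x * cnj (g' x))"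
    by (intro integral_cong_AE) auto
qed

instantiation L2 :: real_vector
begin

lift_definition zero_L2 :: L2 is "\<lambda>x. 0"
  by (simp add: L2_eq_refl_iff sq_integrable_zero)

lift_definition plus_L2 :: "L2 \<Rightarrow> L2 \<Rightarrow> L2" is "\<lambda>f g x. f x + g x"
proof -
  fix f f' g g' assume a: "L2_eq f f'" "L2_eq g g'"
  then have "AE x in halfline. f x = f' x" "AE x in halfline. g x = g' x"
    by (auto simp: L2_eq_def)
  then have "AE x in halfline. f x + g x = f' x + g' x" by eventually_elim simp
  with a show "L2_eq (\<lambda>x. f x + g x) (\<lambda>x. f' x + g' x)"
    by (simp add: L2_eq_def sq_integrable_add)
qed

definition uminus_L2 :: "L2 \<Rightarrow> L2" where "- u = (-1) *\<^sub>C u" for u :: L2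
definition minus_L2 :: "L2 \<Rightarrow> L2 \<Rightarrow> L2" where "u - v = u + - v" for u v :: L2
definition scaleR_L2 :: "real \<Rightarrow> L2 \<Rightarrow> L2" where "r *\<^sub>R u = complex_of_real r *\<^sub>C u" for u :: L2

instance
proof
  fix u v w :: L2 and a b :: real
  show "u + v + w = u + (v + w)"
    by transfer (simp add: L2_eq_def add.assoc sq_integrable_add)
  show "u + v = v + u"
    by transfer (simp add: L2_eq_def add.commute sq_integrable_add)
  show "0 + u = u"
    by transfer (simp add: L2_eq_def)
  show "- u + u = 0"
    unfolding uminus_L2_def by transfer (simp add: L2_eq_def sq_integrable_zero)
  show "u - v = u + - v"
    by (rule minus_L2_def)
  show "a *\<^sub>R (u + v) = a *\<^sub>R u + a *\<^sub>R v"
    unfolding scaleR_L2_def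
    by transfer (simp add: L2_eq_def distrib_left sq_integrable_add sq_integrable_scale)
  show "(a + b) *\<^sub>R u = a *\<^sub>R u + b *\<^sub>R u"
    unfolding scaleR_L2_def
    by transfer (simp add: L2_eq_def distrib_right sq_integrable_add sq_integrable_scale)
  show "a *\<^sub>R b *\<^sub>R u = (a * b) *\<^sub>R u"
    unfolding scaleR_L2_def
    by transfer (simp add: L2_eq_def mult.assoc sq_integrable_scale)
  show "1 *\<^sub>R u = u"
    unfolding scaleR_L2_def by transfer (simp add: L2_eq_def)
qed

end

lemma cinner_add_left: "cinner (u + v) w = cinner u w + cinner v w"
proof (transfer, simp only: L2_eq_refl_iff)
  fix f g h assume "f \<in> sq_integrable" "g \<in> sq_integrable" "h \<in> sq_integrable"
  then show "integral\<^sup>L halfline (\<lambda>x. (f x + g x) * cnj (h x)) =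
      integral\<^sup>L halfline (\<lambda>x. f x * cnj (h x)) + integral\<^sup>L halfline (\<lambda>x. g x * cnj (h x))"
    by (simp add: distrib_right integrable_mult_cnj)
qed

lemma cinner_scaleC_left: "cinner (c *\<^sub>C u) w = c * cinner u w"
proof (transfer, simp only: L2_eq_refl_iff)
  fix c f h
  show "integral\<^sup>L halfline (\<lambda>x. c * f x * cnj (h x)) =
      c * integral\<^sup>L halfline (\<lambda>x. f x * cnj (h x))"
    by (simp add: mult.assoc)
qed

lemma cinner_commute: "cinner u v = cnj (cinner v u)"
proof (transfer, simp only: L2_eq_refl_iff)
  fix f g
  have "cnj (integral\<^sup>L halfline (\<lambda>x. g x * cnj (f x))) =
      integral\<^sup>L halfline (\<lambda>x. cnj (g x * cnj (f x)))"
    by (rule Bochner_Integration.integral_cnj[symmetric])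
  then show "integral\<^sup>L halfline (\<lambda>x. f x * cnj (g x)) =
      cnj (integral\<^sup>L halfline (\<lambda>x. g x * cnj (f x)))"
    by (simp add: mult.commute)
qed

lemma cinner_self:
  assumes "f \<in> sq_integrable"
  shows "integral\<^sup>L halfline (\<lambda>x. f x * cnj (f x)) =
    complex_of_real (integral\<^sup>L halfline (\<lambda>x. (cmod (f x))\<^sup>2))"
  by (simp add: complex_norm_square[symmetric] flip: integral_complex_of_real of_real_power)

lemma cinner_self_nonneg: "0 \<le> Re (cinner u u)"
  by (transfer, simp only: L2_eq_refl_iff, simp add: cinner_self)

lemma cinner_self_eq_0: "Re (cinner u u) = 0 \<longleftrightarrow> u = 0"
proof (transfer, simp only: L2_eq_refl_iff)
  fix f assume f: "f \<in> sq_integrable"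
  then have "integrable halfline (\<lambda>x. (cmod (f x))\<^sup>2)" by (simp add: sq_integrable_def)
  then have "integral\<^sup>L halfline (\<lambda>x. (cmod (f x))\<^sup>2) = 0 \<longleftrightarrow> (AE x in halfline. (cmod (f x))\<^sup>2 = 0)"
    by (intro integral_nonneg_eq_0_iff_AE) auto
  with f show "Re (integral\<^sup>L halfline (\<lambda>x. f x * cnj (f x))) = 0 \<longleftrightarrow> L2_eq f (\<lambda>x. 0)"
    by (simp add: cinner_self L2_eq_def sq_integrable_zero)
qed

text \<open>The real inner product is the real part of the complex one; both induce the same norm.\<close>

instantiation L2 :: real_inner
begin

definition inner_L2 :: "L2 \<Rightarrow> L2 \<Rightarrow> real" where "inner u v = Re (cinner u v)"
definition norm_L2 :: "L2 \<Rightarrow> real" where "norm u = sqrt (Re (cinner u u))" for u :: L2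
definition sgn_L2 :: "L2 \<Rightarrow> L2" where "sgn u = u /\<^sub>R norm u" for u :: L2
definition dist_L2 :: "L2 \<Rightarrow> L2 \<Rightarrow> real" where "dist u v = norm (u - v)" for u v :: L2
definition uniformity_L2 :: "(L2 \<times> L2) filter" where
  "uniformity = (INF e\<in>{0<..}. principal {(u, v). dist u (v :: L2) < e})"
definition open_L2 :: "L2 set \<Rightarrow> bool" where
  "open U \<longleftrightarrow> (\<forall>u\<in>U. eventually (\<lambda>(u', v). u' = u \<longrightarrow> v \<in> U) uniformity)" for U :: "L2 set"

instance
proof
  fix u v w :: L2 and r :: real and U :: "L2 set"
  show "sgn u = u /\<^sub>R norm u" by (rule sgn_L2_def)
  show "dist u v = norm (u - v)" by (rule dist_L2_def)
  show "(uniformity :: (L2 \<times> L2) filter) = (INF e\<in>{0<..}. principal {(u, v). dist u v < e})"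
    by (rule uniformity_L2_def)
  show "open U \<longleftrightarrow> (\<forall>u\<in>U. \<forall>\<^sub>F (u', v) in uniformity. u' = u \<longrightarrow> v \<in> U)"
    by (rule open_L2_def)
  show "inner u v = inner v u"
    unfolding inner_L2_def using cinner_commute[of u v] by simp
  show "inner (u + v) w = inner u w + inner v w"
    by (simp add: inner_L2_def cinner_add_left)
  show "inner (r *\<^sub>R u) v = r * inner u v"
    by (simp add: inner_L2_def scaleR_L2_def cinner_scaleC_left)
  show "0 \<le> inner u u" by (simp add: inner_L2_def cinner_self_nonneg)
  show "inner u u = 0 \<longleftrightarrow> u = 0" by (simp add: inner_L2_def cinner_self_eq_0)
  show "norm u = sqrt (inner u u)" by (simp add: inner_L2_def norm_L2_def)
qed

end

global_interpretation L2: vector_space scaleC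
proof
  fix a b :: complex and u v :: L2
  show "a *\<^sub>C (u + v) = a *\<^sub>C u + a *\<^sub>C v"
    by transfer (simp add: L2_eq_def distrib_left sq_integrable_add sq_integrable_scale)
  show "(a + b) *\<^sub>C u = a *\<^sub>C u + b *\<^sub>C u"
    by transfer (simp add: L2_eq_def distrib_right sq_integrable_add sq_integrable_scale)
  show "a *\<^sub>C b *\<^sub>C u = (a * b) *\<^sub>C u"
    by transfer (simp add: L2_eq_def mult.assoc sq_integrable_scale)
  show "1 *\<^sub>C u = u"
    by transfer (simp add: L2_eq_def)
qed


section \<open>Unbounded operators, represented by their graphs\<close>

type_synonym L2_op = "(L2 \<times> L2) set"

definition op_adjoint :: "L2_op \<Rightarrow> L2_op" where
  "op_adjoint T = {(u, v). \<forall>(f, h)\<in>T. cinner h u = cinner f v}"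

definition self_adjoint :: "L2_op \<Rightarrow> bool" where
  "self_adjoint T \<longleftrightarrow> closure (Domain T) = UNIV \<and> op_adjoint T = T"

definition bounded_from_below :: "L2_op \<Rightarrow> bool" where
  "bounded_from_below T \<longleftrightarrow> (\<exists>c. \<forall>(u, v)\<in>T. c * (norm u)\<^sup>2 \<le> Re (cinner v u))"

text \<open>The graph of \<open>T - z I\<close>.\<close>

definition op_shift :: "L2_op \<Rightarrow> complex \<Rightarrow> L2_op" where
  "op_shift T z = {(u, v - z *\<^sub>C u) | u v. (u, v) \<in> T}"

text \<open>The value at \<open>f\<close> of the inverse of \<open>T - z I\<close>; meaningful if \<open>z\<close> lies in the resolvent set.\<close>

definition resolvent :: "L2_op \<Rightarrow> complex \<Rightarrow> L2 \<Rightarrow> L2" where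
  "resolvent T z f = (THE u. (u, f) \<in> op_shift T z)"

definition resolvent_set :: "L2_op \<Rightarrow> complex set" where
  "resolvent_set T =
     {z. (\<forall>f. \<exists>!u. (u, f) \<in> op_shift T z) \<and> bounded_linear (resolvent T z)}"

definition op_spectrum :: "L2_op \<Rightarrow> complex set" where
  "op_spectrum T = - resolvent_set T"

definition eigenspace :: "L2_op \<Rightarrow> complex \<Rightarrow> L2 set" where
  "eigenspace T \<mu> = {u. (u, \<mu> *\<^sub>C u) \<in> T}"

definition is_eigenvalue :: "L2_op \<Rightarrow> complex \<Rightarrow> bool" where
  "is_eigenvalue T \<mu> \<longleftrightarrow> (\<exists>u\<in>eigenspace T \<mu>. u \<noteq> 0)"

definition negative_eigenvalues :: "L2_op \<Rightarrow> real set" where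
  "negative_eigenvalues T = {\<mu>. \<mu> < 0 \<and> is_eigenvalue T (complex_of_real \<mu>)}"

text \<open>Here \<open>L2.dim\<close> is the dimension over the complex numbers (a \<open>nat\<close>, which is \<open>0\<close> in infinite dimension).\<close>

definition eigen_multiplicity :: "L2_op \<Rightarrow> complex \<Rightarrow> nat" where
  "eigen_multiplicity T \<mu> = L2.dim (eigenspace T \<mu>)"


section \<open>Trace class operators and the trace\<close>

definition bounded_clinear :: "(L2 \<Rightarrow> L2) \<Rightarrow> bool" where
  "bounded_clinear A \<longleftrightarrow> bounded_linear A \<and> (\<forall>c u. A (c *\<^sub>C u) = c *\<^sub>C A u)"

definition positive_op :: "(L2 \<Rightarrow> L2) \<Rightarrow> bool" where
  "positive_op P \<longleftrightarrow>
     bounded_clinear P \<and> (\<forall>u. Im (cinner (P u) u) = 0 \<and> 0 \<le> Re (cinner (P u) u))"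

text \<open>\<open>P = \<bar>A\<bar>\<close>, that is, \<open>P\<close> is positive and \<open>P\<^sup>2 = A\<^sup>* A\<close>.\<close>

definition is_absolute_value :: "(L2 \<Rightarrow> L2) \<Rightarrow> (L2 \<Rightarrow> L2) \<Rightarrow> bool" where
  "is_absolute_value A P \<longleftrightarrow>
     positive_op P \<and> (\<forall>u v. cinner (P (P u)) v = cinner (A u) (A v))"

text \<open>The space is separable and infinite-dimensional, so its orthonormal bases are sequences.\<close>

definition orthonormal_basis :: "(nat \<Rightarrow> L2) \<Rightarrow> bool" where
  "orthonormal_basis e \<longleftrightarrow>
     (\<forall>m n. cinner (e m) (e n) = (if m = n then 1 else 0)) \<and>
     closure (L2.span (range e)) = UNIV"

definition trace_class :: "(L2 \<Rightarrow> L2) \<Rightarrow> bool" where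
  "trace_class A \<longleftrightarrow>
     bounded_clinear A \<and>
     (\<exists>P e. is_absolute_value A P \<and> orthonormal_basis e \<and>
        summable (\<lambda>n. Re (cinner (P (e n)) (e n))))"

text \<open>For trace class \<open>A\<close>, the common value of the sums over all orthonormal bases.\<close>

definition op_trace :: "(L2 \<Rightarrow> L2) \<Rightarrow> complex" where
  "op_trace A = (THE t. \<forall>e. orthonormal_basis e \<longrightarrow> (\<lambda>n. cinner (A (e n)) (e n)) sums t)"


section \<open>The spectral shift function\<close>

text \<open>As the function is only determined up to null sets, so is its vanishing to the left of the
  spectra. \<open>Inf\<close> is the minimum of the union of the two spectra: the spectra of self-adjoint
  operators are nonempty, closed and real.\<close>

definition is_spectral_shift :: "L2_op \<Rightarrow> L2_op \<Rightarrow> (real \<Rightarrow> real) \<Rightarrow> bool" where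
  "is_spectral_shift S S0 \<xi> \<longleftrightarrow>
     self_adjoint S \<and> self_adjoint S0 \<and>
     bounded_from_below S \<and> bounded_from_below S0 \<and>
     (\<forall>z. Im z \<noteq> 0 \<longrightarrow> trace_class (\<lambda>u. resolvent S z u - resolvent S0 z u)) \<and>
     integrable (density lborel (\<lambda>x. ennreal (1 / (1 + x\<^sup>2)))) \<xi> \<and>
     (AE x in lborel.
        x < Inf {\<mu>. complex_of_real \<mu> \<in> op_spectrum S \<union> op_spectrum S0} \<longrightarrow> \<xi> x = 0) \<and>
     (\<forall>z. Im z \<noteq> 0 \<longrightarrow>
        op_trace (\<lambda>u. resolvent S z u - resolvent S0 z u) =
          - (LINT x|lborel. complex_of_real (\<xi> x) / (complex_of_real x - z)\<^sup>2))"

text \<open>Unique up to null sets, hence an arbitrary representative is chosen.\<close>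

definition spectral_shift :: "L2_op \<Rightarrow> L2_op \<Rightarrow> real \<Rightarrow> real" where
  "spectral_shift S S0 = (SOME \<xi>. is_spectral_shift S S0 \<xi>)"


section \<open>The Bessel operators\<close>

definition abs_continuous_on_Icc :: "(real \<Rightarrow> complex) \<Rightarrow> real \<Rightarrow> real \<Rightarrow> bool" where
  "abs_continuous_on_Icc f a b \<longleftrightarrow>
     (\<forall>\<epsilon>>0. \<exists>\<delta>>0. \<forall>(n::nat) s t.
        (\<forall>i<n. a \<le> s i \<and> s i \<le> t i \<and> t i \<le> b) \<and>
        disjoint_family_on (\<lambda>i. {s i<..<t i}) {..<n} \<and>
        (\<Sum>i<n. t i - s i) < \<delta>
        \<longrightarrow> (\<Sum>i<n. cmod (f (t i) - f (s i))) < \<epsilon>)"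

definition AC_loc :: "(real \<Rightarrow> complex) set" where
  "AC_loc = {f. \<forall>a b. 0 < a \<and> a < b \<longrightarrow> abs_continuous_on_Icc f a b}"

text \<open>At points where the derivative does not exist, \<open>fderiv\<close> is an unspecified constant. A
  function in \<open>AC_loc\<close> whose \<open>fderiv\<close> is again in \<open>AC_loc\<close> is continuously differentiable
  on the half-line, and its second derivative exists almost everywhere there.\<close>

abbreviation fderiv :: "(real \<Rightarrow> complex) \<Rightarrow> real \<Rightarrow> complex" where
  "fderiv f \<equiv> (\<lambda>x. vector_derivative f (at x))"

definition D_halfline :: "(real \<Rightarrow> complex) set" where
  "D_halfline = {f \<in> AC_loc. fderiv f \<in> AC_loc}"

definition bessel_expr :: "real \<Rightarrow> (real \<Rightarrow> complex) \<Rightarrow> real \<Rightarrow> complex" where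
  "bessel_expr \<nu> f x = - fderiv (fderiv f) x + complex_of_real ((\<nu>\<^sup>2 - 1 / 4) / x\<^sup>2) * f x"

definition dom_max :: "real \<Rightarrow> (real \<Rightarrow> complex) set" where
  "dom_max \<nu> = {g \<in> D_halfline. g \<in> sq_integrable \<and> bessel_expr \<nu> g \<in> sq_integrable}"

definition lagrange_bracket :: "(real \<Rightarrow> complex) \<Rightarrow> (real \<Rightarrow> complex) \<Rightarrow> real \<Rightarrow> complex" where
  "lagrange_bracket f g x = f x * cnj (fderiv g x) - fderiv f x * cnj (g x)"

definition lagrange_bracket_0 :: "(real \<Rightarrow> complex) \<Rightarrow> (real \<Rightarrow> complex) \<Rightarrow> complex" where
  "lagrange_bracket_0 f g = Lim (at_right 0) (lagrange_bracket f g)"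

definition boundary_functions ::
    "real \<Rightarrow> (real \<Rightarrow> complex) \<Rightarrow> (real \<Rightarrow> complex) \<Rightarrow> bool" where
  "boundary_functions \<nu> \<phi> \<psi> \<longleftrightarrow>
     \<phi> \<in> dom_max \<nu> \<and> \<psi> \<in> dom_max \<nu> \<and>
     (\<forall>x>0. \<phi> x \<in> \<real> \<and> \<psi> x \<in> \<real>) \<and>
     (\<forall>\<^sub>F x in at_top. \<phi> x = 0 \<and> \<psi> x = 0) \<and>
     (\<forall>x\<in>{0<..<1}. \<phi> x = complex_of_real (x powr (1 / 2 + \<nu>)) \<and>
                     \<psi> x = complex_of_real (1 / (2 * \<nu>) * x powr (1 / 2 - \<nu>)))"

text \<open>The restriction of the maximal operator given by the boundary condition at \<open>0\<close>. The bracket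
  is evaluated at the continuously differentiable representative.\<close>

definition bessel_op ::
    "(real \<Rightarrow> complex) \<Rightarrow> (real \<Rightarrow> complex) \<Rightarrow> real \<Rightarrow> real \<Rightarrow> L2_op" where
  "bessel_op \<phi> \<psi> \<nu> \<theta> =
     {(abs_L2 g, abs_L2 (bessel_expr \<nu> g)) | g.
        g \<in> dom_max \<nu> \<and>
        complex_of_real (cos \<theta>) * lagrange_bracket_0 g \<phi> +
        complex_of_real (sin \<theta>) * lagrange_bracket_0 g \<psi> = 0}"

definition e_val :: "real \<Rightarrow> real \<Rightarrow> real" where
  "e_val \<theta> \<nu> =
     - ((Gamma (1 + \<nu>) * 2 powr (2 * \<nu> + 1) * \<nu> * \<bar>cot \<theta>\<bar> / Gamma (1 - \<nu>)) powr (1 / \<nu>))"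

definition lambda_val :: "real \<Rightarrow> real \<Rightarrow> real" where
  "lambda_val \<theta> \<nu> =
     (Gamma (1 + \<nu>) * 2 powr (2 * \<nu> + 1) * \<nu> * \<bar>cot \<theta>\<bar> /
       (Gamma (1 - \<nu>) * \<bar>cos (\<nu> * pi)\<bar>)) powr (1 / \<nu>)"

definition D_fun :: "real \<Rightarrow> real \<Rightarrow> real \<Rightarrow> real" where
  "D_fun \<theta> \<nu> x =
     Gamma (1 + \<nu>) * 2 powr (2 * \<nu> + 1) * \<nu> * cot \<theta> + Gamma (1 - \<nu>) * cos (\<nu> * pi) * \<bar>x\<bar> powr \<nu>"

definition Xi_fun :: "real \<Rightarrow> real \<Rightarrow> real \<Rightarrow> real" where
  "Xi_fun \<theta> \<nu> x =
     (if D_fun \<theta> \<nu> x = 0 then 0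
      else - (1 / pi) * arctan (Gamma (1 - \<nu>) * sin (\<nu> * pi) * \<bar>x\<bar> powr \<nu> / D_fun \<theta> \<nu> x))"

end

theory Submission
 imports Defs "HOL-Complex_Analysis.Complex_Analysis"
begin

text \<open>Writing \<open>a\<close> and \<open>b\<close> for the brackets of a function with \<open>\<phi>\<close> and \<open>\<psi>\<close> at \<open>0\<close>, Green's formula makes
 \<open>(a, b)\<close> a boundary triple: the Friedrichs extension is \<open>a = 0\<close> and the extension with angle \<open>\<theta>\<close> is
 \<open>b = - \<kappa> a\<close> with \<open>\<kappa> = cot \<theta>\<close>. The decaying solution of \<open>\<tau> u = z u\<close> normalized by \<open>a = 1\<close> has \<open>b = C (- z)\<^sup>\<nu>\<close>;
 for \<open>z < 0\<close> this is read off an integral representation of the Macdonald function, and it extends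
 analytically. By Krein's formula the resolvents differ by an operator of rank one with trace
 \<open>- D' / D\<close>, where \<open>D z = \<kappa> + C (- z)\<^sup>\<nu>\<close>. Hence the shift function is the boundary value of
 \<open>Im (ln D) / \<pi>\<close>, and the negative eigenvalues are the negative zeros of \<open>D\<close>.\<close>

section \<open>Absolutely continuous functions\<close>

text \<open>Everything explicit happens at negative energies. For z < 0 the decaying solution is a
  concrete integral; the resolvent of the Friedrichs extension carries the solution at -1 to all
  other z, and the identity theorem carries along the formula for its second boundary value. All
  this rests on self-adjointness of the Friedrichs extension: surjectivity of \<open>T0\<close> + 1
  comes from a Green operator, whose square integrability is the delicate point, and nonnegativity
  from factoring \<tau> into first-order operators. As absolute continuity is defined by increments,
  integration by parts needs the fundamental theorem for such functions first. The five cases are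
  sign patterns. At x + i0 with x > 0 the function \<open>D\<close> equals \<kappa> + C x^\<nu>
  exp(-i \<nu> \<pi>), in the lower half-plane. \<open>D_fun\<close> is a positive multiple of its
  real part, \<lambda> is where that part can vanish, and the arctangent in \<Xi> misses the
  argument by \<pi> exactly where the real part is negative: this produces the characteristic
  functions. Since \<open>spectral_shift\<close> is a choice, its identification also needs a
  uniqueness theorem.\<close>

definition interval_family :: "'i set \<Rightarrow> ('i \<Rightarrow> real) \<Rightarrow> ('i \<Rightarrow> real) \<Rightarrow> real \<Rightarrow> real \<Rightarrow> bool" where
 "interval_family I s t a b \<longleftrightarrow>
   finite I \<and> (\<forall>i\<in>I. a \<le> s i \<and> s i \<le> t i \<and> t i \<le> b) \<and> disjoint_family_on (\<lambda>i. {s i<..<t i}) I"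

lemma interval_family_mono:
 "interval_family I s t a b \<Longrightarrow> a' \<le> a \<Longrightarrow> b \<le> b' \<Longrightarrow> interval_family I s t a' b'"
 unfolding interval_family_def by (meson order_trans)

lemma interval_family_shrink:
 assumes "interval_family I s t a b" "\<And>i. i \<in> I \<Longrightarrow> a' \<le> s' i \<and> s' i \<le> t' i \<and> t' i \<le> b'"
  "\<And>i. i \<in> I \<Longrightarrow> {s' i<..<t' i} \<subseteq> {s i<..<t i}"
 shows "interval_family I s' t' a' b'"
 unfolding interval_family_def disjoint_family_on_def
proof (intro conjI ballI impI)
 fix i j assume "i \<in> I" "j \<in> I" "i \<noteq> j"
 then have "{s i<..<t i} \<inter> {s j<..<t j} = {}"
  using assms(1) unfolding interval_family_def disjoint_family_on_def by blast
 then show "{s' i<..<t' i} \<inter> {s' j<..<t' j} = {}"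
  using assms(3)[OF \<open>i \<in> I\<close>] assms(3)[OF \<open>j \<in> I\<close>] by blast
qed (use assms in \<open>auto simp: interval_family_def\<close>)

lemma abs_continuous_iff_family:
 "abs_continuous_on_Icc f a b \<longleftrightarrow> (\<forall>\<epsilon>>0. \<exists>\<delta>>0. \<forall>n s t. interval_family {..<n::nat} s t a b \<and> (\<Sum>i<n. t i - s i) < \<delta>
  \<longrightarrow> (\<Sum>i<n. cmod (f (t i) - f (s i))) < \<epsilon>)"
 unfolding abs_continuous_on_Icc_def interval_family_def by (simp add: Ball_def)

text \<open>Enumerating the finite index set brings an arbitrary index type back to the initial
  segments of \<open>nat\<close>. Free index types are convenient later: covering intervals index
  themselves, and refinements of a family are indexed by pairs.\<close>

lemma abs_continuous_family:
 fixes I :: "'i set"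
 assumes "abs_continuous_on_Icc f a b" "0 < \<epsilon>"
 shows "\<exists>\<delta>>0. \<forall>(I::'i set) s t. interval_family I s t a b \<and> (\<Sum>i\<in>I. t i - s i) < \<delta>
      \<longrightarrow> (\<Sum>i\<in>I. cmod (f (t i) - f (s i))) < \<epsilon>"
proof -
 obtain \<delta> where \<delta>: "\<delta> > 0" and *: "\<And>(n::nat) s t. interval_family {..<n} s t a b \<Longrightarrow>
    (\<Sum>i<n. t i - s i) < \<delta> \<Longrightarrow> (\<Sum>i<n. cmod (f (t i) - f (s i))) < \<epsilon>"
  using assms unfolding abs_continuous_iff_family by meson
 show ?thesis
 proof (intro exI[of _ \<delta>] conjI allI impI, rule \<delta>)
  fix I :: "'i set" and s t assume a: "interval_family I s t a b \<and> (\<Sum>i\<in>I. t i - s i) < \<delta>"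
  then have fin: "finite I" by (simp add: interval_family_def)
  obtain e where e: "bij_betw e {..<card I} I"
   using ex_bij_betw_nat_finite[OF fin] by (auto simp: atLeast0LessThan)
  have eI: "e i \<in> I" if "i < card I" for i using e that by (auto simp: bij_betw_def)
  have "(\<Sum>i<card I. cmod (f (t (e i)) - f (s (e i)))) < \<epsilon>"
  proof (rule *)
   have "e m \<noteq> e n" if "m < card I" "n < card I" "m \<noteq> n" for m n
    using e that by (auto simp: bij_betw_def inj_on_def)
   then show "interval_family {..<card I} (\<lambda>i. s (e i)) (\<lambda>i. t (e i)) a b"
    using a eI unfolding interval_family_def disjoint_family_on_def by auto
   show "(\<Sum>i<card I. t (e i) - s (e i)) < \<delta>"
    using a sum.reindex_bij_betw[OF e, of "\<lambda>i. t i - s i"] by simp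
  qed
  then show "(\<Sum>i\<in>I. cmod (f (t i) - f (s i))) < \<epsilon>"
   using sum.reindex_bij_betw[OF e, of "\<lambda>i. cmod (f (t i) - f (s i))"] by simp
 qed
qed

text \<open>Covering the null set by nonoverlapping intervals inside an open set of small measure
 transfers absolute continuity of the function to its Stieltjes measure.\<close>

lemma interval_measure_absolutely_continuous:
 fixes F :: "real \<Rightarrow> real"
 assumes mono: "mono F" and cont: "continuous_on UNIV F"
  and ac: "\<And>\<epsilon>. \<epsilon> > 0 \<Longrightarrow> \<exists>\<delta>>0. \<forall>(I::real set set) s t a b. interval_family I s t a b \<and> (\<Sum>i\<in>I. t i - s i) < \<delta>
      \<longrightarrow> (\<Sum>i\<in>I. F (t i) - F (s i)) \<le> \<epsilon>"
 shows "absolutely_continuous lborel (interval_measure F)"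
 unfolding absolutely_continuous_def
proof
 have mF: "\<And>x y. x \<le> y \<Longrightarrow> F x \<le> F y" using mono by (auto simp: mono_def)
 fix N assume N: "N \<in> null_sets (lborel :: real measure)"
 \<comment> \<open>The covering argument needs a bounded set, so \<open>N\<close> is cut by boxes;
   their union restores \<open>N\<close> at the end.\<close>
 have bound: "emeasure (interval_measure F) (N \<inter> cbox (- real n) (real n)) \<le> ennreal \<epsilon>" if "\<epsilon> > 0" for n \<epsilon>
 proof -
  let ?S = "N \<inter> cbox (- real n) (real n)"
  obtain \<delta> where \<delta>: "\<delta> > 0" and d: "\<And>(I::real set set) s t a b. interval_family I s t a b \<Longrightarrow> (\<Sum>i\<in>I. t i - s i) < \<delta>
      \<Longrightarrow> (\<Sum>i\<in>I. F (t i) - F (s i)) \<le> \<epsilon>" using ac[OF \<open>\<epsilon> > 0\<close>] by metis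
  have Nn: "N \<in> null_sets lebesgue" by (rule null_sets_completionI[OF N])
  then have Nl: "N \<in> sets lebesgue" "N \<in> null_sets lebesgue" by (auto simp only: null_setsD2)
  then obtain U where U: "open U" "N \<subseteq> U" "U - N \<in> lmeasurable" "emeasure lebesgue (U - N) < ennreal \<delta>"
   using sets_lebesgue_outer_open[of N \<delta>] \<delta> by metis
  have "emeasure lebesgue U < ennreal \<delta>"
   using emeasure_Diff_null_set[OF Nl(2), of U] U by (simp add: borel_open)
  then have mU: "emeasure lborel U < ennreal \<delta>" using U by simp
  \<comment> \<open>Every covering interval contains a point of \<open>N\<close>, hence of
    \<open>U\<close>; this gauge then forces the whole interval into \<open>U\<close>, so that the
    total length is controlled by the measure of \<open>U\<close>.\<close>
  have g: "gauge (\<lambda>x. if x \<in> U then U else UNIV)" using U by (auto simp: gauge_def)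
  obtain \<D> where D: "countable \<D>" "\<Union>\<D> \<subseteq> cbox (- real (Suc n)) (real (Suc n))"
   "\<And>K. K \<in> \<D> \<Longrightarrow> interior K \<noteq> {} \<and> (\<exists>c d. K = cbox c d)"
   "pairwise (\<lambda>A B. interior A \<inter> interior B = {}) \<D>"
   "\<And>K. K \<in> \<D> \<Longrightarrow> \<exists>x \<in> ?S \<inter> K. K \<subseteq> (if x \<in> U then U else UNIV)"
   "\<And>u v. cbox u v \<in> \<D> \<Longrightarrow> \<exists>m. \<forall>i\<in>Basis. v \<bullet> i - u \<bullet> i = (real (Suc n) \<bullet> i - (- real (Suc n)) \<bullet> i) / 2 ^ m"
   "?S \<subseteq> \<Union>\<D>"
  proof (rule covering_lemma[OF _ _ g])
   show "?S \<subseteq> cbox (- real (Suc n)) (real (Suc n))" by auto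
   show "box (- real (Suc n)) (real (Suc n)) \<noteq> {}" by simp
  qed (rule that)
  have "\<forall>K\<in>\<D>. \<exists>c d. K = cbox c d" using D by blast
  then obtain c d where cd: "\<And>K. K \<in> \<D> \<Longrightarrow> K = {c K..d K}"
   by (metis box_real(2))
  have int: "interior K = {c K<..<d K}" if "K \<in> \<D>" for K
   using cd[OF that] by (metis interior_atLeastAtMost_real)
  have lt: "c K < d K" if "K \<in> \<D>" for K
   using D(3)[OF that] int[OF that] by auto
  have KU: "K \<subseteq> U" if "K \<in> \<D>" for K using D(5)[OF that] U by (auto split: if_splits)
  have fin: "emeasure (interval_measure F) (\<Union>E) \<le> ennreal \<epsilon>" if E: "finite E" "E \<subseteq> \<D>" for E
  proof -
   have dj: "disjoint_family_on (\<lambda>i. {c i<..<d i}) E"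
    using D(4) int E unfolding disjoint_family_on_def pairwise_def by (metis subsetD)
   define a where "a = Min (insert 0 (c ` E))"
   define b where "b = Max (insert 0 (d ` E))"
   have fam: "interval_family E c d a b"
    unfolding interval_family_def
    using E dj lt by (auto simp: a_def b_def less_imp_le subset_iff)
   have "ennreal (\<Sum>K\<in>E. d K - c K) = (\<Sum>K\<in>E. emeasure lborel {c K<..<d K})"
    using lt E by (subst sum_ennreal[symmetric]) (auto simp: less_imp_le subset_iff intro!: sum.cong)
   also have "\<dots> = emeasure lborel (\<Union>K\<in>E. {c K<..<d K})"
    using dj E by (intro sum_emeasure) auto
   also have "\<dots> \<le> emeasure lborel U"
   proof (intro emeasure_mono UN_least)
    fix K assume "K \<in> E"
    then show "{c K<..<d K} \<subseteq> U" using KU int interior_subset E by (metis subset_trans subsetD)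
   qed (use U in auto)
   also note mU
   finally have "(\<Sum>K\<in>E. d K - c K) < \<delta>"
    using sum_nonneg[of E "\<lambda>K. d K - c K"] lt E by (subst (asm) ennreal_less_iff) (auto simp: less_imp_le subset_iff)
   then have le: "(\<Sum>K\<in>E. F (d K) - F (c K)) \<le> \<epsilon>" using d fam by blast
   have "emeasure (interval_measure F) (\<Union>E) = emeasure (interval_measure F) (\<Union>K\<in>E. {c K..d K})"
   proof -
    have "(\<lambda>K. {c K..d K}) ` E = (\<lambda>K. K) ` E" using cd E by (intro image_cong) blast+
    then show ?thesis by simp
   qed
   also have "\<dots> \<le> (\<Sum>K\<in>E. emeasure (interval_measure F) {c K..d K})"
    using E by (intro emeasure_subadditive_finite) auto
   also have "\<dots> = (\<Sum>K\<in>E. ennreal (F (d K) - F (c K)))"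
    using lt E mF cont by (intro sum.cong refl emeasure_interval_measure_Icc) (auto simp: less_imp_le subset_iff)
   also have "\<dots> = ennreal (\<Sum>K\<in>E. F (d K) - F (c K))"
    using lt E mF by (subst sum_ennreal[symmetric]) (auto simp: less_imp_le subset_iff)
   finally show ?thesis using le by (meson ennreal_leI order_trans)
  qed
  show ?thesis
  proof (cases "\<D> = {}")
   case True
   then have "?S = {}" using D(7) by blast
   then show ?thesis by simp
  next
   case False
   \<comment> \<open>The hypothesis speaks of finite families only; the increasing unions
     \<open>A m\<close> pass the bound on to the countable cover.\<close>
   define A where "A m = \<Union>(from_nat_into \<D> ` {..<m})" for m
   have inD: "from_nat_into \<D> i \<in> \<D>" for i using False by (simp add: from_nat_into)
   have setsD: "K \<in> sets borel" if "K \<in> \<D>" for K using cd[OF that] by (metis atLeastAtMost_borel)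
   have inc: "incseq A" unfolding A_def incseq_def by (intro allI impI Union_mono image_mono) auto
   have rng: "range A \<subseteq> sets (interval_measure F)"
    unfolding A_def using inD setsD by (intro image_subsetI sets.finite_Union finite_imageI) auto
   have le: "emeasure (interval_measure F) (A m) \<le> ennreal \<epsilon>" for m
    unfolding A_def using inD by (intro fin) auto
   have "emeasure (interval_measure F) (\<Union>m. A m) \<le> ennreal \<epsilon>"
    unfolding SUP_emeasure_incseq[OF rng inc, symmetric] by (intro SUP_least le)
   moreover have "?S \<subseteq> (\<Union>m. A m)"
   proof
    fix x assume "x \<in> ?S"
    then obtain K where K: "K \<in> \<D>" "x \<in> K" using D(7) by blast
    then obtain i where "from_nat_into \<D> i = K"
     using D(1) from_nat_into_surj by metis
    then show "x \<in> (\<Union>m. A m)" using K unfolding A_def by (auto intro!: exI[of _ "Suc i"])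
   qed
   moreover have "(\<Union>m. A m) \<in> sets (interval_measure F)"
    using rng by (intro sets.countable_UN) auto
   ultimately show ?thesis by (meson emeasure_mono order_trans)
  qed
 qed
 have z: "emeasure (interval_measure F) (N \<inter> cbox (- real n) (real n)) = 0" for n
 proof -
  have "emeasure (interval_measure F) (N \<inter> cbox (- real n) (real n)) \<le> 0"
   by (rule ennreal_le_epsilon) (use bound in auto)
  then show ?thesis by simp
 qed
 have Ns: "N \<in> sets borel" using N by auto
 then have "(\<Union>n. N \<inter> cbox (- real n) (real n)) \<in> null_sets (interval_measure F)"
  by (intro null_sets_UN null_setsI z) auto
 moreover have "(\<Union>n. N \<inter> cbox (- real n) (real n)) = N"
 proof (intro set_eqI iffI)
  fix x assume "x \<in> N"
  moreover obtain n :: nat where "\<bar>x\<bar> \<le> real n" using real_arch_simple by blast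
  ultimately show "x \<in> (\<Union>n. N \<inter> cbox (- real n) (real n))" by (auto intro!: exI[of _ n])
 qed auto
 ultimately show "N \<in> null_sets (interval_measure F)" by simp
qed

text \<open>The density is the Radon-Nikodym derivative of the Stieltjes measure of
  \<open>F\<close>; continuity of \<open>F\<close> makes the measure of a closed interval the
  increment of \<open>F\<close>.\<close>

lemma monotone_density:
 fixes F :: "real \<Rightarrow> real"
 assumes mono: "mono F" and cont: "continuous_on UNIV F"
  and ac: "\<And>\<epsilon>. \<epsilon> > 0 \<Longrightarrow> \<exists>\<delta>>0. \<forall>(I::real set set) s t a b. interval_family I s t a b \<and> (\<Sum>i\<in>I. t i - s i) < \<delta>
      \<longrightarrow> (\<Sum>i\<in>I. F (t i) - F (s i)) \<le> \<epsilon>"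
 shows "\<exists>k. \<forall>x y. x \<le> y \<longrightarrow> k absolutely_integrable_on {x..y} \<and> (k has_integral F y - F x) {x..y}"
proof -
 have mF: "\<And>x y. x \<le> y \<Longrightarrow> F x \<le> F y" using mono by (auto simp: mono_def)
 have "absolutely_continuous lborel (interval_measure F)"
  by (rule interval_measure_absolutely_continuous[OF mono cont ac])
 then obtain f where f: "f \<in> borel_measurable lborel" "density lborel f = interval_measure F"
  using sigma_finite_measure.Radon_Nikodym[OF sigma_finite_lborel, of "interval_measure F"] by auto
 define k where "k x = enn2real (f x)" for x
 have km: "k \<in> borel_measurable borel" using f unfolding k_def by measurable
 have km': "(\<lambda>t. k t * indicator {x..y} t) \<in> borel_measurable lborel" for x y
  using km by measurable
 have nn: "(\<integral>\<^sup>+ t. f t * indicator {x..y} t \<partial>lborel) = ennreal (F y - F x)" if "x \<le> y" for x y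
 proof -
  have "emeasure (density lborel f) {x..y} = ennreal (F y - F x)"
   using emeasure_interval_measure_Icc[OF that mF cont] f(2) by simp
  then show ?thesis using f(1) by (subst (asm) emeasure_density) auto
 qed
 have "((\<lambda>t. k t * indicator {x..y} t) has_integral F y - F x) UNIV \<and> integrable lborel (\<lambda>t. k t * indicator {x..y} t)" if "x \<le> y" for x y
 proof -
  \<comment> \<open>The Radon-Nikodym derivative is finite almost everywhere on bounded intervals,
    so \<open>enn2real\<close> loses nothing under the integral.\<close>
  have "AE t in lborel. f t * indicator {x..y} t \<noteq> \<infinity>"
   using nn[OF that] f(1) by (intro nn_integral_PInf_AE) auto
  then have "AE t in lborel. f t * indicator {x..y} t = ennreal (k t * indicator {x..y} t)"
   by eventually_elim (auto simp: k_def indicator_def less_top split: if_splits)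
  then have e: "(\<integral>\<^sup>+ t. ennreal (k t * indicator {x..y} t) \<partial>lborel) = ennreal (F y - F x)"
   using nn_integral_cong_AE nn[OF that] by metis
  have "has_bochner_integral lborel (\<lambda>t. k t * indicator {x..y} t) (F y - F x)"
   using km' e mF[OF that] by (intro has_bochner_integral_nn_integral) (simp_all add: k_def)
  then show ?thesis
   using has_integral_integral_lborel[of "\<lambda>t. k t * indicator {x..y} t"]
   by (auto simp: has_bochner_integral_iff)
 qed note kk = this
 have "k absolutely_integrable_on {x..y} \<and> (k has_integral F y - F x) {x..y}" if "x \<le> y" for x y
 proof
  have e: "(\<lambda>t. k t * indicator {x..y} t) = (\<lambda>t. if t \<in> {x..y} then k t else 0)" by (auto simp: indicator_def)
  show "(k has_integral F y - F x) {x..y}"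
   using kk[OF that] unfolding e has_integral_restrict_UNIV by blast
  show "k absolutely_integrable_on {x..y}"
  proof -
   have "integrable lborel (\<lambda>t. indicator {x..y} t *\<^sub>R k t)"
    using kk[OF that] by (simp add: mult.commute)
   then show ?thesis
    unfolding set_integrable_def by (subst integrable_completion) auto
  qed
 qed
 then show ?thesis by blast
qed

lemma interval_family_length:
 fixes I :: "'i set"
 assumes f: "interval_family I s t a b" and "a \<le> b"
 shows "(\<Sum>i\<in>I. t i - s i) \<le> b - a"
proof -
 have dj: "disjoint_family_on (\<lambda>i. {s i<..<t i}) I" and fin: "finite I"
  using f by (simp_all add: interval_family_def)
 have st: "a \<le> s i" "s i \<le> t i" "t i \<le> b" if "i \<in> I" for i using f that by (auto simp: interval_family_def)
 have "ennreal (\<Sum>i\<in>I. t i - s i) = (\<Sum>i\<in>I. emeasure lborel {s i<..<t i})"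
  using st by (subst sum_ennreal[symmetric]) (auto intro!: sum.cong)
 also have "\<dots> = emeasure lborel (\<Union>i\<in>I. {s i<..<t i})"
  using dj fin by (intro sum_emeasure) auto
 also have "\<dots> \<le> emeasure lborel {a..b}"
  using st by (intro emeasure_mono UN_least) (force)+
 also have "\<dots> = ennreal (b - a)" using \<open>a \<le> b\<close> by simp
 finally show ?thesis using \<open>a \<le> b\<close> by (subst (asm) ennreal_le_iff) auto
qed

text \<open>Jordan decomposition: the variation function \<open>W a\<close> and the difference
  \<open>W a\<close> - \<open>g\<close> are nondecreasing and absolutely continuous, and subtracting
  their densities gives one for \<open>g\<close>. The bound 1 keeps the variation finite.\<close>

lemma AC_real_decomposition:
 fixes g :: "real \<Rightarrow> real"
 assumes "a \<le> b"
  and bd: "\<And>(n::nat) s t. interval_family {..<n} s t a b \<Longrightarrow> (\<Sum>i<n. \<bar>g (t i) - g (s i)\<bar>) \<le> 1"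
  and ac: "\<And>\<epsilon>. \<epsilon> > 0 \<Longrightarrow> \<exists>\<delta>>0. \<forall>(I::(real set \<times> nat) set) s t. interval_family I s t a b \<and> (\<Sum>i\<in>I. t i - s i) < \<delta>
      \<longrightarrow> (\<Sum>i\<in>I. \<bar>g (t i) - g (s i)\<bar>) < \<epsilon>"
 shows "\<exists>k. \<forall>x y. a \<le> x \<and> x \<le> y \<and> y \<le> b \<longrightarrow> k absolutely_integrable_on {x..y} \<and> (k has_integral g y - g x) {x..y}"
proof -
 define W where "W x y = (SUP (n,s,t)\<in>{(n,s,t). interval_family {..<n::nat} s t x y}. \<Sum>i<n. \<bar>g (t i) - g (s i)\<bar>)" for x y
 have bdd: "bdd_above ((\<lambda>(n,s,t). \<Sum>i<n. \<bar>g (t i) - g (s i)\<bar>) ` {(n,s,t). interval_family {..<n::nat} s t x y})"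
  if "a \<le> x" "y \<le> b" for x y
  using bd[OF interval_family_mono[OF _ that]] by (intro bdd_aboveI[of _ 1]) auto
 have W_upper: "(\<Sum>i<n. \<bar>g (t i) - g (s i)\<bar>) \<le> W x y" if "interval_family {..<n::nat} s t x y" "a \<le> x" "y \<le> b" for n s t x y
  unfolding W_def using that cSUP_upper[OF _ bdd[OF that(2,3)], of "(n,s,t)"] by simp
 have ne: "{(n,s,t). interval_family {..<n::nat} s t x y} \<noteq> {}" for x y
  by (auto intro!: exI[of _ 0] simp: interval_family_def disjoint_family_on_def)
 have W_least: "W x y \<le> B" if "\<And>n s t. interval_family {..<n::nat} s t x y \<Longrightarrow> (\<Sum>i<n. \<bar>g (t i) - g (s i)\<bar>) \<le> B" for x y B
  unfolding W_def by (intro cSUP_least[OF ne]) (use that in auto)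
 have W_inc: "W a x + \<bar>g y - g x\<bar> \<le> W a y" if xy: "a \<le> x" "x \<le> y" "y \<le> b" for x y
 proof -
  have "W a x \<le> W a y - \<bar>g y - g x\<bar>"
  proof (rule W_least)
   fix n s t assume f: "interval_family {..<n::nat} s t a x"
   \<comment> \<open>Any family in [a, x] can be extended by the interval [x, y], so the variation
     grows at least by the increment of \<open>g\<close>.\<close>
   define s' where "s' = s(n := x)" define t' where "t' = t(n := y)"
   have "interval_family {..<Suc n} s' t' a y"
    unfolding interval_family_def disjoint_family_on_def
   proof (intro conjI ballI impI)
    fix i assume i: "i \<in> {..<Suc n}"
    show "a \<le> s' i" "s' i \<le> t' i" "t' i \<le> y"
     using f xy i unfolding interval_family_def s'_def t'_def by (force simp: less_Suc_eq)+
   next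
    fix i j assume ij: "i \<in> {..<Suc n}" "j \<in> {..<Suc n}" "i \<noteq> j"
    have x: "t i \<le> x" if "i < n" for i using f that unfolding interval_family_def by blast
    have dj: "{s i<..<t i} \<inter> {s j<..<t j} = {}" if "i < n" "j < n" "i \<noteq> j" for i j
     using f that unfolding interval_family_def disjoint_family_on_def by blast
    show "{s' i<..<t' i} \<inter> {s' j<..<t' j} = {}"
    proof (cases "i < n \<and> j < n")
     case True then show ?thesis using dj[of i j] ij by (simp add: s'_def t'_def)
    next
     case False
     then consider "i = n" "j < n" | "j = n" "i < n" using ij by (auto simp: less_Suc_eq)
     then show ?thesis using x[of i] x[of j] by cases (auto simp: s'_def t'_def)
    qed
   qed simp
   then have "(\<Sum>i<Suc n. \<bar>g (t' i) - g (s' i)\<bar>) \<le> W a y" using xy by (intro W_upper) auto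
   moreover have "(\<Sum>i<n. \<bar>g (t' i) - g (s' i)\<bar>) = (\<Sum>i<n. \<bar>g (t i) - g (s i)\<bar>)"
    by (intro sum.cong) (auto simp: s'_def t'_def)
   ultimately show "(\<Sum>i<n. \<bar>g (t i) - g (s i)\<bar>) \<le> W a y - \<bar>g y - g x\<bar>"
    by (simp add: s'_def t'_def)
  qed
  then show ?thesis by simp
 qed
 have W_split: "W a y - W a x \<le> W x y" if xy: "a \<le> x" "x \<le> y" "y \<le> b" for x y
 proof -
  have "W a y \<le> W a x + W x y"
  proof (rule W_least)
   fix n s t assume f: "interval_family {..<n::nat} s t a y"
   have st: "a \<le> s i" "s i \<le> t i" "t i \<le> y" if "i < n" for i
    using f that by (auto simp: interval_family_def)
   \<comment> \<open>Every interval is cut at \<open>x\<close> into a left and a right part, one of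
     which may be degenerate.\<close>
   have 1: "interval_family {..<n} (\<lambda>i. min (s i) x) (\<lambda>i. min (t i) x) a x"
    by (rule interval_family_shrink[OF f]) (use st xy in \<open>auto simp: min_def max_def split: if_splits\<close>, (smt (verit) st lessThan_iff)+)
   have 2: "interval_family {..<n} (\<lambda>i. max (s i) x) (\<lambda>i. max (t i) x) x y"
    by (rule interval_family_shrink[OF f]) (use st xy in \<open>auto simp: min_def max_def split: if_splits\<close>, (smt (verit) st lessThan_iff)+)
   have "(\<Sum>i<n. \<bar>g (t i) - g (s i)\<bar>) \<le> (\<Sum>i<n. \<bar>g (min (t i) x) - g (min (s i) x)\<bar>) + (\<Sum>i<n. \<bar>g (max (t i) x) - g (max (s i) x)\<bar>)"
    unfolding sum.distrib[symmetric] by (intro sum_mono) (auto simp: min_def max_def)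
   also have "\<dots> \<le> W a x + W x y"
    by (intro add_mono W_upper 1 2) (use xy in auto)
   finally show "(\<Sum>i<n. \<bar>g (t i) - g (s i)\<bar>) \<le> W a x + W x y" .
  qed
  then show ?thesis by simp
 qed
 have W_ac: "\<exists>\<delta>>0. \<forall>(J::real set set) s t. interval_family J s t a b \<and> (\<Sum>i\<in>J. t i - s i) < \<delta>
      \<longrightarrow> (\<Sum>i\<in>J. W a (t i) - W a (s i)) \<le> \<epsilon>" if "\<epsilon> > 0" for \<epsilon>
 proof -
  obtain \<delta> where \<delta>: "\<delta> > 0" and d: "\<And>(I::(real set \<times> nat) set) s t. interval_family I s t a b \<Longrightarrow> (\<Sum>i\<in>I. t i - s i) < \<delta>
      \<Longrightarrow> (\<Sum>i\<in>I. \<bar>g (t i) - g (s i)\<bar>) < \<epsilon>" using ac[OF \<open>\<epsilon> > 0\<close>] by metis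
  have "(\<Sum>i\<in>J. W (s i) (t i)) \<le> \<epsilon>" if J: "interval_family J s t a b" "(\<Sum>i\<in>J. t i - s i) < \<delta>"
   for J :: "real set set" and s t
  proof (rule ccontr)
   assume neg: "\<not> (\<Sum>i\<in>J. W (s i) (t i)) \<le> \<epsilon>"
   \<comment> \<open>Suppose that the variations over the members of \<open>J\<close> sum to more
     than \<epsilon>. Near-optimal subdivisions, each missing its variation by less than \<eta>,
     together form one family that violates the choice of \<delta>, because \<open>card J\<close>
     times \<eta> is below the excess.\<close>
   define \<eta> where "\<eta> = ((\<Sum>i\<in>J. W (s i) (t i)) - \<epsilon>) / (card J + 1)"
   have \<eta>: "\<eta> > 0" using neg by (auto simp: \<eta>_def)
   have finJ: "finite J" using J by (simp add: interval_family_def)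
   have "\<exists>n u v. interval_family {..<n::nat} u v (s j) (t j) \<and> W (s j) (t j) - \<eta> < (\<Sum>i<n. \<bar>g (v i) - g (u i)\<bar>)" for j
    using W_least[of "s j" "t j" "W (s j) (t j) - \<eta>"] \<eta> by (meson diff_less_eq less_add_same_cancel1 not_le)
   then obtain n u v where nuv: "\<And>j. interval_family {..<n j::nat} (u j) (v j) (s j) (t j)"
    "\<And>j. W (s j) (t j) - \<eta> < (\<Sum>i<n j. \<bar>g (v j i) - g (u j i)\<bar>)" by metis
   have jab: "a \<le> s j" "t j \<le> b" if "j \<in> J" for j using J(1) that by (auto simp: interval_family_def)
   have nu: "s j \<le> u j i" "u j i \<le> v j i" "v j i \<le> t j" if "i < n j" for j i
    using nuv(1)[of j] that unfolding interval_family_def by blast+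
   define I where "I = Sigma J (\<lambda>j. {..<n j})"
   have fam: "interval_family I (\<lambda>(j,i). u j i) (\<lambda>(j,i). v j i) a b"
    unfolding interval_family_def
   proof (intro conjI ballI)
    show "finite I" using finJ by (auto simp: I_def)
    fix p assume "p \<in> I"
    then obtain j i where p: "p = (j,i)" "j \<in> J" "i < n j" by (auto simp: I_def)
    show "a \<le> (case p of (j,i) \<Rightarrow> u j i)" "(case p of (j,i) \<Rightarrow> u j i) \<le> (case p of (j,i) \<Rightarrow> v j i)"
     "(case p of (j,i) \<Rightarrow> v j i) \<le> b"
     using nu[OF p(3)] jab[OF p(2)] p by auto
   next
    show "disjoint_family_on (\<lambda>i. {case i of (j,i) \<Rightarrow> u j i<..<case i of (j,i) \<Rightarrow> v j i}) I"
     unfolding disjoint_family_on_def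
    proof (intro ballI impI)
     fix p q assume "p \<in> I" "q \<in> I" "p \<noteq> q"
     then obtain j i j' i' where p: "p = (j,i)" "j \<in> J" "i < n j" "q = (j',i')" "j' \<in> J" "i' < n j'" "(j,i) \<noteq> (j',i')"
      by (auto simp: I_def)
     have "{u j i<..<v j i} \<inter> {u j' i'<..<v j' i'} = {}"
     proof (cases "j = j'")
      case True
      then show ?thesis using nuv(1)[of j] p unfolding interval_family_def disjoint_family_on_def by blast
     next
      case False
      then have "{s j<..<t j} \<inter> {s j'<..<t j'} = {}"
       using J(1) p unfolding interval_family_def disjoint_family_on_def by blast
      then show ?thesis using nu[OF p(3)] nu[OF p(6)] by (auto simp: disjoint_iff)
     qed
     then show "{case p of (j,i) \<Rightarrow> u j i<..<case p of (j,i) \<Rightarrow> v j i} \<inter> {case q of (j,i) \<Rightarrow> u j i<..<case q of (j,i) \<Rightarrow> v j i} = {}"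
      using p by simp
    qed
   qed
   have len: "(\<Sum>i<n j. v j i - u j i) \<le> t j - s j" if "j \<in> J" for j
    using J(1) that by (intro interval_family_length[OF nuv(1)]) (auto simp: interval_family_def)
   have "(\<Sum>p\<in>I. (case p of (j,i) \<Rightarrow> v j i) - (case p of (j,i) \<Rightarrow> u j i)) = (\<Sum>j\<in>J. \<Sum>i<n j. v j i - u j i)"
    unfolding I_def using finJ by (subst sum.Sigma) (auto intro!: sum.cong)
   also have "\<dots> \<le> (\<Sum>j\<in>J. t j - s j)" using len by (rule sum_mono)
   also have "\<dots> < \<delta>" by fact
   finally have "(\<Sum>p\<in>I. \<bar>g (case p of (j,i) \<Rightarrow> v j i) - g (case p of (j,i) \<Rightarrow> u j i)\<bar>) < \<epsilon>"
    using d[OF fam] by blast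
   moreover have "(\<Sum>p\<in>I. \<bar>g (case p of (j,i) \<Rightarrow> v j i) - g (case p of (j,i) \<Rightarrow> u j i)\<bar>) = (\<Sum>j\<in>J. \<Sum>i<n j. \<bar>g (v j i) - g (u j i)\<bar>)"
    unfolding I_def using finJ by (subst sum.Sigma) (auto intro!: sum.cong)
   moreover have "(\<Sum>j\<in>J. W (s j) (t j) - \<eta>) \<le> (\<Sum>j\<in>J. \<Sum>i<n j. \<bar>g (v j i) - g (u j i)\<bar>)"
    using nuv(2) by (intro sum_mono) (auto intro: less_imp_le)
   ultimately have "(\<Sum>j\<in>J. W (s j) (t j)) - card J * \<eta> < \<epsilon>"
    by (simp add: sum_subtractf)
   moreover have "(\<Sum>i\<in>J. W (s i) (t i)) - \<epsilon> = (card J + 1) * \<eta>"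
    by (simp add: \<eta>_def)
   ultimately show False using \<eta> by (simp add: algebra_simps)
  qed
  moreover have "(\<Sum>i\<in>J. W a (t i) - W a (s i)) \<le> (\<Sum>i\<in>J. W (s i) (t i))" if "interval_family J s t a b" for J :: "real set set" and s t
   using that by (intro sum_mono W_split) (auto simp: interval_family_def)
  ultimately show ?thesis using \<delta> by (meson order_trans)
 qed
 \<comment> \<open>Clamping to [a, b] extends functions by constants to the whole line, where
   Stieltjes measures live, and lengthens no interval.\<close>
 define cl where "cl x = max a (min b x)" for x
 have cl: "a \<le> cl x" "cl x \<le> b" for x using \<open>a \<le> b\<close> by (auto simp: cl_def)
 have cl_mono: "cl x \<le> cl y" if "x \<le> y" for x y using that by (auto simp: cl_def)
 have cl_lip: "cl v - cl u \<le> v - u" if "u \<le> v" for u v using that by (auto simp: cl_def max_def min_def)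
 have cl_fam: "interval_family I (\<lambda>i. cl (s i)) (\<lambda>i. cl (t i)) a b \<and> (\<Sum>i\<in>I. cl (t i) - cl (s i)) \<le> (\<Sum>i\<in>I. t i - s i)"
  if f: "interval_family I s t c d" for I :: "real set set" and s t c d
 proof
  have st: "s i \<le> t i" if "i \<in> I" for i using f that by (auto simp: interval_family_def)
  show "interval_family I (\<lambda>i. cl (s i)) (\<lambda>i. cl (t i)) a b"
   by (rule interval_family_shrink[OF f]) (use st cl cl_mono in \<open>auto simp: cl_def\<close>)
  show "(\<Sum>i\<in>I. cl (t i) - cl (s i)) \<le> (\<Sum>i\<in>I. t i - s i)"
   using st by (intro sum_mono cl_lip)
 qed
 have dens: "\<exists>k. \<forall>x y. x \<le> y \<longrightarrow> k absolutely_integrable_on {x..y} \<and> (k has_integral G (cl y) - G (cl x)) {x..y}"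
  if Gm: "\<And>x y. a \<le> x \<Longrightarrow> x \<le> y \<Longrightarrow> y \<le> b \<Longrightarrow> G x \<le> G y"
   and Gac: "\<And>\<epsilon>. \<epsilon> > 0 \<Longrightarrow> \<exists>\<delta>>0. \<forall>(J::real set set) s t. interval_family J s t a b \<and> (\<Sum>i\<in>J. t i - s i) < \<delta>
      \<longrightarrow> (\<Sum>i\<in>J. G (t i) - G (s i)) \<le> \<epsilon>" for G :: "real \<Rightarrow> real"
 proof (rule monotone_density)
  show m: "mono (\<lambda>x. G (cl x))" by (intro monoI Gm cl cl_mono)
  show acG: "\<exists>\<delta>>0. \<forall>(I::real set set) s t a b. interval_family I s t a b \<and> (\<Sum>i\<in>I. t i - s i) < \<delta>
      \<longrightarrow> (\<Sum>i\<in>I. G (cl (t i)) - G (cl (s i))) \<le> \<epsilon>" if "\<epsilon> > 0" for \<epsilon>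
  proof -
   obtain \<delta> where \<delta>: "\<delta> > 0" and d: "\<And>(J::real set set) s t. interval_family J s t a b \<Longrightarrow> (\<Sum>i\<in>J. t i - s i) < \<delta>
      \<Longrightarrow> (\<Sum>i\<in>J. G (t i) - G (s i)) \<le> \<epsilon>" using Gac[OF \<open>\<epsilon> > 0\<close>] by metis
   show ?thesis
   proof (intro exI[of _ \<delta>] conjI allI impI, rule \<delta>)
    fix I :: "real set set" and s t and a' b' :: real
    assume "interval_family I s t a' b' \<and> (\<Sum>i\<in>I. t i - s i) < \<delta>"
    then show "(\<Sum>i\<in>I. G (cl (t i)) - G (cl (s i))) \<le> \<epsilon>"
     using d[of I "\<lambda>i. cl (s i)" "\<lambda>i. cl (t i)"] cl_fam[of I s t a' b'] by linarith
   qed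
  qed
  show "continuous_on UNIV (\<lambda>x. G (cl x))"
   unfolding continuous_on_iff
  proof (intro ballI allI impI)
   fix x e :: real assume "e > 0"
   then obtain \<delta> where \<delta>: "\<delta> > 0" and d: "\<And>(I::real set set) s t a b. interval_family I s t a b \<Longrightarrow> (\<Sum>i\<in>I. t i - s i) < \<delta>
      \<Longrightarrow> (\<Sum>i\<in>I. G (cl (t i)) - G (cl (s i))) \<le> e / 2" using acG[OF half_gt_zero[OF \<open>e > 0\<close>]] by blast
   \<comment> \<open>A family with a single interval; \<open>{{}}\<close> merely serves as a
     one-element set of the required index type.\<close>
   have *: "G (cl v) - G (cl u) \<le> e/2" if "u \<le> v" "v - u < \<delta>" for u v
    using d[of "{{}}" "\<lambda>_. u" "\<lambda>_. v" u v] that by (auto simp: interval_family_def disjoint_family_on_def)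
   have m': "G (cl u) \<le> G (cl v)" if "u \<le> v" for u v using m that by (auto simp: mono_def)
   show "\<exists>d>0. \<forall>x'\<in>UNIV. dist x' x < d \<longrightarrow> dist (G (cl x')) (G (cl x)) < e"
   proof (intro exI[of _ \<delta>] conjI ballI impI \<delta>)
    fix x' assume "dist x' x < \<delta>"
    then show "dist (G (cl x')) (G (cl x)) < e"
     using *[of x x'] *[of x' x] m'[of x x'] m'[of x' x] \<open>e > 0\<close>
     by (cases "x \<le> x'") (auto simp: dist_real_def)
   qed
  qed
 qed
 have W_mono: "\<bar>g y - g x\<bar> \<le> W a y - W a x" if "a \<le> x" "x \<le> y" "y \<le> b" for x y using W_inc[OF that] by simp
 have "\<exists>k. \<forall>x y. x \<le> y \<longrightarrow> k absolutely_integrable_on {x..y} \<and> (k has_integral W a (cl y) - W a (cl x)) {x..y}"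
  using W_mono by (intro dens W_ac) force+
 then obtain k1 where k1: "\<And>x y. x \<le> y \<Longrightarrow> k1 absolutely_integrable_on {x..y} \<and> (k1 has_integral W a (cl y) - W a (cl x)) {x..y}" by blast
 have "\<exists>k. \<forall>x y. x \<le> y \<longrightarrow> k absolutely_integrable_on {x..y} \<and> (k has_integral (W a (cl y) - g (cl y)) - (W a (cl x) - g (cl x))) {x..y}"
 proof (rule dens)
  show "W a x - g x \<le> W a y - g y" if "a \<le> x" "x \<le> y" "y \<le> b" for x y using W_mono[OF that] by simp
  fix \<epsilon> :: real assume "\<epsilon> > 0"
  obtain \<delta> where \<delta>: "\<delta> > 0" and d: "\<And>(J::real set set) s t. interval_family J s t a b \<Longrightarrow> (\<Sum>i\<in>J. t i - s i) < \<delta>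
      \<Longrightarrow> (\<Sum>i\<in>J. W a (t i) - W a (s i)) \<le> \<epsilon>/2" using W_ac[OF half_gt_zero[OF \<open>\<epsilon> > 0\<close>]] by blast
  have "(\<Sum>i\<in>J. (W a (t i) - g (t i)) - (W a (s i) - g (s i))) \<le> \<epsilon>"
   if J: "interval_family J s t a b" "(\<Sum>i\<in>J. t i - s i) < \<delta>" for J :: "real set set" and s t
  proof -
   have "(\<Sum>i\<in>J. (W a (t i) - g (t i)) - (W a (s i) - g (s i))) \<le> (\<Sum>i\<in>J. 2 * (W a (t i) - W a (s i)))"
   proof (rule sum_mono)
    fix i assume "i \<in> J"
    then show "(W a (t i) - g (t i)) - (W a (s i) - g (s i)) \<le> 2 * (W a (t i) - W a (s i))"
     using W_mono[of "s i" "t i"] J(1) by (simp add: interval_family_def)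
   qed
   then show ?thesis using d[OF J] unfolding sum_distrib_left[symmetric] by linarith
  qed
  then show "\<exists>\<delta>>0. \<forall>(J::real set set) s t. interval_family J s t a b \<and> (\<Sum>i\<in>J. t i - s i) < \<delta>
      \<longrightarrow> (\<Sum>i\<in>J. (W a (t i) - g (t i)) - (W a (s i) - g (s i))) \<le> \<epsilon>" using \<delta> by blast
 qed
 then obtain k2 where k2: "\<And>x y. x \<le> y \<Longrightarrow> k2 absolutely_integrable_on {x..y} \<and> (k2 has_integral (W a (cl y) - g (cl y)) - (W a (cl x) - g (cl x))) {x..y}" by blast
 show ?thesis
 proof (intro exI[of _ "\<lambda>x. k1 x - k2 x"] allI impI)
  fix x y assume xy: "a \<le> x \<and> x \<le> y \<and> y \<le> b"
  then have c: "cl x = x" "cl y = y" by (auto simp: cl_def)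
  show "(\<lambda>x. k1 x - k2 x) absolutely_integrable_on {x..y} \<and> ((\<lambda>x. k1 x - k2 x) has_integral g y - g x) {x..y}"
  proof
   show "(\<lambda>x. k1 x - k2 x) absolutely_integrable_on {x..y}"
    using k1[of x y] k2[of x y] xy by (intro set_integral_diff) auto
   have "((\<lambda>x. k1 x - k2 x) has_integral (W a y - W a x) - ((W a y - g y) - (W a x - g x))) {x..y}"
    using k1[of x y] k2[of x y] xy unfolding c by (intro has_integral_diff) auto
   then show "((\<lambda>x. k1 x - k2 x) has_integral g y - g x) {x..y}" by (simp add: algebra_simps)
  qed
 qed
qed

text \<open>Lebesgue's differentiation theorem. The form used here speaks of averages over intervals
  starting at the point; applied to the reflected function it yields the left derivative, off the
  reflected exceptional set.\<close>

lemma indefinite_integral_has_derivative_ae: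
 fixes k :: "real \<Rightarrow> complex"
 assumes k: "k absolutely_integrable_on {a..b}"
 shows "\<exists>N. negligible N \<and> (\<forall>x\<in>{a<..<b} - N. ((\<lambda>x. integral {a..x} k) has_vector_derivative k x) (at x))"
proof -
 define f where "f x = (if x \<in> {a..b} then k x else 0)" for x
 have kint: "k integrable_on {a..b}" using k set_lebesgue_integral_eq_integral(1) by blast
 have fU: "f integrable_on UNIV" unfolding f_def using kint by (simp only: Henstock_Kurzweil_Integration.integrable_restrict_UNIV)
 then have f: "f integrable_on cbox c d" for c d by (meson integrable_on_subcbox subset_UNIV)
 have f2: "(\<lambda>x. f (- x)) integrable_on cbox c d" for c d
  using f[of "-d" "-c"] Henstock_Kurzweil_Integration.integrable_reflect_real[where f=f and a="-d" and b="-c"] by simp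
 obtain N1 where N1: "negligible N1" "\<And>x e. x \<notin> N1 \<Longrightarrow> 0 < e \<Longrightarrow>
        \<exists>d>0. \<forall>h. 0 < h \<and> h < d \<longrightarrow> norm ((integral (cbox x (x + h *\<^sub>R One)) f) /\<^sub>R (h ^ DIM(real)) - f x) < e"
  using integrable_ccontinuous_explicit[OF f] by metis
 obtain N2 where N2: "negligible N2" "\<And>x e. x \<notin> N2 \<Longrightarrow> 0 < e \<Longrightarrow>
        \<exists>d>0. \<forall>h. 0 < h \<and> h < d \<longrightarrow> norm(integral (cbox x (x + h *\<^sub>R One)) (\<lambda>x. f (- x)) /\<^sub>R h ^ DIM(real) - f (- x)) < e"
  using integrable_ccontinuous_explicit[OF f2] by metis
 define N where "N = N1 \<union> uminus ` N2"
 have "negligible (uminus ` N2)"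
  using N2(1) by (intro negligible_differentiable_image_negligible)
   (auto intro!: differentiable_at_imp_differentiable_on differentiable_minus)
 then have N: "negligible N" using N1 by (simp add: N_def)
 have "((\<lambda>x. integral {a..x} k) has_vector_derivative k x) (at x)" if x: "x \<in> {a<..<b} - N" for x
  unfolding has_vector_derivative_def has_derivative_within_alt
 proof (intro conjI allI impI)
  show "bounded_linear (\<lambda>h. h *\<^sub>R k x)" by (rule bounded_linear_scaleR_left)
  fix e :: real assume "e > 0"
  have fx: "f x = k x" using x by (simp add: f_def)
  obtain d1 where d1: "d1 > 0" "\<And>h. 0 < h \<Longrightarrow> h < d1 \<Longrightarrow> norm(integral {x..x+h} f /\<^sub>R h - k x) < e"
   using N1(2)[of x e] x \<open>e > 0\<close> fx by (auto simp: N_def)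
  have xN2: "- x \<notin> N2" using x by (force simp: N_def)
  obtain d2 where d2: "d2 > 0" "\<And>h. 0 < h \<Longrightarrow> h < d2 \<Longrightarrow> norm(integral {-x..-x+h} (\<lambda>x. f (- x)) /\<^sub>R h - k x) < e"
   using N2(2)[OF xN2 \<open>e > 0\<close>] fx by auto
  have fk: "integral {u..v} f = integral {u..v} k" if "a \<le> u" "v \<le> b" for u v
   using that by (intro integral_cong) (auto simp: f_def)
  have ki: "k integrable_on {u..v}" if "a \<le> u" "v \<le> b" for u v
   using kint that by (meson atLeastatMost_subset_iff integrable_on_subinterval)
  have mult: "norm (I - h *\<^sub>R k x) \<le> e * h" if "norm (I /\<^sub>R h - k x) < e" "h > 0" for I h
  proof -
   have "I - h *\<^sub>R k x = h *\<^sub>R (I /\<^sub>R h - k x)" using that by (simp add: scaleR_diff_right)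
   then have "norm (I - h *\<^sub>R k x) = h * norm (I /\<^sub>R h - k x)" using that by simp
   then show ?thesis using that by (simp add: mult.commute)
  qed
  define d where "d = min (min d1 d2) (min (x - a) (b - x))"
  show "\<exists>d>0. \<forall>y\<in>UNIV. norm (y - x) < d \<longrightarrow>
       norm (integral {a..y} k - integral {a..x} k - (y - x) *\<^sub>R k x) \<le> e * norm (y - x)"
  proof (intro exI[of _ d] conjI ballI impI)
   show "d > 0" using d1 d2 x by (auto simp: d_def)
   fix y assume y: "norm (y - x) < d"
   have bnds: "\<bar>y - x\<bar> < d1" "\<bar>y - x\<bar> < d2" "\<bar>y - x\<bar> < x - a" "\<bar>y - x\<bar> < b - x"
    using y by (auto simp: d_def)
   consider "y = x" | "x < y" | "y < x" by linarith
   then show "norm (integral {a..y} k - integral {a..x} k - (y - x) *\<^sub>R k x) \<le> e * norm (y - x)"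
   proof cases
    case 2
    have "integral {a..x} k + integral {x..y} k = integral {a..y} k"
     using 2 bnds x by (intro Henstock_Kurzweil_Integration.integral_combine ki) auto
    moreover have "norm (integral {x..y} k - (y - x) *\<^sub>R k x) \<le> e * (y - x)"
     using mult[OF d1(2)[of "y - x"]] bnds 2 fk[of x y] x by auto
    moreover have "integral {a..y} k - integral {a..x} k = integral {x..y} k"
     using calculation(1) by (metis add_diff_cancel_left')
    ultimately show ?thesis using 2 by simp
   next
    case 3
    have "integral {a..y} k + integral {y..x} k = integral {a..x} k"
     using 3 bnds x by (intro Henstock_Kurzweil_Integration.integral_combine ki) auto
    from this[symmetric] have eq: "integral {a..y} k - integral {a..x} k - (y - x) *\<^sub>R k x = - (integral {y..x} k - (x - y) *\<^sub>R k x)"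
     by (simp add: scaleR_diff_left)
    have "integral {-x..-x+(x-y)} (\<lambda>x. f (- x)) = integral {y..x} f"
     using Henstock_Kurzweil_Integration.integral_reflect_real[where f=f and a=y and b=x] by simp
    then have "norm (integral {y..x} k - (x - y) *\<^sub>R k x) \<le> e * (x - y)"
     using mult[OF d2(2)[of "x - y"]] bnds 3 fk[of y x] x by auto
    then show ?thesis using 3 unfolding eq by (simp add: norm_minus_commute)
   qed auto
  qed
 qed
 then show ?thesis using N by blast
qed

text \<open>Inside an interval shorter than the \<delta> that belongs to \<epsilon> = 1 the
  variation is at most 1. So densities exist on short intervals, with no prior proof that the
  variation over [a, b] is finite. Real and imaginary part are 1-Lipschitz and are treated
  together.\<close>

lemma abs_continuous_local_density:
 assumes ac: "abs_continuous_on_Icc h a b"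
 shows "\<exists>\<delta>>0. \<forall>x y. a \<le> x \<and> x \<le> y \<and> y \<le> b \<and> y - x < \<delta> \<longrightarrow>
  (\<exists>k. \<forall>u v. x \<le> u \<and> u \<le> v \<and> v \<le> y \<longrightarrow> k absolutely_integrable_on {u..v} \<and> (k has_integral h v - h u) {u..v})"
proof -
 obtain \<delta> where \<delta>: "\<delta> > 0" and d: "\<And>(I::nat set) s t. interval_family I s t a b \<Longrightarrow> (\<Sum>i\<in>I. t i - s i) < \<delta>
      \<Longrightarrow> (\<Sum>i\<in>I. cmod (h (t i) - h (s i))) < 1"
  using abs_continuous_family[OF ac zero_less_one] by blast
 show ?thesis
 proof (intro exI[of _ \<delta>] conjI allI impI \<delta>)
  fix x y assume xy: "a \<le> x \<and> x \<le> y \<and> y \<le> b \<and> y - x < \<delta>"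
  have 1: "(\<Sum>i<n. cmod (h (t i) - h (s i))) \<le> 1" if "interval_family {..<n::nat} s t x y" for n s t
   using interval_family_length[OF that] d[OF interval_family_mono[OF that]] xy by force
  have 2: "\<exists>\<delta>>0. \<forall>(I::(real set \<times> nat) set) s t. interval_family I s t x y \<and> (\<Sum>i\<in>I. t i - s i) < \<delta>
      \<longrightarrow> (\<Sum>i\<in>I. cmod (h (t i) - h (s i))) < \<epsilon>" if "\<epsilon> > 0" for \<epsilon>
   using abs_continuous_family[OF ac that, where 'i="real set \<times> nat"] interval_family_mono xy by meson
  have comp: "\<exists>k. \<forall>u v. x \<le> u \<and> u \<le> v \<and> v \<le> y \<longrightarrow> k absolutely_integrable_on {u..v} \<and> (k has_integral p (h v) - p (h u)) {u..v}"
   if p: "\<And>z w. \<bar>p z - p w\<bar> \<le> cmod (z - w)" for p :: "complex \<Rightarrow> real"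
  proof (rule AC_real_decomposition)
   fix n s t assume "interval_family {..<n::nat} s t x y"
   then show "(\<Sum>i<n. \<bar>p (h (t i)) - p (h (s i))\<bar>) \<le> 1"
    using 1[of n s t] sum_mono[of "{..<n}" "\<lambda>i. \<bar>p (h (t i)) - p (h (s i))\<bar>" "\<lambda>i. cmod (h (t i) - h (s i))"] p by force
  next
   fix \<epsilon> :: real assume "\<epsilon> > 0"
   then obtain \<delta> where "\<delta> > 0" and e: "\<And>(I::(real set \<times> nat) set) s t. interval_family I s t x y \<Longrightarrow> (\<Sum>i\<in>I. t i - s i) < \<delta>
      \<Longrightarrow> (\<Sum>i\<in>I. cmod (h (t i) - h (s i))) < \<epsilon>" using 2[OF \<open>\<epsilon> > 0\<close>] by blast
   show "\<exists>\<delta>>0. \<forall>(I::(real set \<times> nat) set) s t. interval_family I s t x y \<and> (\<Sum>i\<in>I. t i - s i) < \<delta>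
      \<longrightarrow> (\<Sum>i\<in>I. \<bar>p (h (t i)) - p (h (s i))\<bar>) < \<epsilon>"
   proof (intro exI[of _ \<delta>] conjI allI impI)
    fix I :: "(real set \<times> nat) set" and s t assume "interval_family I s t x y \<and> (\<Sum>i\<in>I. t i - s i) < \<delta>"
    then have "(\<Sum>i\<in>I. cmod (h (t i) - h (s i))) < \<epsilon>" using e by blast
    moreover have "(\<Sum>i\<in>I. \<bar>p (h (t i)) - p (h (s i))\<bar>) \<le> (\<Sum>i\<in>I. cmod (h (t i) - h (s i)))"
     by (intro sum_mono p)
    ultimately show "(\<Sum>i\<in>I. \<bar>p (h (t i)) - p (h (s i))\<bar>) < \<epsilon>" by linarith
   qed (rule \<open>\<delta> > 0\<close>)
  qed (use xy in auto)
  obtain k1 where k1: "\<And>u v. x \<le> u \<Longrightarrow> u \<le> v \<Longrightarrow> v \<le> y \<Longrightarrow> k1 absolutely_integrable_on {u..v} \<and> (k1 has_integral Re (h v) - Re (h u)) {u..v}"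
   using comp[of Re] abs_Re_le_cmod by (metis minus_complex.simps(1))
  obtain k2 where k2: "\<And>u v. x \<le> u \<Longrightarrow> u \<le> v \<Longrightarrow> v \<le> y \<Longrightarrow> k2 absolutely_integrable_on {u..v} \<and> (k2 has_integral Im (h v) - Im (h u)) {u..v}"
   using comp[of Im] abs_Im_le_cmod by (metis minus_complex.simps(2))
  show "\<exists>k. \<forall>u v. x \<le> u \<and> u \<le> v \<and> v \<le> y \<longrightarrow> k absolutely_integrable_on {u..v} \<and> (k has_integral h v - h u) {u..v}"
  proof (intro exI[of _ "\<lambda>t. k1 t *\<^sub>R 1 + k2 t *\<^sub>R \<i>"] allI impI)
   fix u v assume uv: "x \<le> u \<and> u \<le> v \<and> v \<le> y"
   have bl: "bounded_linear (\<lambda>r. r *\<^sub>R (c::complex))" for c by (rule bounded_linear_scaleR_left)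
   have K1: "k1 absolutely_integrable_on {u..v}" and K2: "k2 absolutely_integrable_on {u..v}"
    using k1[of u v] k2[of u v] uv by blast+
   have H1: "((\<lambda>t. k1 t *\<^sub>R (1::complex)) has_integral (Re (h v) - Re (h u)) *\<^sub>R 1) {u..v}"
    using has_integral_linear[OF _ bl[of 1], of k1 "Re (h v) - Re (h u)" "{u..v}"] k1[of u v] uv by (simp add: o_def)
   have H2: "((\<lambda>t. k2 t *\<^sub>R \<i>) has_integral (Im (h v) - Im (h u)) *\<^sub>R \<i>) {u..v}"
    using has_integral_linear[OF _ bl[of \<i>], of k2 "Im (h v) - Im (h u)" "{u..v}"] k2[of u v] uv by (simp add: o_def)
   have eq: "(Re (h v) - Re (h u)) *\<^sub>R 1 + (Im (h v) - Im (h u)) *\<^sub>R \<i> = h v - h u"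
    by (simp add: complex_eq_iff)
   have 1: "((\<lambda>t. k1 t *\<^sub>R 1 + k2 t *\<^sub>R \<i>) has_integral h v - h u) {u..v}"
    using has_integral_add[OF H1 H2] unfolding eq .
   have "(\<lambda>t. k1 t *\<^sub>R (1::complex)) absolutely_integrable_on {u..v}"
    using absolutely_integrable_linear[OF K1 bl[of 1]] by (simp add: o_def)
   moreover have "(\<lambda>t. k2 t *\<^sub>R \<i>) absolutely_integrable_on {u..v}"
    using absolutely_integrable_linear[OF K2 bl[of \<i>]] by (simp add: o_def)
   ultimately show "(\<lambda>t. k1 t *\<^sub>R 1 + k2 t *\<^sub>R \<i>) absolutely_integrable_on {u..v} \<and> ((\<lambda>t. k1 t *\<^sub>R 1 + k2 t *\<^sub>R \<i>) has_integral h v - h u) {u..v}"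
    using 1 by (intro conjI set_integral_add)
  qed
 qed
qed

text \<open>\<open>fderiv\<close> is unspecified where the derivative does not exist, but off a null
  set it agrees with the density, so it is itself a density.\<close>

lemma density_imp_FTC:
 fixes h k :: "real \<Rightarrow> complex"
 assumes "x \<le> y" and k: "\<And>u v. x \<le> u \<Longrightarrow> u \<le> v \<Longrightarrow> v \<le> y \<Longrightarrow> k absolutely_integrable_on {u..v} \<and> (k has_integral h v - h u) {u..v}"
 shows "fderiv h absolutely_integrable_on {x..y} \<and> (fderiv h has_integral h y - h x) {x..y} \<and>
  (\<exists>N. negligible N \<and> (\<forall>t\<in>{x<..<y} - N. (h has_vector_derivative k t) (at t) \<and> fderiv h t = k t))"
proof -
 have kk: "k absolutely_integrable_on {x..y}" "(k has_integral h y - h x) {x..y}" using k[of x y] assms(1) by auto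
 obtain N where N: "negligible N" "\<And>t. t \<in> {x<..<y} - N \<Longrightarrow> ((\<lambda>t. integral {x..t} k) has_vector_derivative k t) (at t)"
  using indefinite_integral_has_derivative_ae[OF kk(1)] by blast
 have der: "(h has_vector_derivative k t) (at t)" if t: "t \<in> {x<..<y} - N" for t
 proof -
  have "((\<lambda>t. h x + integral {x..t} k) has_vector_derivative k t) (at t)"
   using N(2)[OF t] by (auto intro!: derivative_eq_intros)
  then show ?thesis
  proof (rule has_vector_derivative_transform_within_open[of _ _ _ "{x<..<y}"])
   fix u assume "u \<in> {x<..<y}"
   then show "h x + integral {x..u} k = h u" using k[of x u] by (auto simp: integral_unique)
  qed (use t in auto)
 qed
 then have eq: "fderiv h t = k t" if "t \<in> {x<..<y} - N" for t using that vector_derivative_at by blast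
 have N': "negligible (N \<union> {x,y})" using N by auto
 have "fderiv h absolutely_integrable_on {x..y}"
  by (rule absolutely_integrable_spike[OF kk(1) N']) (use eq in auto)
 moreover have "(fderiv h has_integral h y - h x) {x..y}"
  by (rule has_integral_spike[OF N' _ kk(2)]) (use eq in auto)
 ultimately show ?thesis using der eq N(1) by blast
qed

text \<open>Short intervals are glued together: by induction on n, an interval of length below (n+1)
  \<delta> is shortened by one short piece, and the integrals and exceptional null sets of both
  parts are combined.\<close>

lemma abs_continuous_FTC:
 assumes ac: "abs_continuous_on_Icc h a b" and "a \<le> b"
 shows "fderiv h absolutely_integrable_on {a..b} \<and> (fderiv h has_integral h b - h a) {a..b} \<and>
  (\<exists>N. negligible N \<and> (\<forall>t\<in>{a<..<b} - N. (h has_vector_derivative fderiv h t) (at t)))"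
proof -
 obtain \<delta> where \<delta>: "\<delta> > 0" and d: "\<And>x y. a \<le> x \<Longrightarrow> x \<le> y \<Longrightarrow> y \<le> b \<Longrightarrow> y - x < \<delta> \<Longrightarrow>
  (\<exists>k. \<forall>u v. x \<le> u \<and> u \<le> v \<and> v \<le> y \<longrightarrow> k absolutely_integrable_on {u..v} \<and> (k has_integral h v - h u) {u..v})"
  using abs_continuous_local_density[OF ac] by blast
 define P where "P x y \<longleftrightarrow> fderiv h absolutely_integrable_on {x..y} \<and> (fderiv h has_integral h y - h x) {x..y} \<and>
  (\<exists>N. negligible N \<and> (\<forall>t\<in>{x<..<y} - N. (h has_vector_derivative fderiv h t) (at t)))" for x y
 have short: "P x y" if xy: "a \<le> x" "x \<le> y" "y \<le> b" "y - x < \<delta>" for x y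
 proof -
  obtain k where k: "\<And>u v. x \<le> u \<Longrightarrow> u \<le> v \<Longrightarrow> v \<le> y \<Longrightarrow> k absolutely_integrable_on {u..v} \<and> (k has_integral h v - h u) {u..v}"
   using d[OF xy] by blast
  have *: "fderiv h absolutely_integrable_on {x..y}" "(fderiv h has_integral h y - h x) {x..y}"
   using density_imp_FTC[OF xy(2) k] by blast+
  obtain N where N: "negligible N" "\<And>t. t \<in> {x<..<y} - N \<Longrightarrow> (h has_vector_derivative k t) (at t) \<and> fderiv h t = k t"
   using density_imp_FTC[OF xy(2) k] by blast
  have "(h has_vector_derivative fderiv h t) (at t)" if "t \<in> {x<..<y} - N" for t
   using N(2)[OF that] by metis
  then show ?thesis unfolding P_def using * N(1) by blast
 qed
 have join: "P x y" if P: "P x z" "P z y" and z: "x \<le> z" "z \<le> y" for x y z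
 proof -
  have eq: "{x..y} = {x..z} \<union> {z..y}" using z by auto
  have ai: "fderiv h absolutely_integrable_on {x..y}"
   unfolding eq by (rule set_integrable_Un) (use P in \<open>auto simp only: P_def sets_completionI_sets\<close>, auto)
  have hi: "(fderiv h has_integral h y - h x) {x..y}"
  proof -
   have "(fderiv h has_integral (h z - h x) + (h y - h z)) {x..y}"
    by (rule has_integral_combine[OF z]) (use P in \<open>auto simp only: P_def\<close>)
   then show ?thesis by (simp add: algebra_simps)
  qed
  obtain N1 N2 where N: "negligible N1" "\<And>t. t\<in>{x<..<z} - N1 \<Longrightarrow> (h has_vector_derivative fderiv h t) (at t)"
   "negligible N2" "\<And>t. t\<in>{z<..<y} - N2 \<Longrightarrow> (h has_vector_derivative fderiv h t) (at t)"
   using P unfolding P_def by blast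
  have "negligible (insert z (N1 \<union> N2))" using N by auto
  moreover have "(h has_vector_derivative fderiv h t) (at t)" if "t\<in>{x<..<y} - insert z (N1 \<union> N2)" for t
   using N(2)[of t] N(4)[of t] that by (cases "t < z") auto
  ultimately show ?thesis unfolding P_def using ai hi by blast
 qed
 have "P x y" if "a \<le> x" "x \<le> y" "y \<le> b" "y - x < real (Suc n) * \<delta>" for n x y
  using that
 proof (induction n arbitrary: x y)
  case 0 then show ?case using short[of x y] by simp
 next
  case (Suc n)
  show ?case
  proof (cases "y - x < real (Suc n) * \<delta>")
   case True then show ?thesis using Suc by blast
  next
   case long: False
   \<comment> \<open>Half of the slack: the last piece has length \<delta> - s, which is below
     \<delta>, while the rest still has length below (n+1) \<delta>.\<close>
   define s where "s = (real (Suc (Suc n)) * \<delta> - (y - x)) / 2"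
   define z where "z = y - \<delta> + s"
   have n: "\<delta> * real n \<ge> 0" using \<delta> by simp
   have s: "s > 0" "s \<le> \<delta>/2" using Suc.prems long \<delta> by (auto simp: s_def algebra_simps)
   have z: "x \<le> z" "z \<le> y" "y - z < \<delta>"
   proof -
    have "y - x \<ge> \<delta> + \<delta> * real n" using long by (simp add: algebra_simps)
    then show "x \<le> z" "z \<le> y" "y - z < \<delta>" using s n \<delta> unfolding z_def by linarith+
   qed
   have "z - x < real (Suc n) * \<delta>"
    using s(1) unfolding z_def s_def by (simp add: field_simps)
   then have "P x z" using Suc.IH[of x z] z Suc.prems by simp
   moreover have "P z y" using short[of z y] z Suc.prems by simp
   ultimately show ?thesis using join z by blast
  qed
 qed note * = this
 obtain n :: nat where "b - a < real n * \<delta>" using reals_Archimedean3[OF \<delta>] by blast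
 then have "b - a < real (Suc n) * \<delta>" using \<delta> by (simp add: algebra_simps)
 from *[OF order_refl \<open>a \<le> b\<close> order_refl this] show ?thesis unfolding P_def .
qed

section \<open>Calculus of locally absolutely continuous functions on the half-line\<close>

lemma abs_continuous_subinterval:
 assumes "abs_continuous_on_Icc f a b" "a \<le> a'" "b' \<le> b"
 shows "abs_continuous_on_Icc f a' b'"
 using assms unfolding abs_continuous_iff_family by (meson interval_family_mono)

lemma AC_locD:
 assumes "h \<in> AC_loc" "0 < a"
 shows "abs_continuous_on_Icc h a b"
proof (rule abs_continuous_subinterval)
 show "abs_continuous_on_Icc h a (max b a + 1)"
  using assms by (simp add: AC_loc_def)
qed simp_all

lemma AC_loc_FTC:
 assumes "h \<in> AC_loc" "0 < a" "a \<le> b"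
 shows "fderiv h absolutely_integrable_on {a..b}" "(fderiv h has_integral h b - h a) {a..b}"
 using abs_continuous_FTC[OF AC_locD[OF assms(1,2)] assms(3)] by blast+

text \<open>The intervals from 1/(n+2) to n+2 exhaust the half-line, and countably many null sets
  are collected; the shift by 2 keeps the interval nondegenerate at n = 0.\<close>

lemma half_line_ae:
 assumes "\<And>n::nat. \<exists>N. negligible N \<and> (\<forall>t\<in>{1/(real n + 2)<..<real n + 2} - N. P t)"
 shows "\<exists>N. negligible N \<and> (\<forall>t>0. t \<notin> N \<longrightarrow> P t)"
proof -
 obtain N where N: "\<And>n. negligible (N n)" "\<And>n t. t \<in> {1/(real n + 2)<..<real n + 2} - N n \<Longrightarrow> P t"
  using assms by metis
 have "negligible (\<Union>n. N n)" using N(1) by (intro negligible_countable_Union) auto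
 moreover have "P t" if "t > 0" "t \<notin> (\<Union>n. N n)" for t
 proof -
  obtain n :: nat where n: "max t (1/t) < real n" using reals_Archimedean2 by blast
  then have "1/t < real n + 2" by simp
  then have "1 < (real n + 2) * t" using that by (simp add: field_simps)
  then have "1/(real n + 2) < t" by (simp add: field_simps)
  then show ?thesis using N(2)[of t n] that n by auto
 qed
 ultimately show ?thesis by blast
qed

lemma half_line_exhaustion: "0 < 1/(real n + 2)" "1/(real n + 2) \<le> real n + 2"
 by (auto simp: field_simps)

lemma AC_loc_differentiable_ae:
 assumes "h \<in> AC_loc"
 shows "\<exists>N. negligible N \<and> (\<forall>t>0. t \<notin> N \<longrightarrow> (h has_vector_derivative fderiv h t) (at t))"
 by (rule half_line_ae)
  (use abs_continuous_FTC[OF AC_locD[OF assms half_line_exhaustion(1)] half_line_exhaustion(2)] in blast)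

lemma AC_loc_continuous_on:
 assumes "h \<in> AC_loc"
 shows "continuous_on {0<..} h"
 unfolding continuous_on_eq_continuous_at[OF open_greaterThan]
proof
 fix x :: real assume x: "x \<in> {0<..}"
 have "continuous_on {x/2..2*x} (\<lambda>y. h (x/2) + integral {x/2..y} (fderiv h))"
  using AC_loc_FTC[OF assms, of "x/2" "2*x"] x
  by (intro continuous_intros indefinite_integral_continuous_1) (auto simp: integrable_on_def)
 moreover have "h (x/2) + integral {x/2..y} (fderiv h) = h y" if "y \<in> {x/2..2*x}" for y
  using AC_loc_FTC(2)[OF assms, of "x/2" y] x that by (simp add: integral_unique)
 ultimately have "continuous_on {x/2..2*x} h" by (rule continuous_on_eq)
 then show "isCont h x"
  using x by (intro continuous_on_interior[of "{x/2..2*x}"]) auto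
qed

text \<open>The common source of the closure properties: in sums, multiples, conjugates and products
  the increments are locally dominated by those of the constituents.\<close>

lemma AC_loc_dominated:
 assumes f: "f \<in> AC_loc" and g: "g \<in> AC_loc"
  and dom: "\<And>a b. 0 < a \<Longrightarrow> a < b \<Longrightarrow> \<exists>M. \<forall>s t. a \<le> s \<and> s \<le> t \<and> t \<le> b \<longrightarrow>
   cmod (h t - h s) \<le> M * (cmod (f t - f s) + cmod (g t - g s))"
 shows "h \<in> AC_loc"
 unfolding AC_loc_def
proof (intro CollectI allI impI)
 fix a b :: real assume ab: "0 < a \<and> a < b"
 obtain M0 where M0: "\<And>s t. a \<le> s \<Longrightarrow> s \<le> t \<Longrightarrow> t \<le> b \<Longrightarrow> cmod (h t - h s) \<le> M0 * (cmod (f t - f s) + cmod (g t - g s))"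
  using dom ab by blast
 define M where "M = max M0 1"
 have M1: "M > 0" by (simp add: M_def)
 have M: "cmod (h t - h s) \<le> M * (cmod (f t - f s) + cmod (g t - g s))" if "a \<le> s" "s \<le> t" "t \<le> b" for s t
  using M0[OF that] mult_right_mono[of M0 M "cmod (f t - f s) + cmod (g t - g s)"] by (simp add: M_def)
 show "abs_continuous_on_Icc h a b"
  unfolding abs_continuous_iff_family
 proof (intro allI impI)
  fix \<epsilon> :: real assume "\<epsilon> > 0"
  then have e: "\<epsilon> / (2 * M) > 0" using M1 by simp
  have acs: "abs_continuous_on_Icc f a b" "abs_continuous_on_Icc g a b"
   using AC_locD f g ab by blast+
  obtain \<delta>1 where \<delta>1: "\<delta>1 > 0" and d1: "\<And>(I::nat set) s t. interval_family I s t a b \<Longrightarrow> (\<Sum>i\<in>I. t i - s i) < \<delta>1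
      \<Longrightarrow> (\<Sum>i\<in>I. cmod (f (t i) - f (s i))) < \<epsilon> / (2*M)"
   using abs_continuous_family[OF acs(1) e, where 'i=nat] by blast
  obtain \<delta>2 where \<delta>2: "\<delta>2 > 0" and d2: "\<And>(I::nat set) s t. interval_family I s t a b \<Longrightarrow> (\<Sum>i\<in>I. t i - s i) < \<delta>2
      \<Longrightarrow> (\<Sum>i\<in>I. cmod (g (t i) - g (s i))) < \<epsilon> / (2*M)"
   using abs_continuous_family[OF acs(2) e, where 'i=nat] by blast
  show "\<exists>\<delta>>0. \<forall>(n::nat) s t. interval_family {..<n} s t a b \<and> (\<Sum>i<n. t i - s i) < \<delta>
    \<longrightarrow> (\<Sum>i<n. cmod (h (t i) - h (s i))) < \<epsilon>"
  proof (intro exI[of _ "min \<delta>1 \<delta>2"] conjI allI impI)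
   fix n :: nat and s t
   assume a: "interval_family {..<n} s t a b \<and> (\<Sum>i<n. t i - s i) < min \<delta>1 \<delta>2"
   have F: "(\<Sum>i<n. cmod (f (t i) - f (s i))) < \<epsilon> / (2*M)" using d1[of "{..<n}" s t] a by simp
   have G: "(\<Sum>i<n. cmod (g (t i) - g (s i))) < \<epsilon> / (2*M)" using d2[of "{..<n}" s t] a by simp
   have "(\<Sum>i<n. cmod (h (t i) - h (s i))) \<le> (\<Sum>i<n. M * (cmod (f (t i) - f (s i)) + cmod (g (t i) - g (s i))))"
    using a by (intro sum_mono M) (auto simp: interval_family_def)
   also have "\<dots> = M * ((\<Sum>i<n. cmod (f (t i) - f (s i))) + (\<Sum>i<n. cmod (g (t i) - g (s i))))"
    by (simp only: sum_distrib_left[symmetric] sum.distrib)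
   also have "\<dots> < M * (\<epsilon> / (2*M) + \<epsilon> / (2*M))"
    using F G M1 by (intro mult_strict_left_mono add_strict_mono)
   also have "\<dots> = \<epsilon>" using M1 by (simp add: field_simps)
   finally show "(\<Sum>i<n. cmod (h (t i) - h (s i))) < \<epsilon>" .
  qed (use \<delta>1 \<delta>2 in auto)
 qed
qed

lemma AC_loc_add: "f \<in> AC_loc \<Longrightarrow> g \<in> AC_loc \<Longrightarrow> (\<lambda>x. f x + g x) \<in> AC_loc"
proof (erule (1) AC_loc_dominated, rule exI[of _ 1], intro allI impI)
 fix s t :: real
 show "cmod (f t + g t - (f s + g s)) \<le> 1 * (cmod (f t - f s) + cmod (g t - g s))"
  unfolding add_diff_add mult_1 by (rule norm_triangle_ineq)
qed

lemma AC_loc_cmult: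
 assumes "f \<in> AC_loc" shows "(\<lambda>x. c * f x) \<in> AC_loc"
proof (rule AC_loc_dominated[OF assms assms], rule exI[of _ "cmod c"], intro allI impI)
 fix s t :: real
 have "cmod (c * f t - c * f s) = cmod c * cmod (f t - f s)"
  by (metis norm_mult right_diff_distrib)
 also have "\<dots> \<le> cmod c * (cmod (f t - f s) + cmod (f t - f s))" by (intro mult_left_mono) auto
 finally show "cmod (c * f t - c * f s) \<le> cmod c * (cmod (f t - f s) + cmod (f t - f s))" .
qed

lemma AC_loc_cnj:
 assumes "f \<in> AC_loc" shows "(\<lambda>x. cnj (f x)) \<in> AC_loc"
proof (rule AC_loc_dominated[OF assms assms], rule exI[of _ 1], intro allI impI)
 fix s t :: real
 have "cmod (cnj (f t) - cnj (f s)) = cmod (f t - f s)"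
  by (metis complex_cnj_diff complex_mod_cnj)
 then show "cmod (cnj (f t) - cnj (f s)) \<le> 1 * (cmod (f t - f s) + cmod (f t - f s))" by simp
qed

lemma AC_loc_mult:
 assumes f: "f \<in> AC_loc" and g: "g \<in> AC_loc" shows "(\<lambda>x. f x * g x) \<in> AC_loc"
proof (rule AC_loc_dominated[OF f g])
 fix a b :: real assume ab: "0 < a" "a < b"
 have bdd: "\<exists>M. \<forall>x\<in>{a..b}. cmod (k x) \<le> M" if "k \<in> AC_loc" for k
 proof -
  have "continuous_on {a..b} k"
   using AC_loc_continuous_on[OF that] ab by (rule_tac continuous_on_subset) auto
  then have "bounded (k ` {a..b})" by (intro compact_imp_bounded compact_continuous_image) auto
  then show ?thesis by (auto simp: bounded_iff)
 qed
 obtain F where F: "\<And>x. x \<in> {a..b} \<Longrightarrow> cmod (f x) \<le> F" using bdd[OF f] by blast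
 obtain G where G: "\<And>x. x \<in> {a..b} \<Longrightarrow> cmod (g x) \<le> G" using bdd[OF g] by blast
 show "\<exists>M. \<forall>s t. a \<le> s \<and> s \<le> t \<and> t \<le> b \<longrightarrow>
   cmod (f t * g t - f s * g s) \<le> M * (cmod (f t - f s) + cmod (g t - g s))"
 proof (intro exI[of _ "max F G"] allI impI)
  fix s t assume st: "a \<le> s \<and> s \<le> t \<and> t \<le> b"
  have "f t * g t - f s * g s = f t * (g t - g s) + g s * (f t - f s)" by (simp add: algebra_simps)
  then have "cmod (f t * g t - f s * g s) \<le> cmod (f t) * cmod (g t - g s) + cmod (g s) * cmod (f t - f s)"
   by (metis norm_mult norm_triangle_ineq)
  also have "\<dots> \<le> max F G * cmod (g t - g s) + max F G * cmod (f t - f s)"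
   using F[of t] G[of s] st by (intro add_mono mult_right_mono) auto
  finally show "cmod (f t * g t - f s * g s) \<le> max F G * (cmod (f t - f s) + cmod (g t - g s))"
   by (simp add: algebra_simps)
 qed
qed

text \<open>Cutting the integrand at height \<open>n\<close> leaves an excess \<open>r n\<close>
  whose integral tends to 0 by dominated convergence; the bounded part contributes at most
  \<open>n\<close> times the total length.\<close>

lemma AC_loc_integral:
 assumes k: "\<And>a b. 0 < a \<Longrightarrow> a \<le> b \<Longrightarrow> k absolutely_integrable_on {a..b} \<and> (k has_integral h b - h a) {a..b}"
 shows "h \<in> AC_loc"
 unfolding AC_loc_def
proof (intro CollectI allI impI)
 fix a b :: real assume ab: "0 < a \<and> a < b"
 define r where "r n x = max 0 (cmod (k x) - real n)" for n x
 have kab: "k absolutely_integrable_on {a..b}" using k ab by simp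
 then have nk: "(\<lambda>x. cmod (k x)) absolutely_integrable_on {a..b}" by (rule absolutely_integrable_norm[unfolded o_def])
 have rab: "r n absolutely_integrable_on {a..b}" for n
  unfolding r_def by (intro absolutely_integrable_max_1 nk set_integral_diff absolutely_integrable_on_const) auto
 have "((\<lambda>n. integral {a..b} (r n)) \<longlonglongrightarrow> integral {a..b} (\<lambda>x. 0))"
 proof (rule dominated_convergence(2))
  show "r n integrable_on {a..b}" for n using rab set_lebesgue_integral_eq_integral(1) by blast
  show "(\<lambda>x. cmod (k x)) integrable_on {a..b}" using nk set_lebesgue_integral_eq_integral(1) by blast
  show "norm (r n x) \<le> cmod (k x)" for n x by (auto simp: r_def)
  show "(\<lambda>n. r n x) \<longlonglongrightarrow> 0" for x
  proof (rule tendsto_eventually)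
   obtain N :: nat where "cmod (k x) \<le> real N" using real_arch_simple by blast
   then show "\<forall>\<^sub>F n in sequentially. r n x = 0"
    by (intro eventually_mono[OF eventually_ge_at_top[of N]]) (auto simp: r_def)
  qed
 qed
 then have lim: "(\<lambda>n. integral {a..b} (r n)) \<longlonglongrightarrow> 0" by simp
 show "abs_continuous_on_Icc h a b"
  unfolding abs_continuous_iff_family
 proof (intro allI impI)
  fix \<epsilon> :: real assume "\<epsilon> > 0"
  then obtain n where n: "integral {a..b} (r n) < \<epsilon> / 2"
   using order_tendstoD(2)[OF lim, of "\<epsilon>/2"] by (auto simp: eventually_sequentially)
  \<comment> \<open>With this choice the bounded part contributes at most \<epsilon>/2; adding 1 to
    \<open>n\<close> keeps the denominator positive at n = 0.\<close>
  define \<delta> where "\<delta> = \<epsilon> / (2 * (real n + 1))"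
  show "\<exists>\<delta>>0. \<forall>(m::nat) s t. interval_family {..<m} s t a b \<and> (\<Sum>i<m. t i - s i) < \<delta>
    \<longrightarrow> (\<Sum>i<m. cmod (h (t i) - h (s i))) < \<epsilon>"
  proof (intro exI[of _ \<delta>] conjI allI impI)
   show "\<delta> > 0" using \<open>\<epsilon> > 0\<close> by (simp add: \<delta>_def)
   fix m :: nat and s t
   assume A: "interval_family {..<m} s t a b \<and> (\<Sum>i<m. t i - s i) < \<delta>"
   then have st: "\<And>i. i < m \<Longrightarrow> a \<le> s i" "\<And>i. i < m \<Longrightarrow> s i \<le> t i" "\<And>i. i < m \<Longrightarrow> t i \<le> b" by (auto simp: interval_family_def)
   have ri: "r n integrable_on {u..v}" if "a \<le> u" "v \<le> b" for u v
    by (rule integrable_on_subinterval[of _ "{a..b}"])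
     (use rab[of n] that set_lebesgue_integral_eq_integral(1) in \<open>auto\<close>)
   have one: "cmod (h (t i) - h (s i)) \<le> real n * (t i - s i) + integral {s i..t i} (r n)" if "i < m" for i
   proof -
    have hi: "(k has_integral h (t i) - h (s i)) {s i..t i}" using k[of "s i" "t i"] st that ab by fastforce
    have "cmod (integral {s i..t i} k) \<le> integral {s i..t i} (\<lambda>x. real n + r n x)"
    proof (rule Henstock_Kurzweil_Integration.integral_norm_bound_integral)
     show "k integrable_on {s i..t i}" using hi by blast
     show "(\<lambda>x. real n + r n x) integrable_on {s i..t i}"
      using ri st that by (intro Henstock_Kurzweil_Integration.integrable_add) auto
     show "cmod (k x) \<le> real n + r n x" for x by (auto simp: r_def)
    qed
    also have "\<dots> = real n * (t i - s i) + integral {s i..t i} (r n)"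
     using ri st that by (subst Henstock_Kurzweil_Integration.integral_add) auto
    finally show ?thesis using hi by (simp add: integral_unique)
   qed
   have "((r n) has_integral (\<Sum>i<m. integral {s i<..<t i} (r n))) (\<Union>i<m. {s i<..<t i})"
   proof (rule has_integral_UN)
    show "(r n has_integral integral {s i<..<t i} (r n)) {s i<..<t i}" if "i \<in> {..<m}" for i
     using ri[of "s i" "t i"] st that by (intro integrable_integral) (auto simp: integrable_on_open_interval_real)
    show "pairwise (\<lambda>i i'. negligible ({s i<..<t i} \<inter> {s i'<..<t i'})) {..<m}"
     using A by (auto simp: interval_family_def pairwise_def disjoint_family_on_def)
   qed simp
   then have "(\<Sum>i<m. integral {s i<..<t i} (r n)) \<le> integral {a..b} (r n)"
    using st ri[of a b] by (intro has_integral_subset_le[of "\<Union>i<m. {s i<..<t i}" "{a..b}" "r n"])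
     (force simp: r_def intro!: integrable_integral)+
   then have "(\<Sum>i<m. integral {s i..t i} (r n)) < \<epsilon>/2" using n by (simp add: integral_open_interval_real)
   moreover have "(\<Sum>i<m. real n * (t i - s i)) \<le> \<epsilon>/2"
   proof -
    have "(\<Sum>i<m. real n * (t i - s i)) = real n * (\<Sum>i<m. t i - s i)" by (simp add: sum_distrib_left)
    also have "\<dots> \<le> (real n + 1) * \<delta>"
     using A st by (intro mult_mono) (auto intro!: sum_nonneg)
    also have "\<dots> = \<epsilon>/2" by (simp add: \<delta>_def field_simps)
    finally show ?thesis .
   qed
   moreover have "(\<Sum>i<m. cmod (h (t i) - h (s i))) \<le> (\<Sum>i<m. real n * (t i - s i) + integral {s i..t i} (r n))"
    using one by (intro sum_mono) auto
   ultimately show "(\<Sum>i<m. cmod (h (t i) - h (s i))) < \<epsilon>" by (simp add: sum.distrib)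
  qed
 qed
qed

lemma AC_loc_C1:
 assumes d: "\<And>x. 0 < x \<Longrightarrow> (h has_vector_derivative h' x) (at x)" and c: "continuous_on {0<..} h'"
 shows "h \<in> AC_loc"
proof (rule AC_loc_integral)
 fix a b :: real assume ab: "0 < a" "a \<le> b"
 have "continuous_on {a..b} h'" using c ab by (rule_tac continuous_on_subset) auto
 then have "h' absolutely_integrable_on {a..b}" by (rule absolutely_integrable_continuous_real)
 moreover have "(h' has_integral h b - h a) {a..b}"
  using ab d by (intro fundamental_theorem_of_calculus) (auto intro: has_vector_derivative_at_within)
 ultimately show "h' absolutely_integrable_on {a..b} \<and> (h' has_integral h b - h a) {a..b}" by blast
qed

text \<open>The integral does not see the null set, so \<open>h\<close> is a primitive of the
  continuous function \<open>k\<close> and is differentiable at every point.\<close>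

lemma AC_loc_fderiv_continuous:
 assumes h: "h \<in> AC_loc" and N: "negligible N" "\<And>t. 0 < t \<Longrightarrow> t \<notin> N \<Longrightarrow> fderiv h t = k t" and k: "continuous_on {0<..} k"
  and "0 < x"
 shows "(h has_vector_derivative k x) (at x)"
proof -
 have kc: "continuous_on {x/2..2*x} k" using k \<open>0 < x\<close> by (rule_tac continuous_on_subset) auto
 have "((\<lambda>y. h (x/2) + integral {x/2..y} k) has_vector_derivative k x) (at x within {x/2..2*x})"
  using integral_has_vector_derivative[OF kc, of x] \<open>0 < x\<close> by (auto intro!: derivative_eq_intros)
 then have "((\<lambda>y. h (x/2) + integral {x/2..y} k) has_vector_derivative k x) (at x)"
  using \<open>0 < x\<close> by (simp add: at_within_interior[of x "{x/2..2*x}"])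
 then show ?thesis
 proof (rule has_vector_derivative_transform_within_open[of _ _ _ "{x/2<..<2*x}"])
  fix y assume y: "y \<in> {x/2<..<2*x}"
  have "(fderiv h has_integral h y - h (x/2)) {x/2..y}" using AC_loc_FTC(2)[OF h, of "x/2" y] y \<open>0 < x\<close> by auto
  then have "(k has_integral h y - h (x/2)) {x/2..y}"
   by (rule has_integral_spike[OF N(1), rotated]) (use N(2) \<open>0 < x\<close> in auto)
  then show "h (x/2) + integral {x/2..y} k = h y" by (simp add: integral_unique)
 qed (use \<open>0 < x\<close> in auto)
qed

lemma AC_loc_cong:
 assumes "\<And>x. 0 < x \<Longrightarrow> f x = g x" shows "f \<in> AC_loc \<longleftrightarrow> g \<in> AC_loc"
proof -
 have "g \<in> AC_loc" if "f \<in> AC_loc" "\<And>x. 0 < x \<Longrightarrow> f x = g x" for f g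
  by (rule AC_loc_dominated[OF that(1) that(1)], rule exI[of _ 1]) (use that(2) in auto)
 from this[of f g] this[of g f] assms show ?thesis by force
qed

lemma fderiv_cong:
 assumes "\<And>x. 0 < x \<Longrightarrow> f x = g x" "0 < x" shows "fderiv f x = fderiv g x"
proof -
 have "(f has_vector_derivative d) (at x) \<longleftrightarrow> (g has_vector_derivative d) (at x)" for d
  using has_vector_derivative_transform_within_open[of f d x "{0<..}" g]
   has_vector_derivative_transform_within_open[of g d x "{0<..}" f] assms by auto
 then show ?thesis by (simp add: vector_derivative_def)
qed

lemma D_halflineD:
 assumes "f \<in> D_halfline"
 shows "f \<in> AC_loc" "fderiv f \<in> AC_loc" "0 < x \<Longrightarrow> (f has_vector_derivative fderiv f x) (at x)"
  "continuous_on {0<..} f" "continuous_on {0<..} (fderiv f)"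
proof -
 show *: "f \<in> AC_loc" "fderiv f \<in> AC_loc" using assms by (auto simp: D_halfline_def)
 then show c: "continuous_on {0<..} f" "continuous_on {0<..} (fderiv f)" by (auto intro: AC_loc_continuous_on)
 show "0 < x \<Longrightarrow> (f has_vector_derivative fderiv f x) (at x)"
  by (rule AC_loc_fderiv_continuous[OF *(1) negligible_empty _ c(2)]) auto
qed

lemma D_halflineI:
 assumes d: "\<And>x. 0 < x \<Longrightarrow> (f has_vector_derivative f1 x) (at x)" and f1: "f1 \<in> AC_loc"
 shows "f \<in> D_halfline" "0 < x \<Longrightarrow> fderiv f x = f1 x" "0 < x \<Longrightarrow> fderiv (fderiv f) x = fderiv f1 x"
proof -
 have e: "\<And>x. 0 < x \<Longrightarrow> fderiv f x = f1 x" using d vector_derivative_at by blast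
 then show "0 < x \<Longrightarrow> fderiv f x = f1 x" .
 show "0 < x \<Longrightarrow> fderiv (fderiv f) x = fderiv f1 x" by (rule fderiv_cong[OF e])
 show "f \<in> D_halfline"
  using AC_loc_C1[OF d AC_loc_continuous_on[OF f1]] AC_loc_cong[of "fderiv f" f1] e f1
  by (auto simp: D_halfline_def)
qed

section \<open>The Hilbert space\<close>

lemma L2_rep: obtains f where "f \<in> sq_integrable" "u = abs_L2 f"
 using Quotient3_rep_reflp[OF Quotient3_L2, of u] Quotient3_abs_rep[OF Quotient3_L2, of u]
 by (metis L2_eq_refl_iff)

lemma abs_L2_eq_iff:
 "f \<in> sq_integrable \<Longrightarrow> g \<in> sq_integrable \<Longrightarrow> abs_L2 f = abs_L2 g \<longleftrightarrow> (AE x in halfline. f x = g x)"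
 using Quotient3_rel[OF Quotient3_L2, of f g] by (auto simp: L2_eq_def)

lemma cinner_abs_L2:
 "f \<in> sq_integrable \<Longrightarrow> g \<in> sq_integrable \<Longrightarrow>
  cinner (abs_L2 f) (abs_L2 g) = integral\<^sup>L halfline (\<lambda>x. f x * cnj (g x))"
 by (rule cinner.abs_eq) (simp_all add: L2_eq_refl_iff)

lemma plus_abs_L2:
 "f \<in> sq_integrable \<Longrightarrow> g \<in> sq_integrable \<Longrightarrow> abs_L2 f + abs_L2 g = abs_L2 (\<lambda>x. f x + g x)"
 by (rule plus_L2.abs_eq) (simp_all add: L2_eq_refl_iff)

lemma scaleC_abs_L2: "f \<in> sq_integrable \<Longrightarrow> c *\<^sub>C abs_L2 f = abs_L2 (\<lambda>x. c * f x)"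
 by (rule scaleC.abs_eq) (simp_all add: L2_eq_refl_iff)

lemma uminus_L2_scaleC: "- u = (-1) *\<^sub>C u" for u :: L2
 by (rule uminus_L2_def)

lemma sq_integrable_diff:
 "f \<in> sq_integrable \<Longrightarrow> g \<in> sq_integrable \<Longrightarrow> (\<lambda>x. f x - g x) \<in> sq_integrable"
 using sq_integrable_add[of f "\<lambda>x. (-1) * g x"] sq_integrable_scale[of g "-1"] by simp

lemma minus_abs_L2:
 assumes "f \<in> sq_integrable" "g \<in> sq_integrable"
 shows "abs_L2 f - abs_L2 g = abs_L2 (\<lambda>x. f x - g x)"
proof -
 have "abs_L2 f - abs_L2 g = abs_L2 f + (-1) *\<^sub>C abs_L2 g"
  by (simp only: diff_conv_add_uminus uminus_L2_scaleC)
 also have "\<dots> = abs_L2 (\<lambda>x. f x + (-1) * g x)"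
  by (simp only: scaleC_abs_L2 plus_abs_L2 sq_integrable_scale assms)
 finally show ?thesis by simp
qed

lemma norm_abs_L2:
 assumes "f \<in> sq_integrable"
 shows "(norm (abs_L2 f))\<^sup>2 = integral\<^sup>L halfline (\<lambda>x. (cmod (f x))\<^sup>2)"
 using cinner_self[OF assms] cinner_abs_L2[OF assms assms] cinner_self_nonneg[of "abs_L2 f"]
 by (simp add: norm_L2_def)

lemma sq_integrableD:
 "f \<in> sq_integrable \<Longrightarrow> f \<in> borel_measurable halfline"
 "f \<in> sq_integrable \<Longrightarrow> integrable halfline (\<lambda>x. (cmod (f x))\<^sup>2)"
 by (auto simp: sq_integrable_def)

lemma nn_integral_abs_L2:
 assumes "f \<in> sq_integrable"
 shows "(\<integral>\<^sup>+ x. ennreal ((cmod (f x))\<^sup>2) \<partial>halfline) = ennreal ((norm (abs_L2 f))\<^sup>2)"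
 unfolding norm_abs_L2[OF assms]
 by (rule nn_integral_eq_integral) (use sq_integrableD[OF assms] in auto)

lemma cinner_diff_left: "cinner (u - v) w = cinner u w - cinner v w"
 by (metis add_diff_cancel_right' cinner_add_left diff_add_cancel)

lemma cinner_add_right: "cinner w (u + v) = cinner w u + cinner w v"
 by (metis cinner_add_left cinner_commute complex_cnj_add)

lemma cinner_diff_right: "cinner w (u - v) = cinner w u - cinner w v"
 by (metis cinner_diff_left cinner_commute complex_cnj_diff)

lemma cinner_scaleC_right: "cinner w (c *\<^sub>C u) = cnj c * cinner w u"
 by (metis cinner_scaleC_left cinner_commute complex_cnj_mult)

lemma cinner_zero [simp]: "cinner 0 u = 0" "cinner u 0 = 0"
 using cinner_diff_left[of u u u] cinner_diff_right[of u u u] by simp_all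

lemma cinner_self_norm: "cinner u u = complex_of_real ((norm u)\<^sup>2)"
proof -
 have "Im (cinner u u) = 0" using cinner_commute[of u u] by (simp add: complex_eq_iff)
 then show ?thesis using cinner_self_nonneg[of u] by (simp add: complex_eq_iff norm_L2_def)
qed

lemma norm_scaleC: "norm (c *\<^sub>C u) = cmod c * norm u"
proof -
 have "cinner (c *\<^sub>C u) (c *\<^sub>C u) = (c * cnj c) * cinner u u"
  by (simp add: cinner_scaleC_left cinner_scaleC_right)
 then have "complex_of_real ((norm (c *\<^sub>C u))\<^sup>2) = complex_of_real ((cmod c * norm u)\<^sup>2)"
  unfolding cinner_self_norm by (simp add: complex_norm_square[symmetric] power_mult_distrib)
 then have "(norm (c *\<^sub>C u))\<^sup>2 = (cmod c * norm u)\<^sup>2" by (simp only: of_real_eq_iff)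
 then show ?thesis by (rule power2_eq_imp_eq) simp_all
qed

lemma cinner_Cauchy_Schwarz: "cmod (cinner u v) \<le> norm u * norm v"
proof (cases "cinner u v = 0")
 case False
 define c where "c = cnj (cinner u v) / cmod (cinner u v)"
 have c: "cmod c = 1" using False by (simp add: c_def norm_divide)
 have "cnj (cinner u v) * cinner u v = complex_of_real ((cmod (cinner u v))\<^sup>2)"
  by (metis complex_norm_square mult.commute of_real_power)
 then have "cinner (c *\<^sub>C u) v = complex_of_real (cmod (cinner u v))"
  using False by (simp add: cinner_scaleC_left c_def power2_eq_square)
 then have "cmod (cinner u v) = inner (c *\<^sub>C u) v" by (simp add: inner_L2_def)
 also have "\<dots> \<le> norm (c *\<^sub>C u) * norm v" by (rule norm_cauchy_schwarz)
 finally show ?thesis by (simp add: norm_scaleC c)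
qed simp

lemma bounded_bilinear_cinner: "bounded_bilinear cinner"
proof
 show "\<exists>K. \<forall>a b. norm (cinner a b) \<le> norm a * norm b * K"
  using cinner_Cauchy_Schwarz by (metis mult.right_neutral)
qed (simp_all add: cinner_add_left cinner_add_right scaleR_L2_def cinner_scaleC_left cinner_scaleC_right scaleR_conv_of_real)

lemmas tendsto_cinner = bounded_bilinear.tendsto[OF bounded_bilinear_cinner]
lemmas continuous_on_cinner = bounded_bilinear.continuous_on[OF bounded_bilinear_cinner]

lemma tendsto_scaleC:
 assumes "(f \<longlongrightarrow> u) F" shows "((\<lambda>x. c *\<^sub>C f x) \<longlongrightarrow> c *\<^sub>C u) F"
proof -
 have "((\<lambda>x. norm (f x - u)) \<longlongrightarrow> 0) F" using assms by (simp add: tendsto_norm_zero_iff LIM_zero_iff)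
 then have "((\<lambda>x. cmod c * norm (f x - u)) \<longlongrightarrow> 0) F" by (rule tendsto_mult_right_zero)
 then have "((\<lambda>x. norm (c *\<^sub>C f x - c *\<^sub>C u)) \<longlongrightarrow> 0) F"
  by (simp add: L2.scale_right_diff_distrib[symmetric] norm_scaleC)
 then show ?thesis by (simp add: tendsto_norm_zero_iff LIM_zero_iff)
qed

text \<open>Riesz-Fischer: a rapidly convergent subsequence converges almost everywhere, and Fatou's
  lemma turns the Cauchy estimate into convergence in norm to the pointwise limit.\<close>

lemma L2_Cauchy_convergent:
 fixes X :: "nat \<Rightarrow> L2"
 assumes "Cauchy X" shows "convergent X"
proof -
 have "\<exists>N. \<forall>m\<ge>N. \<forall>n\<ge>N. norm (X m - X n) < 1 / 8 ^ k" for k :: nat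
  using CauchyD[OF assms, of "1/8^k"] by simp
 then obtain N where N: "\<And>k m n. m \<ge> N k \<Longrightarrow> n \<ge> N k \<Longrightarrow> norm (X m - X n) < 1 / 8 ^ k" by metis
 \<comment> \<open>Taking the maximum over \<open>{..k}\<close> puts \<open>r m\<close> beyond
   \<open>N k\<close> whenever k \<le> m, which is all that the estimates use.\<close>
 define r where "r k = Max (N ` {..k})" for k
 have rN: "N j \<le> r k" if "j \<le> k" for j k using that by (auto simp: r_def)
 have close: "norm (X (r m) - X n) < 1/8^k" if "k \<le> m" "N k \<le> n" for k m n
  using N[of k "r m" n] rN that by simp
 have "\<forall>n. \<exists>f. f \<in> sq_integrable \<and> X n = abs_L2 f" by (metis L2_rep)
 then obtain F where F: "\<And>n. F n \<in> sq_integrable" "\<And>n. X n = abs_L2 (F n)" by metis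
 define g where "g k x = F (r (Suc k)) x - F (r k) x" for k x
 have g: "g k \<in> sq_integrable" for k unfolding g_def by (intro sq_integrable_diff F)
 have gm[measurable]: "g k \<in> borel_measurable halfline" for k using g sq_integrableD by blast
 have gn: "norm (abs_L2 (g k)) < 1/8^k" for k
 proof -
  have "abs_L2 (g k) = X (r (Suc k)) - X (r k)"
   unfolding g_def F(2) by (rule minus_abs_L2[symmetric]) (rule F)+
  then show ?thesis using close[of k "Suc k" "r k"] rN[of k k] by simp
 qed
 \<comment> \<open>The weight 4^k costs little against norms below 8^(-k), and convergence of the
   weighted squares to 0 yields the geometric pointwise bound 2^(-k).\<close>
 have "(\<integral>\<^sup>+ x. ennreal (4^k * (cmod (g k x))\<^sup>2) \<partial>halfline) \<le> ennreal ((1/2)^k)" for k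
 proof -
  have "(\<integral>\<^sup>+ x. ennreal (4^k * (cmod (g k x))\<^sup>2) \<partial>halfline) = ennreal (4^k) * (\<integral>\<^sup>+ x. ennreal ((cmod (g k x))\<^sup>2) \<partial>halfline)"
   by (subst nn_integral_cmult[symmetric]) (auto simp: ennreal_mult)
  also have "\<dots> = ennreal (4^k * (norm (abs_L2 (g k)))\<^sup>2)"
   by (simp add: nn_integral_abs_L2[OF g] ennreal_mult)
  also have "\<dots> \<le> ennreal ((1/2)^k)"
  proof (rule ennreal_leI)
   have "4^k * (norm (abs_L2 (g k)))\<^sup>2 \<le> 4^k * (1/8^k)\<^sup>2"
    using gn[of k] by (intro mult_left_mono power_mono) auto
   also have "\<dots> = (4 * (1/8) * (1/8))^k" by (simp only: power2_eq_square power_mult_distrib power_one_over mult.assoc)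
   also have "\<dots> \<le> (1/2)^k" by (intro power_mono) auto
   finally show "4^k * (norm (abs_L2 (g k)))\<^sup>2 \<le> (1/2)^k" .
  qed
  finally show ?thesis .
 qed
 then have "(\<Sum>k. \<integral>\<^sup>+ x. ennreal (4^k * (cmod (g k x))\<^sup>2) \<partial>halfline) \<le> (\<Sum>k. ennreal ((1/2)^k))"
  by (intro suminf_le) auto
 also have "\<dots> = ennreal (\<Sum>k. (1/2)^k)" by (intro suminf_ennreal2) auto
 finally have "(\<integral>\<^sup>+ x. (\<Sum>k. ennreal (4^k * (cmod (g k x))\<^sup>2)) \<partial>halfline) \<noteq> \<infinity>"
  by (subst nn_integral_suminf) (auto simp: top_unique)
 then have "AE x in halfline. (\<Sum>k. ennreal (4^k * (cmod (g k x))\<^sup>2)) \<noteq> \<infinity>"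
  by (intro nn_integral_PInf_AE) auto
 then have conv: "AE x in halfline. convergent (\<lambda>k. F (r k) x)"
 proof eventually_elim
  case (elim x)
  then have "summable (\<lambda>k. 4^k * (cmod (g k x))\<^sup>2)"
   by (intro summable_suminf_not_top) auto
  then have "(\<lambda>k. 4^k * (cmod (g k x))\<^sup>2) \<longlonglongrightarrow> 0" by (rule summable_LIMSEQ_zero)
  then have "\<forall>\<^sub>F k in sequentially. 4^k * (cmod (g k x))\<^sup>2 < 1" by (rule order_tendstoD) simp
  then have ev: "\<forall>\<^sub>F k in sequentially. norm (g k x) \<le> (1/2)^k"
  proof eventually_elim
   case (elim k)
   have "(2^k * cmod (g k x))\<^sup>2 < 1\<^sup>2"
    using elim by (simp add: power_mult_distrib power_mult[symmetric] mult.commute[of k] power_mult)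
   then have "2^k * cmod (g k x) < 1" by (rule power_less_imp_less_base) simp
   then show ?case by (simp add: field_simps power_divide)
  qed
  have "summable (\<lambda>k. g k x)"
   by (rule summable_comparison_test_ev[OF ev]) (simp add: summable_geometric)
  then have "convergent (\<lambda>n. \<Sum>k<n. g k x)" by (simp add: summable_iff_convergent)
  moreover have "(\<Sum>k<n. g k x) = F (r n) x - F (r 0) x" for n
   unfolding g_def by (rule sum_lessThan_telescope)
  ultimately have "convergent (\<lambda>n. (F (r n) x - F (r 0) x) + F (r 0) x)"
   by (intro convergent_add convergent_const) simp
  then show ?case by simp
 qed
 define f where "f x = lim (\<lambda>k. F (r k) x)" for x
 have Fm: "F n \<in> borel_measurable halfline" for n using F sq_integrableD by blast
 have fm: "f \<in> borel_measurable halfline"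
  unfolding f_def by (rule borel_measurable_lim_metric) (rule Fm)
 have lim: "AE x in halfline. (\<lambda>k. F (r k) x) \<longlonglongrightarrow> f x"
  using conv by eventually_elim (simp add: f_def convergent_LIMSEQ_iff)
 have fatou: "(\<integral>\<^sup>+ x. ennreal ((cmod (f x - F n x))\<^sup>2) \<partial>halfline) \<le> ennreal ((1/8^k)\<^sup>2)" if n: "n \<ge> N k" for n k
 proof -
  have "(\<integral>\<^sup>+ x. ennreal ((cmod (f x - F n x))\<^sup>2) \<partial>halfline)
   = (\<integral>\<^sup>+ x. liminf (\<lambda>m. ennreal ((cmod (F (r m) x - F n x))\<^sup>2)) \<partial>halfline)"
  proof (rule nn_integral_cong_AE)
   show "AE x in halfline. ennreal ((cmod (f x - F n x))\<^sup>2) = liminf (\<lambda>m. ennreal ((cmod (F (r m) x - F n x))\<^sup>2))"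
    using lim
   proof eventually_elim
    case (elim x)
    then have "(\<lambda>m. ennreal ((cmod (F (r m) x - F n x))\<^sup>2)) \<longlonglongrightarrow> ennreal ((cmod (f x - F n x))\<^sup>2)"
     by (intro tendsto_intros)
    then show ?case using lim_imp_Liminf[OF trivial_limit_sequentially] by metis
   qed
  qed
  also have "\<dots> \<le> liminf (\<lambda>m. \<integral>\<^sup>+ x. ennreal ((cmod (F (r m) x - F n x))\<^sup>2) \<partial>halfline)"
   using Fm by (intro nn_integral_liminf) measurable
  also have "\<dots> \<le> liminf (\<lambda>m. ennreal ((1/8^k)\<^sup>2))"
  proof (rule Liminf_mono)
   show "\<forall>\<^sub>F m in sequentially. (\<integral>\<^sup>+ x. ennreal ((cmod (F (r m) x - F n x))\<^sup>2) \<partial>halfline) \<le> ennreal ((1/8^k)\<^sup>2)"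
    using eventually_ge_at_top[of k]
   proof eventually_elim
    case (elim m)
    have "(\<integral>\<^sup>+ x. ennreal ((cmod (F (r m) x - F n x))\<^sup>2) \<partial>halfline) = ennreal ((norm (X (r m) - X n))\<^sup>2)"
     unfolding F(2) minus_abs_L2[OF F(1) F(1)] by (rule nn_integral_abs_L2) (rule sq_integrable_diff[OF F(1) F(1)])
    then show ?case using close[of k m n] elim n by (auto intro!: ennreal_leI power_mono)
   qed
  qed
  also have "\<dots> = ennreal ((1/8^k)\<^sup>2)" by (simp add: Liminf_const)
  finally show ?thesis .
 qed
 have fsq: "(\<lambda>x. f x - F (N 0) x) \<in> sq_integrable"
  unfolding sq_integrable_def
 proof (intro CollectI conjI)
  show m: "(\<lambda>x. f x - F (N 0) x) \<in> borel_measurable halfline" using fm Fm by measurable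
  show "integrable halfline (\<lambda>x. (cmod (f x - F (N 0) x))\<^sup>2)"
  proof (rule integrableI_bounded)
   show "(\<integral>\<^sup>+ x. ennreal (norm ((cmod (f x - F (N 0) x))\<^sup>2)) \<partial>halfline) < \<infinity>"
    using fatou[of 0 "N 0"] by (simp add: top_unique) (metis ennreal_one_less_top order_le_less_trans)
  qed (use m in measurable)
 qed
 have "(\<lambda>x. (f x - F (N 0) x) + F (N 0) x) \<in> sq_integrable" by (rule sq_integrable_add[OF fsq F(1)])
 then have fs: "f \<in> sq_integrable" by simp
 have "X \<longlonglongrightarrow> abs_L2 f"
 proof (rule LIMSEQ_I)
  fix e :: real assume "e > 0"
  obtain k where k: "(1/8)^k < e" using real_arch_pow_inv[of e "1/8"] \<open>e > 0\<close> by auto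
  have "norm (X n - abs_L2 f) < e" if "n \<ge> N k" for n
  proof -
   have "ennreal ((norm (abs_L2 f - X n))\<^sup>2) \<le> ennreal ((1/8^k)\<^sup>2)"
    unfolding F(2) minus_abs_L2[OF fs F(1)] nn_integral_abs_L2[OF sq_integrable_diff[OF fs F(1)], symmetric]
    by (rule fatou[OF that])
   then have "(norm (abs_L2 f - X n))\<^sup>2 \<le> (1/8^k)\<^sup>2" by (subst (asm) ennreal_le_iff) auto
   then have "norm (abs_L2 f - X n) \<le> 1/8^k" by (rule power2_le_imp_le) simp
   then show ?thesis using k by (simp add: norm_minus_commute power_divide)
  qed
  then show "\<exists>n0. \<forall>n\<ge>n0. norm (X n - abs_L2 f) < e" by blast
 qed
 then show ?thesis by (rule convergentI)
qed

instance L2 :: complete_space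
 by standard (rule L2_Cauchy_convergent)

section \<open>Orthogonal projection and density in the Hilbert space\<close>

lemma norm_pythagoras:
 assumes "cinner u v = 0" shows "(norm (u + v))\<^sup>2 = (norm u)\<^sup>2 + (norm v)\<^sup>2"
proof -
 have "cinner v u = 0" using assms cinner_commute[of v u] by simp
 then have "complex_of_real ((norm (u + v))\<^sup>2) = complex_of_real ((norm u)\<^sup>2 + (norm v)\<^sup>2)"
  unfolding cinner_self_norm[symmetric] of_real_add using assms by (simp add: cinner_add_left cinner_add_right)
 then show ?thesis by (simp only: of_real_eq_iff)
qed

text \<open>The witness is a vector outside \<open>M\<close> minus its nearest point in
  \<open>M\<close>. The variational argument yields orthogonality for the real inner product only;
  testing with i times the vector adds the imaginary part.\<close>

lemma L2_projection:
 assumes M: "L2.subspace M" "closed M" "M \<noteq> UNIV"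
 shows "\<exists>v. v \<noteq> 0 \<and> (\<forall>m\<in>M. cinner m v = 0)"
proof -
 obtain u where u: "u \<notin> M" using M(3) by blast
 have M0: "0 \<in> M" using M(1) by (simp add: L2.subspace_0)
 have Ms: "c *\<^sub>C m \<in> M" "m + m' \<in> M" if "m \<in> M" "m' \<in> M" for m m' c
  using that M(1) by (auto intro: L2.subspace_scale L2.subspace_add)
 have MR: "r *\<^sub>R m \<in> M" if "m \<in> M" for m r using Ms(1)[OF that that] by (simp add: scaleR_L2_def)
 define D where "D = (INF m\<in>M. (norm (u - m))\<^sup>2)"
 have bdd: "bdd_below ((\<lambda>m. (norm (u - m))\<^sup>2) ` M)" by (rule bdd_belowI[of _ 0]) auto
 have D: "D \<le> (norm (u - m))\<^sup>2" if "m \<in> M" for m unfolding D_def by (rule cINF_lower[OF bdd that])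
 have "\<exists>m\<in>M. (norm (u - m))\<^sup>2 < D + 1 / (real n + 1)" for n
 proof (rule ccontr)
  assume "\<not> ?thesis"
  then have "D + 1 / (real n + 1) \<le> D" unfolding D_def[symmetric] using M0
   by (subst (2) D_def, intro cINF_greatest) (auto simp: not_less)
  then show False by (simp add: field_simps)
 qed
 then obtain m where m: "\<And>n. m n \<in> M" "\<And>n. (norm (u - m n))\<^sup>2 < D + 1 / (real n + 1)" by metis
 \<comment> \<open>Parallelogram law: the midpoint of \<open>m p\<close> and \<open>m q\<close> lies
   in \<open>M\<close>, so its squared distance from \<open>u\<close> is at least
   \<open>D\<close>.\<close>
 have par: "(norm (m p - m q))\<^sup>2 \<le> 2 / (real p + 1) + 2 / (real q + 1)" for p q
 proof -
  let ?h = "(1/2) *\<^sub>R (m p + m q)"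
  have "D \<le> (norm (u - ?h))\<^sup>2" by (intro D MR Ms m)
  moreover have "(norm (m p - m q))\<^sup>2 = 2 * (norm (u - m p))\<^sup>2 + 2 * (norm (u - m q))\<^sup>2 - 4 * (norm (u - ?h))\<^sup>2"
   by (simp add: power2_norm_eq_inner inner_diff_left inner_diff_right inner_add_left inner_add_right inner_commute algebra_simps)
  moreover have "2 / (real i + 1) = 2 * (1 / (real i + 1))" for i by simp
  ultimately show ?thesis using m(2)[of p] m(2)[of q] by linarith
 qed
 have "Cauchy m"
 proof (rule CauchyI)
  fix e :: real assume e: "e > 0"
  obtain N :: nat where N: "4 / e\<^sup>2 < real N" using reals_Archimedean2 by blast
  have "norm (m p - m q) < e" if "p \<ge> N" "q \<ge> N" for p q
  proof -
   have "2 / (real p + 1) \<le> 2 / (real N + 1)" "2 / (real q + 1) \<le> 2 / (real N + 1)"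
    using that by (auto intro!: divide_left_mono)
   then have "(norm (m p - m q))\<^sup>2 \<le> 4 / (real N + 1)" using par[of p q] by simp
   also have "\<dots> < e\<^sup>2" using N e by (simp add: field_simps) (smt (verit) zero_less_power)
   finally show ?thesis using e by (simp add: power2_less_imp_less)
  qed
  then show "\<exists>M. \<forall>p\<ge>M. \<forall>q\<ge>M. norm (m p - m q) < e" by blast
 qed
 then obtain m0 where m0: "m \<longlonglongrightarrow> m0" using Cauchy_convergent_iff convergent_def by blast
 have m0M: "m0 \<in> M" using closed_sequentially[OF M(2) m(1) m0] .
 define v where "v = u - m0"
 have "(\<lambda>n. (norm (u - m n))\<^sup>2) \<longlonglongrightarrow> (norm v)\<^sup>2" unfolding v_def by (intro tendsto_intros m0)
 moreover have "(\<lambda>n. D + 1 / (real n + 1)) \<longlonglongrightarrow> D + 0"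
  by (intro tendsto_add tendsto_const) (use LIMSEQ_inverse_real_of_nat in \<open>simp add: inverse_eq_divide add.commute\<close>)
 ultimately have vD: "(norm v)\<^sup>2 \<le> D" using m(2) by (intro LIMSEQ_le) (auto intro: less_imp_le)
 have vmin: "(norm v)\<^sup>2 \<le> (norm (v - m'))\<^sup>2" if "m' \<in> M" for m'
 proof -
  have "v - m' = u - (m0 + m')" by (simp add: v_def)
  then have "(norm (v - m'))\<^sup>2 = (norm (u - (m0 + m')))\<^sup>2" by (simp only:)
  then show ?thesis using D[OF Ms(2)[OF m0M that]] vD by linarith
 qed
 have orth: "inner v m' = 0" if m': "m' \<in> M" for m'
 proof (rule ccontr)
  assume nz: "inner v m' \<noteq> 0"
  then have m'0: "m' \<noteq> 0" by auto
  \<comment> \<open>The coefficient of the orthogonal projection of \<open>v\<close> onto the line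
    of \<open>m'\<close>; it gives the largest decrease of the distance.\<close>
  define t where "t = inner v m' / (norm m')\<^sup>2"
  have "(norm v)\<^sup>2 \<le> (norm (v - t *\<^sub>R m'))\<^sup>2" by (intro vmin MR m')
  also have "\<dots> = (norm v)\<^sup>2 - 2 * t * inner v m' + t\<^sup>2 * (norm m')\<^sup>2"
   unfolding power2_norm_eq_inner
   by (simp add: inner_diff_left inner_diff_right inner_commute[of m' v] algebra_simps power2_eq_square)
  also have "t\<^sup>2 * (norm m')\<^sup>2 = t * inner v m'" using m'0 by (simp add: t_def power2_eq_square)
  finally have "t * inner v m' \<le> 0" by simp
  moreover have "t * inner v m' = (inner v m')\<^sup>2 / (norm m')\<^sup>2" by (simp add: t_def power2_eq_square)
  then have "t * inner v m' > 0" using nz m'0 by simp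
  ultimately show False by simp
 qed
 have "cinner m' v = 0" if m': "m' \<in> M" for m'
 proof -
  have "Re (cinner m' v) = 0" using orth[OF m'] inner_commute[of v m'] by (simp add: inner_L2_def)
  moreover have "Re (cinner (\<i> *\<^sub>C m') v) = 0"
   using orth[OF Ms(1)[OF m' m', of \<i>]] inner_commute[of v "\<i> *\<^sub>C m'"] by (simp add: inner_L2_def)
  ultimately show ?thesis by (simp add: cinner_scaleC_left complex_eq_iff)
 qed
 moreover have "v \<noteq> 0" using u m0M by (auto simp: v_def)
 ultimately show ?thesis by blast
qed

lemma L2_subspace_closure:
 assumes "L2.subspace M" shows "L2.subspace (closure M)"
proof (rule L2.subspaceI)
 show "0 \<in> closure M" using L2.subspace_0[OF assms] closure_subset by blast
next
 fix x y assume "x \<in> closure M" "y \<in> closure M"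
 then obtain a b where ab: "\<And>n. a n \<in> M" "a \<longlonglongrightarrow> x" "\<And>n. b n \<in> M" "b \<longlonglongrightarrow> y"
  unfolding closure_sequential by blast
 have "(\<lambda>n. a n + b n) \<longlonglongrightarrow> x + y" by (intro tendsto_add ab)
 moreover have "a n + b n \<in> M" for n using ab L2.subspace_add[OF assms] by blast
 ultimately show "x + y \<in> closure M" unfolding closure_sequential by (intro exI[of _ "\<lambda>n. a n + b n"]) auto
next
 fix c x assume "x \<in> closure M"
 then obtain a where ab: "\<And>n. a n \<in> M" "a \<longlonglongrightarrow> x"
  unfolding closure_sequential by blast
 have "(\<lambda>n. c *\<^sub>C a n) \<longlonglongrightarrow> c *\<^sub>C x" by (intro tendsto_scaleC ab)
 moreover have "c *\<^sub>C a n \<in> M" for n using ab L2.subspace_scale[OF assms] by blast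
 ultimately show "c *\<^sub>C x \<in> closure M" unfolding closure_sequential by (intro exI[of _ "\<lambda>n. c *\<^sub>C a n"]) auto
qed

lemma L2_dense_iff:
 assumes "L2.subspace M" "\<And>v. (\<And>m. m \<in> M \<Longrightarrow> cinner m v = 0) \<Longrightarrow> v = 0"
 shows "closure M = UNIV"
proof (rule ccontr)
 assume "closure M \<noteq> UNIV"
 then obtain v where "v \<noteq> 0" "\<forall>m\<in>closure M. cinner m v = 0"
  using L2_projection[OF L2_subspace_closure[OF assms(1)] closed_closure] by blast
 then show False using assms(2)[of v] closure_subset by blast
qed

section \<open>Self-adjoint relations and their resolvents\<close>

definition linear_relation :: "L2_op \<Rightarrow> bool" where
 "linear_relation T \<longleftrightarrow> (0, 0) \<in> T \<and>
   (\<forall>u v u' v'. (u, v) \<in> T \<longrightarrow> (u', v') \<in> T \<longrightarrow> (u + u', v + v') \<in> T) \<and>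
   (\<forall>c u v. (u, v) \<in> T \<longrightarrow> (c *\<^sub>C u, c *\<^sub>C v) \<in> T)"

lemma linear_relationD:
 assumes "linear_relation T"
 shows "(0, 0) \<in> T" "(u, v) \<in> T \<Longrightarrow> (u', v') \<in> T \<Longrightarrow> (u + u', v + v') \<in> T"
  "(u, v) \<in> T \<Longrightarrow> (c *\<^sub>C u, c *\<^sub>C v) \<in> T" "(u, v) \<in> T \<Longrightarrow> (u', v') \<in> T \<Longrightarrow> (u - u', v - v') \<in> T"
proof -
 show *: "(0, 0) \<in> T" "(u, v) \<in> T \<Longrightarrow> (u', v') \<in> T \<Longrightarrow> (u + u', v + v') \<in> T"
  "(u, v) \<in> T \<Longrightarrow> (c *\<^sub>C u, c *\<^sub>C v) \<in> T" for u v u' v' c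
  using assms by (auto simp: linear_relation_def)
 show "(u, v) \<in> T \<Longrightarrow> (u', v') \<in> T \<Longrightarrow> (u - u', v - v') \<in> T"
  using *(2)[OF _ *(3)[of u' v' "-1"], of u v] by simp
qed

lemma op_adjoint_iff: "(u, v) \<in> op_adjoint T \<longleftrightarrow> (\<forall>f h. (f, h) \<in> T \<longrightarrow> cinner h u = cinner f v)"
 by (auto simp: op_adjoint_def)

lemma linear_relation_op_adjoint: "linear_relation (op_adjoint T)"
 unfolding linear_relation_def op_adjoint_iff by (simp add: cinner_add_right cinner_scaleC_right)

lemma self_adjoint_linear: "self_adjoint T \<Longrightarrow> linear_relation T"
 using linear_relation_op_adjoint[of T] by (simp add: self_adjoint_def)

text \<open>For a pair in the adjoint, surjectivity provides an element of \<open>T\<close> with the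
  same image under T - c. By symmetry the difference of the first components is orthogonal to the
  range of T - c, hence zero. A vector x orthogonal to the domain is shown in the same way to
  satisfy (0, x) \<in> T, and single-valuedness then gives density.\<close>

lemma self_adjointI:
 fixes c :: real
 assumes lin: "linear_relation T"
  and sym: "\<And>u v u' v'. (u, v) \<in> T \<Longrightarrow> (u', v') \<in> T \<Longrightarrow> cinner v u' = cinner u v'"
  and surj: "\<And>f. \<exists>u v. (u, v) \<in> T \<and> v - complex_of_real c *\<^sub>C u = f"
  and single: "\<And>v. (0, v) \<in> T \<Longrightarrow> v = 0"
 shows "self_adjoint T"
proof -
 have sep: "x = y" if "\<And>f h. (f, h) \<in> T \<Longrightarrow> cinner (h - complex_of_real c *\<^sub>C f) x = cinner (h - complex_of_real c *\<^sub>C f) y" for x y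
 proof -
  obtain f h where "(f, h) \<in> T" "h - complex_of_real c *\<^sub>C f = x - y" using surj by blast
  then have "cinner (x - y) (x - y) = 0" using that[of f h] by (simp add: cinner_diff_right)
  then show ?thesis by (simp add: cinner_self_norm)
 qed
 have shift: "cinner (h - complex_of_real c *\<^sub>C f) w = cinner f (y - complex_of_real c *\<^sub>C w)"
  if "cinner h w = cinner f y" for f h w y
  using that by (simp add: cinner_diff_left cinner_diff_right cinner_scaleC_left cinner_scaleC_right)
 have adj: "op_adjoint T = T"
 proof (intro equalityI subrelI)
  fix u v assume "(u, v) \<in> op_adjoint T"
  then have a: "\<And>f h. (f, h) \<in> T \<Longrightarrow> cinner h u = cinner f v" by (simp add: op_adjoint_iff)
  obtain w y where wy: "(w, y) \<in> T" "y - complex_of_real c *\<^sub>C w = v - complex_of_real c *\<^sub>C u" using surj by blast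
  have "u = w"
  proof (rule sep)
   fix f h assume fh: "(f, h) \<in> T"
   show "cinner (h - complex_of_real c *\<^sub>C f) u = cinner (h - complex_of_real c *\<^sub>C f) w"
    using shift[OF a[OF fh]] shift[OF sym[OF fh wy(1)]] wy(2) by simp
  qed
  then show "(u, v) \<in> T" using wy by simp
 next
  fix u v assume "(u, v) \<in> T"
  then show "(u, v) \<in> op_adjoint T" using sym by (auto simp: op_adjoint_iff)
 qed
 have "closure (Domain T) = UNIV"
 proof (rule L2_dense_iff)
  show "L2.subspace (Domain T)"
   by (rule L2.subspaceI) (use linear_relationD[OF lin] in blast)+
  fix x assume x: "\<And>m. m \<in> Domain T \<Longrightarrow> cinner m x = 0"
  obtain w y where wy: "(w, y) \<in> T" "y - complex_of_real c *\<^sub>C w = x" using surj by blast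
  have "w = 0"
  proof (rule sep)
   fix f h assume fh: "(f, h) \<in> T"
   show "cinner (h - complex_of_real c *\<^sub>C f) w = cinner (h - complex_of_real c *\<^sub>C f) 0"
    using shift[OF sym[OF fh wy(1)]] wy(2) x[of f] fh by auto
  qed
  then show "x = 0" using wy single by auto
 qed
 with adj show ?thesis by (simp add: self_adjoint_def)
qed

lemma op_shift_iff: "(u, f) \<in> op_shift T z \<longleftrightarrow> (u, f + z *\<^sub>C u) \<in> T"
 unfolding op_shift_def by (auto simp: algebra_simps)

text \<open>The first lower bound makes T - z injective with closed range. A vector orthogonal to
  that range is an eigenvector of the adjoint, that is of \<open>T\<close>, for the conjugate of
  \<open>z\<close>, and the second bound excludes it.\<close>

lemma self_adjoint_resolvent:
 assumes sa: "self_adjoint T" and k: "0 < k"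
  and low: "\<And>u v. (u, v) \<in> T \<Longrightarrow> k * norm u \<le> norm (v - z *\<^sub>C u)"
  and low': "\<And>u v. (u, v) \<in> T \<Longrightarrow> k * norm u \<le> norm (v - cnj z *\<^sub>C u)"
 shows "z \<in> resolvent_set T" "(resolvent T z f, f + z *\<^sub>C resolvent T z f) \<in> T"
  "norm (resolvent T z f) \<le> norm f / k" "(u, f + z *\<^sub>C u) \<in> T \<Longrightarrow> resolvent T z f = u"
proof -
 have lin: "linear_relation T" by (rule self_adjoint_linear[OF sa])
 note linD = linear_relationD[OF lin]
 have adj: "op_adjoint T = T" using sa by (simp add: self_adjoint_def)
 define M where "M = {v - z *\<^sub>C u | u v. (u, v) \<in> T}"
 have sub: "L2.subspace M"
 proof (rule L2.subspaceI)
  show "0 \<in> M" unfolding M_def by (intro CollectI exI[of _ 0] conjI linD(1)) simp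
 next
  fix x y assume "x \<in> M" "y \<in> M"
  then obtain u v u' v' where *: "x = v - z *\<^sub>C u" "(u, v) \<in> T" "y = v' - z *\<^sub>C u'" "(u', v') \<in> T" by (auto simp: M_def)
  have "x + y = (v + v') - z *\<^sub>C (u + u')" by (simp add: * L2.scale_right_distrib)
  then show "x + y \<in> M" unfolding M_def using linD(2)[OF *(2,4)] by blast
 next
  fix c x assume "x \<in> M"
  then obtain u v where *: "x = v - z *\<^sub>C u" "(u, v) \<in> T" by (auto simp: M_def)
  have "c *\<^sub>C x = c *\<^sub>C v - z *\<^sub>C (c *\<^sub>C u)" by (simp add: * L2.scale_right_diff_distrib mult.commute)
  then show "c *\<^sub>C x \<in> M" unfolding M_def using linD(3)[OF *(2)] by blast
 qed
 have "closed M"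
  unfolding closed_sequential_limits
 proof (intro allI impI)
  fix x l assume a: "(\<forall>n. x n \<in> M) \<and> x \<longlonglongrightarrow> l"
  then have "\<forall>n. \<exists>u v. x n = v - z *\<^sub>C u \<and> (u, v) \<in> T" by (auto simp: M_def)
  then obtain u v where uv: "\<And>n. x n = v n - z *\<^sub>C u n" "\<And>n. (u n, v n) \<in> T" by metis
  have le: "k * norm (u m - u n) \<le> norm (x m - x n)" for m n
  proof -
   have "(v m - v n) - z *\<^sub>C (u m - u n) = x m - x n" by (simp add: uv(1) L2.scale_right_diff_distrib)
   then show ?thesis using low[OF linD(4)[OF uv(2)[of m] uv(2)[of n]]] by simp
  qed
  have "Cauchy x" using a LIMSEQ_imp_Cauchy by blast
  have "Cauchy u"
  proof (rule CauchyI)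
   fix e :: real assume "e > 0"
   then obtain N where N: "\<And>m n. m \<ge> N \<Longrightarrow> n \<ge> N \<Longrightarrow> norm (x m - x n) < k * e"
    using CauchyD[OF \<open>Cauchy x\<close>, of "k * e"] k by auto
   have "norm (u m - u n) < e" if "m \<ge> N" "n \<ge> N" for m n
   proof -
    have "k * norm (u m - u n) < k * e" using le[of m n] N[OF that] by linarith
    then show ?thesis using k by simp
   qed
   then show "\<exists>M. \<forall>p\<ge>M. \<forall>q\<ge>M. norm (u p - u q) < e" by blast
  qed
  then obtain u0 where u0: "u \<longlonglongrightarrow> u0" using Cauchy_convergent_iff convergent_def by blast
  have "(\<lambda>n. x n + z *\<^sub>C u n) \<longlonglongrightarrow> l + z *\<^sub>C u0" by (intro tendsto_add tendsto_scaleC u0 conjunct2[OF a])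
  then have v0: "v \<longlonglongrightarrow> l + z *\<^sub>C u0" by (simp add: uv(1))
  have "(u0, l + z *\<^sub>C u0) \<in> op_adjoint T"
   unfolding op_adjoint_iff
  proof (intro allI impI)
   fix f h assume fh: "(f, h) \<in> T"
   have "cinner h (u n) = cinner f (v n)" for n
    using uv(2)[of n] fh adj op_adjoint_iff by metis
   then have "(\<lambda>n. cinner f (v n)) \<longlonglongrightarrow> cinner h u0"
    using tendsto_cinner[OF tendsto_const[of h] u0] by simp
   then show "cinner h u0 = cinner f (l + z *\<^sub>C u0)"
    using tendsto_cinner[OF tendsto_const[of f] v0] LIMSEQ_unique by blast
  qed
  then show "l \<in> M" unfolding adj M_def by (intro CollectI exI[of _ u0] exI[of _ "l + z *\<^sub>C u0"]) simp
 qed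
 have M: "M = UNIV"
 proof (rule ccontr)
  assume "M \<noteq> UNIV"
  then obtain x where x: "x \<noteq> 0" "\<forall>m\<in>M. cinner m x = 0" using L2_projection[OF sub \<open>closed M\<close>] by blast
  have "(x, cnj z *\<^sub>C x) \<in> op_adjoint T"
   unfolding op_adjoint_iff
  proof (intro allI impI)
   fix f h assume "(f, h) \<in> T"
   then have "cinner (h - z *\<^sub>C f) x = 0" using x(2) by (auto simp: M_def)
   then show "cinner h x = cinner f (cnj z *\<^sub>C x)" by (simp add: cinner_diff_left cinner_scaleC_left cinner_scaleC_right)
  qed
  then have "k * norm x \<le> 0" using low'[of x "cnj z *\<^sub>C x"] adj by simp
  then show False using k x(1) by (simp add: mult_le_0_iff)
 qed
 have ex: "\<exists>u. (u, f + z *\<^sub>C u) \<in> T" for f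
 proof -
  have "f \<in> M" using M by simp
  then obtain u v where "f = v - z *\<^sub>C u" "(u, v) \<in> T" by (auto simp: M_def)
  then show ?thesis by (intro exI[of _ u]) simp
 qed
 have uniq: "u = u'" if "(u, f + z *\<^sub>C u) \<in> T" "(u', f + z *\<^sub>C u') \<in> T" for u u' f
 proof -
  have "(u - u', z *\<^sub>C (u - u')) \<in> T" using linD(4)[OF that] by (simp add: L2.scale_right_diff_distrib)
  then have "k * norm (u - u') \<le> 0" using low by force
  then show ?thesis using k by (simp add: mult_le_0_iff)
 qed
 have ex1: "\<exists>!u. (u, f) \<in> op_shift T z" for f
  unfolding op_shift_iff using ex uniq by blast
 have res: "(resolvent T z f, f + z *\<^sub>C resolvent T z f) \<in> T" for f
  using theI'[OF ex1, of f] unfolding resolvent_def op_shift_iff .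
 show "(resolvent T z f, f + z *\<^sub>C resolvent T z f) \<in> T" by (rule res)
 have eq: "resolvent T z f = u" if "(u, f + z *\<^sub>C u) \<in> T" for f u by (rule uniq[OF res that])
 show "(u, f + z *\<^sub>C u) \<in> T \<Longrightarrow> resolvent T z f = u" by (rule eq)
 have bd: "norm (resolvent T z f) \<le> norm f / k" for f
  using low[OF res[of f]] k by (simp add: field_simps)
 show "norm (resolvent T z f) \<le> norm f / k" by (rule bd)
 have "bounded_linear (resolvent T z)"
 proof (rule bounded_linear_intro)
  fix f g :: L2 and r :: real
  show "resolvent T z (f + g) = resolvent T z f + resolvent T z g"
   by (rule eq) (use linD(2)[OF res[of f] res[of g]] in \<open>simp add: L2.scale_right_distrib algebra_simps\<close>)
  show "resolvent T z (r *\<^sub>R f) = r *\<^sub>R resolvent T z f"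
   by (rule eq) (use linD(3)[OF res[of f], of "complex_of_real r"] in \<open>simp add: scaleR_L2_def L2.scale_right_distrib mult.commute\<close>)
  show "norm (resolvent T z f) \<le> norm f * (1 / k)" using bd[of f] by simp
 qed
 then show "z \<in> resolvent_set T" using ex1 by (simp add: resolvent_set_def)
qed

section \<open>Orthonormal bases and rank-one operators\<close>

lemma ae_zero_if_integrals_zero:
 fixes k :: "real \<Rightarrow> complex"
 assumes k: "k absolutely_integrable_on {a..b}" and z: "\<And>x. a \<le> x \<Longrightarrow> x \<le> b \<Longrightarrow> integral {a..x} k = 0"
 shows "\<exists>N. negligible N \<and> (\<forall>x\<in>{a<..<b} - N. k x = 0)"
proof -
 obtain N where N: "negligible N" "\<And>x. x \<in> {a<..<b} - N \<Longrightarrow> ((\<lambda>x. integral {a..x} k) has_vector_derivative k x) (at x)"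
  using indefinite_integral_has_derivative_ae[OF k] by blast
 have "k x = 0" if x: "x \<in> {a<..<b} - N" for x
 proof -
  have "((\<lambda>x. 0) has_vector_derivative k x) (at x)"
   by (rule has_vector_derivative_transform_within_open[OF N(2)[OF x], of "{a<..<b}"]) (use x z in auto)
  then show ?thesis using vector_derivative_unique_at[OF _ has_vector_derivative_const] by blast
 qed
 then show ?thesis using N(1) by blast
qed

lemma integrable_halfline_iff: "integrable halfline f \<longleftrightarrow> f absolutely_integrable_on {0<..}"
 for f :: "real \<Rightarrow> 'b::euclidean_space"
 by (simp add: set_integrable_def integrable_restrict_space)

text \<open>On a set of finite measure the inequality |f| \<le> 1 + |f|^2 suffices. The interval is
  open at 0 because elements of \<open>sq_integrable\<close> are constrained on the open half-line
  only.\<close>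

lemma sq_integrable_near_zero:
 assumes f: "f \<in> sq_integrable"
 shows "f absolutely_integrable_on {0<..b}"
proof (rule measurable_bounded_by_integrable_imp_absolutely_integrable)
 have s: "{0<..b} \<subseteq> {0<..}" by auto
 show "f \<in> borel_measurable (lebesgue_on {0<..b})"
  using measurable_restrict_mono[OF sq_integrableD(1)[OF f] s] .
 have "(\<lambda>x. (cmod (f x))\<^sup>2) absolutely_integrable_on {0<..b}"
  by (rule set_integrable_subset[OF _ _ s]) (use sq_integrableD(2)[OF f] in \<open>auto simp: integrable_halfline_iff\<close>)
 moreover have "(\<lambda>x. 1::real) integrable_on {0<..b}"
  by (rule integrable_spike_set[OF integrable_const_ivl[of _ 0 b]]) (auto intro: negligible_subset[of "{0}"])
 ultimately show "(\<lambda>x. 1 + (cmod (f x))\<^sup>2) integrable_on {0<..b}"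
  by (intro integrable_add) (auto simp: absolutely_integrable_on_def)
 show "norm (f x) \<le> 1 + (cmod (f x))\<^sup>2" for x
 proof -
  have "2 * cmod (f x) \<le> 1 + (cmod (f x))\<^sup>2" using zero_le_power2[of "cmod (f x) - 1"] by (simp add: power2_diff)
  then show ?thesis using norm_ge_zero[of "f x"] by linarith
 qed
qed simp

lemma sq_integrable_absolutely_integrable:
 "f \<in> sq_integrable \<Longrightarrow> 0 < a \<Longrightarrow> f absolutely_integrable_on {a..b}"
 by (rule set_integrable_subset[OF sq_integrable_near_zero[of f b]]) auto

text \<open>With rational end-points these indicators form a countable total family, which makes the
  space separable.\<close>

definition box_fun :: "real \<Rightarrow> real \<Rightarrow> real \<Rightarrow> complex" where
 "box_fun p q x = (if x \<in> {p..q} then 1 else 0)"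

lemma box_fun_sq: "box_fun p q \<in> sq_integrable"
 unfolding sq_integrable_def
proof (intro CollectI conjI)
 have "box_fun p q \<in> borel_measurable lborel" unfolding box_fun_def by measurable
 then show "box_fun p q \<in> borel_measurable halfline"
  by (intro measurable_restrict_space1 measurable_completion)
 have "{0<..} \<inter> {p..q} \<in> lmeasurable"
  by (rule bounded_set_imp_lmeasurable) (auto intro: bounded_subset[OF bounded_closed_interval])
 then have "integrable lebesgue (indicat_real ({0<..} \<inter> {p..q}))"
  by (intro integrable_real_indicator) (auto simp: fmeasurable_def)
 moreover have "indicat_real ({0<..} \<inter> {p..q}) = (\<lambda>x. indicat_real {0<..} x *\<^sub>R (cmod (box_fun p q x))\<^sup>2)"
  by (auto simp: box_fun_def indicator_def fun_eq_iff)
 ultimately show "integrable halfline (\<lambda>x. (cmod (box_fun p q x))\<^sup>2)"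
  by (simp add: integrable_restrict_space)
qed

lemma cinner_box_fun:
 assumes f: "f \<in> sq_integrable" and p: "0 < p"
 shows "cinner (abs_L2 f) (abs_L2 (box_fun p q)) = integral {p..q} f"
proof -
 have "cinner (abs_L2 f) (abs_L2 (box_fun p q)) = integral\<^sup>L halfline (\<lambda>x. if x \<in> {p..q} then f x else 0)"
  unfolding cinner_abs_L2[OF f box_fun_sq] by (intro Bochner_Integration.integral_cong) (auto simp: box_fun_def)
 also have "\<dots> = integral\<^sup>L (lebesgue_on {p..q}) f"
  by (rule Lebesgue_Measure.integral_restrict) (use p in auto)
 also have "\<dots> = integral {p..q} f"
  by (rule lebesgue_integral_eq_integral, rule absolutely_integrable_imp_integrable,
    rule sq_integrable_absolutely_integrable[OF f p]) simp_all
 finally show ?thesis .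
qed

text \<open>The indefinite integral vanishes at rational points, by continuity everywhere, and the
  differentiation theorem makes the function vanish almost everywhere.\<close>

lemma box_fun_total:
 assumes "\<And>p q. p \<in> \<rat> \<Longrightarrow> q \<in> \<rat> \<Longrightarrow> 0 < p \<Longrightarrow> p < q \<Longrightarrow> cinner u (abs_L2 (box_fun p q)) = 0"
 shows "u = 0"
proof -
 obtain f where f: "f \<in> sq_integrable" "u = abs_L2 f" by (rule L2_rep)
 have "\<exists>N. negligible N \<and> (\<forall>x>0. x \<notin> N \<longrightarrow> f x = 0)"
 proof (rule half_line_ae, rule ae_zero_if_integrals_zero)
  fix n :: nat
  let ?a = "1/(real n + 2)" and ?b = "real n + 2"
  show ai: "f absolutely_integrable_on {?a..?b}" by (rule sq_integrable_absolutely_integrable[OF f(1)]) simp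
  then have fi: "f integrable_on {?a..?b}" using set_lebesgue_integral_eq_integral(1) by blast
  have aQ: "?a \<in> \<rat>" by (intro Rats_divide Rats_add Rats_1 Rats_of_nat Rats_number_of)
  have rat: "integral {?a..q} f = 0" if "q \<in> \<rat>" "?a < q" for q
   using assms[OF aQ that(1) _ that(2)] f by (simp add: cinner_box_fun)
  have cont: "continuous_on {?a..?b} (\<lambda>x. integral {?a..x} f)" by (rule indefinite_integral_continuous_1[OF fi])
  fix x assume x: "?a \<le> x" "x \<le> ?b"
  show "integral {?a..x} f = 0"
  proof (cases "x = ?a")
   case False
   then have ax: "?a < x" using x by simp
   show ?thesis
   proof (rule ccontr)
    assume nz: "integral {?a..x} f \<noteq> 0"
    obtain d where d: "d > 0" "\<And>y. y \<in> {?a..?b} \<Longrightarrow> dist y x < d \<Longrightarrow>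
      dist (integral {?a..y} f) (integral {?a..x} f) < cmod (integral {?a..x} f)"
     using cont x nz unfolding continuous_on_iff by (metis atLeastAtMost_iff zero_less_norm_iff)
    obtain q where q: "q \<in> \<rat>" "max ?a (x - d) < q" "q < x" using Rats_dense_in_real[of "max ?a (x - d)" x] ax d(1) by auto
    then show False using d(2)[of q] rat[of q] x by (auto simp: dist_real_def)
   qed
  qed simp
 qed
 then obtain N where "negligible N" "\<forall>x>0. x \<notin> N \<longrightarrow> f x = 0" by blast
 then have "AE x in lebesgue. x \<in> {0<..} \<longrightarrow> f x = 0"
  by (intro AE_I'[of N]) (auto simp: negligible_iff_null_sets)
 then have "AE x in halfline. f x = 0" by (subst AE_restrict_space_iff) auto
 then show ?thesis unfolding f(2) zero_L2_def using abs_L2_eq_iff[OF f(1) sq_integrable_zero]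
  by (simp add: zero_L2.abs_eq[symmetric])
qed

definition orthonormal_set :: "L2 set \<Rightarrow> bool" where
 "orthonormal_set B \<longleftrightarrow> (\<forall>x\<in>B. \<forall>y\<in>B. cinner x y = (if x = y then 1 else 0))"

lemma Bessel_finite:
 assumes B: "orthonormal_set B" and F: "finite F" "F \<subseteq> B"
 shows "(\<Sum>b\<in>F. (cmod (cinner g b))\<^sup>2) \<le> (norm g)\<^sup>2"
proof -
 define s where "s = (\<Sum>b\<in>F. cinner g b *\<^sub>C b)"
 have sb: "cinner s b = cinner g b" if "b \<in> F" for b
 proof -
  have "cinner s b = (\<Sum>x\<in>F. cinner g x * cinner x b)"
   unfolding s_def using F(1) by (induction F rule: finite_induct) (auto simp: cinner_add_left cinner_scaleC_left)
  also have "\<dots> = (\<Sum>x\<in>F. if x = b then cinner g b else 0)"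
  proof (intro sum.cong refl)
   fix x assume "x \<in> F"
   then have "cinner x b = (if x = b then 1 else 0)" using B F that unfolding orthonormal_set_def by blast
   then show "cinner g x * cinner x b = (if x = b then cinner g b else 0)" by simp
  qed
  finally show ?thesis using F that by simp
 qed
 have os: "cinner (g - s) w = 0" if "w = (\<Sum>b\<in>F. c b *\<^sub>C b)" for w c
 proof -
  have "cinner (g - s) w = (\<Sum>b\<in>F. cnj (c b) * cinner (g - s) b)"
   unfolding that using F(1) by (induction F rule: finite_induct) (auto simp: cinner_add_right cinner_scaleC_right)
  also have "\<dots> = 0" by (intro sum.neutral) (simp add: cinner_diff_left sb)
  finally show ?thesis .
 qed
 have "(norm ((g - s) + s))\<^sup>2 = (norm (g - s))\<^sup>2 + (norm s)\<^sup>2" by (rule norm_pythagoras, rule os[OF s_def])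
 then have "(norm s)\<^sup>2 \<le> (norm g)\<^sup>2" by simp
 moreover have "complex_of_real ((norm s)\<^sup>2) = (\<Sum>b\<in>F. cnj (cinner g b) * cinner s b)"
 proof -
  have "cinner s (\<Sum>b\<in>F. cinner g b *\<^sub>C b) = (\<Sum>b\<in>F. cnj (cinner g b) * cinner s b)"
   using F(1) by (induction F rule: finite_induct) (auto simp: cinner_add_right cinner_scaleC_right)
  then show ?thesis unfolding cinner_self_norm[symmetric] by (simp add: s_def[symmetric])
 qed
 moreover have "(\<Sum>b\<in>F. cnj (cinner g b) * cinner s b) = (\<Sum>b\<in>F. cinner g b * cnj (cinner g b))"
  by (intro sum.cong) (simp_all add: sb mult.commute)
 ultimately have "complex_of_real ((norm s)\<^sup>2) = complex_of_real (\<Sum>b\<in>F. (cmod (cinner g b))\<^sup>2)"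
  unfolding of_real_sum complex_norm_square by (simp only:)
 then have "(norm s)\<^sup>2 = (\<Sum>b\<in>F. (cmod (cinner g b))\<^sup>2)" by (simp only: of_real_eq_iff)
 then show ?thesis using \<open>(norm s)\<^sup>2 \<le> (norm g)\<^sup>2\<close> by simp
qed

text \<open>By Bessel's inequality the squared coefficients are summable, and a summable family has
  countable support.\<close>

lemma Bessel_countable:
 assumes B: "orthonormal_set B"
 shows "countable {b\<in>B. cinner g b \<noteq> 0}"
proof -
 have "(\<lambda>b. (cmod (cinner g b))\<^sup>2) summable_on B"
 proof (rule nonneg_bdd_above_summable_on)
  show "bdd_above (sum (\<lambda>b. (cmod (cinner g b))\<^sup>2) ` {F. F \<subseteq> B \<and> finite F})"
   by (rule bdd_aboveI[of _ "(norm g)\<^sup>2"]) (use Bessel_finite[OF B] in auto)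
 qed auto
 then have "(\<lambda>b. norm ((cmod (cinner g b))\<^sup>2)) summable_on B" by simp
 then have "countable {b\<in>B. (cmod (cinner g b))\<^sup>2 \<noteq> 0}" by (rule abs_summable_countable)
 then show ?thesis by simp
qed

text \<open>\<open>orthonormal_basis\<close> asks for a sequence without repetition. Zorn's lemma is
  applied above a given orthonormal sequence, so the maximal set is infinite. It is countable
  because each member is non-orthogonal to one of countably many box functions, and each of these is
  non-orthogonal to countably many members.\<close>

lemma orthonormal_basis_exists: "\<exists>e. orthonormal_basis e"
proof -
 \<comment> \<open>Indicators of disjoint intervals of length 1/2, whence the factor sqrt 2 in
   \<open>b0\<close>.\<close>
 define i where "i n = abs_L2 (box_fun (real n + 1) (real n + 3/2))" for n :: nat
 have ii: "cinner (i m) (i n) = (if m = n then 1/2 else 0)" for m n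
 proof -
  have "cinner (i m) (i n) = integral {real n + 1..real n + 3/2} (box_fun (real m + 1) (real m + 3/2))"
   unfolding i_def by (rule cinner_box_fun[OF box_fun_sq]) simp
  also have "\<dots> = (if m = n then 1/2 else 0)"
  proof (cases "m = n")
   case True
   have "integral {real n + 1..real n + 3/2} (box_fun (real m + 1) (real m + 3/2)) = integral {real n + 1..real n + 3/2} (\<lambda>x. 1)"
    using True by (intro Henstock_Kurzweil_Integration.integral_cong) (simp add: box_fun_def)
   then show ?thesis using True by (simp add: content_real scaleR_conv_of_real)
  next
   case False
   then have mn: "real m + 1 \<le> real n \<or> real n + 1 \<le> real m" by linarith
   have "integral {real n + 1..real n + 3/2} (box_fun (real m + 1) (real m + 3/2)) = integral {real n + 1..real n + 3/2} (\<lambda>x. 0)"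
    using mn by (intro Henstock_Kurzweil_Integration.integral_cong) (auto simp: box_fun_def)
   then show ?thesis using False by simp
  qed
  finally show ?thesis .
 qed
 define b0 where "b0 n = complex_of_real (sqrt 2) *\<^sub>C i n" for n
 have b0: "cinner (b0 m) (b0 n) = (if m = n then 1 else 0)" for m n
  unfolding b0_def by (simp add: cinner_scaleC_left cinner_scaleC_right ii) (metis of_real_mult of_real_numeral real_sqrt_mult_self abs_numeral)
 have inj: "inj b0" by (rule injI) (metis b0 zero_neq_one)
 define \<A> where "\<A> = {B. orthonormal_set B \<and> range b0 \<subseteq> B}"
 have "range b0 \<in> \<A>" unfolding \<A>_def orthonormal_set_def using b0 by (auto simp: inj_eq[OF inj])
 then have "\<exists>M\<in>\<A>. \<forall>X\<in>\<A>. M \<subseteq> X \<longrightarrow> X = M"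
 proof (intro subset_Zorn_nonempty)
  fix \<C> assume C: "\<C> \<noteq> {}" "subset.chain \<A> \<C>"
  then have sub: "\<And>B. B \<in> \<C> \<Longrightarrow> orthonormal_set B \<and> range b0 \<subseteq> B" by (auto simp: subset.chain_def \<A>_def)
  have "orthonormal_set (\<Union>\<C>)"
   unfolding orthonormal_set_def
  proof (intro ballI)
   fix x y assume "x \<in> \<Union>\<C>" "y \<in> \<Union>\<C>"
   then obtain X Y where XY: "X \<in> \<C>" "x \<in> X" "Y \<in> \<C>" "y \<in> Y" by blast
   then have "X \<subseteq> Y \<or> Y \<subseteq> X" using C(2) by (auto simp: subset.chain_def)
   then obtain Z where "Z \<in> \<C>" "x \<in> Z" "y \<in> Z" using XY by blast
   then show "cinner x y = (if x = y then 1 else 0)" using sub[of Z] by (simp add: orthonormal_set_def)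
  qed
  then show "\<Union>\<C> \<in> \<A>" using sub C(1) by (auto simp: \<A>_def)
 qed auto
 then obtain B where B: "orthonormal_set B" "range b0 \<subseteq> B" and max: "\<And>X. orthonormal_set X \<Longrightarrow> range b0 \<subseteq> X \<Longrightarrow> B \<subseteq> X \<Longrightarrow> X = B"
  by (auto simp: \<A>_def)
 have total: "v = 0" if v: "\<And>b. b \<in> B \<Longrightarrow> cinner b v = 0" for v
 proof (rule ccontr)
  assume "v \<noteq> 0"
  define w where "w = complex_of_real (1 / norm v) *\<^sub>C v"
  have "norm w = 1" using \<open>v \<noteq> 0\<close> unfolding w_def norm_scaleC by (simp del: of_real_divide)
  then have ww: "cinner w w = 1" by (simp add: cinner_self_norm)
  have bw: "cinner b w = 0" if "b \<in> B" for b using v[OF that] by (simp add: w_def cinner_scaleC_right)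
  have wb: "cinner w b = 0" if "b \<in> B" for b using bw[OF that] cinner_commute[of w b] by simp
  have "w \<notin> B" using bw ww by force
  have "orthonormal_set (insert w B)"
   using B(1) ww bw wb \<open>w \<notin> B\<close> unfolding orthonormal_set_def by auto
  then have "insert w B = B" using B(2) by (intro max) auto
  then show False using \<open>w \<notin> B\<close> by blast
 qed
 have inf: "infinite B" using B(2) inj range_inj_infinite infinite_super by blast
 define G where "G = (\<lambda>(p,q). abs_L2 (box_fun p q)) ` (\<rat> \<times> \<rat>)"
 have "B \<subseteq> (\<Union>g\<in>G. {b\<in>B. cinner g b \<noteq> 0})"
 proof
  fix b assume b: "b \<in> B"
  then have "cinner b b = 1" using B(1) by (auto simp: orthonormal_set_def)
  then have "b \<noteq> 0" by auto
  then obtain p q where pq: "p \<in> \<rat>" "q \<in> \<rat>" "cinner b (abs_L2 (box_fun p q)) \<noteq> 0" using box_fun_total[of b] by metis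
  then have "cinner (abs_L2 (box_fun p q)) b \<noteq> 0" using cinner_commute[of b] by auto
  moreover have "abs_L2 (box_fun p q) \<in> G" using pq unfolding G_def by force
  ultimately show "b \<in> (\<Union>g\<in>G. {b\<in>B. cinner g b \<noteq> 0})" using b by blast
 qed
 moreover have "countable (\<Union>g\<in>G. {b\<in>B. cinner g b \<noteq> 0})"
  using Bessel_countable[OF B(1)] by (intro countable_UN) (auto simp: G_def countable_rat)
 ultimately have "countable B" using countable_subset by blast
 then have e: "bij_betw (from_nat_into B) UNIV B" using inf by (rule bij_betw_from_nat_into)
 define e where "e = from_nat_into B"
 have eB: "e n \<in> B" for n using e by (auto simp: e_def bij_betw_def)
 have "cinner (e m) (e n) = (if m = n then 1 else 0)" for m n
  using B(1) eB[of m] eB[of n] e by (auto simp: orthonormal_set_def e_def bij_betw_def inj_eq)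
 moreover have "closure (L2.span (range e)) = UNIV"
 proof (rule L2_dense_iff[OF L2.subspace_span])
  fix v assume v: "\<And>m. m \<in> L2.span (range e) \<Longrightarrow> cinner m v = 0"
  show "v = 0"
  proof (rule total)
   fix b assume "b \<in> B"
   then have "b \<in> range e" using e by (auto simp: e_def bij_betw_def)
   then show "cinner b v = 0" using v L2.span_base by blast
  qed
 qed
 ultimately show ?thesis unfolding orthonormal_basis_def by blast
qed

text \<open>The partial sums \<open>S N\<close> are orthogonal projections, hence best
  approximations from the span of the first \<open>N\<close> vectors; density of the whole span
  makes them converge to \<open>u\<close>.\<close>

lemma Parseval:
 assumes e: "orthonormal_basis e"
 shows "(\<lambda>n. cinner u (e n) * cinner (e n) v) sums cinner u v"
proof -
 have on: "cinner (e m) (e n) = (if m = n then 1 else 0)" for m n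
  using e by (auto simp: orthonormal_basis_def)
 have cl: "closure (L2.span (range e)) = UNIV"
  using e by (auto simp: orthonormal_basis_def)
 define S where "S N = (\<Sum>n<N. cinner u (e n) *\<^sub>C e n)" for N
 have Sc: "cinner (S N) w = (\<Sum>n<N. cinner u (e n) * cinner (e n) w)" for N w
  unfolding S_def by (induction N) (auto simp: cinner_add_left cinner_scaleC_left)
 have Se: "cinner (S N) (e m) = cinner u (e m)" if "m < N" for N m
  unfolding Sc on using that by (simp add: sum.delta' if_distrib[of "\<lambda>x. _ * x"] cong: if_cong)
 have perp: "cinner (u - S N) w = 0" if "w \<in> L2.span (e ` {..<N})" for N w
  using that
 proof (induction rule: L2.span_induct_alt)
  case (step c x y)
  then show ?case by (auto simp: cinner_add_right cinner_scaleC_right cinner_diff_left Se)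
 qed simp
 have Sspan: "S N \<in> L2.span (e ` {..<N})" for N
  unfolding S_def by (intro L2.span_sum L2.span_scale L2.span_base) auto
 have best: "norm (u - S N) \<le> norm (u - w)" if "w \<in> L2.span (e ` {..<N})" for N w
 proof -
  have "cinner (u - S N) (S N - w) = 0" by (intro perp L2.span_diff Sspan that)
  then have "(norm ((u - S N) + (S N - w)))\<^sup>2 = (norm (u - S N))\<^sup>2 + (norm (S N - w))\<^sup>2" by (rule norm_pythagoras)
  then have "(norm (u - S N))\<^sup>2 \<le> (norm (u - w))\<^sup>2" by simp
  then show ?thesis by (rule power2_le_imp_le) simp
 qed
 have "S \<longlonglongrightarrow> u"
 proof (rule LIMSEQ_I)
  fix \<epsilon> :: real assume "\<epsilon> > 0"
  then obtain w where w: "w \<in> L2.span (range e)" "dist w u < \<epsilon>" using cl closure_approachable by blast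
  from w(1) obtain t r where t: "finite t" "t \<subseteq> range e" "w = (\<Sum>a\<in>t. r a *\<^sub>C a)" unfolding L2.span_explicit by blast
  then obtain J where J: "finite J" "t = e ` J" using finite_subset_image[OF t(1,2)] by blast
  then obtain N where N: "J \<subseteq> {..<N}" using finite_nat_iff_bounded by blast
  have "norm (S n - u) < \<epsilon>" if "n \<ge> N" for n
  proof -
   have "t \<subseteq> e ` {..<n}" using J N that by auto
   then have "w \<in> L2.span (e ` {..<n})" unfolding t(3) by (intro L2.span_sum L2.span_scale L2.span_base) auto
   then have "norm (u - S n) \<le> norm (u - w)" by (rule best)
   then show ?thesis using w(2) by (simp add: dist_norm norm_minus_commute)
  qed
  then show "\<exists>N. \<forall>n\<ge>N. norm (S n - u) < \<epsilon>" by blast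
 qed
 then have "(\<lambda>N. cinner (S N) v) \<longlonglongrightarrow> cinner u v" by (intro tendsto_cinner tendsto_const)
 then show ?thesis unfolding Sc sums_def .
qed

text \<open>The absolute value is the operator f to r <f, a> a: comparing its square with the
  adjoint times the operator forces r |a| = |b|. Parseval's identity evaluates the trace, in every
  basis alike.\<close>

lemma rank_one_trace_class: "trace_class (\<lambda>f. cinner f a *\<^sub>C b)"
 and op_trace_rank_one: "op_trace (\<lambda>f. cinner f a *\<^sub>C b) = cinner b a"
proof -
 have bc: "bounded_clinear (\<lambda>f. cinner f a *\<^sub>C b)" for a b
  unfolding bounded_clinear_def
 proof (intro conjI allI)
  show "bounded_linear (\<lambda>f. cinner f a *\<^sub>C b)"
  proof (rule bounded_linear_intro)
   fix f g :: L2 and r :: real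
   show "cinner (f + g) a *\<^sub>C b = cinner f a *\<^sub>C b + cinner g a *\<^sub>C b" by (simp add: cinner_add_left L2.scale_left_distrib)
   show "cinner (r *\<^sub>R f) a *\<^sub>C b = r *\<^sub>R (cinner f a *\<^sub>C b)" by (simp add: cinner_scaleC_left scaleR_L2_def)
   have "cmod (cinner f a) * norm b \<le> (norm f * norm a) * norm b" by (intro mult_right_mono cinner_Cauchy_Schwarz) simp
   then show "norm (cinner f a *\<^sub>C b) \<le> norm f * (norm a * norm b)" by (simp add: norm_scaleC mult.assoc)
  qed
  show "cinner (c *\<^sub>C u) a *\<^sub>C b = c *\<^sub>C cinner u a *\<^sub>C b" for c u by (simp add: cinner_scaleC_left)
 qed
 obtain e where e: "orthonormal_basis e" using orthonormal_basis_exists by blast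
 \<comment> \<open>For a = 0 division by zero gives r = 0, in accordance with the zero
   operator.\<close>
 define r where "r = norm b / norm a"
 define P where "P f = cinner f a *\<^sub>C (complex_of_real r *\<^sub>C a)" for f
 have r: "r \<ge> 0" by (simp add: r_def)
 have Pu: "cinner (P u) v = complex_of_real r * (cinner u a * cinner a v)" for u v
  by (simp add: P_def cinner_scaleC_left)
 have Puu: "cinner (P u) u = complex_of_real (r * (cmod (cinner u a))\<^sup>2)" for u
  unfolding Pu cinner_commute[of a u] by (simp only: of_real_mult complex_norm_square)
 have "positive_op P"
  unfolding positive_op_def Puu using bc[of a "complex_of_real r *\<^sub>C a"] r by (auto simp: P_def[abs_def])
 moreover have "cinner (P (P u)) v = cinner (cinner u a *\<^sub>C b) (cinner v a *\<^sub>C b)" for u v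
 proof -
  have "cinner (P (P u)) v = complex_of_real (r\<^sup>2 * (norm a)\<^sup>2) * (cinner u a * cinner a v)"
   by (simp add: Pu cinner_self_norm power2_eq_square)
  also have "(complex_of_real (r\<^sup>2 * (norm a)\<^sup>2)) * (cinner u a * cinner a v) = complex_of_real ((norm b)\<^sup>2) * (cinner u a * cinner a v)"
   by (cases "a = 0") (simp_all add: r_def power_divide)
  finally show ?thesis unfolding cinner_commute[of a v]
   by (simp add: cinner_scaleC_left cinner_scaleC_right cinner_self_norm)
 qed
 ultimately have "is_absolute_value (\<lambda>f. cinner f a *\<^sub>C b) P" by (simp add: is_absolute_value_def)
 moreover have "summable (\<lambda>n. Re (cinner (P (e n)) (e n)))"
 proof -
  have "summable (\<lambda>n. Re (cinner a (e n) * cinner (e n) a))"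
   using Parseval[OF e, of a a] by (intro summable_Re) (auto simp: sums_iff)
  then have "summable (\<lambda>n. r * Re (cinner a (e n) * cinner (e n) a))" by (rule summable_mult)
  then show ?thesis by (simp add: Pu mult.commute)
 qed
 ultimately show "trace_class (\<lambda>f. cinner f a *\<^sub>C b)"
  unfolding trace_class_def using bc e by blast
 have sums: "(\<lambda>n. cinner (cinner (e n) a *\<^sub>C b) (e n)) sums cinner b a" if "orthonormal_basis e" for e
  using Parseval[OF that, of b a] by (simp add: cinner_scaleC_left mult.commute)
 show "op_trace (\<lambda>f. cinner f a *\<^sub>C b) = cinner b a"
  unfolding op_trace_def
 proof (rule the_equality)
  show "\<forall>e. orthonormal_basis e \<longrightarrow> (\<lambda>n. cinner (cinner (e n) a *\<^sub>C b) (e n)) sums cinner b a" using sums by blast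
  show "t = cinner b a" if "\<forall>e. orthonormal_basis e \<longrightarrow> (\<lambda>n. cinner (cinner (e n) a *\<^sub>C b) (e n)) sums t" for t
   using that e sums[OF e] sums_unique2 by blast
 qed
qed

section \<open>A Poisson formula for the upper half-plane\<close>

lemma upper_arc:
 assumes "w \<in> path_image (part_circlepath 0 R 0 pi)" "0 \<le> R"
 shows "cmod w = R" "0 \<le> Im w"
proof -
 obtain t where t: "0 \<le> t" "t \<le> pi" "w = of_real R * cis t"
  using assms by (auto simp: path_image_part_circlepath' closed_segment_eq_real_ivl)
 show "cmod w = R" using t assms by (simp add: norm_mult)
 have "Im w = R * sin t" using t by simp
 then show "0 \<le> Im w" using t assms by (simp add: sin_ge_zero)
qed

text \<open>Cauchy's theorem on the half-disc of radius R: the arc has length \<pi> R and the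
  integrand there is at most (a + c R^\<nu>) / R^2, so the arc contributes nothing in the limit when
  \<nu> < 1.\<close>

lemma real_line_integral_tendsto_0:
 fixes H :: "complex \<Rightarrow> complex"
 assumes "0 < \<epsilon>" and hol: "H holomorphic_on {w. Im w > - \<epsilon>}" and nu: "\<nu> < 1" and c: "0 \<le> c" "0 \<le> a"
  and bd: "\<And>w. R0 \<le> cmod w \<Longrightarrow> 0 \<le> Im w \<Longrightarrow> cmod (H w) \<le> (a + c * cmod w powr \<nu>) / (cmod w)\<^sup>2"
 shows "((\<lambda>R. integral {-R..R} (\<lambda>x. H (of_real x))) \<longlongrightarrow> 0) at_top"
proof (rule Lim_null_comparison)
 define b where "b R = pi * (a / R + c * R powr (\<nu> - 1))" for R :: real
 have "((\<lambda>R::real. R powr (\<nu> - 1)) \<longlongrightarrow> 0) at_top" using nu by (intro tendsto_neg_powr filterlim_ident) auto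
 moreover have "((\<lambda>R::real. a / R) \<longlongrightarrow> 0) at_top" by (intro tendsto_divide_0[OF tendsto_const] filterlim_at_top_imp_at_infinity filterlim_ident)
 ultimately have "(b \<longlongrightarrow> pi * (0 + c * 0)) at_top" unfolding b_def by (intro tendsto_intros)
 then show "(b \<longlongrightarrow> 0) at_top" by simp
 show "\<forall>\<^sub>F R in at_top. norm (integral {-R..R} (\<lambda>x. H (of_real x))) \<le> b R"
  using eventually_ge_at_top[of "max R0 1"]
 proof eventually_elim
  case (elim R)
  then have R: "R \<ge> R0" "R \<ge> 1" by auto
  let ?g = "linepath (- of_real R) (of_real R) +++ part_circlepath 0 R 0 pi"
  have ends: "pathfinish (linepath (- complex_of_real R) (of_real R)) = pathstart (part_circlepath 0 R 0 pi)" by simp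
  have pl: "path_image (linepath (- complex_of_real R) (of_real R)) \<subseteq> {w. - \<epsilon> < Im w}"
   using \<open>0 < \<epsilon>\<close> by (auto simp: closed_segment_def)
  have pc: "path_image (part_circlepath 0 R 0 pi) \<subseteq> {w. - \<epsilon> < Im w}"
   using upper_arc(2)[of _ R] R \<open>0 < \<epsilon>\<close> by force
  have cs: "(H has_contour_integral 0) ?g"
  proof (rule Cauchy_theorem_convex_simple[OF hol])
   show "convex {w. - \<epsilon> < Im w}" using convex_halfspace_Im_gt[of "- \<epsilon>"] by simp
   show "path_image ?g \<subseteq> {w. - \<epsilon> < Im w}"
    by (rule order_trans[OF path_image_join_subset]) (rule Un_least[OF pl pc])
  qed (use ends in auto)
  have ci: "H contour_integrable_on linepath (- complex_of_real R) (of_real R)" "H contour_integrable_on part_circlepath 0 R 0 pi"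
   using contour_integrable_holomorphic_simple[OF hol open_halfspace_Im_gt] pl pc by simp_all
  have "contour_integral (linepath (- complex_of_real R) (of_real R)) H + contour_integral (part_circlepath 0 R 0 pi) H = 0"
   using cs ci by (metis contour_integral_join contour_integral_unique valid_path_linepath valid_path_part_circlepath)
  moreover have "contour_integral (linepath (- complex_of_real R) (of_real R)) H = integral {-R..R} (\<lambda>x. H (of_real x))"
   using contour_integral_linepath_Reals_eq[of "- of_real R" "of_real R" H] R by simp
  ultimately have "integral {-R..R} (\<lambda>x. H (of_real x)) = - contour_integral (part_circlepath 0 R 0 pi) H"
   by (simp add: eq_neg_iff_add_eq_0)
  moreover have "norm (contour_integral (part_circlepath 0 R 0 pi) H) \<le> ((a + c * R powr \<nu>) / R\<^sup>2) * R * \<bar>pi - 0\<bar>"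
  proof (rule contour_integral_bound_part_circlepath[OF ci(2)])
   show "norm (H w) \<le> (a + c * R powr \<nu>) / R\<^sup>2" if "w \<in> path_image (part_circlepath 0 R 0 pi)" for w
    using bd[of w] upper_arc[OF that] R by simp
  qed (use R c in auto)
  moreover have "((a + c * R powr \<nu>) / R\<^sup>2) * R * \<bar>pi - 0\<bar> = b R"
  proof -
   have "R powr (\<nu> - 1) = R powr \<nu> / R" using R by (simp add: powr_diff)
   then show ?thesis using R by (simp add: b_def field_simps power2_eq_square)
  qed
  ultimately show ?case by simp
 qed
qed

lemma arctan_scaled_derivative:
 fixes a y :: real
 assumes "0 < y"
 shows "((\<lambda>x. arctan ((x - a) / y)) has_real_derivative y / ((x - a)\<^sup>2 + y\<^sup>2)) (at x within S)"
proof -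
 have "((\<lambda>x. arctan ((x - a) / y)) has_real_derivative (1 / y) * inverse (1 + ((x - a) / y)\<^sup>2)) (at x within S)"
  using assms by (auto intro!: derivative_eq_intros)
 moreover have "(x - a)\<^sup>2 + y\<^sup>2 > 0" using assms by (simp add: add_nonneg_pos)
 then have "(1 / y) * inverse (1 + ((x - a) / y)\<^sup>2) = y / ((x - a)\<^sup>2 + y\<^sup>2)"
  using assms by (simp add: field_simps power2_eq_square)
 ultimately show ?thesis by simp
qed

lemma arctan_scaled_at_top:
 fixes b y :: real
 assumes "0 < y" shows "((\<lambda>x. arctan ((x + b) / y)) \<longlongrightarrow> pi / 2) at_top"
proof (rule filterlim_compose[OF tendsto_arctan_at_top])
 show "filterlim (\<lambda>x. (x + b) / y) at_top at_top"
  unfolding filterlim_at_top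
 proof
  fix Z show "\<forall>\<^sub>F x in at_top. Z \<le> (x + b) / y"
   using eventually_ge_at_top[of "Z * y - b"] by eventually_elim (use assms in \<open>simp add: field_simps\<close>)
 qed
qed

text \<open>Im G is (G - conj G)/(2i). The conjugate term integrates to 0 in the limit, because
  moving the pole to the conjugate of z makes its conjugated integrand holomorphic in the upper
  half-plane. From the other term two explicit functions are subtracted, so that the remainder
  \<open>H\<close> is holomorphic and the half-disc argument applies; their own integrals are
  computed from primitives and leave 2 \<pi> i G'(z).\<close>

lemma half_plane_Cauchy:
 fixes G :: "complex \<Rightarrow> complex"
 assumes e: "0 < \<epsilon>" and hol: "G holomorphic_on {w. Im w > - \<epsilon>}" and nu: "0 < \<nu>" "\<nu> < 1" and AC: "0 \<le> A" "0 \<le> C"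
  and growth: "\<And>w. 0 \<le> Im w \<Longrightarrow> cmod (G w) \<le> A + C * cmod w powr \<nu>"
  and z: "0 < Im z"
 shows "((\<lambda>R. integral {-R..R} (\<lambda>x. complex_of_real (Im (G (of_real x))) / (of_real x - z)\<^sup>2)) \<longlongrightarrow> of_real pi * deriv G z) at_top"
proof -
 \<comment> \<open>\<delta> \<le> Im z keeps the conjugate of \<open>z\<close> outside the slightly
   enlarged half-plane \<open>S\<close>.\<close>
 define \<delta> where "\<delta> = min \<epsilon> (Im z)"
 have d: "0 < \<delta>" "\<delta> \<le> \<epsilon>" "\<delta> \<le> Im z" using e z by (auto simp: \<delta>_def)
 define S where "S = {w. Im w > - \<delta>}"
 have oS: "open S" unfolding S_def by (rule open_halfspace_Im_gt)
 have zS: "z \<in> S" using d z by (simp add: S_def)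
 have zS': "cnj z \<notin> S" using d by (simp add: S_def)
 have GS: "G holomorphic_on S" by (rule holomorphic_on_subset[OF hol]) (use d in \<open>auto simp: S_def\<close>)
 define D where "D = deriv G z"
 \<comment> \<open>With this factor D k / ((w - z)(w - conj z)) has residue \<open>D\<close> at
   \<open>z\<close>, yet decays like |w|^(-2), as D / (w - z) would not.\<close>
 define k where "k = z - cnj z"
 define Q where "Q w = (if w = z then D else (G w - G z) / (w - z))" for w
 have QS: "Q holomorphic_on S" unfolding Q_def D_def using pole_lemma[OF GS] zS oS by (simp add: interior_open)
 define T where "T w = Q w - D * k / (w - cnj z)" for w
 have TS: "T holomorphic_on S" unfolding T_def using zS' by (intro holomorphic_intros QS) auto
 have k0: "k \<noteq> 0" using z by (auto simp: k_def complex_eq_iff)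
 have Tz: "T z = 0" using k0 by (simp add: T_def Q_def k_def)
 define H where "H w = (if w = z then deriv T z else (T w - T z) / (w - z))" for w
 have HS: "H holomorphic_on S" unfolding H_def using pole_lemma[OF TS] zS oS by (simp add: interior_open)
 have Hw: "H w = G w / (w - z)\<^sup>2 - G z / (w - z)\<^sup>2 - D * k / ((w - z) * (w - cnj z))" if "w \<noteq> z" "w \<noteq> cnj z" for w
  using that unfolding H_def Tz by (simp add: T_def Q_def power2_eq_square diff_divide_distrib mult.commute)
 have far: "cmod w / 2 \<le> cmod (w - z)" "cmod w / 2 \<le> cmod (w - cnj z)" if "2 * cmod z \<le> cmod w" for w
  using norm_triangle_ineq2[of w z] norm_triangle_ineq2[of w "cnj z"] that by simp_all
 have sq: "(cmod w)\<^sup>2 / 4 \<le> cmod (w - p) * cmod (w - q)" if "cmod w / 2 \<le> cmod (w - p)" "cmod w / 2 \<le> cmod (w - q)" for w p q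
  using mult_mono[OF that] by (simp add: power2_eq_square)
 have quot: "cmod (u / ((w - p) * (w - q))) \<le> 4 * cmod u / (cmod w)\<^sup>2"
  if "cmod w / 2 \<le> cmod (w - p)" "cmod w / 2 \<le> cmod (w - q)" "cmod w \<ge> 1" for u w p q
 proof -
  have "cmod (u / ((w - p) * (w - q))) = cmod u / (cmod (w - p) * cmod (w - q))" by (simp add: norm_divide norm_mult)
  also have "\<dots> \<le> cmod u / ((cmod w)\<^sup>2 / 4)"
  proof (rule divide_left_mono[OF sq[OF that(1,2)]])
   have "0 < cmod w / 2" using that(3) by linarith
   then have "0 < cmod (w - p)" "0 < cmod (w - q)" using that(1,2) by linarith+
   moreover have "0 < (cmod w)\<^sup>2 / 4" using \<open>0 < cmod w / 2\<close> by (intro divide_pos_pos zero_less_power) auto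
   ultimately show "0 < cmod (w - p) * cmod (w - q) * ((cmod w)\<^sup>2 / 4)" by (intro mult_pos_pos)
  qed simp
  finally show ?thesis by (simp add: mult.commute)
 qed
 define R0 where "R0 = max 1 (2 * cmod z)"
 have L1: "((\<lambda>R. integral {-R..R} (\<lambda>x. H (of_real x))) \<longlongrightarrow> 0) at_top"
 proof (rule real_line_integral_tendsto_0[where \<epsilon>=\<delta> and \<nu>=\<nu> and a="4 * A + 4 * cmod (G z) + 4 * cmod (D * k)" and c="4 * C" and ?R0.0="R0 + 1"])
  show "H holomorphic_on {w. - \<delta> < Im w}" using HS by (simp add: S_def)
  fix w assume w: "R0 + 1 \<le> cmod w" "0 \<le> Im w"
  then have w': "2 * cmod z \<le> cmod w" "1 \<le> cmod w" by (auto simp: R0_def)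
  have ne: "w \<noteq> z" "w \<noteq> cnj z" using w by (auto simp: R0_def)
  have "cmod (H w) \<le> cmod (G w / (w - z)\<^sup>2) + cmod (G z / (w - z)\<^sup>2) + cmod (D * k / ((w - z) * (w - cnj z)))"
   unfolding Hw[OF ne] by (meson add_right_mono norm_triangle_ineq4 order_trans)
  also have "\<dots> \<le> 4 * cmod (G w) / (cmod w)\<^sup>2 + 4 * cmod (G z) / (cmod w)\<^sup>2 + 4 * cmod (D * k) / (cmod w)\<^sup>2"
   unfolding power2_eq_square[of "w - z"] using far[OF w'(1)] w'(2) by (intro add_mono quot)
  also have "\<dots> = (4 * cmod (G w) + 4 * cmod (G z) + 4 * cmod (D * k)) / (cmod w)\<^sup>2" by (simp add: add_divide_distrib)
  also have "\<dots> \<le> (4 * A + 4 * cmod (G z) + 4 * cmod (D * k) + 4 * C * cmod w powr \<nu>) / (cmod w)\<^sup>2"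
   using growth[OF w(2)] by (intro divide_right_mono) auto
  finally show "cmod (H w) \<le> (4 * A + 4 * cmod (G z) + 4 * cmod (D * k) + 4 * C * cmod w powr \<nu>) / (cmod w)\<^sup>2" .
 qed (use d nu AC in auto)
 have L2: "((\<lambda>R. integral {-R..R} (\<lambda>x. G (of_real x) / (of_real x - cnj z)\<^sup>2)) \<longlongrightarrow> 0) at_top"
 proof (rule real_line_integral_tendsto_0[where \<epsilon>=\<delta> and \<nu>=\<nu> and a="4 * A" and c="4 * C" and ?R0.0="R0" and H="\<lambda>w. G w / (w - cnj z)\<^sup>2"])
  show "(\<lambda>w. G w / (w - cnj z)\<^sup>2) holomorphic_on {w. - \<delta> < Im w}" using GS zS' unfolding S_def
   by (intro holomorphic_intros) auto
  fix w assume w: "R0 \<le> cmod w" "0 \<le> Im w"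
  then have w': "2 * cmod z \<le> cmod w" "1 \<le> cmod w" by (auto simp: R0_def)
  have "cmod (G w / (w - cnj z)\<^sup>2) \<le> 4 * cmod (G w) / (cmod w)\<^sup>2"
   unfolding power2_eq_square[of "w - _"] using far[OF w'(1)] w'(2) by (intro quot)
  also have "\<dots> \<le> (4 * A + 4 * C * cmod w powr \<nu>) / (cmod w)\<^sup>2"
   using growth[OF w(2)] by (intro divide_right_mono) auto
  finally show "cmod (G w / (w - cnj z)\<^sup>2) \<le> (4 * A + 4 * C * cmod w powr \<nu>) / (cmod w)\<^sup>2" .
 qed (use d nu AC in auto)
 have xz: "of_real x \<noteq> z" "of_real x \<noteq> cnj z" for x :: real using z by (auto simp: complex_eq_iff)
 have Gc: "continuous_on UNIV (\<lambda>x::real. G (of_real x))"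
  using holomorphic_on_imp_continuous_on[OF GS] d
  by (intro continuous_on_compose2[of S G UNIV of_real] continuous_intros) (auto simp: S_def)
 have cont1: "continuous_on X (\<lambda>x::real. G (of_real x) / (of_real x - z)\<^sup>2)" "continuous_on X (\<lambda>x::real. G (of_real x) / (of_real x - cnj z)\<^sup>2)"
  "continuous_on X (\<lambda>x::real. G z / (of_real x - z)\<^sup>2)" "continuous_on X (\<lambda>x::real. D * k / ((of_real x - z) * (of_real x - cnj z)))"
  for X using xz by (auto intro!: continuous_intros continuous_on_subset[OF Gc])
 have I2: "((\<lambda>R. integral {-R..R} (\<lambda>x::real. G z / (of_real x - z)\<^sup>2)) \<longlongrightarrow> 0) at_top"
 proof -
  have ev: "\<forall>\<^sub>F R in at_top. - G z / (of_real R - z) + G z / (- of_real R - z) = integral {-R..R} (\<lambda>x::real. G z / (of_real x - z)\<^sup>2)"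
   using eventually_ge_at_top[of 0]
  proof eventually_elim
   case (elim R)
   have "((\<lambda>x::real. G z / (of_real x - z)\<^sup>2) has_integral (- G z / (of_real R - z)) - (- G z / (of_real (-R) - z))) {-R..R}"
    using elim xz by (intro fundamental_theorem_of_calculus)
     (auto intro!: derivative_eq_intros has_vector_derivative_real_field simp: power2_eq_square)
   then show ?case by (simp add: integral_unique)
  qed
  moreover have "((\<lambda>R::real. G z / (of_real R - w)) \<longlongrightarrow> 0) at_top" for w
   unfolding diff_conv_add_uminus
   by (intro tendsto_divide_0[OF tendsto_const] tendsto_add_filterlim_at_infinity'[OF _ tendsto_const]
     filterlim_of_real_at_infinity filterlim_ident)
  from tendsto_minus[OF tendsto_add[OF this[of z] this[of "- z"]]]
  have "((\<lambda>R::real. - G z / (of_real R - z) + G z / - (of_real R - - z)) \<longlongrightarrow> 0) at_top"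
   unfolding divide_minus_right by simp
  moreover have "- complex_of_real R - z = - (of_real R - - z)" for R by simp
  ultimately have "((\<lambda>R::real. - G z / (of_real R - z) + G z / (- of_real R - z)) \<longlongrightarrow> 0) at_top" by (simp only:)
  then show ?thesis using tendsto_cong[OF ev] by simp
 qed
 have I3: "((\<lambda>R. integral {-R..R} (\<lambda>x::real. D * k / ((of_real x - z) * (of_real x - cnj z)))) \<longlongrightarrow> 2 * of_real pi * \<i> * D) at_top"
 proof -
  define y where "y = Im z" define a where "a = Re z"
  have y: "y > 0" using z by (simp add: y_def)
  have ev: "\<forall>\<^sub>F R in at_top. 2 * \<i> * D * of_real (arctan ((R - a) / y) - arctan ((- R - a) / y)) = integral {-R..R} (\<lambda>x::real. D * k / ((of_real x - z) * (of_real x - cnj z)))"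
   using eventually_ge_at_top[of 0]
  proof eventually_elim
   case (elim R)
   have "((\<lambda>x. y / ((x - a)\<^sup>2 + y\<^sup>2)) has_integral arctan ((R - a) / y) - arctan ((- R - a) / y)) {-R..R}"
   proof (rule fundamental_theorem_of_calculus)
    show "((\<lambda>x. arctan ((x - a) / y)) has_vector_derivative y / ((x - a)\<^sup>2 + y\<^sup>2)) (at x within {-R..R})" for x
     using arctan_scaled_derivative[OF y] by (simp add: has_real_derivative_iff_has_vector_derivative)
   qed (use elim in auto)
   then have "((\<lambda>x. 2 * \<i> * D * complex_of_real (y / ((x - a)\<^sup>2 + y\<^sup>2))) has_integral 2 * \<i> * D * of_real (arctan ((R - a) / y) - arctan ((- R - a) / y))) {-R..R}"
    by (intro has_integral_mult_right has_integral_of_real)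
   moreover have "2 * \<i> * D * complex_of_real (y / ((x - a)\<^sup>2 + y\<^sup>2)) = D * k / ((of_real x - z) * (of_real x - cnj z))" for x
   proof -
    have "k = 2 * \<i> * of_real y" by (simp add: k_def y_def complex_eq_iff)
    moreover have "(of_real x - z) * (of_real x - cnj z) = of_real ((x - a)\<^sup>2 + y\<^sup>2)"
     by (simp add: complex_eq_iff a_def y_def power2_eq_square algebra_simps)
    ultimately show ?thesis by simp
   qed
   ultimately show ?case by (simp add: integral_unique)
  qed
  moreover have "((\<lambda>R. 2 * \<i> * D * of_real (arctan ((R - a) / y) - arctan ((- R - a) / y))) \<longlongrightarrow> 2 * \<i> * D * of_real (pi/2 - (- (pi/2)))) at_top"
  proof (intro tendsto_intros)
   from arctan_scaled_at_top[OF y, of "- a"] show "((\<lambda>R. arctan ((R - a) / y)) \<longlongrightarrow> pi / 2) at_top" by simp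
   have "(- R - a) / y = - ((R + a) / y)" for R using y by (simp add: field_simps)
   then have "arctan ((- R - a) / y) = - arctan ((R + a) / y)" for R by (simp only: arctan_minus)
   then show "((\<lambda>R. arctan ((- R - a) / y)) \<longlongrightarrow> - (pi / 2)) at_top"
    using tendsto_minus[OF arctan_scaled_at_top[OF y, of a]] by simp
  qed
  ultimately show ?thesis using tendsto_cong[OF ev] by (simp add: algebra_simps)
 qed
 have I1: "((\<lambda>R. integral {-R..R} (\<lambda>x::real. G (of_real x) / (of_real x - z)\<^sup>2)) \<longlongrightarrow> 2 * of_real pi * \<i> * D) at_top"
 proof -
  have "integral {-R..R} (\<lambda>x. H (of_real x)) + integral {-R..R} (\<lambda>x::real. G z / (of_real x - z)\<^sup>2) + integral {-R..R} (\<lambda>x::real. D * k / ((of_real x - z) * (of_real x - cnj z)))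
   = integral {-R..R} (\<lambda>x::real. G (of_real x) / (of_real x - z)\<^sup>2)" for R
   unfolding Hw[OF xz] using cont1[of "{-R..R}"]
   by (simp add: Henstock_Kurzweil_Integration.integral_diff integrable_continuous_real Henstock_Kurzweil_Integration.integrable_diff)
  then show ?thesis using tendsto_add[OF tendsto_add[OF L1 I2] I3] by simp
 qed
 have "((\<lambda>R. cnj (integral {-R..R} (\<lambda>x. G (of_real x) / (of_real x - cnj z)\<^sup>2))) \<longlongrightarrow> cnj 0) at_top"
  by (rule tendsto_cnj[OF L2])
 then have L3: "((\<lambda>R. integral {-R..R} (\<lambda>x. cnj (G (of_real x)) / (of_real x - z)\<^sup>2)) \<longlongrightarrow> 0) at_top"
  by (simp add: Henstock_Kurzweil_Integration.integral_cnj)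
 have "((\<lambda>R. (integral {-R..R} (\<lambda>x::real. G (of_real x) / (of_real x - z)\<^sup>2) - integral {-R..R} (\<lambda>x. cnj (G (of_real x)) / (of_real x - z)\<^sup>2)) / (2 * \<i>))
   \<longlongrightarrow> (2 * of_real pi * \<i> * D - 0) / (2 * \<i>)) at_top"
  by (intro tendsto_divide tendsto_diff I1 L3 tendsto_const) simp
 moreover have "(integral {-R..R} (\<lambda>x::real. G (of_real x) / (of_real x - z)\<^sup>2) - integral {-R..R} (\<lambda>x. cnj (G (of_real x)) / (of_real x - z)\<^sup>2)) / (2 * \<i>)
   = integral {-R..R} (\<lambda>x. complex_of_real (Im (G (of_real x))) / (of_real x - z)\<^sup>2)" for R
 proof -
  have c: "continuous_on {-R..R} (\<lambda>x::real. cnj (G (of_real x)) / (of_real x - z)\<^sup>2)"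
   using xz by (auto intro!: continuous_intros continuous_on_subset[OF Gc])
  have "integral {-R..R} (\<lambda>x::real. G (of_real x) / (of_real x - z)\<^sup>2) - integral {-R..R} (\<lambda>x. cnj (G (of_real x)) / (of_real x - z)\<^sup>2)
   = integral {-R..R} (\<lambda>x::real. G (of_real x) / (of_real x - z)\<^sup>2 - cnj (G (of_real x)) / (of_real x - z)\<^sup>2)"
   using cont1(1) c by (intro Henstock_Kurzweil_Integration.integral_diff[symmetric] integrable_continuous_real)
  also have "(\<lambda>x::real. G (of_real x) / (of_real x - z)\<^sup>2 - cnj (G (of_real x)) / (of_real x - z)\<^sup>2) = (\<lambda>x. (2 * \<i>) * (complex_of_real (Im (G (of_real x))) / (of_real x - z)\<^sup>2))"
   by (simp add: diff_divide_distrib[symmetric] complex_diff_cnj mult_ac)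
  also have "integral {-R..R} (\<lambda>x. (2 * \<i>) * (complex_of_real (Im (G (of_real x))) / (of_real x - z)\<^sup>2))
    = (2 * \<i>) * integral {-R..R} (\<lambda>x. complex_of_real (Im (G (of_real x))) / (of_real x - z)\<^sup>2)"
   by (rule Henstock_Kurzweil_Integration.integral_mult_right)
  finally show ?thesis by (simp only:) simp
 qed
 moreover have "(2 * of_real pi * \<i> * D - 0) / (2 * \<i>) = of_real pi * deriv G z" by (simp add: D_def complex_eq_iff)
 ultimately show ?thesis by (simp only:)
qed

text \<open>The mean value inequality bounds the difference quotients by the majorant of the
  derivative, so dominated convergence applies along every sequence.\<close>

lemma has_derivative_parameter_integral:
 fixes f f' :: "real \<Rightarrow> 'a \<Rightarrow> real"
 assumes t0: "a < t0" "t0 < b"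
  and d: "\<And>t x. a < t \<Longrightarrow> t < b \<Longrightarrow> x \<in> space M \<Longrightarrow> ((\<lambda>t. f t x) has_real_derivative f' t x) (at t)"
  and i: "\<And>t. a < t \<Longrightarrow> t < b \<Longrightarrow> integrable M (f t)"
  and m: "f' t0 \<in> borel_measurable M"
  and bd: "\<And>t x. a < t \<Longrightarrow> t < b \<Longrightarrow> x \<in> space M \<Longrightarrow> \<bar>f' t x\<bar> \<le> g x" and g: "integrable M g"
 shows "((\<lambda>t. integral\<^sup>L M (f t)) has_real_derivative integral\<^sup>L M (f' t0)) (at t0)"
 unfolding has_field_derivative_iff tendsto_at_iff_sequentially
proof (intro allI impI)
 fix X :: "nat \<Rightarrow> real" assume "\<forall>n. X n \<in> UNIV - {t0}" and X: "X \<longlonglongrightarrow> t0"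
 then have ne: "X n \<noteq> t0" for n by auto
 have "\<forall>\<^sub>F n in sequentially. X n \<in> {a<..<b}"
  using X t0 by (intro topological_tendstoD[OF X]) auto
 then obtain N where N: "\<And>n. n \<ge> N \<Longrightarrow> a < X n \<and> X n < b" by (auto simp: eventually_sequentially)
 define q where "q n x = (f (X (n + N)) x - f t0 x) / (X (n + N) - t0)" for n x
 have qm: "q n \<in> borel_measurable M" for n
  using i[of "X (n + N)"] i[OF t0] N[of "n + N"] unfolding q_def
  by (intro borel_measurable_divide borel_measurable_diff borel_measurable_const) auto
 have "(\<lambda>n. integral\<^sup>L M (q n)) \<longlonglongrightarrow> integral\<^sup>L M (f' t0)"
 proof (rule integral_dominated_convergence[OF m qm g])
  show "AE x in M. (\<lambda>n. q n x) \<longlonglongrightarrow> f' t0 x"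
  proof (rule AE_I2)
   fix x assume x: "x \<in> space M"
   have "((\<lambda>t. (f t x - f t0 x) / (t - t0)) \<longlongrightarrow> f' t0 x) (at t0)"
    using d[OF t0 x] by (simp add: has_field_derivative_iff)
   moreover have "(\<lambda>n. X (n + N)) \<longlonglongrightarrow> t0" using X by (rule LIMSEQ_ignore_initial_segment)
   ultimately show "(\<lambda>n. q n x) \<longlonglongrightarrow> f' t0 x"
    unfolding q_def tendsto_at_iff_sequentially o_def using ne by auto
  qed
  show "AE x in M. norm (q n x) \<le> g x" for n
  proof (rule AE_I2)
   fix x assume x: "x \<in> space M"
   let ?Y = "X (n + N)"
   have Y: "a < ?Y" "?Y < b" using N[of "n + N"] by auto
   have "\<bar>f ?Y x - f t0 x\<bar> \<le> g x * \<bar>?Y - t0\<bar>"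
   proof -
    have "norm (f ?Y x - f t0 x) \<le> g x * norm (?Y - t0)"
    proof (rule field_differentiable_bound[where S="{a<..<b}" and f="\<lambda>t. f t x" and f'="\<lambda>t. f' t x"])
     show "((\<lambda>t. f t x) has_field_derivative f' t x) (at t within {a<..<b})" if "t \<in> {a<..<b}" for t
      by (rule has_field_derivative_at_within, rule d) (use x that in simp_all)
     show "norm (f' t x) \<le> g x" if "t \<in> {a<..<b}" for t using bd[of t x] x that by auto
    qed (use Y t0 in auto)
    then show ?thesis by simp
   qed
   then show "norm (q n x) \<le> g x" using ne[of "n + N"] by (simp add: q_def abs_divide divide_le_eq)
  qed
 qed
 moreover have "integral\<^sup>L M (q n) = (integral\<^sup>L M (f (X (n + N))) - integral\<^sup>L M (f t0)) / (X (n + N) - t0)" for n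
  unfolding q_def using i[of "X (n + N)"] i[OF t0] N[of "n + N"] by (simp add: Bochner_Integration.integral_diff)
 ultimately have "(\<lambda>n. (integral\<^sup>L M (f (X (n + N))) - integral\<^sup>L M (f t0)) / (X (n + N) - t0)) \<longlonglongrightarrow> integral\<^sup>L M (f' t0)" by simp
 then have "(\<lambda>n. (integral\<^sup>L M (f (X n)) - integral\<^sup>L M (f t0)) / (X n - t0)) \<longlonglongrightarrow> integral\<^sup>L M (f' t0)"
  by (rule LIMSEQ_offset)
 then show "((\<lambda>t. (integral\<^sup>L M (f t) - integral\<^sup>L M (f t0)) / (t - t0)) \<circ> X) \<longlonglongrightarrow> integral\<^sup>L M (f' t0)"
  by (simp add: o_def)
qed

section \<open>Uniqueness of a function with given integrals against 1 / (x - z)^2\<close>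

lemma integrable_inverse_one_plus_square: "integrable lborel (\<lambda>x::real. 1 / (1 + x\<^sup>2))"
proof (rule integrable_monotone_convergence)
 have pos: "1 + x\<^sup>2 > 0" for x :: real by (simp add: add_pos_nonneg)
 have c: "isCont (\<lambda>x. 1 / (1 + x\<^sup>2)) x" for x :: real using pos[of x] by (intro continuous_intros) auto
 show "integrable lborel (\<lambda>x::real. 1 / (1 + x\<^sup>2) * indicator {- real n..real n} x)" for n
  using borel_integrable_atLeastAtMost[of "- real n" "real n" "\<lambda>x. 1 / (1 + x\<^sup>2)"] c by simp
 have "integral\<^sup>L lborel (\<lambda>x::real. 1 / (1 + x\<^sup>2) * indicator {- real n..real n} x) = arctan (real n) - arctan (- real n)" for n
  by (rule integral_FTC_Icc_real) (auto intro!: derivative_eq_intros c simp: inverse_eq_divide)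
 moreover have "(\<lambda>n. arctan (real n) - arctan (- real n)) \<longlonglongrightarrow> pi/2 - - (pi/2)"
  unfolding arctan_minus
  by (intro tendsto_diff tendsto_minus filterlim_compose[OF tendsto_arctan_at_top filterlim_real_sequentially])
 ultimately show "(\<lambda>n. integral\<^sup>L lborel (\<lambda>x::real. 1 / (1 + x\<^sup>2) * indicator {- real n..real n} x)) \<longlonglongrightarrow> pi/2 - - (pi/2)" by simp
 show "AE x in lborel. mono (\<lambda>n. 1 / (1 + x\<^sup>2) * indicator {- real n..real n} x)"
  by (intro AE_I2 monoI) (auto simp: indicator_def)
 show "AE x in lborel. (\<lambda>n. 1 / (1 + x\<^sup>2) * indicator {- real n..real n} x) \<longlonglongrightarrow> 1 / (1 + x\<^sup>2)"
 proof (intro AE_I2 tendsto_eventually)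
  fix x :: real
  obtain N :: nat where "\<bar>x\<bar> \<le> real N" using real_arch_simple by blast
  then show "\<forall>\<^sub>F n in sequentially. 1 / (1 + x\<^sup>2) * indicator {- real n..real n} x = 1 / (1 + x\<^sup>2)"
   by (intro eventually_mono[OF eventually_ge_at_top[of N]]) (auto simp: indicator_def)
 qed
qed measurable

lemma Cauchy_kernel_bound:
 fixes a y :: real
 assumes "0 < y"
 shows "\<exists>M>0. \<forall>x. 1 / ((x - a)\<^sup>2 + y\<^sup>2) \<le> M / (1 + x\<^sup>2)"
proof (intro exI conjI allI)
 let ?M = "2 + (1 + 2 * a\<^sup>2) / y\<^sup>2"
 show "?M > 0" by (simp add: add_pos_nonneg)
 fix x
 have y2: "y\<^sup>2 > 0" using assms by simp
 have "x\<^sup>2 \<le> 2 * (x - a)\<^sup>2 + 2 * a\<^sup>2" using zero_le_power2[of "x - 2*a"] by (simp add: power2_eq_square algebra_simps)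
 then have "1 + x\<^sup>2 \<le> 2 * (x - a)\<^sup>2 + (1 + 2 * a\<^sup>2)" by simp
 also have "\<dots> \<le> 2 * ((x - a)\<^sup>2 + y\<^sup>2) + (1 + 2 * a\<^sup>2) / y\<^sup>2 * ((x - a)\<^sup>2 + y\<^sup>2)"
 proof (rule add_mono)
  have "(1 + 2 * a\<^sup>2) = (1 + 2 * a\<^sup>2) / y\<^sup>2 * y\<^sup>2" using y2 by simp
  also have "\<dots> \<le> (1 + 2 * a\<^sup>2) / y\<^sup>2 * ((x - a)\<^sup>2 + y\<^sup>2)" using y2 by (intro mult_left_mono) auto
  finally show "1 + 2 * a\<^sup>2 \<le> (1 + 2 * a\<^sup>2) / y\<^sup>2 * ((x - a)\<^sup>2 + y\<^sup>2)" .
 qed simp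
 also have "\<dots> = ?M * ((x - a)\<^sup>2 + y\<^sup>2)" by (simp only: distrib_right)
 finally have *: "1 + x\<^sup>2 \<le> ?M * ((x - a)\<^sup>2 + y\<^sup>2)" .
 have "(x - a)\<^sup>2 + y\<^sup>2 > 0" "1 + x\<^sup>2 > 0" using y2 by (simp_all add: add_nonneg_pos add_pos_nonneg)
 then show "1 / ((x - a)\<^sup>2 + y\<^sup>2) \<le> ?M / (1 + x\<^sup>2)"
 proof -
  assume A: "(x - a)\<^sup>2 + y\<^sup>2 > 0" and B: "1 + x\<^sup>2 > 0"
  have "1 \<le> ?M * ((x - a)\<^sup>2 + y\<^sup>2) / (1 + x\<^sup>2)" using * pos_le_divide_eq[OF B] by simp
  then show ?thesis unfolding pos_divide_le_eq[OF A] by simp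
 qed
qed

lemma integrable_weighted:
 fixes h g :: "real \<Rightarrow> real"
 assumes "integrable lborel (\<lambda>x. h x / (1 + x\<^sup>2))" "h \<in> borel_measurable borel" "g \<in> borel_measurable borel" "\<And>x. \<bar>g x\<bar> \<le> M / (1 + x\<^sup>2)"
 shows "integrable lborel (\<lambda>x. h x * g x)"
proof (rule Bochner_Integration.integrable_bound)
 show "integrable lborel (\<lambda>x. M * (h x / (1 + x\<^sup>2)))" by (rule integrable_mult_right) (rule assms(1))
 show "AE x in lborel. norm (h x * g x) \<le> norm (M * (h x / (1 + x\<^sup>2)))"
 proof (rule AE_I2)
  fix x :: real
  have pos: "1 + x\<^sup>2 > 0" by (simp add: add_pos_nonneg)
  have "\<bar>g x\<bar> \<le> \<bar>M\<bar> / (1 + x\<^sup>2)" using assms(4)[of x] pos by (meson abs_ge_self divide_right_mono less_imp_le order_trans)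
  then have "\<bar>h x\<bar> * \<bar>g x\<bar> \<le> \<bar>h x\<bar> * (\<bar>M\<bar> / (1 + x\<^sup>2))" by (intro mult_left_mono) auto
  then show "norm (h x * g x) \<le> norm (M * (h x / (1 + x\<^sup>2)))" using pos by (simp add: abs_mult mult.commute)
 qed
qed (use assms in measurable)

lemma integrable_Cauchy_square:
 assumes f: "integrable lborel (\<lambda>x. f x / (1 + x\<^sup>2))" "f \<in> borel_measurable borel" and z: "0 < Im z"
 shows "integrable lborel (\<lambda>x. complex_of_real (f x) / (of_real x - z)\<^sup>2)"
proof -
 obtain M where M: "\<And>x. 1 / ((x - Re z)\<^sup>2 + (Im z)\<^sup>2) \<le> M / (1 + x\<^sup>2)" using Cauchy_kernel_bound[OF z] by blast
 have e: "(cmod (of_real x - z))\<^sup>2 = (x - Re z)\<^sup>2 + (Im z)\<^sup>2" for x by (simp add: cmod_power2)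
 have "integrable lborel (\<lambda>x. f x * (1 / (cmod (of_real x - z))\<^sup>2))"
  using M by (intro integrable_weighted[OF f, of _ M]) (auto simp: e)
 then show ?thesis
 proof (rule Bochner_Integration.integrable_bound)
  show "AE x in lborel. norm (complex_of_real (f x) / (of_real x - z)\<^sup>2) \<le> norm (f x * (1 / (cmod (of_real x - z))\<^sup>2))"
   by (auto simp: norm_divide norm_power abs_divide)
 qed (use f in measurable)
qed

text \<open>Integrating the Cauchy kernel twice turns the hypothesis into the vanishing of all Poisson
 integrals, first up to a constant, which is zero because \<open>h\<close> vanishes near \<open>-\<infinity>\<close>.\<close>

lemma Cauchy_square_uniqueness:
 fixes h :: "real \<Rightarrow> real"
 assumes hi: "integrable lborel (\<lambda>x. h x / (1 + x\<^sup>2))" and hm: "h \<in> borel_measurable borel"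
  and z: "\<And>z. 0 < Im z \<Longrightarrow> (LINT x|lborel. complex_of_real (h x) / (of_real x - z)\<^sup>2) = 0"
  and left: "AE x in lborel. x < c \<longrightarrow> h x = 0"
 shows "AE x in lborel. h x = 0"
proof -
 \<comment> \<open>Up to the factor 1/\<pi>, the Poisson kernel of the upper half-plane at t + iy;
   \<open>p'\<close> is its derivative in \<open>t\<close>.\<close>
 define p where "p y t x = y / ((x - t)\<^sup>2 + y\<^sup>2)" for y t x :: real
 define p' where "p' y t x = 2 * y * (x - t) / ((x - t)\<^sup>2 + y\<^sup>2)\<^sup>2" for y t x :: real
 have pos: "(x - t)\<^sup>2 + y\<^sup>2 > 0" if "y > 0" for x t y :: real using that by (simp add: add_nonneg_pos)
 have pm[measurable]: "p y t \<in> borel_measurable borel" "p' y t \<in> borel_measurable borel" for y t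
  unfolding p_def p'_def by measurable
 have pp: "((\<lambda>t. p y t x) has_real_derivative p' y t x) (at t)" if "y > 0" for y t x
  unfolding p_def p'_def using pos[OF that, of x t]
  by (auto intro!: derivative_eq_intros simp: power2_eq_square minus_divide_left algebra_simps)
 have pbd: "\<exists>M>0. \<forall>x. p y t x \<le> M / (1 + x\<^sup>2)" if "y > 0" for y t
 proof -
  obtain M where M: "M > 0" "\<And>x. 1 / ((x - t)\<^sup>2 + y\<^sup>2) \<le> M / (1 + x\<^sup>2)" using Cauchy_kernel_bound[OF \<open>y > 0\<close>] by blast
  have "p y t x \<le> (y * M) / (1 + x\<^sup>2)" for x
   using mult_left_mono[OF M(2)[of x], of y] that by (simp add: p_def)
  then show ?thesis using M(1) that by (intro exI[of _ "y * M"]) auto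
 qed
 have p0: "p y t x \<ge> 0" if "y > 0" for y t x using that by (simp add: p_def)
 have hp: "integrable lborel (\<lambda>x. h x * p y t x)" if y: "y > 0" for y t
 proof -
  obtain M where "\<And>x. p y t x \<le> M / (1 + x\<^sup>2)" using pbd[OF y, of t] by blast
  then show ?thesis using p0[OF y] by (intro integrable_weighted[OF hi hm pm(1), of _ _ M]) (simp add: abs_of_nonneg)
 qed
 have p'p: "\<bar>p' y t x\<bar> \<le> p y t x / y" if "y > 0" for y t x
 proof -
  have "2 * y * \<bar>x - t\<bar> \<le> (x - t)\<^sup>2 + y\<^sup>2" using zero_le_power2[of "\<bar>x - t\<bar> - y"] by (simp add: power2_eq_square algebra_simps)
  then have "2 * y * \<bar>x - t\<bar> / ((x - t)\<^sup>2 + y\<^sup>2)\<^sup>2 \<le> ((x - t)\<^sup>2 + y\<^sup>2) / ((x - t)\<^sup>2 + y\<^sup>2)\<^sup>2" by (intro divide_right_mono) auto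
  also have "\<dots> = 1 / ((x - t)\<^sup>2 + y\<^sup>2)" using pos[OF that, of x t] by (simp add: power2_eq_square)
  finally show ?thesis using that by (simp add: p'_def p_def abs_mult)
 qed
 \<comment> \<open>Control of the kernel that is uniform for \<open>t\<close> near
   \<open>t0\<close>, the majorant for differentiating under the integral sign.\<close>
 have ploc: "p y t x \<le> 4 * p y t0 x" if "y > 0" "\<bar>t - t0\<bar> < y" for y t t0 x
 proof -
  have "(x - t0)\<^sup>2 \<le> 2 * (x - t)\<^sup>2 + 2 * (t - t0)\<^sup>2" using zero_le_power2[of "(x - t) - (t - t0)"] by (simp add: power2_eq_square algebra_simps)
  moreover have "(t - t0)\<^sup>2 \<le> y\<^sup>2" using that by (intro abs_le_square_iff[THEN iffD1]) auto
  ultimately have "(x - t0)\<^sup>2 + y\<^sup>2 \<le> 4 * ((x - t)\<^sup>2 + y\<^sup>2)" using zero_le_power2[of "x - t"] zero_le_power2[of y] unfolding distrib_left by linarith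
  then have "1 / (4 * ((x - t)\<^sup>2 + y\<^sup>2)) \<le> 1 / ((x - t0)\<^sup>2 + y\<^sup>2)" using pos[OF that(1), of x t0] by (intro divide_left_mono) (auto intro!: mult_pos_pos pos that)
  then have "4 * y * (1 / (4 * ((x - t)\<^sup>2 + y\<^sup>2))) \<le> 4 * y * (1 / ((x - t0)\<^sup>2 + y\<^sup>2))" using that by (intro mult_left_mono) auto
  moreover have "4 * y * (1 / (4 * ((x - t)\<^sup>2 + y\<^sup>2))) = p y t x" unfolding p_def by (simp del: distrib_left_numeral)
  ultimately show ?thesis by (simp add: p_def)
 qed
 \<comment> \<open>\<open>p'\<close> is the imaginary part of 1 / (x - z)^2 at z = t + iy, so the
   hypothesis says that the Poisson integral \<open>P y\<close> has derivative 0.\<close>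
 have hp': "(LINT x|lborel. h x * p' y t x) = 0" if "y > 0" for y t
 proof -
  let ?z = "Complex t y"
  have "(LINT x|lborel. h x * p' y t x) = (LINT x|lborel. Im (complex_of_real (h x) / (of_real x - ?z)\<^sup>2))"
  proof (intro Bochner_Integration.integral_cong refl)
   fix x
   have "(of_real x - ?z)\<^sup>2 = Complex ((x - t)\<^sup>2 - y\<^sup>2) (- 2 * y * (x - t))"
    by (simp add: complex_eq_iff power2_eq_square algebra_simps)
   moreover have "((x - t)\<^sup>2 - y\<^sup>2)\<^sup>2 + (2 * y * (x - t))\<^sup>2 = ((x - t)\<^sup>2 + y\<^sup>2)\<^sup>2" by (simp add: power2_eq_square algebra_simps)
   ultimately show "h x * p' y t x = Im (complex_of_real (h x) / (of_real x - ?z)\<^sup>2)"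
    by (simp add: p'_def Im_divide)
  qed
  also have "\<dots> = Im (LINT x|lborel. complex_of_real (h x) / (of_real x - ?z)\<^sup>2)"
   using that by (intro integral_Im integrable_Cauchy_square hi hm) simp
  also have "\<dots> = 0" using z[of ?z] that by simp
  finally show ?thesis .
 qed
 define P where "P y t = (LINT x|lborel. h x * p y t x)" for y t
 have Pder: "(P y has_real_derivative 0) (at t)" if "y > 0" for y t
 proof -
  have "((\<lambda>t. integral\<^sup>L lborel (\<lambda>x. h x * p y t x)) has_real_derivative integral\<^sup>L lborel (\<lambda>x. h x * p' y t x)) (at t)"
  proof (rule has_derivative_parameter_integral[where a="t - y" and b="t + y" and g="\<lambda>x. \<bar>h x * p y t x\<bar> * (4 / y)"])
   fix s x assume s: "t - y < s" "s < t + y"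
   show "((\<lambda>t. h x * p y t x) has_real_derivative h x * p' y s x) (at s)" using DERIV_cmult[OF pp[OF that]] .
   have "\<bar>p' y s x\<bar> \<le> 4 * p y t x / y" using p'p[OF that, of s x] ploc[OF that, of s t x] s that
    by (smt (verit, best) divide_right_mono)
   then have "\<bar>h x\<bar> * \<bar>p' y s x\<bar> \<le> \<bar>h x\<bar> * (4 * p y t x / y)" by (intro mult_left_mono) auto
   then show "\<bar>h x * p' y s x\<bar> \<le> \<bar>h x * p y t x\<bar> * (4 / y)" using p0[OF that, of t x] by (simp add: abs_mult mult_ac)
  qed (use that hp hm pm in \<open>auto intro!: integrable_mult_left integrable_abs borel_measurable_times\<close>)
  then show ?thesis unfolding hp'[OF that] P_def .
 qed
 have Pconst: "P y t = P y s" if "y > 0" for y t s using DERIV_isconst_all[of "P y" t s] Pder[OF that] by blast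
 \<comment> \<open>As the parameter tends to minus infinity the kernel tends to 0 pointwise; for x
   \<ge> c it stays below its value at parameter c - 1, which dominates, and to the left of c the
   function \<open>h\<close> vanishes.\<close>
 have P0: "P y t = 0" if y: "y > 0" for y t
 proof -
  have "(\<lambda>n. P y (c - 1 - real n)) \<longlonglongrightarrow> (LINT x|(lborel :: real measure). (0::real))"
   unfolding P_def
  proof (rule integral_dominated_convergence[where w="\<lambda>x. \<bar>h x * p y (c - 1) x\<bar>"])
   show "AE x in lborel. (\<lambda>n. h x * p y (c - 1 - real n) x) \<longlonglongrightarrow> 0"
   proof (rule AE_I2)
    fix x :: real
    have "filterlim (\<lambda>n. real n) at_top sequentially" by (rule filterlim_real_sequentially)
    then have "filterlim (\<lambda>n. (x - c + 1) + real n) at_top sequentially"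
     by (rule filterlim_tendsto_add_at_top[OF tendsto_const])
    then have "filterlim (\<lambda>n. ((x - c + 1) + real n)^2) at_top sequentially" by (rule filterlim_pow_at_top[rotated]) simp
    then have "filterlim (\<lambda>n. y\<^sup>2 + ((x - c + 1) + real n)^2) at_top sequentially"
     by (rule filterlim_tendsto_add_at_top[OF tendsto_const])
    then have "(\<lambda>n. y / (y\<^sup>2 + ((x - c + 1) + real n)^2)) \<longlonglongrightarrow> 0"
     by (intro tendsto_divide_0[OF tendsto_const] filterlim_at_top_imp_at_infinity)
    moreover have "y / (y\<^sup>2 + ((x - c + 1) + real n)^2) = p y (c - 1 - real n) x" for n
     by (simp add: p_def add.commute algebra_simps)
    ultimately have "(\<lambda>n. p y (c - 1 - real n) x) \<longlonglongrightarrow> 0" by simp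
    then show "(\<lambda>n. h x * p y (c - 1 - real n) x) \<longlonglongrightarrow> 0" by (rule tendsto_mult_right_zero)
   qed
   show "AE x in lborel. norm (h x * p y (c - 1 - real n) x) \<le> \<bar>h x * p y (c - 1) x\<bar>" for n
    using left
   proof eventually_elim
    case (elim x)
    show ?case
    proof (cases "x < c")
     case False
     then have "(x - (c - 1))\<^sup>2 \<le> (x - (c - 1 - real n))\<^sup>2" by (intro power_mono) auto
     then have "p y (c - 1 - real n) x \<le> p y (c - 1) x" unfolding p_def using y pos[OF y] by (intro divide_left_mono) auto
     then show ?thesis using p0[OF y] by (simp add: abs_mult mult_left_mono)
    qed (use elim in simp)
   qed
  qed (use hp[OF y] hm in auto)
  moreover have "P y (c - 1 - real n) = P y t" for n by (rule Pconst[OF y])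
  ultimately show ?thesis by (simp add: LIMSEQ_const_iff)
 qed
 \<comment> \<open>The integral of the kernel over its parameter from \<open>s\<close> to
   \<open>t\<close>. As \<open>y\<close> tends to 0 it becomes \<pi> times the indicator of [s, t],
   up to the end-points.\<close>
 define K where "K y s t x = arctan ((t - x) / y) - arctan ((s - x) / y)" for y s t x :: real
 have Km[measurable]: "K y s t \<in> borel_measurable borel" for y s t
  unfolding K_def
  by (intro borel_measurable_diff borel_measurable_continuous_on[OF continuous_on_arctan[OF continuous_on_id]])
   (measurable)
 have Kder: "((\<lambda>t. K y s t x) has_real_derivative p y t x) (at t)" if "y > 0" for y s t x
  unfolding K_def using DERIV_diff[OF arctan_scaled_derivative[OF that, of x t UNIV] DERIV_const]
  by (simp add: p_def power2_commute)
 \<comment> \<open>Uniformity in y \<le> 1 matters, since this is the majorant for the limit y to 0.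
   Far out the mean value theorem gives quadratic decay; near the origin both arctangents are
   bounded.\<close>
 have Kbd: "\<exists>M. \<forall>y x. 0 < y \<and> y \<le> 1 \<longrightarrow> \<bar>K y s t x\<bar> \<le> M / (1 + x\<^sup>2)" if "s < t" for s t
 proof -
  define \<rho> where "\<rho> = \<bar>s\<bar> + \<bar>t\<bar> + 1"
  define M where "M = pi * (1 + 4 * \<rho>\<^sup>2) + 8 * (t - s)"
  have "\<bar>K y s t x\<bar> \<le> M / (1 + x\<^sup>2)" if y: "0 < y" "y \<le> 1" for y x
  proof -
   have x1: "1 + x\<^sup>2 > 0" by (simp add: add_pos_nonneg)
   have "\<bar>K y s t x\<bar> * (1 + x\<^sup>2) \<le> M"
   proof (cases "\<bar>x\<bar> \<le> 2 * \<rho>")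
    case True
    have "\<bar>K y s t x\<bar> \<le> pi"
     using arctan_bounded[of "(t - x) / y"] arctan_bounded[of "(s - x) / y"] unfolding K_def by linarith
    moreover have "x\<^sup>2 \<le> 4 * \<rho>\<^sup>2" using power_mono[OF True, of 2] by (simp add: power_mult_distrib)
    ultimately have "\<bar>K y s t x\<bar> * (1 + x\<^sup>2) \<le> pi * (1 + 4 * \<rho>\<^sup>2)" using x1 by (intro mult_mono) auto
    then show ?thesis using \<open>s < t\<close> by (simp add: M_def)
   next
    case False
    obtain u where u: "s < u" "u < t" "K y s t x - K y s s x = (t - s) * p y u x"
     using MVT2[OF \<open>s < t\<close>, of "\<lambda>t. K y s t x" "\<lambda>u. p y u x"] Kder[OF y(1)] by blast
    have Ku: "\<bar>K y s t x\<bar> = (t - s) * p y u x" using u p0[OF y(1), of u x] by (simp add: K_def)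
    have "\<bar>u\<bar> \<le> \<bar>s\<bar> + \<bar>t\<bar>" "\<bar>x\<bar> \<le> \<bar>x - u\<bar> + \<bar>u\<bar>" using u(1,2) by linarith+
    then have "\<bar>x\<bar> / 2 \<le> \<bar>x - u\<bar>" using False unfolding \<rho>_def by simp
    then have "(\<bar>x\<bar> / 2)\<^sup>2 \<le> \<bar>x - u\<bar>\<^sup>2" by (intro power_mono) auto
    then have A: "x\<^sup>2 / 4 \<le> (x - u)\<^sup>2 + y\<^sup>2" by (simp add: power_divide add_increasing2)
    have "1 \<le> \<bar>x\<bar>" using False abs_ge_zero[of s] abs_ge_zero[of t] unfolding \<rho>_def not_le distrib_left by linarith
    then have "1 \<le> x\<^sup>2" using power_mono[of 1 "\<bar>x\<bar>" 2] by simp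
    then have "1 + x\<^sup>2 \<le> 8 * (x\<^sup>2 / 4)" by simp
    also have "\<dots> \<le> 8 * ((x - u)\<^sup>2 + y\<^sup>2)" using A by (rule mult_left_mono) simp
    finally have "1 + x\<^sup>2 \<le> 8 * ((x - u)\<^sup>2 + y\<^sup>2)" .
    then have "y * (1 + x\<^sup>2) \<le> 1 * (8 * ((x - u)\<^sup>2 + y\<^sup>2))" using y x1 by (intro mult_mono) auto
    then have "p y u x * (1 + x\<^sup>2) \<le> 8" using pos[OF y(1), of x u] by (simp add: p_def divide_le_eq)
    then have "(t - s) * (p y u x * (1 + x\<^sup>2)) \<le> (t - s) * 8" using \<open>s < t\<close> by (intro mult_left_mono) auto
    then have "(t - s) * p y u x * (1 + x\<^sup>2) \<le> 8 * (t - s)" by (simp only: mult.assoc mult.commute[of 8])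
    moreover have "0 \<le> pi * (1 + 4 * \<rho>\<^sup>2)" by (intro mult_nonneg_nonneg) auto
    ultimately show ?thesis unfolding Ku M_def by linarith
   qed
   then show ?thesis using x1 by (simp add: pos_le_divide_eq)
  qed
  then show ?thesis by blast
 qed
 have Kbd2: "\<exists>M. \<forall>x. \<bar>K y s t x\<bar> \<le> M / (1 + x\<^sup>2)" if y: "0 < y" "y \<le> 1" for y s t
 proof -
  consider "s < t" | "s = t" | "t < s" by linarith
  then show ?thesis
  proof cases
   case 1 then show ?thesis using Kbd[of s t] y by blast
  next
   case 2 then show ?thesis by (intro exI[of _ 0]) (simp add: K_def)
  next
   case 3
   obtain M where "\<And>x. \<bar>K y t s x\<bar> \<le> M / (1 + x\<^sup>2)" using Kbd[OF 3] y by blast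
   moreover have "\<bar>K y s t x\<bar> = \<bar>K y t s x\<bar>" for x by (simp add: K_def)
   ultimately show ?thesis by (intro exI[of _ M]) simp
  qed
 qed
 have hK: "integrable lborel (\<lambda>x. h x * K y s t x)" if y: "0 < y" "y \<le> 1" for y s t
  using Kbd2[OF y, of s t] integrable_weighted[OF hi hm Km[of y s t]] by blast
 have Qder: "((\<lambda>t. LINT x|lborel. h x * K y s t x) has_real_derivative 0) (at t)" if y: "0 < y" "y \<le> 1" for y s t
 proof -
  have "((\<lambda>t. integral\<^sup>L lborel (\<lambda>x. h x * K y s t x)) has_real_derivative integral\<^sup>L lborel (\<lambda>x. h x * p y t x)) (at t)"
  proof (rule has_derivative_parameter_integral[where a="t - y" and b="t + y" and g="\<lambda>x. \<bar>h x * p y t x\<bar> * 4"])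
   fix u x assume u: "t - y < u" "u < t + y"
   show "((\<lambda>t. h x * K y s t x) has_real_derivative h x * p y u x) (at u)" using DERIV_cmult[OF Kder[OF y(1)]] .
   have "p y u x \<le> 4 * p y t x" using ploc[OF y(1), of u t x] u by (simp add: abs_if)
   then have "\<bar>h x\<bar> * p y u x \<le> \<bar>h x\<bar> * (4 * p y t x)" by (intro mult_left_mono) auto
   then show "\<bar>h x * p y u x\<bar> \<le> \<bar>h x * p y t x\<bar> * 4" using p0[OF y(1)] by (simp add: abs_mult)
  qed (use y hp hK hm pm in \<open>auto intro!: integrable_mult_left integrable_abs borel_measurable_times\<close>)
  then show ?thesis using P0[OF y(1), of t] unfolding P_def by simp
 qed
 have Q0: "(LINT x|lborel. h x * K y s t x) = 0" if y: "0 < y" "y \<le> 1" for y s t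
 proof -
  have "(LINT x|lborel. h x * K y s t x) = (LINT x|lborel. h x * K y s s x)"
   using DERIV_isconst_all[of "\<lambda>t. LINT x|lborel. h x * K y s t x" t s] Qder[OF y] by blast
  then show ?thesis by (simp add: K_def)
 qed
 have lim_arctan: "(\<lambda>n. arctan (d / (1 / (real n + 1)))) \<longlonglongrightarrow> pi / 2 * sgn d" for d :: real
 proof -
  have pos: "(\<lambda>n. arctan (d * (real n + 1))) \<longlonglongrightarrow> pi / 2" if "d > 0" for d :: real
   using filterlim_compose[OF arctan_scaled_at_top[of "1 / d" 1] filterlim_real_sequentially] that
   by (simp add: mult.commute)
  consider "d > 0" | "d = 0" | "d < 0" by linarith
  then show ?thesis
  proof cases
   case 3
   then have "(\<lambda>n. - arctan (- d * (real n + 1))) \<longlonglongrightarrow> - (pi / 2)" by (intro tendsto_minus pos) simp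
   then show ?thesis using 3 by (simp add: arctan_minus)
  qed (use pos[of d] in auto)
 qed
 have int0: "integrable lborel (\<lambda>x. h x * indicator {s..t} x) \<and> (LINT x|lborel. h x * indicator {s..t} x) = 0" if st: "s < t" for s t
 proof
  obtain M where M: "\<And>y x. 0 < y \<Longrightarrow> y \<le> 1 \<Longrightarrow> \<bar>K y s t x\<bar> \<le> M / (1 + x\<^sup>2)" using Kbd[OF st] by blast
  define L where "L x = pi / 2 * sgn (t - x) - pi / 2 * sgn (s - x)" for x
  have Lm: "L \<in> borel_measurable borel" unfolding L_def by measurable
  have KL: "(\<lambda>n. K (1 / (real n + 1)) s t x) \<longlonglongrightarrow> L x" for x
   unfolding K_def L_def by (intro tendsto_diff lim_arctan)
  have Mi: "integrable lborel (\<lambda>x. \<bar>h x\<bar> * (M / (1 + x\<^sup>2)))"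
  proof -
   have "integrable lborel (\<lambda>x. M * \<bar>h x / (1 + x\<^sup>2)\<bar>)" by (intro integrable_mult_right integrable_abs hi)
   moreover have "M * \<bar>h x / (1 + x\<^sup>2)\<bar> = \<bar>h x\<bar> * (M / (1 + x\<^sup>2))" for x
    using add_pos_nonneg[of 1 "x\<^sup>2"] by (simp add: abs_divide)
   ultimately show ?thesis by (simp only:)
  qed
  have "(\<lambda>n. LINT x|lborel. h x * K (1 / (real n + 1)) s t x) \<longlonglongrightarrow> (LINT x|lborel. h x * L x)"
  proof (rule integral_dominated_convergence[OF _ _ Mi])
   show "AE x in lborel. (\<lambda>n. h x * K (1 / (real n + 1)) s t x) \<longlonglongrightarrow> h x * L x"
    by (intro AE_I2 tendsto_mult_left KL)
   show "AE x in lborel. norm (h x * K (1 / (real n + 1)) s t x) \<le> \<bar>h x\<bar> * (M / (1 + x\<^sup>2))" for n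
   proof (rule AE_I2)
    fix x
    have "\<bar>K (1 / (real n + 1)) s t x\<bar> \<le> M / (1 + x\<^sup>2)" by (rule M) auto
    from mult_left_mono[OF this abs_ge_zero[of "h x"]]
    show "norm (h x * K (1 / (real n + 1)) s t x) \<le> \<bar>h x\<bar> * (M / (1 + x\<^sup>2))" by (simp add: abs_mult)
   qed
  qed (use hm Lm in auto)
  moreover have "(LINT x|lborel. h x * K (1 / (real n + 1)) s t x) = 0" for n by (rule Q0) auto
  ultimately have hL: "(LINT x|lborel. h x * L x) = 0" by (simp add: LIMSEQ_const_iff)
  have Lb: "\<bar>L x\<bar> \<le> M / (1 + x\<^sup>2)" for x
   using tendsto_rabs[OF KL[of x]] M by (intro LIMSEQ_le_const2) (auto)
  have LI: "L x = pi * indicator {s..t} x" if "x \<notin> {s,t}" for x using that st by (auto simp: L_def indicator_def sgn_if)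
  have ae: "AE x in lborel. h x * L x = pi * (h x * indicator {s..t} x)"
  proof -
   have "AE x in lborel. x \<notin> {s,t}" by (rule AE_not_in) (auto intro: finite_imp_null_set_lborel)
   then show ?thesis by eventually_elim (simp add: LI)
  qed
  have iL: "integrable lborel (\<lambda>x. h x * L x)" by (rule integrable_weighted[OF hi hm Lm Lb])
  then have "integrable lborel (\<lambda>x. pi * (h x * indicator {s..t} x))"
   using integrable_cong_AE_imp[OF iL _ ae] hm by (simp add: AE_symmetric)
  then show i: "integrable lborel (\<lambda>x. h x * indicator {s..t} x)" by simp
  have "(LINT x|lborel. pi * (h x * indicator {s..t} x)) = (LINT x|lborel. h x * L x)"
   using ae hm Lm by (intro integral_cong_AE) (auto elim: AE_mp)
  then show "(LINT x|lborel. h x * indicator {s..t} x) = 0" using hL by simp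
 qed
 have "\<exists>N. negligible N \<and> (\<forall>x\<in>{- real n<..<real n} - N. complex_of_real (h x) = 0)" for n
 proof (cases "n = 0")
  case True then show ?thesis by (intro exI[of _ "{}"]) auto
 next
  case False
  have si: "set_integrable lborel {- real n..x} (\<lambda>x. complex_of_real (h x))" if "- real n < x" for x
   using int0[OF that] unfolding set_integrable_def
   by (auto simp: scaleR_conv_of_real mult.commute simp flip: of_real_mult intro!: integrable_of_real)
  have ai: "(\<lambda>x. complex_of_real (h x)) absolutely_integrable_on {- real n..x}" if "- real n < x" for x
   using si[OF that] unfolding set_integrable_def by (subst integrable_completion) (use hm in auto)
  show ?thesis
  proof (rule ae_zero_if_integrals_zero)
   show "(\<lambda>x. complex_of_real (h x)) absolutely_integrable_on {- real n..real n}" using ai[of "real n"] False by simp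
   fix x assume x: "- real n \<le> x" "x \<le> real n"
   show "integral {- real n..x} (\<lambda>x. complex_of_real (h x)) = 0"
   proof (cases "x = - real n")
    case False
    then have nx: "- real n < x" using x by simp
    have "integral {- real n..x} (\<lambda>x. complex_of_real (h x)) = (LINT u:{- real n..x}|lborel. complex_of_real (h u))"
     using set_borel_integral_eq_integral(2)[OF si[OF nx]] by simp
    also have "\<dots> = complex_of_real (LINT u|lborel. h u * indicator {- real n..x} u)"
     unfolding set_lebesgue_integral_def integral_complex_of_real[symmetric]
     by (intro Bochner_Integration.integral_cong) (auto simp: indicator_def)
    finally show ?thesis using int0[OF nx] by simp
   qed simp
  qed
 qed
 then obtain N where N: "\<And>n. negligible (N n)" "\<And>n x. x \<in> {- real n<..<real n} - N n \<Longrightarrow> h x = 0" by (metis of_real_eq_0_iff)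
 have "negligible (\<Union>n. N n)" using N(1) by (intro negligible_countable_Union) auto
 moreover have "h x = 0" if "x \<notin> (\<Union>n. N n)" for x
 proof -
  obtain n :: nat where "\<bar>x\<bar> < real n" using reals_Archimedean2 by blast
  then have "x \<in> {- real n<..<real n} - N n" using that by (simp add: abs_less_iff)
  then show ?thesis by (rule N(2))
 qed
 ultimately have "AE x in lebesgue. h x = 0"
  by (intro AE_I'[of "\<Union>n. N n"]) (auto simp: negligible_iff_null_sets)
 then show ?thesis by (simp add: AE_completion_iff)
qed

section \<open>From holomorphic functions on the open half-plane to their boundary values\<close>

lemma Cauchy_kernel_integrable:
 assumes "0 < Im z"
 shows "integrable lborel (\<lambda>x. 1 / (cmod (of_real x - z))\<^sup>2)"
proof -
 obtain M where M: "\<And>x. 1 / ((x - Re z)\<^sup>2 + (Im z)\<^sup>2) \<le> M / (1 + x\<^sup>2)"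
  using Cauchy_kernel_bound[OF assms, of "Re z"] by blast
 have e: "(cmod (of_real x - z))\<^sup>2 = (x - Re z)\<^sup>2 + (Im z)\<^sup>2" for x by (simp add: cmod_power2)
 have "integrable lborel (\<lambda>x::real. M * (1 / (1 + x\<^sup>2)))"
  by (rule integrable_mult_right) (rule integrable_inverse_one_plus_square)
 then show ?thesis
 proof (rule Bochner_Integration.integrable_bound)
  show "AE x in lborel. norm (1 / (cmod (of_real x - z))\<^sup>2) \<le> norm (M * (1 / (1 + x\<^sup>2)))"
  proof (rule AE_I2)
   fix x :: real
   have "norm (1 / (cmod (of_real x - z))\<^sup>2) = 1 / ((x - Re z)\<^sup>2 + (Im z)\<^sup>2)" by (simp add: e)
   also have "\<dots> \<le> M / (1 + x\<^sup>2)" by (rule M)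
   also have "\<dots> = M * (1 / (1 + x\<^sup>2))" by simp
   also have "\<dots> \<le> norm (M * (1 / (1 + x\<^sup>2)))" unfolding real_norm_def by (rule abs_ge_self)
   finally show "norm (1 / (cmod (of_real x - z))\<^sup>2) \<le> norm (M * (1 / (1 + x\<^sup>2)))" .
  qed
 qed measurable
qed

lemma integral_symmetric_tendsto:
 fixes f :: "real \<Rightarrow> complex"
 assumes f: "integrable lborel f"
 shows "((\<lambda>R. integral {-R..R} f) \<longlongrightarrow> integral\<^sup>L lborel f) at_top"
proof -
 have "((\<lambda>R. LINT x|lborel. indicator {-R..R} x *\<^sub>R f x) \<longlongrightarrow> integral\<^sup>L lborel f) at_top"
 proof (rule integral_dominated_convergence_at_top)
  show "\<forall>\<^sub>F R in at_top. AE x in lborel. norm (indicator {-R..R} x *\<^sub>R f x) \<le> norm (f x)"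
   by (intro always_eventually allI AE_I2) (auto simp: indicator_def)
  show "AE x in lborel. ((\<lambda>R. indicator {-R..R} x *\<^sub>R f x) \<longlongrightarrow> f x) at_top"
  proof (intro AE_I2 tendsto_eventually)
   fix x :: real
   show "\<forall>\<^sub>F R in at_top. indicator {-R..R} x *\<^sub>R f x = f x"
    using eventually_ge_at_top[of "\<bar>x\<bar>"] by eventually_elim (auto simp: indicator_def)
  qed
 qed (use f in auto)
 moreover have "(LINT x|lborel. indicator {-R..R} x *\<^sub>R f x) = integral {-R..R} f" for R
 proof -
  have "set_integrable lborel {-R..R} f" using f unfolding set_integrable_def by (intro integrable_mult_indicator) auto
  from set_borel_integral_eq_integral(2)[OF this] show ?thesis by (simp add: set_lebesgue_integral_def)
 qed
 ultimately show ?thesis by simp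
qed

text \<open>The translates by i/(n+1) are holomorphic across the real axis, so
  \<open>half_plane_Cauchy\<close> applies to them. The growth constant may deteriorate as \<delta>
  decreases; the passage to the limit uses only the uniform bound on the imaginary part.\<close>

lemma half_plane_boundary_formula:
 fixes G :: "complex \<Rightarrow> complex"
 assumes hol: "G holomorphic_on {w. 0 < Im w}" and nu: "0 < \<nu>" "\<nu> < 1" and C: "0 \<le> C"
  and Im: "\<And>w. 0 < Im w \<Longrightarrow> \<bar>Im (G w)\<bar> \<le> B"
  and growth: "\<And>\<delta>. 0 < \<delta> \<Longrightarrow> \<exists>A\<ge>0. \<forall>w. \<delta> \<le> Im w \<longrightarrow> cmod (G w) \<le> A + C * cmod w powr \<nu>"
  and lim: "AE x in lborel. (\<lambda>n. Im (G (Complex x (1 / (real n + 1))))) \<longlonglongrightarrow> v x" and v: "v \<in> borel_measurable borel"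
  and z: "0 < Im z"
 shows "(LINT x|lborel. complex_of_real (v x) / (of_real x - z)\<^sup>2) = of_real pi * deriv G z"
proof -
 define d where "d n = 1 / (real n + 1)" for n
 have d: "0 < d n" "d n \<le> 1" for n by (auto simp: d_def)
 define g where "g n w = G (w + \<i> * of_real (d n))" for n w
 have opn: "open {w. 0 < Im w}" by (rule open_halfspace_Im_gt)
 have dG: "(G has_field_derivative deriv G w) (at w)" if "0 < Im w" for w
  using holomorphic_derivI[OF hol opn] that by simp
 have dg: "(g n has_field_derivative deriv G (w + \<i> * of_real (d n))) (at w)" if "- d n < Im w" for n w
 proof -
  have h: "(G has_field_derivative deriv G (w + \<i> * of_real (d n))) (at (w + \<i> * of_real (d n)))"
   using that by (intro dG) simp
  have "((\<lambda>w. G (w + \<i> * of_real (d n))) has_field_derivative deriv G (w + \<i> * of_real (d n)) * 1) (at w)"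
   by (rule DERIV_chain2[where g="\<lambda>w. w + \<i> * of_real (d n)", OF h]) (auto intro!: derivative_eq_intros)
  then show ?thesis by (simp add: g_def[abs_def])
 qed
 have gx: "g n (of_real x) = G (Complex x (1 / (real n + 1)))" for n x
  by (simp add: g_def d_def Complex_eq)
 have gh: "g n holomorphic_on {w. - d n < Im w}" for n
  unfolding holomorphic_on_open[OF open_halfspace_Im_gt] using dg by blast
 have gI: "\<bar>Im (g n (of_real x))\<bar> \<le> B" for n x unfolding g_def using d[of n] by (intro Im) simp
 have xz: "of_real x \<noteq> z" for x :: real using z by (auto simp: complex_eq_iff)
 have gc: "continuous_on UNIV (\<lambda>x::real. g n (of_real x))" for n
  using d[of n] by (intro continuous_on_compose2[OF holomorphic_on_imp_continuous_on[OF gh[of n]], of UNIV of_real] continuous_intros) auto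
 have B: "0 \<le> B" using gI[of 0 0] by linarith
 have KB: "integrable lborel (\<lambda>x. B * (1 / (cmod (of_real x - z))\<^sup>2))"
  by (rule integrable_mult_right) (rule Cauchy_kernel_integrable[OF z])
 have bnd: "norm (complex_of_real (Im (g n (of_real x))) / (of_real x - z)\<^sup>2) \<le> B * (1 / (cmod (of_real x - z))\<^sup>2)" for n x
  using gI[of n x] by (auto simp: norm_divide norm_power intro!: divide_right_mono)
 have fm: "(\<lambda>x. complex_of_real (Im (g n (of_real x))) / (of_real x - z)\<^sup>2) \<in> borel_measurable lborel" for n
  using xz gc[of n] by (simp, intro borel_measurable_continuous_onI continuous_intros) auto
 have fi: "integrable lborel (\<lambda>x. complex_of_real (Im (g n (of_real x))) / (of_real x - z)\<^sup>2)" for n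
  by (rule Bochner_Integration.integrable_bound[OF KB fm]) (intro AE_I2 order_trans[OF bnd], unfold real_norm_def, rule abs_ge_self)
 have eq: "(LINT x|lborel. complex_of_real (Im (g n (of_real x))) / (of_real x - z)\<^sup>2) = of_real pi * deriv G (z + \<i> * of_real (d n))" for n
 proof -
  obtain A where A: "A \<ge> 0" "\<And>w. d n \<le> Im w \<Longrightarrow> cmod (G w) \<le> A + C * cmod w powr \<nu>" using growth[OF d(1)[of n]] by blast
  have l1: "((\<lambda>R. integral {-R..R} (\<lambda>x. complex_of_real (Im (g n (of_real x))) / (of_real x - z)\<^sup>2)) \<longlongrightarrow> of_real pi * deriv (g n) z) at_top"
  proof (rule half_plane_Cauchy[OF d(1) gh nu _ _ _ z, where A="A + 2 * C" and C="2 * C"])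
   fix w :: complex assume w: "0 \<le> Im w"
   let ?w = "w + \<i> * of_real (d n)"
   have "cmod ?w \<le> cmod w + cmod (\<i> * of_real (d n))" by (rule norm_triangle_ineq)
   also have "\<dots> \<le> cmod w + 1" using d[of n] by (simp add: norm_mult)
   also have "\<dots> \<le> 2 * max (cmod w) 1" by simp
   finally have "cmod ?w powr \<nu> \<le> (2 * max (cmod w) 1) powr \<nu>" using nu by (intro powr_mono2) auto
   also have "\<dots> = 2 powr \<nu> * max (cmod w) 1 powr \<nu>" by (simp add: powr_mult)
   also have "\<dots> \<le> 2 * (cmod w powr \<nu> + 1)"
   proof (rule mult_mono)
    show "2 powr \<nu> \<le> (2::real)" using powr_mono[of \<nu> 1 "2::real"] nu by simp
    show "max (cmod w) 1 powr \<nu> \<le> cmod w powr \<nu> + 1" by (simp add: max_def)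
   qed auto
   finally have "C * cmod ?w powr \<nu> \<le> C * (2 * (cmod w powr \<nu> + 1))" using C by (intro mult_left_mono)
   moreover have "cmod (g n w) \<le> A + C * cmod ?w powr \<nu>" unfolding g_def using w by (intro A(2)) simp
   ultimately show "cmod (g n w) \<le> A + 2 * C + 2 * C * cmod w powr \<nu>" by (simp add: algebra_simps)
  qed (use A C in auto)
  have "deriv (g n) z = deriv G (z + \<i> * of_real (d n))"
   using dg[of n z] z d[of n] by (intro DERIV_imp_deriv) simp
  then show ?thesis
   using tendsto_unique[OF trivial_limit_at_top_linorder integral_symmetric_tendsto[OF fi[of n]] l1] by simp
 qed
 have L1: "(\<lambda>n. LINT x|lborel. complex_of_real (Im (g n (of_real x))) / (of_real x - z)\<^sup>2) \<longlonglongrightarrow>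
   (LINT x|lborel. complex_of_real (v x) / (of_real x - z)\<^sup>2)"
 proof (rule integral_dominated_convergence[OF _ fm KB])
  show "AE x in lborel. (\<lambda>n. complex_of_real (Im (g n (of_real x))) / (of_real x - z)\<^sup>2) \<longlonglongrightarrow> complex_of_real (v x) / (of_real x - z)\<^sup>2"
   using lim
  proof eventually_elim
   case (elim x)
   then have "(\<lambda>n. Im (g n (of_real x))) \<longlonglongrightarrow> v x" by (simp add: gx)
   then show ?case using xz[of x] by (intro tendsto_intros) auto
  qed
 qed (use v bnd in auto)
 have L2: "(\<lambda>n. of_real pi * deriv G (z + \<i> * of_real (d n))) \<longlonglongrightarrow> of_real pi * deriv G (z + \<i> * of_real 0)"
 proof (intro tendsto_mult_left)
  have "isCont (deriv G) z"
   using holomorphic_deriv[OF hol opn] z opn by (auto simp: continuous_on_eq_continuous_at dest!: holomorphic_on_imp_continuous_on)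
  moreover have "d \<longlonglongrightarrow> 0" unfolding d_def using LIMSEQ_inverse_real_of_nat by (simp add: inverse_eq_divide add.commute)
  then have "(\<lambda>n. z + \<i> * of_real (d n)) \<longlonglongrightarrow> z + \<i> * of_real 0" by (intro tendsto_intros)
  ultimately show "(\<lambda>n. deriv G (z + \<i> * of_real (d n))) \<longlonglongrightarrow> deriv G (z + \<i> * of_real 0)"
   using isCont_tendsto_compose[of "z + \<i> * of_real 0" "deriv G"] by simp
 qed
 show ?thesis using LIMSEQ_unique[OF L1[unfolded eq] L2] by simp
qed

section \<open>Abstract boundary triples\<close>

text \<open>An element \<open>(u, v, a, b)\<close> of \<open>A\<close> stands for a function \<open>u\<close> in the domain of the maximal operator,
 its image \<open>v\<close> and its two boundary values \<open>a\<close>, \<open>b\<close>.\<close>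

lemma norm_bound_by_cinner:
 assumes "c * (norm u)\<^sup>2 \<le> cmod (cinner w u)" shows "c * norm u \<le> norm w"
 using order_trans[OF assms cinner_Cauchy_Schwarz] by (cases "norm u = 0") (simp_all add: power2_eq_square flip: mult.assoc)

locale boundary_triple =
 fixes A :: "(L2 \<times> L2 \<times> complex \<times> complex) set" and C \<nu> :: real
 assumes zero: "(0, 0, 0, 0) \<in> A"
  and add: "(u, v, a, b) \<in> A \<Longrightarrow> (u', v', a', b') \<in> A \<Longrightarrow> (u + u', v + v', a + a', b + b') \<in> A"
  and scale: "(u, v, a, b) \<in> A \<Longrightarrow> (c *\<^sub>C u, c *\<^sub>C v, c * a, c * b) \<in> A"
  and Green: "(u, v, a, b) \<in> A \<Longrightarrow> (u', v', a', b') \<in> A \<Longrightarrow> cinner v u' - cinner u v' = a * cnj b' - b * cnj a'"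
  and single: "(0, v, a, b) \<in> A \<Longrightarrow> v = 0 \<and> a = 0 \<and> b = 0"
  and nonneg: "(u, v, 0, b) \<in> A \<Longrightarrow> 0 \<le> Re (cinner v u)"
  and surj: "\<exists>u v b. (u, v, 0, b) \<in> A \<and> v + u = f"
  and Weyl: "0 < k \<Longrightarrow> \<exists>e. (e, - (complex_of_real k *\<^sub>C e), 1, complex_of_real (C * k powr \<nu>)) \<in> A"
  and C: "0 < C" and nu: "0 < \<nu>" "\<nu> < 1"
begin

lemma diff: "(u, v, a, b) \<in> A \<Longrightarrow> (u', v', a', b') \<in> A \<Longrightarrow> (u - u', v - v', a - a', b - b') \<in> A"
 using add[OF _ scale[of u' v' a' b' "-1"], of u v a b] by simp

definition T0 :: L2_op where "T0 = {(u, v). \<exists>b. (u, v, 0, b) \<in> A}"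
definition Tk :: "real \<Rightarrow> L2_op" where "Tk \<kappa> = {(u, v). \<exists>a. (u, v, a, - of_real \<kappa> * a) \<in> A}"

lemma T0_iff: "(u, v) \<in> T0 \<longleftrightarrow> (\<exists>b. (u, v, 0, b) \<in> A)" by (simp add: T0_def)
lemma Tk_iff: "(u, v) \<in> Tk \<kappa> \<longleftrightarrow> (\<exists>a. (u, v, a, - of_real \<kappa> * a) \<in> A)" by (simp add: Tk_def)

lemma linear_T0: "linear_relation T0"
 unfolding linear_relation_def T0_iff
proof (intro conjI allI impI)
 show "\<exists>b. (0, 0, 0, b) \<in> A" using zero by blast
 show "\<exists>b. (u + u', v + v', 0, b) \<in> A" if "\<exists>b. (u, v, 0, b) \<in> A" "\<exists>b. (u', v', 0, b) \<in> A" for u v u' v'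
  using that add[of u v 0 _ u' v' 0] by fastforce
 show "\<exists>b. (c *\<^sub>C u, c *\<^sub>C v, 0, b) \<in> A" if "\<exists>b. (u, v, 0, b) \<in> A" for c u v
  using that scale[of u v 0 _ c] by fastforce
qed

lemma linear_Tk: "linear_relation (Tk \<kappa>)"
 unfolding linear_relation_def Tk_iff
proof (intro conjI allI impI)
 show "\<exists>a. (0, 0, a, - of_real \<kappa> * a) \<in> A" using zero by (intro exI[of _ 0]) simp
next
 fix u v u' v' assume "\<exists>a. (u, v, a, - of_real \<kappa> * a) \<in> A" "\<exists>a. (u', v', a, - of_real \<kappa> * a) \<in> A"
 then obtain a a' where "(u, v, a, - of_real \<kappa> * a) \<in> A" "(u', v', a', - of_real \<kappa> * a') \<in> A" by blast
 from add[OF this] show "\<exists>a. (u + u', v + v', a, - of_real \<kappa> * a) \<in> A"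
  by (intro exI[of _ "a + a'"]) (simp add: algebra_simps)
next
 fix c u v assume "\<exists>a. (u, v, a, - of_real \<kappa> * a) \<in> A"
 then obtain a where "(u, v, a, - of_real \<kappa> * a) \<in> A" by blast
 from scale[OF this, of c] show "\<exists>a. (c *\<^sub>C u, c *\<^sub>C v, a, - of_real \<kappa> * a) \<in> A"
  by (intro exI[of _ "c * a"]) (simp add: algebra_simps)
qed

lemma self_adjoint_T0: "self_adjoint T0"
proof (rule self_adjointI[where c="-1"])
 show "linear_relation T0" by (rule linear_T0)
 show "cinner v u' = cinner u v'" if "(u, v) \<in> T0" "(u', v') \<in> T0" for u v u' v'
  using that Green unfolding T0_iff by fastforce
 show "\<exists>u v. (u, v) \<in> T0 \<and> v - complex_of_real (- 1) *\<^sub>C u = f" for f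
  using surj[of f] unfolding T0_iff by fastforce
 show "v = 0" if "(0, v) \<in> T0" for v using that single unfolding T0_iff by blast
qed

lemma T0_nonneg: "(u, v) \<in> T0 \<Longrightarrow> 0 \<le> Re (cinner v u)"
 using nonneg by (auto simp: T0_iff)

lemma T0_Im: assumes "(u, v) \<in> T0" shows "Im (cinner v u) = 0"
proof -
 have "cinner v u = cinner u v" using assms Green unfolding T0_iff by fastforce
 then show ?thesis using cinner_commute[of v u] by (simp add: complex_eq_iff)
qed

section \<open>The slit plane, the resolvent of \<open>T0\<close> and the Weyl function\<close>

definition \<Omega> :: "complex set" where "\<Omega> = {z. Im z \<noteq> 0 \<or> Re z < 0}"

text \<open>A lower bound for the distance from \<open>z\<close> to [0, \<infinity>) that is
  continuous in \<open>z\<close> and invariant under conjugation.\<close>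

definition gap :: "complex \<Rightarrow> real" where "gap z = max \<bar>Im z\<bar> (- Re z)"

lemma gap_pos: "z \<in> \<Omega> \<Longrightarrow> 0 < gap z" by (auto simp: \<Omega>_def gap_def)

lemma T0_lower:
 assumes "(u, v) \<in> T0" shows "gap z * norm u \<le> norm (v - z *\<^sub>C u)"
proof -
 have e: "cinner (v - z *\<^sub>C u) u = cinner v u - z * of_real ((norm u)\<^sup>2)"
  by (simp add: cinner_diff_left cinner_scaleC_left cinner_self_norm)
 have "\<bar>Im z\<bar> * (norm u)\<^sup>2 = \<bar>Im (cinner (v - z *\<^sub>C u) u)\<bar>" unfolding e using T0_Im[OF assms] by (simp add: abs_mult)
 moreover have "- Re z * (norm u)\<^sup>2 \<le> Re (cinner (v - z *\<^sub>C u) u)" unfolding e using T0_nonneg[OF assms] by simp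
 ultimately show ?thesis
  using abs_Im_le_cmod[of "cinner (v - z *\<^sub>C u) u"] complex_Re_le_cmod[of "cinner (v - z *\<^sub>C u) u"]
  by (intro norm_bound_by_cinner) (auto simp: gap_def max_def)
qed

lemma gap_cnj: "gap (cnj z) = gap z" by (simp add: gap_def)

definition R0 :: "complex \<Rightarrow> L2 \<Rightarrow> L2" where "R0 z = resolvent T0 z"

lemma R0:
 assumes "z \<in> \<Omega>"
 shows "z \<in> resolvent_set T0" "(R0 z f, f + z *\<^sub>C R0 z f) \<in> T0" "norm (R0 z f) \<le> norm f / gap z"
  "(u, f + z *\<^sub>C u) \<in> T0 \<Longrightarrow> R0 z f = u"
proof -
 have l: "gap z * norm u \<le> norm (v - z *\<^sub>C u)" if "(u, v) \<in> T0" for u v by (rule T0_lower[OF that])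
 have l': "gap z * norm u \<le> norm (v - cnj z *\<^sub>C u)" if "(u, v) \<in> T0" for u v
  using T0_lower[OF that, of "cnj z"] by (simp add: gap_cnj)
 note * = self_adjoint_resolvent[OF self_adjoint_T0 gap_pos[OF assms] l l']
 show "z \<in> resolvent_set T0" "(R0 z f, f + z *\<^sub>C R0 z f) \<in> T0" "norm (R0 z f) \<le> norm f / gap z"
  "(u, f + z *\<^sub>C u) \<in> T0 \<Longrightarrow> R0 z f = u"
  unfolding R0_def using * by blast+
qed

text \<open>The solution \<open>e\<close> at -1 satisfies (T - z) e = -(z + 1) e, and adding (z + 1)
  R0(z) e repairs this without changing the first boundary value.\<close>

lemma Weyl_exists: "z \<in> \<Omega> \<Longrightarrow> \<exists>e b. (e, z *\<^sub>C e, 1, b) \<in> A"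
proof -
 assume z: "z \<in> \<Omega>"
 obtain e b where e: "(e, - e, 1, b) \<in> A" using Weyl[of 1] by auto
 obtain b' where w: "(R0 z e, e + z *\<^sub>C R0 z e, 0, b') \<in> A" using R0(2)[OF z, of e] unfolding T0_iff by blast
 have "(e + (z + 1) *\<^sub>C R0 z e, - e + (z + 1) *\<^sub>C (e + z *\<^sub>C R0 z e), 1 + (z + 1) * 0, b + (z + 1) * b') \<in> A"
  by (rule add[OF e scale[OF w]])
 moreover have "- e + (z + 1) *\<^sub>C (e + z *\<^sub>C R0 z e) = z *\<^sub>C (e + (z + 1) *\<^sub>C R0 z e)"
  by (simp add: L2.scale_left_distrib L2.scale_right_distrib distrib_left distrib_right)
 ultimately show ?thesis by auto
qed

text \<open>The difference with the matching multiple of \<open>e\<close> has first boundary value 0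
  and so belongs to the Friedrichs extension, which has no eigenvalue in \<Omega>.\<close>

lemma kernel:
 assumes z: "z \<in> \<Omega>" and e: "(e, z *\<^sub>C e, 1, b) \<in> A" and u: "(u, z *\<^sub>C u, a, c) \<in> A"
 shows "u = a *\<^sub>C e" "c = a * b"
proof -
 have "(u - a *\<^sub>C e, z *\<^sub>C u - a *\<^sub>C (z *\<^sub>C e), a - a * 1, c - a * b) \<in> A" by (rule diff[OF u scale[OF e]])
 moreover have "z *\<^sub>C u - a *\<^sub>C (z *\<^sub>C e) = z *\<^sub>C (u - a *\<^sub>C e)" by (simp add: L2.scale_right_diff_distrib mult.commute)
 ultimately have w: "(u - a *\<^sub>C e, z *\<^sub>C (u - a *\<^sub>C e), 0, c - a * b) \<in> A" by simp
 then have "(u - a *\<^sub>C e, z *\<^sub>C (u - a *\<^sub>C e)) \<in> T0" unfolding T0_iff by blast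
 from T0_lower[OF this, of z] have "gap z * norm (u - a *\<^sub>C e) \<le> 0" by simp
 then have "norm (u - a *\<^sub>C e) \<le> 0" using gap_pos[OF z] by (simp add: mult_le_0_iff)
 then show ue: "u = a *\<^sub>C e" by simp
 have "(0, z *\<^sub>C (u - a *\<^sub>C e), 0, c - a * b) \<in> A" using w ue by simp
 from single[OF this] show "c = a * b" by simp
qed

text \<open>The gamma field of the boundary triple; \<open>\<beta>\<close> below is the Weyl
  function.\<close>

definition E :: "complex \<Rightarrow> L2" where "E z = (SOME e. \<exists>b. (e, z *\<^sub>C e, 1, b) \<in> A)"
definition \<beta> :: "complex \<Rightarrow> complex" where "\<beta> z = (SOME b. (E z, z *\<^sub>C E z, 1, b) \<in> A)"

lemma E: "z \<in> \<Omega> \<Longrightarrow> (E z, z *\<^sub>C E z, 1, \<beta> z) \<in> A"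
 unfolding \<beta>_def by (rule someI_ex) (use someI_ex[OF Weyl_exists] in \<open>simp add: E_def\<close>)

lemma E_nonzero: "z \<in> \<Omega> \<Longrightarrow> E z \<noteq> 0"
 using E[of z] single[of "z *\<^sub>C E z" 1 "\<beta> z"] by auto

lemma \<Omega>_cnj: "z \<in> \<Omega> \<Longrightarrow> cnj z \<in> \<Omega>" by (simp add: \<Omega>_def)

lemma \<beta>_cnj: assumes "z \<in> \<Omega>" shows "\<beta> (cnj z) = cnj (\<beta> z)"
proof -
 have "cinner (z *\<^sub>C E z) (E (cnj z)) - cinner (E z) (cnj z *\<^sub>C E (cnj z)) = 1 * cnj (\<beta> (cnj z)) - \<beta> z * cnj 1"
  by (rule Green[OF E[OF assms] E[OF \<Omega>_cnj[OF assms]]])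
 then have "cnj (\<beta> (cnj z)) = \<beta> z" by (simp add: cinner_scaleC_left cinner_scaleC_right)
 then show ?thesis by (metis complex_cnj_cnj)
qed

lemma \<beta>_diff:
 assumes z: "z \<in> \<Omega>" and w: "w \<in> \<Omega>"
 shows "(z - w) * cinner (E z) (E (cnj w)) = \<beta> w - \<beta> z"
proof -
 have "cinner (z *\<^sub>C E z) (E (cnj w)) - cinner (E z) (cnj w *\<^sub>C E (cnj w)) = 1 * cnj (\<beta> (cnj w)) - \<beta> z * cnj 1"
  by (rule Green[OF E[OF z] E[OF \<Omega>_cnj[OF w]]])
 then show ?thesis using \<beta>_cnj[OF w] by (simp add: cinner_scaleC_left cinner_scaleC_right algebra_simps)
qed

text \<open>E z - E w has first boundary value 0, and T - z maps it to (z - w) E w.\<close>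

lemma E_diff:
 assumes z: "z \<in> \<Omega>" and w: "w \<in> \<Omega>"
 shows "E z - E w = (z - w) *\<^sub>C R0 z (E w)"
proof (cases "z = w")
 case False
 then have nz: "z - w \<noteq> 0" by simp
 have "(E z - E w, z *\<^sub>C E z - w *\<^sub>C E w, 1 - 1, \<beta> z - \<beta> w) \<in> A" by (rule diff[OF E[OF z] E[OF w]])
 then have "(inverse (z - w) *\<^sub>C (E z - E w), inverse (z - w) *\<^sub>C (z *\<^sub>C E z - w *\<^sub>C E w)) \<in> T0"
  unfolding T0_iff using scale[of "E z - E w" "z *\<^sub>C E z - w *\<^sub>C E w" 0 "\<beta> z - \<beta> w" "inverse (z - w)"] by auto
 moreover have "inverse (z - w) *\<^sub>C (z *\<^sub>C E z - w *\<^sub>C E w) = E w + z *\<^sub>C (inverse (z - w) *\<^sub>C (E z - E w))"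
 proof -
  have "E w = inverse (z - w) *\<^sub>C ((z - w) *\<^sub>C E w)" using nz by simp
  then have "E w + z *\<^sub>C (inverse (z - w) *\<^sub>C (E z - E w)) = inverse (z - w) *\<^sub>C ((z - w) *\<^sub>C E w + z *\<^sub>C (E z - E w))"
   by (metis L2.scale_left_commute L2.scale_right_distrib)
  also have "(z - w) *\<^sub>C E w + z *\<^sub>C (E z - E w) = z *\<^sub>C E z - w *\<^sub>C E w"
   by (simp add: L2.scale_left_diff_distrib L2.scale_right_diff_distrib)
  finally show ?thesis by simp
 qed
 ultimately have "R0 z (E w) = inverse (z - w) *\<^sub>C (E z - E w)" using R0(4)[OF z] by simp
 then show ?thesis using nz by simp
qed simp

lemma open_\<Omega>: "open \<Omega>"
proof -
 have eq: "\<Omega> = {z. 0 < Im z} \<union> {z. Im z < 0} \<union> {z. Re z < 0}" by (auto simp: \<Omega>_def)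
 show ?thesis unfolding eq by (intro open_Un open_halfspace_Im_gt open_halfspace_Im_lt open_halfspace_Re_lt)
qed

text \<open>Green's formula writes the difference quotient of \<beta> as minus the inner product of
  E(w) with E(conj z), and the resolvent bound, uniform near \<open>z\<close>, makes
  \<open>E\<close> continuous.\<close>

lemma \<beta>_derivative:
 assumes z: "z \<in> \<Omega>"
 shows "(\<beta> has_field_derivative - cinner (E z) (E (cnj z))) (at z)"
proof -
 have gc: "(gap \<longlongrightarrow> gap z) (at z)"
  unfolding gap_def by (intro tendsto_intros)
 have ev: "\<forall>\<^sub>F w in at z. w \<in> \<Omega> \<and> gap z / 2 < gap w"
 proof (rule eventually_conj)
  show "\<forall>\<^sub>F w in at z. w \<in> \<Omega>" using eventually_at_in_open'[OF open_\<Omega> z] .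
  show "\<forall>\<^sub>F w in at z. gap z / 2 < gap w" using order_tendstoD(1)[OF gc, of "gap z / 2"] gap_pos[OF z] by simp
 qed
 have "((\<lambda>w. E w - E z) \<longlongrightarrow> 0) (at z)"
 proof (rule Lim_null_comparison)
  have "((\<lambda>w. cmod (w - z) * (norm (E z) / (gap z / 2))) \<longlongrightarrow> cmod (z - z) * (norm (E z) / (gap z / 2))) (at z)"
   by (intro tendsto_intros)
  then show "((\<lambda>w. cmod (w - z) * (norm (E z) / (gap z / 2))) \<longlongrightarrow> 0) (at z)" by simp
  show "\<forall>\<^sub>F w in at z. norm (E w - E z) \<le> cmod (w - z) * (norm (E z) / (gap z / 2))"
   using ev
  proof eventually_elim
   case (elim w)
   then have w: "w \<in> \<Omega>" by simp
   have "norm (R0 w (E z)) \<le> norm (E z) / gap w" by (rule R0(3)[OF w])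
   also have "\<dots> \<le> norm (E z) / (gap z / 2)" using elim gap_pos[OF z] gap_pos[OF w] by (intro divide_left_mono) auto
   finally show ?case unfolding E_diff[OF w z] norm_scaleC by (rule mult_left_mono) simp
  qed
 qed
 then have "(E \<longlongrightarrow> E z) (at z)" by (simp add: LIM_zero_iff)
 then have "((\<lambda>w. - cinner (E w) (E (cnj z))) \<longlongrightarrow> - cinner (E z) (E (cnj z))) (at z)"
  by (intro tendsto_minus tendsto_cinner tendsto_const)
 moreover have "\<forall>\<^sub>F w in at z. - cinner (E w) (E (cnj z)) = (\<beta> w - \<beta> z) / (w - z)"
  using ev eventually_neq_at_within[of z z UNIV]
 proof eventually_elim
  case (elim w)
  then have "(w - z) * cinner (E w) (E (cnj z)) = \<beta> z - \<beta> w" using \<beta>_diff[of w z] z by simp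
  then have "- ((w - z) * cinner (E w) (E (cnj z))) = \<beta> w - \<beta> z" by simp
  then show ?case using elim by (simp add: field_simps)
 qed
 ultimately have "((\<lambda>w. (\<beta> w - \<beta> z) / (w - z)) \<longlongrightarrow> - cinner (E z) (E (cnj z))) (at z)"
  by (rule Lim_transform_eventually)
 then show ?thesis by (simp add: has_field_derivative_iff)
qed

lemma \<beta>_real: assumes "0 < k" shows "\<beta> (- of_real k) = of_real (C * k powr \<nu>)"
proof -
 have z: "- of_real k \<in> \<Omega>" using assms by (simp add: \<Omega>_def)
 obtain e where "(e, - (complex_of_real k *\<^sub>C e), 1, complex_of_real (C * k powr \<nu>)) \<in> A" using Weyl[OF assms] by blast
 then have "(e, (- complex_of_real k) *\<^sub>C e, 1, complex_of_real (C * k powr \<nu>)) \<in> A" by simp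
 from kernel(2)[OF z E[OF z] this] show ?thesis by simp
qed

lemma connected_\<Omega>: "connected \<Omega>"
proof -
 have "starlike \<Omega>" unfolding starlike_def
 proof (intro bexI ballI subsetI)
  show "-1 \<in> \<Omega>" by (simp add: \<Omega>_def)
  fix z x assume z: "z \<in> \<Omega>" and "x \<in> closed_segment (-1) z"
  then obtain u where u: "0 \<le> u" "u \<le> 1" "x = (1 - u) *\<^sub>R (-1) + u *\<^sub>R z" by (auto simp: closed_segment_def)
  show "x \<in> \<Omega>"
  proof (cases "u = 0 \<or> Im z = 0")
   case True
   then have "Re x < 0"
   proof
    assume "Im z = 0"
    then have "Re z < 0" using z by (simp add: \<Omega>_def)
    then have "u * Re z \<le> 0" "u \<noteq> 0 \<Longrightarrow> u * Re z < 0" using u(1) by (auto simp: mult_le_0_iff mult_pos_neg)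
    then show "Re x < 0" using u by (cases "u = 0") auto
   qed (use u in simp)
   then show ?thesis by (simp add: \<Omega>_def)
  next
   case False
   then show ?thesis using u by (simp add: \<Omega>_def)
  qed
 qed
 then show ?thesis by (rule starlike_imp_connected)
qed

lemma minus_\<Omega>: "z \<in> \<Omega> \<Longrightarrow> - z \<notin> \<real>\<^sub>\<le>\<^sub>0" by (auto simp: \<Omega>_def complex_nonpos_Reals_iff)

lemma powr_holomorphic_\<Omega>: "(\<lambda>z. of_real C * (- z) powr of_real \<nu>) holomorphic_on \<Omega>"
 using minus_\<Omega> by (intro holomorphic_intros) auto

text \<open>On the negative axis the formula is part of the triple. The segment from -2 to -1
  already has a limit point, so the identity theorem extends the formula to the connected set
  \<Omega>.\<close>

lemma \<beta>_eq: assumes "z \<in> \<Omega>" shows "\<beta> z = of_real C * (- z) powr of_real \<nu>"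
proof -
 have hol: "\<beta> holomorphic_on \<Omega>"
  unfolding holomorphic_on_open[OF open_\<Omega>] using \<beta>_derivative by blast
 have "\<beta> z - of_real C * (- z) powr of_real \<nu> = 0"
 proof (rule analytic_continuation[where S=\<Omega> and U="(\<lambda>r. - complex_of_real r) ` {1..2}" and \<xi>="-1" and f="\<lambda>z. \<beta> z - of_real C * (- z) powr of_real \<nu>"])
  show "(\<lambda>z. \<beta> z - of_real C * (- z) powr of_real \<nu>) holomorphic_on \<Omega>"
   by (intro holomorphic_on_diff hol powr_holomorphic_\<Omega>)
  show "(\<lambda>r. - complex_of_real r) ` {1..2} \<subseteq> \<Omega>" by (auto simp: \<Omega>_def)
  show "- 1 islimpt (\<lambda>r. - complex_of_real r) ` {1..2}"
   unfolding islimpt_approachable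
  proof (intro allI impI)
   fix e :: real assume "0 < e"
   define r where "r = 1 + min 1 (e/2)"
   have r: "r \<in> {1..2}" "r \<noteq> 1" "\<bar>r - 1\<bar> < e" using \<open>0 < e\<close> by (auto simp: r_def)
   have "- complex_of_real r - (- 1) = of_real (1 - r)" by simp
   then have "dist (- complex_of_real r) (- 1) = \<bar>1 - r\<bar>" unfolding dist_norm by (simp only: norm_of_real)
   moreover have "- complex_of_real r \<noteq> - 1" using r(2) by (metis neg_equal_iff_equal of_real_eq_1_iff)
   ultimately show "\<exists>x'\<in>(\<lambda>r. - complex_of_real r) ` {1..2}. x' \<noteq> - 1 \<and> dist x' (- 1) < e"
    using r by (intro bexI[of _ "- complex_of_real r"]) auto
  qed
  fix w assume "w \<in> (\<lambda>r. - complex_of_real r) ` {1..2}"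
  then obtain r where r: "1 \<le> r" "w = - complex_of_real r" by auto
  then show "\<beta> w - of_real C * (- w) powr of_real \<nu> = 0"
   using \<beta>_real[of r] powr_of_real[of r \<nu>] by simp
 qed (use open_\<Omega> connected_\<Omega> assms in \<open>auto simp: \<Omega>_def\<close>)
 then show ?thesis by simp
qed

end

section \<open>Krein's formula, the extensions \<open>Tk\<close> and their negative spectrum\<close>

lemma cinner_minus [simp]: "cinner (- u) v = - cinner u v" "cinner u (- v) = - cinner u v"
 using cinner_scaleC_left[of "-1" u v] cinner_scaleC_right[of u "-1" v] by simp_all

context boundary_triple
begin

text \<open>For Im z > 0 the argument of -z lies in (-\<pi>, 0), and multiplying it by a factor
  \<nu> between 0 and 1 keeps it there.\<close>

lemma Im_powr:
 assumes "0 < Im z"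
 shows "Im ((- z) powr of_real \<nu>) < 0"
proof -
 have nz: "- z \<noteq> 0" using assms by auto
 have "\<not> (0 \<le> Im (Ln (- z)))" using Im_Ln_pos_le[OF nz] Im_Ln_le_pi[OF nz] assms by simp
 then have n: "Im (Ln (- z)) < 0" by simp
 have l: "- pi < Im (Ln (- z))" by (rule mpi_less_Im_Ln[OF nz])
 have "- (pi * 1) < \<nu> * Im (Ln (- z))"
 proof -
  have "\<nu> * (- Im (Ln (- z))) < 1 * pi" using nu n l by (intro mult_strict_mono) auto
  then show ?thesis by simp
 qed
 moreover have "\<nu> * Im (Ln (- z)) < 0" using nu n by (simp add: mult_pos_neg)
 ultimately have "sin (\<nu> * Im (Ln (- z))) < 0" using sin_gt_zero[of "- (\<nu> * Im (Ln (- z)))"] by simp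
 moreover have "Im ((- z) powr of_real \<nu>) = exp (\<nu> * Re (Ln (- z))) * sin (\<nu> * Im (Ln (- z)))"
  using nz by (simp add: powr_def Im_exp)
 ultimately show ?thesis by (simp add: mult_pos_neg)
qed

text \<open>Krein's function \<kappa> + \<beta>, taken in closed form so that its boundary values
  can be read off.\<close>

definition D :: "real \<Rightarrow> complex \<Rightarrow> complex" where "D \<kappa> z = of_real \<kappa> + of_real C * (- z) powr of_real \<nu>"

lemma D_eq: "z \<in> \<Omega> \<Longrightarrow> D \<kappa> z = of_real \<kappa> + \<beta> z" by (simp add: D_def \<beta>_eq)

lemma D_cnj: "z \<in> \<Omega> \<Longrightarrow> D \<kappa> (cnj z) = cnj (D \<kappa> z)"
 using \<beta>_cnj[of z] D_eq[of z \<kappa>] D_eq[of "cnj z" \<kappa>] \<Omega>_cnj[of z] by simp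

lemma Im_D: "0 < Im z \<Longrightarrow> Im (D \<kappa> z) < 0"
 using Im_powr[of z] C by (simp add: D_def mult_pos_neg)

lemma D_nonreal: assumes "Im z \<noteq> 0" shows "D \<kappa> z \<noteq> 0"
proof (cases "0 < Im z")
 case True
 then show ?thesis using Im_D[OF True, of \<kappa>] by auto
next
 case False
 then have "0 < Im (cnj z)" using assms by simp
 then have "Im (D \<kappa> (cnj z)) < 0" by (rule Im_D)
 moreover have "z \<in> \<Omega>" using assms by (simp add: \<Omega>_def)
 ultimately show ?thesis using D_cnj[of z \<kappa>] by auto
qed

lemma D_neg: assumes "0 < t" shows "D \<kappa> (- of_real t) = of_real (\<kappa> + C * t powr \<nu>)"
 using powr_of_real[of t \<nu>] assms by (simp add: D_def)

text \<open>By Green's formula R0(z) f has second boundary value b = -<f, E(conj z)>. Adding c E(z)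
  turns the pair (0, b) into (c, b + c \<beta>), and the boundary condition b + c \<beta> =
  -\<kappa> c determines c.\<close>

lemma Krein_surj:
 assumes z: "z \<in> \<Omega>" and D: "D \<kappa> z \<noteq> 0"
 shows "(R0 z f + (cinner f (E (cnj z)) / D \<kappa> z) *\<^sub>C E z, f + z *\<^sub>C (R0 z f + (cinner f (E (cnj z)) / D \<kappa> z) *\<^sub>C E z)) \<in> Tk \<kappa>"
proof -
 obtain b where w: "(R0 z f, f + z *\<^sub>C R0 z f, 0, b) \<in> A" using R0(2)[OF z, of f] unfolding T0_iff by blast
 have "cinner (f + z *\<^sub>C R0 z f) (E (cnj z)) - cinner (R0 z f) (cnj z *\<^sub>C E (cnj z)) = 0 * cnj (\<beta> (cnj z)) - b * cnj 1"
  by (rule Green[OF w E[OF \<Omega>_cnj[OF z]]])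
 then have b: "b = - cinner f (E (cnj z))"
  by (simp add: cinner_add_left cinner_scaleC_left cinner_scaleC_right)
 define c where "c = cinner f (E (cnj z)) / D \<kappa> z"
 have "(R0 z f + c *\<^sub>C E z, (f + z *\<^sub>C R0 z f) + c *\<^sub>C (z *\<^sub>C E z), 0 + c * 1, b + c * \<beta> z) \<in> A"
  by (rule add[OF w scale[OF E[OF z]]])
 moreover have "(f + z *\<^sub>C R0 z f) + c *\<^sub>C (z *\<^sub>C E z) = f + z *\<^sub>C (R0 z f + c *\<^sub>C E z)"
  by (simp add: L2.scale_right_distrib mult.commute)
 moreover have "b + c * \<beta> z = - of_real \<kappa> * c"
 proof -
  have "c * D \<kappa> z = cinner f (E (cnj z))" using D by (simp add: c_def)
  then show ?thesis unfolding b D_eq[OF z] by (simp add: algebra_simps)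
 qed
 ultimately have "(R0 z f + c *\<^sub>C E z, f + z *\<^sub>C (R0 z f + c *\<^sub>C E z), c, - of_real \<kappa> * c) \<in> A"
  by (simp only: add_0_left mult_1_right)
 then show ?thesis unfolding Tk_iff c_def[symmetric] by blast
qed

lemma Tk_symmetric: "(u, v) \<in> Tk \<kappa> \<Longrightarrow> (u', v') \<in> Tk \<kappa> \<Longrightarrow> cinner v u' = cinner u v'"
 using Green[of u v _ _ u' v'] unfolding Tk_iff by fastforce

lemma large_t: "\<exists>t0>0. \<forall>t\<ge>t0. 0 < \<kappa> + C * t powr \<nu>"
proof (intro exI conjI allI impI)
 \<comment> \<open>Chosen so that C times its power \<nu> is |\<kappa>| + 1.\<close>
 let ?t0 = "((\<bar>\<kappa>\<bar> + 1) / C) powr (1 / \<nu>)"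
 have pos: "(\<bar>\<kappa>\<bar> + 1) / C > 0" using C by simp
 have "(\<bar>\<kappa>\<bar> + 1) / C \<noteq> 0" using pos by linarith
 then show t0: "?t0 > 0" by (simp only: powr_gt_zero not_False_eq_True)
 fix t assume t: "?t0 \<le> t"
 have "(\<bar>\<kappa>\<bar> + 1) / C = ?t0 powr \<nu>" using pos nu C by (simp add: powr_powr)
 also have "\<dots> \<le> t powr \<nu>" using t nu by (intro powr_mono2) auto
 finally have "\<bar>\<kappa>\<bar> + 1 \<le> C * t powr \<nu>" using C by (simp add: field_simps)
 then show "0 < \<kappa> + C * t powr \<nu>" by linarith
qed

text \<open>At a point -t far to the left \<open>D\<close> is positive, so Krein's formula solves (T
  + t) u = f for every f.\<close>

lemma self_adjoint_Tk: "self_adjoint (Tk \<kappa>)"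
proof -
 obtain t where t: "t > 0" "0 < \<kappa> + C * t powr \<nu>" using large_t by blast
 have z: "- complex_of_real t \<in> \<Omega>" using t by (simp add: \<Omega>_def)
 have D: "D \<kappa> (- complex_of_real t) \<noteq> 0" unfolding D_neg[OF t(1)] of_real_eq_0_iff using t(2) by linarith
 show ?thesis
 proof (rule self_adjointI[where c="-t"])
  show "\<exists>u v. (u, v) \<in> Tk \<kappa> \<and> v - complex_of_real (- t) *\<^sub>C u = f" for f
   using Krein_surj[OF z D, of f] by fastforce
  show "v = 0" if "(0, v) \<in> Tk \<kappa>" for v using that single unfolding Tk_iff by blast
 qed (use linear_Tk Tk_symmetric in auto)
qed

text \<open>With f = (T + t) u and R0 taken at -t, Krein's formula gives <f, u> = <f, R0 f> + |a|^2
  D(-t). Both terms have nonnegative real part once \<open>D\<close> is positive at -t.\<close>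

lemma Tk_bounded_below: "\<exists>t0>0. \<forall>(u, v)\<in>Tk \<kappa>. - t0 * (norm u)\<^sup>2 \<le> Re (cinner v u)"
proof -
 obtain t where t: "t > 0" "0 < \<kappa> + C * t powr \<nu>" using large_t by blast
 have z: "- complex_of_real t \<in> \<Omega>" using t by (simp add: \<Omega>_def)
 have "- t * (norm u)\<^sup>2 \<le> Re (cinner v u)" if uv: "(u, v) \<in> Tk \<kappa>" for u v
 proof -
  define f where "f = v + complex_of_real t *\<^sub>C u"
  let ?z = "- complex_of_real t"
  obtain a where a: "(u, v, a, - of_real \<kappa> * a) \<in> A" using uv unfolding Tk_iff by blast
  obtain b where w: "(R0 ?z f, f + ?z *\<^sub>C R0 ?z f, 0, b) \<in> A" using R0(2)[OF z, of f] unfolding T0_iff by blast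
  have "(u - R0 ?z f, v - (f + ?z *\<^sub>C R0 ?z f), a - 0, - of_real \<kappa> * a - b) \<in> A" by (rule diff[OF a w])
  moreover have "v - (f + ?z *\<^sub>C R0 ?z f) = ?z *\<^sub>C (u - R0 ?z f)"
   by (simp add: f_def L2.scale_right_diff_distrib)
  ultimately have k: "(u - R0 ?z f, ?z *\<^sub>C (u - R0 ?z f), a, - of_real \<kappa> * a - b) \<in> A" by simp
  have u: "u - R0 ?z f = a *\<^sub>C E ?z" and b: "- of_real \<kappa> * a - b = a * \<beta> ?z" using kernel[OF z E[OF z] k] by auto
  have "cinner (f + ?z *\<^sub>C R0 ?z f) (E ?z) - cinner (R0 ?z f) (?z *\<^sub>C E ?z) = 0 * cnj (\<beta> ?z) - b * cnj 1"
   by (rule Green[OF w E[OF z]])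
  then have fb: "cinner f (E ?z) = - b" by (simp add: cinner_diff_left cinner_scaleC_left cinner_scaleC_right)
  have "a * D \<kappa> ?z = - b" unfolding D_eq[OF z] distrib_left b[symmetric] by simp
  then have fa: "cinner f (E ?z) = a * of_real (\<kappa> + C * t powr \<nu>)" using fb D_neg[OF t(1), of \<kappa>] by simp
  have ue: "u = R0 ?z f + a *\<^sub>C E ?z" using u by (simp add: algebra_simps)
  have "cinner f u = cinner f (R0 ?z f) + cnj a * cinner f (E ?z)"
   by (subst ue) (simp add: cinner_add_right cinner_scaleC_right)
  also have "Re (\<dots>) \<ge> 0"
  proof -
   have "Re (cinner f (R0 ?z f)) \<ge> 0"
   proof -
    have "cinner (f + ?z *\<^sub>C R0 ?z f) (R0 ?z f) = cinner f (R0 ?z f) - of_real t * of_real ((norm (R0 ?z f))\<^sup>2)"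
     by (simp add: cinner_add_left cinner_scaleC_left cinner_self_norm cinner_diff_left)
    then have "Re (cinner (f + ?z *\<^sub>C R0 ?z f) (R0 ?z f)) = Re (cinner f (R0 ?z f)) - t * (norm (R0 ?z f))\<^sup>2" by simp
    then show ?thesis using T0_nonneg[OF R0(2)[OF z, of f]] t(1) by (smt (verit) mult_nonneg_nonneg zero_le_power2)
   qed
   moreover have "cnj a * cinner f (E ?z) = of_real ((cmod a)\<^sup>2 * (\<kappa> + C * t powr \<nu>))"
    unfolding fa of_real_mult complex_norm_square by simp
   then have "Re (cnj a * cinner f (E ?z)) \<ge> 0" using t(2) by (simp del: of_real_mult of_real_power)
   ultimately show ?thesis by simp
  qed
  finally have "0 \<le> Re (cinner f u)" .
  moreover have "cinner f u = cinner v u + of_real (t * (norm u)\<^sup>2)"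
   by (simp add: f_def cinner_add_left cinner_scaleC_left cinner_self_norm)
  ultimately show ?thesis by simp
 qed
 then show ?thesis using t(1) by blast
qed

lemma bounded_from_below_T0: "bounded_from_below T0"
 unfolding bounded_from_below_def using T0_nonneg by (intro exI[of _ 0]) auto

lemma bounded_from_below_Tk: "bounded_from_below (Tk \<kappa>)"
 unfolding bounded_from_below_def using Tk_bounded_below by blast

lemma resolvent_set_below:
 fixes T :: L2_op
 assumes sa: "self_adjoint T" and c: "\<forall>(u, v)\<in>T. c * (norm u)\<^sup>2 \<le> Re (cinner v u)" and "\<mu> < c"
 shows "complex_of_real \<mu> \<in> resolvent_set T"
proof -
 have l: "(c - \<mu>) * norm u \<le> norm (v - complex_of_real \<mu> *\<^sub>C u)" if "(u, v) \<in> T" for u v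
 proof -
  have "(c - \<mu>) * (norm u)\<^sup>2 \<le> Re (cinner (v - complex_of_real \<mu> *\<^sub>C u) u)"
   using c that by (auto simp: cinner_diff_left cinner_scaleC_left cinner_self_norm algebra_simps)
  then show ?thesis using complex_Re_le_cmod by (intro norm_bound_by_cinner) (rule order_trans)
 qed
 show ?thesis by (rule self_adjoint_resolvent(1)[OF sa, of "c - \<mu>"]) (use l assms(3) in auto)
qed

definition joint_spectrum :: "real \<Rightarrow> real set" where
 "joint_spectrum \<kappa> = {\<mu>. complex_of_real \<mu> \<in> op_spectrum (Tk \<kappa>) \<union> op_spectrum T0}"

lemma joint_spectrum_bdd_below: "bdd_below (joint_spectrum \<kappa>)"
proof -
 obtain t where t: "t > 0" "\<forall>(u, v)\<in>Tk \<kappa>. - t * (norm u)\<^sup>2 \<le> Re (cinner v u)" using Tk_bounded_below by blast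
 have "- t \<le> \<mu>" if "\<mu> \<in> joint_spectrum \<kappa>" for \<mu>
 proof (rule ccontr)
  assume "\<not> ?thesis"
  then have "complex_of_real \<mu> \<in> resolvent_set (Tk \<kappa>)" "complex_of_real \<mu> \<in> resolvent_set T0"
   using resolvent_set_below[OF self_adjoint_Tk t(2)] R0(1)[of "of_real \<mu>"] t(1) by (auto simp: \<Omega>_def)
  then show False using that by (simp add: joint_spectrum_def op_spectrum_def)
 qed
 then show ?thesis by (rule bdd_belowI)
qed

text \<open>If \<open>0\<close> were in the resolvent set of \<open>T0\<close>, the boundary value \<open>\<beta> (- t) = C t\<^sup>\<nu>\<close> would be Lipschitz at \<open>0\<close>.\<close>

lemma zero_in_spectrum: "0 \<in> joint_spectrum \<kappa>"
proof (rule ccontr)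
 assume "0 \<notin> joint_spectrum \<kappa>"
 then have "0 \<in> resolvent_set T0" by (simp add: joint_spectrum_def op_spectrum_def)
 then have ex: "\<exists>!u. (u, f) \<in> T0" for f by (simp add: resolvent_set_def op_shift_iff)
 obtain e b where e: "(e, - e, 1, b) \<in> A" using Weyl[of 1] by auto
 obtain w b' where w: "(w, e, 0, b') \<in> A" using ex[of e] unfolding T0_iff by blast
 \<comment> \<open>\<open>e0\<close> plays the part of E(0): it is mapped to 0 and has first
   boundary value 1. It exists because \<open>T0\<close> is assumed to be invertible at 0.\<close>
 define e0 where "e0 = e + w" define b0 where "b0 = b + b'"
 have e0: "(e0, 0, 1, b0) \<in> A" using add[OF e w] by (simp add: e0_def b0_def)
 have est: "cmod (of_real (C * t powr \<nu>) - b0) \<le> t * (2 * norm e0) * norm e0" if t: "t > 0" for t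
 proof -
  let ?z = "- complex_of_real t"
  have z: "?z \<in> \<Omega>" using t by (simp add: \<Omega>_def)
  have "(E ?z - e0, ?z *\<^sub>C E ?z - 0, 1 - 1, \<beta> ?z - b0) \<in> A" by (rule diff[OF E[OF z] e0])
  then have "(E ?z - e0, ?z *\<^sub>C E ?z) \<in> T0" unfolding T0_iff by auto
  from T0_lower[OF this, of ?z] have "t * norm (E ?z - e0) \<le> norm (?z *\<^sub>C E ?z - ?z *\<^sub>C (E ?z - e0))"
   using t by (simp add: gap_def)
  also have "?z *\<^sub>C E ?z - ?z *\<^sub>C (E ?z - e0) = ?z *\<^sub>C e0" by (simp add: L2.scale_right_diff_distrib)
  finally have "t * norm (E ?z - e0) \<le> t * norm e0" using t by (simp add: norm_scaleC)
  then have "norm (E ?z - e0) \<le> norm e0" using t by simp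
  then have nE: "norm (E ?z) \<le> 2 * norm e0" using norm_triangle_ineq2[of "E ?z" e0] by linarith
  have "cinner (?z *\<^sub>C E ?z) e0 - cinner (E ?z) 0 = 1 * cnj b0 - \<beta> ?z * cnj 1" by (rule Green[OF E[OF z] e0])
  then have g1: "of_real (C * t powr \<nu>) - cnj b0 = of_real t * cinner (E ?z) e0" using \<beta>_real[OF t] by (simp add: cinner_scaleC_left algebra_simps)
  have "cinner 0 e0 - cinner e0 0 = 1 * cnj b0 - b0 * cnj 1" by (rule Green[OF e0 e0])
  then have "cnj b0 = b0" by simp
  then have "cmod (of_real (C * t powr \<nu>) - b0) = t * cmod (cinner (E ?z) e0)" using g1 t by (simp add: norm_mult)
  also have "\<dots> \<le> t * (norm (E ?z) * norm e0)" using t by (intro mult_left_mono cinner_Cauchy_Schwarz) auto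
  also have "\<dots> \<le> t * ((2 * norm e0) * norm e0)" using t nE by (intro mult_left_mono mult_right_mono) auto
  finally show ?thesis by (simp add: mult.assoc)
 qed
 define K where "K = 2 * norm e0 * norm e0"
 have K: "K \<ge> 0" by (simp add: K_def)
 have est': "cmod (of_real (C * t powr \<nu>) - b0) \<le> t * K" if "t > 0" for t using est[OF that] by (simp add: K_def mult.assoc)
 have b0: "b0 = 0"
 proof -
  have l1: "((\<lambda>t. C * t powr \<nu>) \<longlongrightarrow> C * 0) (at_right 0)"
   by (intro tendsto_mult_left tendsto_zero_powrI[OF tendsto_ident_at tendsto_const])
    (use nu eventually_at_right_less[of "0::real"] in \<open>auto elim: eventually_mono\<close>)
  have "((\<lambda>t. cmod (of_real (C * t powr \<nu>) - b0)) \<longlongrightarrow> cmod (of_real (C * 0) - b0)) (at_right 0)"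
   by (intro tendsto_intros l1)
  moreover have "((\<lambda>t. t * K) \<longlongrightarrow> 0 * K) (at_right 0)" by (intro tendsto_intros)
  moreover have "\<forall>\<^sub>F t in at_right 0. cmod (of_real (C * t powr \<nu>) - b0) \<le> t * K"
   using eventually_at_right_less[of 0] by eventually_elim (rule est')
  ultimately have "cmod (of_real (C * 0) - b0) \<le> 0 * K" by (intro tendsto_le[OF trivial_limit_at_right_real])
  then show ?thesis by simp
 qed
 have "C * t powr (\<nu> - 1) \<le> K" if "t > 0" for t
 proof -
  have "C * t powr \<nu> \<le> t * K" using est'[OF that] C that unfolding b0 diff_zero norm_of_real by simp
  moreover have "t powr (\<nu> - 1) = t powr \<nu> / t" using that by (simp add: powr_diff)
  moreover have "C * t powr \<nu> / t \<le> K" using calculation(1) by (simp add: pos_divide_le_eq[OF that] mult.commute)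
  ultimately show ?thesis by simp
 qed note le = this
 \<comment> \<open>Makes C t^(\<nu> - 1) equal to K + 1, above the bound \<open>K\<close> just
   obtained.\<close>
 define t where "t = ((K + 1) / C) powr (1 / (\<nu> - 1))"
 have "(K + 1) / C > 0" using K C by simp
 then have "t > 0" "t powr (\<nu> - 1) = (K + 1) / C" using nu K C by (simp_all add: t_def powr_powr)
 then show False using le[of t] C by simp
qed

lemma eigenvalue_in_spectrum:
 assumes "t > 0" "\<kappa> + C * t powr \<nu> = 0"
 shows "- t \<in> joint_spectrum \<kappa>" "E (- of_real t) \<in> eigenspace (Tk \<kappa>) (- of_real t)"
proof -
 let ?z = "- complex_of_real t"
 have z: "?z \<in> \<Omega>" using assms by (simp add: \<Omega>_def)
 have "of_real \<kappa> + of_real (C * t powr \<nu>) = (0::complex)" using assms(2) by (metis of_real_add of_real_0)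
 then have "\<beta> ?z = - of_real \<kappa> * 1" unfolding \<beta>_real[OF assms(1)] by (simp add: eq_neg_iff_add_eq_0 add.commute)
 then have "(E ?z, ?z *\<^sub>C E ?z) \<in> Tk \<kappa>" unfolding Tk_iff using E[OF z] by metis
 then show e: "E ?z \<in> eigenspace (Tk \<kappa>) ?z" by (simp add: eigenspace_def)
 have "?z \<notin> resolvent_set (Tk \<kappa>)"
 proof
  assume "?z \<in> resolvent_set (Tk \<kappa>)"
  then have "\<exists>!u. (u, 0) \<in> op_shift (Tk \<kappa>) ?z" by (simp add: resolvent_set_def)
  moreover have "(E ?z, 0) \<in> op_shift (Tk \<kappa>) ?z" "(0, 0) \<in> op_shift (Tk \<kappa>) ?z"
   using e linear_relationD(1)[OF linear_Tk] by (auto simp: op_shift_iff eigenspace_def)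
  ultimately show False using E_nonzero[OF z] by blast
 qed
 then show "- t \<in> joint_spectrum \<kappa>" by (simp add: joint_spectrum_def op_spectrum_def)
qed

text \<open>An eigenvector is a nonzero multiple of E(-t), so the boundary condition reduces to
  D(-t) = 0.\<close>

lemma negative_eigenvalue_iff:
 assumes "t > 0"
 shows "is_eigenvalue (Tk \<kappa>) (- of_real t) \<longleftrightarrow> \<kappa> + C * t powr \<nu> = 0"
proof
 let ?z = "- complex_of_real t"
 have z: "?z \<in> \<Omega>" using assms by (simp add: \<Omega>_def)
 assume "is_eigenvalue (Tk \<kappa>) ?z"
 then obtain u where u: "u \<noteq> 0" "(u, ?z *\<^sub>C u) \<in> Tk \<kappa>" by (auto simp: is_eigenvalue_def eigenspace_def)
 then obtain a where a: "(u, ?z *\<^sub>C u, a, - of_real \<kappa> * a) \<in> A" unfolding Tk_iff by blast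
 have *: "u = a *\<^sub>C E ?z" "- of_real \<kappa> * a = a * \<beta> ?z" using kernel[OF z E[OF z] a] by auto
 then have "a \<noteq> 0" using u(1) by auto
 have "a * (of_real \<kappa> + \<beta> ?z) = 0" unfolding distrib_left *(2)[symmetric] by simp
 then have "of_real (\<kappa> + C * t powr \<nu>) = (0::complex)" using \<open>a \<noteq> 0\<close> \<beta>_real[OF assms] by simp
 then show "\<kappa> + C * t powr \<nu> = 0" by (simp only: of_real_eq_0_iff)
next
 assume "\<kappa> + C * t powr \<nu> = 0"
 then show "is_eigenvalue (Tk \<kappa>) (- of_real t)"
  using eigenvalue_in_spectrum(2)[OF assms] E_nonzero[of "- of_real t"] assms
  by (auto simp: is_eigenvalue_def \<Omega>_def)
qed

lemma eigen_multiplicity_one: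
 assumes "t > 0" "\<kappa> + C * t powr \<nu> = 0"
 shows "eigen_multiplicity (Tk \<kappa>) (- of_real t) = 1"
proof -
 let ?z = "- complex_of_real t"
 have z: "?z \<in> \<Omega>" using assms by (simp add: \<Omega>_def)
 have "eigenspace (Tk \<kappa>) ?z \<subseteq> L2.span {E ?z}"
 proof
  fix u assume "u \<in> eigenspace (Tk \<kappa>) ?z"
  then have "(u, ?z *\<^sub>C u) \<in> Tk \<kappa>" by (simp add: eigenspace_def)
  then obtain a where a: "(u, ?z *\<^sub>C u, a, - of_real \<kappa> * a) \<in> A" unfolding Tk_iff by blast
  have "u = a *\<^sub>C E ?z" using kernel(1)[OF z E[OF z] a] .
  then show "u \<in> L2.span {E ?z}" by (simp add: L2.span_scale L2.span_base)
 qed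
 moreover have "L2.independent {E ?z}" using E_nonzero[OF z] by (simp add: L2.dependent_single)
 ultimately have "L2.dim (eigenspace (Tk \<kappa>) ?z) = card {E ?z}"
  using eigenvalue_in_spectrum(2)[OF assms] by (intro L2.dim_unique) auto
 then show ?thesis by (simp add: eigen_multiplicity_def)
qed

lemma resolvent_difference:
 assumes "Im z \<noteq> 0"
 shows "(\<lambda>f. resolvent (Tk \<kappa>) z f - resolvent T0 z f) = (\<lambda>f. cinner f (cnj (1 / D \<kappa> z) *\<^sub>C E (cnj z)) *\<^sub>C E z)"
proof
 fix f
 have z: "z \<in> \<Omega>" using assms by (simp add: \<Omega>_def)
 \<comment> \<open>Symmetry alone bounds T - w below by |Im z|, for \<open>z\<close> and its
   conjugate alike.\<close>
 have low: "\<bar>Im z\<bar> * norm u \<le> norm (v - w *\<^sub>C u)" if uv: "(u, v) \<in> Tk \<kappa>" and w: "w = z \<or> w = cnj z" for u v w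
 proof -
  have "cinner v u = cinner u v" by (rule Tk_symmetric[OF uv uv])
  then have "Im (cinner v u) = 0" using cinner_commute[of v u] by (simp add: complex_eq_iff)
  then have "\<bar>Im z\<bar> * (norm u)\<^sup>2 = \<bar>Im (cinner (v - w *\<^sub>C u) u)\<bar>" using w
   by (auto simp: cinner_diff_left cinner_scaleC_left cinner_self_norm abs_mult)
  then show ?thesis using abs_Im_le_cmod by (intro norm_bound_by_cinner) simp
 qed
 have "resolvent (Tk \<kappa>) z f = R0 z f + (cinner f (E (cnj z)) / D \<kappa> z) *\<^sub>C E z"
  by (rule self_adjoint_resolvent(4)[OF self_adjoint_Tk _ _ _ Krein_surj[OF z D_nonreal[OF assms]], of "\<bar>Im z\<bar>"])
   (use low assms in auto)
 then show "resolvent (Tk \<kappa>) z f - resolvent T0 z f = cinner f (cnj (1 / D \<kappa> z) *\<^sub>C E (cnj z)) *\<^sub>C E z"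
  by (simp add: R0_def cinner_scaleC_right)
qed

lemma D_derivative:
 assumes "z \<in> \<Omega>" shows "(D \<kappa> has_field_derivative - cinner (E z) (E (cnj z))) (at z)"
proof -
 have "((\<lambda>z. of_real \<kappa> + \<beta> z) has_field_derivative 0 + - cinner (E z) (E (cnj z))) (at z)"
  by (intro DERIV_add DERIV_const \<beta>_derivative assms)
 then show ?thesis
  using has_field_derivative_transform_within_open[OF _ open_\<Omega> assms, of "\<lambda>z. of_real \<kappa> + \<beta> z" _ "D \<kappa>"] D_eq by simp
qed

lemma resolvent_difference_trace:
 assumes "Im z \<noteq> 0"
 shows "trace_class (\<lambda>f. resolvent (Tk \<kappa>) z f - resolvent T0 z f)"
  "op_trace (\<lambda>f. resolvent (Tk \<kappa>) z f - resolvent T0 z f) = - deriv (D \<kappa>) z / D \<kappa> z"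
proof -
 have z: "z \<in> \<Omega>" using assms by (simp add: \<Omega>_def)
 show "trace_class (\<lambda>f. resolvent (Tk \<kappa>) z f - resolvent T0 z f)"
  unfolding resolvent_difference[OF assms] by (rule rank_one_trace_class)
 have "deriv (D \<kappa>) z = - cinner (E z) (E (cnj z))" by (rule DERIV_imp_deriv[OF D_derivative[OF z]])
 then show "op_trace (\<lambda>f. resolvent (Tk \<kappa>) z f - resolvent T0 z f) = - deriv (D \<kappa>) z / D \<kappa> z"
  unfolding resolvent_difference[OF assms] op_trace_rank_one by (simp add: cinner_scaleC_right)
qed

end

section \<open>The spectral shift function of a boundary triple\<close>

context boundary_triple
begin

lemma deriv_D_cnj: "z \<in> \<Omega> \<Longrightarrow> deriv (D \<kappa>) (cnj z) = cnj (deriv (D \<kappa>) z)"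
 using DERIV_imp_deriv[OF D_derivative[of z \<kappa>]] DERIV_imp_deriv[OF D_derivative[OF \<Omega>_cnj[of z], of \<kappa>]]
 by (simp add: cinner_commute[of "E (cnj z)" "E z"])

lemma cmod_D_le: "z \<in> \<Omega> \<Longrightarrow> cmod (D \<kappa> z) \<le> \<bar>\<kappa>\<bar> + C * cmod z powr \<nu>"
 and cmod_D_ge: "z \<in> \<Omega> \<Longrightarrow> C * cmod z powr \<nu> - \<bar>\<kappa>\<bar> \<le> cmod (D \<kappa> z)"
proof -
 assume z: "z \<in> \<Omega>"
 then have nz: "z \<noteq> 0" by (auto simp: \<Omega>_def)
 have n: "cmod (of_real C * (- z) powr of_real \<nu>) = C * cmod z powr \<nu>"
  using nz C by (simp add: norm_mult powr_def)
 show "cmod (D \<kappa> z) \<le> \<bar>\<kappa>\<bar> + C * cmod z powr \<nu>"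
  using norm_triangle_ineq[of "of_real \<kappa>" "of_real C * (- z) powr of_real \<nu>"] n by (simp add: D_def)
 show "C * cmod z powr \<nu> - \<bar>\<kappa>\<bar> \<le> cmod (D \<kappa> z)"
  using norm_triangle_ineq2[of "of_real C * (- z) powr of_real \<nu>" "- of_real \<kappa>"] n by (simp add: D_def add.commute)
qed

text \<open>\<open>D\<close> maps the upper half-plane into the lower one, so the principal branch
  of the logarithm is holomorphic there.\<close>

definition G :: "real \<Rightarrow> complex \<Rightarrow> complex" where "G \<kappa> w = Ln (D \<kappa> w)"

lemma upper_\<Omega>: "0 < Im w \<Longrightarrow> w \<in> \<Omega>" by (simp add: \<Omega>_def)

lemma D_slit: "0 < Im w \<Longrightarrow> D \<kappa> w \<notin> \<real>\<^sub>\<le>\<^sub>0"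
 using Im_D[of w \<kappa>] by (auto simp: complex_nonpos_Reals_iff)

lemma G_derivative: assumes "0 < Im w"
 shows "(G \<kappa> has_field_derivative deriv (D \<kappa>) w / D \<kappa> w) (at w)"
proof -
 have "(D \<kappa> has_field_derivative deriv (D \<kappa>) w) (at w)"
  using D_derivative[OF upper_\<Omega>[OF assms], of \<kappa>] DERIV_imp_deriv by metis
 from DERIV_chain2[where f=Ln and g="D \<kappa>", OF has_field_derivative_Ln[OF D_slit[OF assms]] this]
 show ?thesis by (simp add: G_def[abs_def] field_simps)
qed

text \<open>The modulus of ln |D| is at most |ln m| + |D|, where m \<le> 1 bounds |D| from below for
  Im w \<ge> \<delta>: by compactness on a bounded part, and by the growth of \<open>D\<close>
  outside it.\<close>

lemma G_growth:
 assumes "0 < \<delta>"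
 shows "\<exists>A\<ge>0. \<forall>w. \<delta> \<le> Im w \<longrightarrow> cmod (G \<kappa> w) \<le> A + C * cmod w powr \<nu>"
proof -
 \<comment> \<open>Beyond this radius C |w|^\<nu> exceeds |\<kappa>| + 1, so that |D| \<ge>
   1.\<close>
 obtain t0 where t0: "t0 > 0" "\<And>t. t \<ge> t0 \<Longrightarrow> 0 < - (\<bar>\<kappa>\<bar> + 1) + C * t powr \<nu>"
  using large_t[of "- (\<bar>\<kappa>\<bar> + 1)"] by blast
 define K where "K = {w. \<delta> \<le> Im w} \<inter> cball 0 t0"
 have "compact K" unfolding K_def by (intro closed_Int_compact closed_halfspace_Im_ge compact_cball)
 moreover have "continuous_on K (\<lambda>w. cmod (D \<kappa> w))"
 proof (intro continuous_on_norm continuous_at_imp_continuous_on ballI)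
  fix w assume "w \<in> K"
  then have "0 < Im w" using assms by (auto simp: K_def)
  then show "isCont (D \<kappa>) w" using DERIV_isCont[OF D_derivative[OF upper_\<Omega>]] by blast
 qed
 moreover have pos: "0 < cmod (D \<kappa> w)" if "\<delta> \<le> Im w" for w
  using D_nonreal[of w \<kappa>] that assms by simp
 ultimately have "\<exists>m>0. \<forall>w\<in>K. m \<le> cmod (D \<kappa> w)"
 proof (cases "K = {}")
  case True then show ?thesis by (intro exI[of _ 1]) auto
 next
  case False
  then obtain w0 where w0: "w0 \<in> K" and least: "\<forall>w\<in>K. cmod (D \<kappa> w0) \<le> cmod (D \<kappa> w)"
   using continuous_attains_inf[OF \<open>compact K\<close> _ \<open>continuous_on K _\<close>] by blast
  have "0 < cmod (D \<kappa> w0)" using w0 by (intro pos) (simp add: K_def)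
  with least show ?thesis by (intro exI[of _ "cmod (D \<kappa> w0)"] conjI)
 qed
 then obtain m0 where m0: "m0 > 0" "\<And>w. w \<in> K \<Longrightarrow> m0 \<le> cmod (D \<kappa> w)" by blast
 define m where "m = min m0 1"
 have m: "0 < m" "m \<le> 1" using m0 by (auto simp: m_def)
 have mD: "m \<le> cmod (D \<kappa> w)" if w: "\<delta> \<le> Im w" for w
 proof (cases "cmod w \<le> t0")
  case True
  then have "w \<in> K" using w by (simp add: K_def)
  then show ?thesis using m0(2)[of w] by (simp add: m_def)
 next
  case False
  then have "1 \<le> cmod (D \<kappa> w)" using t0(2)[of "cmod w"] cmod_D_ge[of w \<kappa>] upper_\<Omega>[of w] w assms by linarith
  then show ?thesis using m by linarith
 qed
 show ?thesis
 proof (intro exI[of _ "\<bar>ln m\<bar> + \<bar>\<kappa>\<bar> + pi"] conjI allI impI)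
  fix w assume w: "\<delta> \<le> Im w"
  let ?d = "D \<kappa> w"
  have dp: "0 < cmod ?d" by (rule pos[OF w])
  then have nz: "?d \<noteq> 0" by auto
  have "\<bar>ln (cmod ?d)\<bar> \<le> \<bar>ln m\<bar> + cmod ?d"
  proof (cases "1 \<le> cmod ?d")
   case True
   then have "0 \<le> ln (cmod ?d)" by simp
   moreover have "ln (cmod ?d) \<le> cmod ?d" using ln_le_minus_one[OF dp] by linarith
   ultimately show ?thesis by linarith
  next
   case False
   have "ln m \<le> ln (cmod ?d)" using m mD[OF w] dp by simp
   moreover have "ln (cmod ?d) \<le> 0" using False dp by simp
   ultimately show ?thesis using dp by linarith
  qed
  moreover have "cmod (G \<kappa> w) \<le> \<bar>ln (cmod ?d)\<bar> + pi"
  proof -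
   have "\<bar>Im (Ln ?d)\<bar> \<le> pi" using mpi_less_Im_Ln[OF nz] Im_Ln_le_pi[OF nz] by linarith
   then show ?thesis using cmod_le[of "Ln ?d"] nz by (simp add: G_def Re_Ln)
  qed
  moreover have "cmod ?d \<le> \<bar>\<kappa>\<bar> + C * cmod w powr \<nu>" using w assms by (intro cmod_D_le upper_\<Omega>) simp
  ultimately show "cmod (G \<kappa> w) \<le> \<bar>ln m\<bar> + \<bar>\<kappa>\<bar> + pi + C * cmod w powr \<nu>" by linarith
 qed simp
qed

text \<open>For x > 0 the limit of \<open>D\<close> at x + i0 is \<open>Rp\<close> - i
  \<open>Ip\<close>.\<close>

definition Rp :: "real \<Rightarrow> real \<Rightarrow> real" where "Rp \<kappa> x = \<kappa> + C * x powr \<nu> * cos (\<nu> * pi)"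
definition Ip :: "real \<Rightarrow> real" where "Ip x = C * x powr \<nu> * sin (\<nu> * pi)"

text \<open>Almost everywhere the limit of the argument of \<open>D\<close> from above the real
  axis. On the negative axis, where \<kappa> + C |x|^\<nu> is negative, the value is -\<pi> rather
  than \<pi>, because \<open>D\<close> reaches the cut of the logarithm from below.\<close>

definition v :: "real \<Rightarrow> real \<Rightarrow> real" where
 "v \<kappa> x = (if x > 0 then
    (if Rp \<kappa> x > 0 then - arctan (Ip x / Rp \<kappa> x) else if Rp \<kappa> x < 0 then - arctan (Ip x / Rp \<kappa> x) - pi else - pi / 2)
   else if \<kappa> + C * \<bar>x\<bar> powr \<nu> < 0 then - pi else 0)"

lemma Ip_pos: "0 < x \<Longrightarrow> 0 < Ip x"
 unfolding Ip_def using C nu by (intro mult_pos_pos sin_gt_zero) auto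

lemma v_measurable: "v \<kappa> \<in> borel_measurable borel"
proof -
 have [measurable]: "(\<lambda>x. arctan (Ip x / Rp \<kappa> x)) \<in> borel_measurable borel"
  by (intro borel_measurable_continuous_on[OF continuous_on_arctan[OF continuous_on_id]]) (simp add: Ip_def Rp_def)
 have [measurable]: "Rp \<kappa> \<in> borel_measurable borel" unfolding Rp_def by measurable
 show ?thesis unfolding v_def by measurable
qed

lemma v_bound: "\<bar>v \<kappa> x\<bar> \<le> pi"
proof -
 have "0 < Ip x / Rp \<kappa> x" if "0 < x" "Rp \<kappa> x > 0" using Ip_pos[OF that(1)] that(2) by simp
 then have 1: "0 < arctan (Ip x / Rp \<kappa> x)" if "0 < x" "Rp \<kappa> x > 0" using that by simp
 have "Ip x / Rp \<kappa> x < 0" if "0 < x" "Rp \<kappa> x < 0" using Ip_pos[OF that(1)] that(2) by (simp add: divide_pos_neg)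
 then have 2: "arctan (Ip x / Rp \<kappa> x) < 0" if "0 < x" "Rp \<kappa> x < 0" using that by simp
 show ?thesis
  using 1 2 arctan_bounded[of "Ip x / Rp \<kappa> x"] pi_gt_zero unfolding v_def by (auto split: if_splits)
qed

lemma D_boundary_limit:
 assumes "x \<noteq> 0"
 shows "(\<lambda>n. D \<kappa> (Complex x (1 / (real n + 1)))) \<longlonglongrightarrow>
  (if x > 0 then Complex (Rp \<kappa> x) (- Ip x) else of_real (\<kappa> + C * \<bar>x\<bar> powr \<nu>))"
proof -
 define w where "w n = Complex x (1 / (real n + 1))" for n
 have wlim: "w \<longlonglongrightarrow> of_real x"
 proof -
  have "(\<lambda>n. 1 / (real n + 1)) \<longlonglongrightarrow> 0" using LIMSEQ_inverse_real_of_nat by (simp add: inverse_eq_divide add.commute)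
  then have "(\<lambda>n. complex_of_real x + \<i> * of_real (1 / (real n + 1))) \<longlonglongrightarrow> of_real x + \<i> * of_real 0" by (intro tendsto_intros)
  then show ?thesis by (simp add: w_def[abs_def] Complex_eq)
 qed
 show ?thesis
 proof (cases "x > 0")
  case True
  have wnz: "w n \<noteq> 0" for n using True by (simp add: w_def complex_eq_iff)
  have "D \<kappa> (w n) = of_real \<kappa> + of_real C * (w n powr of_real \<nu> * cis (- (\<nu> * pi)))" for n
  proof -
   \<comment> \<open>In the upper half-plane passing from w to -w lowers the argument by \<pi>; this
     is the origin of the factor exp(-i \<nu> \<pi>).\<close>
   have "Ln (- w n) = Ln (w n) - \<i> * of_real pi" using Ln_minus[OF wnz[of n]] by (simp add: w_def)
   then have "(- w n) powr of_real \<nu> = exp (of_real \<nu> * Ln (w n) - of_real \<nu> * (\<i> * of_real pi))"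
    unfolding powr_def using wnz[of n] by (simp only: if_False neg_equal_0_iff_equal right_diff_distrib)
   also have "\<dots> = w n powr of_real \<nu> * cis (- (\<nu> * pi))"
    using wnz[of n] by (simp add: powr_def exp_diff cis_conv_exp exp_minus field_simps)
   finally show ?thesis by (simp add: D_def)
  qed
  moreover have "(\<lambda>n. of_real \<kappa> + of_real C * (w n powr of_real \<nu> * cis (- (\<nu> * pi)))) \<longlonglongrightarrow>
    of_real \<kappa> + of_real C * (of_real x powr of_real \<nu> * cis (- (\<nu> * pi)))"
   using True by (intro tendsto_intros wlim) (auto simp: complex_nonpos_Reals_iff)
  moreover have "of_real \<kappa> + of_real C * (of_real x powr of_real \<nu> * cis (- (\<nu> * pi))) = Complex (Rp \<kappa> x) (- Ip x)"
   using powr_of_real[of x \<nu>] True by (simp add: complex_eq_iff Rp_def Ip_def)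
  ultimately show ?thesis using True by (simp add: w_def)
 next
  case False
  then have x: "x < 0" using assms by simp
  have "(\<lambda>n. of_real \<kappa> + of_real C * ((- w n) powr of_real \<nu>)) \<longlonglongrightarrow> of_real \<kappa> + of_real C * ((- of_real x) powr of_real \<nu>)"
   using x by (intro tendsto_intros wlim) (auto simp: complex_nonpos_Reals_iff)
  moreover have "(- of_real x) powr of_real \<nu> = complex_of_real (\<bar>x\<bar> powr \<nu>)"
   using powr_of_real[of "- x" \<nu>] x by simp
  ultimately show ?thesis using False by (simp add: w_def D_def)
 qed
qed

lemma G_boundary_limit:
 assumes x: "x \<noteq> 0" and ne: "x < 0 \<Longrightarrow> \<kappa> + C * \<bar>x\<bar> powr \<nu> \<noteq> 0"
 shows "(\<lambda>n. Im (G \<kappa> (Complex x (1 / (real n + 1))))) \<longlonglongrightarrow> v \<kappa> x"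
proof -
 define d where "d n = D \<kappa> (Complex x (1 / (real n + 1)))" for n
 have dI: "Im (d n) < 0" for n unfolding d_def by (rule Im_D) simp
 note lim = D_boundary_limit[OF x, of \<kappa>, folded d_def]
 show ?thesis
 proof (cases "x > 0")
  case True
  have l: "d \<longlonglongrightarrow> Complex (Rp \<kappa> x) (- Ip x)" using lim True by (simp add: d_def[abs_def])
  have nz: "Complex (Rp \<kappa> x) (- Ip x) \<notin> \<real>\<^sub>\<le>\<^sub>0" using Ip_pos[OF True] by (simp add: complex_nonpos_Reals_iff)
  then have nz': "Complex (Rp \<kappa> x) (- Ip x) \<noteq> 0" by auto
  have "(\<lambda>n. Im (Ln (d n))) \<longlonglongrightarrow> Im (Ln (Complex (Rp \<kappa> x) (- Ip x)))"
   using nz by (intro tendsto_intros l)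
  moreover have "Im (Ln (Complex (Rp \<kappa> x) (- Ip x))) = v \<kappa> x"
   using Im_Ln_eq[OF nz'] Ip_pos[OF True] True by (auto simp: v_def arctan_minus)
  ultimately show ?thesis by (simp add: G_def d_def)
 next
  case False
  define r where "r = \<kappa> + C * \<bar>x\<bar> powr \<nu>"
  have l: "d \<longlonglongrightarrow> of_real r" using lim False by (simp add: d_def[abs_def] r_def)
  have r: "r \<noteq> 0" using ne False x by (auto simp: r_def)
  show ?thesis
  proof (cases "r < 0")
   case True
   \<comment> \<open>The limit \<open>r\<close> lies on the cut of \<open>Ln\<close>. As
     \<open>d n\<close> lies in the lower half-plane, reflecting it moves the limit to the positive
     axis at the cost of \<pi>.\<close>
   have "Ln (d n) = Ln (- d n) - \<i> * of_real pi" for n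

   proof -
    have "d n \<noteq> 0" using dI[of n] by auto
    from Ln_minus[OF this] show ?thesis using dI[of n] by simp
   qed
   then have "Im (Ln (d n)) = Im (Ln (- d n)) - pi" for n by simp
   moreover have "(\<lambda>n. Im (Ln (- d n)) - pi) \<longlonglongrightarrow> Im (Ln (- of_real r)) - pi"
    using True by (intro tendsto_intros l) (auto simp: complex_nonpos_Reals_iff)
   moreover have "Im (Ln (- of_real r)) = 0" using Im_Ln_eq_0[of "- of_real r"] True by simp
   ultimately show ?thesis using False True by (simp add: G_def d_def v_def r_def)
  next
   case nneg: False
   then have "r > 0" using r by simp
   then have "(\<lambda>n. Im (Ln (d n))) \<longlonglongrightarrow> Im (Ln (of_real r))"
    by (intro tendsto_intros l) (auto simp: complex_nonpos_Reals_iff)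
   moreover have "Im (Ln (of_real r)) = 0" using Im_Ln_eq_0[of "of_real r"] \<open>r > 0\<close> by simp
   ultimately show ?thesis using False nneg by (simp add: G_def d_def v_def r_def)
  qed
 qed
qed

lemma v_integral_upper:
 assumes z: "0 < Im z"
 shows "(LINT x|lborel. complex_of_real (v \<kappa> x) / (of_real x - z)\<^sup>2) = of_real pi * (deriv (D \<kappa>) z / D \<kappa> z)"
proof -
 have "(LINT x|lborel. complex_of_real (v \<kappa> x) / (of_real x - z)\<^sup>2) = of_real pi * deriv (G \<kappa>) z"
 proof (rule half_plane_boundary_formula[OF _ nu less_imp_le[OF C] _ G_growth _ v_measurable z, where B=pi])
  show "G \<kappa> holomorphic_on {w. 0 < Im w}"
   unfolding holomorphic_on_open[OF open_halfspace_Im_gt] using G_derivative by blast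
  show "\<bar>Im (G \<kappa> w)\<bar> \<le> pi" if "0 < Im w" for w
  proof -
   have nz: "D \<kappa> w \<noteq> 0" using D_nonreal[of w \<kappa>] that by simp
   show ?thesis using mpi_less_Im_Ln[OF nz] Im_Ln_le_pi[OF nz] unfolding G_def by linarith
  qed
  \<comment> \<open>-t is the only candidate for a zero of \<open>D\<close> on the negative axis;
    the boundary limit is claimed away from this point and 0.\<close>
  define t where "t = (- \<kappa> / C) powr (1 / \<nu>)"
  have "AE x in lborel. x \<notin> {0, - t}" by (rule AE_not_in) (auto intro: finite_imp_null_set_lborel)
  then show "AE x in lborel. (\<lambda>n. Im (G \<kappa> (Complex x (1 / (real n + 1))))) \<longlonglongrightarrow> v \<kappa> x"
  proof eventually_elim
   case (elim x)
   have "\<kappa> + C * \<bar>x\<bar> powr \<nu> \<noteq> 0" if "x < 0"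
   proof
    assume "\<kappa> + C * \<bar>x\<bar> powr \<nu> = 0"
    then have "- \<kappa> / C = \<bar>x\<bar> powr \<nu>" using C by (simp add: field_simps eq_neg_iff_add_eq_0)
    then have "t = \<bar>x\<bar>" using nu that by (simp add: t_def powr_powr)
    then show False using elim that by simp
   qed
   then show ?case using elim by (intro G_boundary_limit) auto
  qed
 qed
 then show ?thesis using DERIV_imp_deriv[OF G_derivative[OF z, of \<kappa>]] by simp
qed

definition \<xi> :: "real \<Rightarrow> real \<Rightarrow> real" where "\<xi> \<kappa> x = v \<kappa> x / pi"

lemma \<xi>_measurable: "\<xi> \<kappa> \<in> borel_measurable borel" unfolding \<xi>_def using v_measurable by measurable

lemma \<xi>_bound: "\<bar>\<xi> \<kappa> x\<bar> \<le> 1" using v_bound[of \<kappa> x] by (simp add: \<xi>_def abs_divide)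

lemma \<xi>_integral:
 assumes z: "Im z \<noteq> 0"
 shows "(LINT x|lborel. complex_of_real (\<xi> \<kappa> x) / (of_real x - z)\<^sup>2) = deriv (D \<kappa>) z / D \<kappa> z"
proof -
 have up: "(LINT x|lborel. complex_of_real (\<xi> \<kappa> x) / (of_real x - z)\<^sup>2) = deriv (D \<kappa>) z / D \<kappa> z" if "0 < Im z" for z
 proof -
  have "(LINT x|lborel. complex_of_real (\<xi> \<kappa> x) / (of_real x - z)\<^sup>2)
    = (LINT x|lborel. (1 / of_real pi) * (complex_of_real (v \<kappa> x) / (of_real x - z)\<^sup>2))"
   by (intro Bochner_Integration.integral_cong) (auto simp: \<xi>_def)
  also have "\<dots> = (1 / of_real pi) * (LINT x|lborel. complex_of_real (v \<kappa> x) / (of_real x - z)\<^sup>2)"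
   by (rule integral_mult_right_zero)
  finally show ?thesis unfolding v_integral_upper[OF that] by simp
 qed
 show ?thesis
 proof (cases "0 < Im z")
  case True then show ?thesis by (rule up)
 next
  case False
  then have z': "0 < Im (cnj z)" using z by simp
  have zO: "z \<in> \<Omega>" using z by (simp add: \<Omega>_def)
  have "(LINT x|lborel. complex_of_real (\<xi> \<kappa> x) / (of_real x - z)\<^sup>2)
   = (LINT x|lborel. cnj (complex_of_real (\<xi> \<kappa> x) / (of_real x - cnj z)\<^sup>2))"
   by (intro Bochner_Integration.integral_cong) auto
  also have "\<dots> = cnj (LINT x|lborel. complex_of_real (\<xi> \<kappa> x) / (of_real x - cnj z)\<^sup>2)"
   by (rule Bochner_Integration.integral_cnj)
  also have "\<dots> = deriv (D \<kappa>) z / D \<kappa> z"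
   unfolding up[OF z'] using deriv_D_cnj[OF zO, of \<kappa>] D_cnj[OF zO, of \<kappa>] by simp
  finally show ?thesis .
 qed
qed

text \<open>As 0 is in the spectrum, x < 0. A nonzero value at \<open>x\<close> means that
  \<open>D\<close> is negative there. Since \<open>D\<close> increases as its argument moves left,
  it has a zero below \<open>x\<close>, which is an eigenvalue and contradicts the choice of
  \<open>x\<close>.\<close>

lemma \<xi>_vanishes_below:
 assumes "x < Inf (joint_spectrum \<kappa>)" shows "\<xi> \<kappa> x = 0"
proof -
 have low: "Inf (joint_spectrum \<kappa>) \<le> \<mu>" if "\<mu> \<in> joint_spectrum \<kappa>" for \<mu> by (rule cInf_lower[OF that joint_spectrum_bdd_below])
 have x0: "x < 0" using assms low[OF zero_in_spectrum] by linarith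
 have "\<not> \<kappa> + C * \<bar>x\<bar> powr \<nu> < 0"
 proof
  assume neg: "\<kappa> + C * \<bar>x\<bar> powr \<nu> < 0"
  define t where "t = (- \<kappa> / C) powr (1 / \<nu>)"
  have "\<bar>x\<bar> powr \<nu> < - \<kappa> / C" using neg C by (simp add: field_simps)
  then have "(\<bar>x\<bar> powr \<nu>) powr (1 / \<nu>) < t" unfolding t_def using nu by (intro powr_less_mono2) auto
  then have "\<bar>x\<bar> < t" using nu x0 by (simp add: powr_powr)
  moreover have "0 < - \<kappa> / C" using \<open>\<bar>x\<bar> powr \<nu> < - \<kappa> / C\<close> by (metis le_less_trans powr_ge_zero)
  then have "t powr \<nu> = - \<kappa> / C" unfolding t_def
  proof -
   have "(r powr (1 / \<nu>)) powr \<nu> = r" if "0 < r" for r using that nu by (simp add: powr_powr)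
   then show "0 < - \<kappa> / C \<Longrightarrow> ((- \<kappa> / C) powr (1 / \<nu>)) powr \<nu> = - \<kappa> / C" .
  qed
  then have "\<kappa> + C * t powr \<nu> = 0" using C by (simp only:) (simp add: field_simps)
  moreover have "t > 0" using \<open>\<bar>x\<bar> < t\<close> by linarith
  ultimately have "Inf (joint_spectrum \<kappa>) \<le> - t" using low eigenvalue_in_spectrum(1) by blast
  then show False using assms x0 \<open>\<bar>x\<bar> < t\<close> by linarith
 qed
 then show ?thesis using x0 by (simp add: \<xi>_def v_def)
qed

lemma weight_density:
 fixes f :: "real \<Rightarrow> real"
 shows "integrable (density lborel (\<lambda>x. ennreal (1 / (1 + x\<^sup>2)))) f \<longleftrightarrow>
  f \<in> borel_measurable borel \<and> integrable lborel (\<lambda>x. f x / (1 + x\<^sup>2))"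
proof -
 have pos: "0 \<le> 1 / (1 + x\<^sup>2)" for x :: real by (simp add: add_pos_nonneg less_imp_le)
 have "integrable (density lborel (\<lambda>x. ennreal (1 / (1 + x\<^sup>2)))) f \<longleftrightarrow> integrable lborel (\<lambda>x. (1 / (1 + x\<^sup>2)) *\<^sub>R f x)"
  if "f \<in> borel_measurable borel" using that pos by (intro integrable_density) auto
 moreover have "f \<in> borel_measurable borel" if "integrable (density lborel (\<lambda>x. ennreal (1 / (1 + x\<^sup>2)))) f"
  using borel_measurable_integrable[OF that] by simp
 ultimately show ?thesis by auto
qed

lemma \<xi>_weight: "integrable lborel (\<lambda>x. \<xi> \<kappa> x / (1 + x\<^sup>2))"
proof (rule Bochner_Integration.integrable_bound[OF integrable_inverse_one_plus_square])
 show "AE x in lborel. norm (\<xi> \<kappa> x / (1 + x\<^sup>2)) \<le> norm (1 / (1 + x\<^sup>2))"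
  using \<xi>_bound by (auto simp: abs_divide intro!: divide_right_mono)
qed (use \<xi>_measurable in measurable)

lemma is_spectral_shift_\<xi>: "is_spectral_shift (Tk \<kappa>) T0 (\<xi> \<kappa>)"
 unfolding is_spectral_shift_def joint_spectrum_def[symmetric]
 using self_adjoint_Tk self_adjoint_T0 bounded_from_below_Tk bounded_from_below_T0
  resolvent_difference_trace \<xi>_weight \<xi>_measurable \<xi>_vanishes_below
 by (auto simp: weight_density \<xi>_integral)

text \<open>\<open>spectral_shift\<close> is an arbitrary choice, so only the defining property is
  available for it. The difference with \<xi> has vanishing integrals against 1 / (x - z)^2 and
  vanishes to the left of the spectra, hence almost everywhere.\<close>

lemma spectral_shift_eq: "AE x in lborel. spectral_shift (Tk \<kappa>) T0 x = \<xi> \<kappa> x"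
proof -
 define h0 where "h0 = spectral_shift (Tk \<kappa>) T0"
 have h0: "is_spectral_shift (Tk \<kappa>) T0 h0"
  unfolding h0_def spectral_shift_def
  by (rule someI[where P="is_spectral_shift (Tk \<kappa>) T0", OF is_spectral_shift_\<xi>])
 have h0m: "h0 \<in> borel_measurable borel" and h0i: "integrable lborel (\<lambda>x. h0 x / (1 + x\<^sup>2))"
  using h0 by (auto simp: is_spectral_shift_def weight_density)
 have "AE x in lborel. h0 x - \<xi> \<kappa> x = 0"
 proof (rule Cauchy_square_uniqueness[where c="Inf (joint_spectrum \<kappa>)"])
  show "integrable lborel (\<lambda>x. (h0 x - \<xi> \<kappa> x) / (1 + x\<^sup>2))"
   unfolding diff_divide_distrib by (intro Bochner_Integration.integrable_diff h0i \<xi>_weight)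
  show "(\<lambda>x. h0 x - \<xi> \<kappa> x) \<in> borel_measurable borel" using h0m \<xi>_measurable by measurable
  have "AE x in lborel. x < Inf (joint_spectrum \<kappa>) \<longrightarrow> h0 x = 0"
   using h0 unfolding is_spectral_shift_def joint_spectrum_def by blast
  then show "AE x in lborel. x < Inf (joint_spectrum \<kappa>) \<longrightarrow> h0 x - \<xi> \<kappa> x = 0"
   by eventually_elim (simp add: \<xi>_vanishes_below)
  fix z :: complex assume z: "0 < Im z"
  have "(LINT x|lborel. complex_of_real (h0 x) / (of_real x - z)\<^sup>2) = (LINT x|lborel. complex_of_real (\<xi> \<kappa> x) / (of_real x - z)\<^sup>2)"
  proof -
   have tr: "op_trace (\<lambda>u. resolvent (Tk \<kappa>) z u - resolvent T0 z u) =
     - (LINT x|lborel. complex_of_real (h x) / (of_real x - z)\<^sup>2)"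
    if "is_spectral_shift (Tk \<kappa>) T0 h" "Im z \<noteq> 0" for h
    using that unfolding is_spectral_shift_def by (elim conjE) (drule spec[of _ z], drule (1) mp, assumption)+
   have "Im z \<noteq> 0" using z by simp
   then have "- (LINT x|lborel. complex_of_real (h0 x) / (of_real x - z)\<^sup>2) = - (LINT x|lborel. complex_of_real (\<xi> \<kappa> x) / (of_real x - z)\<^sup>2)"
    using tr[OF h0] tr[OF is_spectral_shift_\<xi>] by simp
   then show ?thesis by simp
  qed
  then show "(LINT x|lborel. complex_of_real (h0 x - \<xi> \<kappa> x) / (of_real x - z)\<^sup>2) = 0"
   using integrable_Cauchy_square[OF h0i h0m z] integrable_Cauchy_square[OF \<xi>_weight \<xi>_measurable z] by (simp add: diff_divide_distrib Bochner_Integration.integral_diff)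
 qed
 then show ?thesis unfolding h0_def[symmetric] by eventually_elim simp
qed

end

section \<open>The maximal operator\<close>

lemma tendsto_integral_at_right:
 fixes k :: "real \<Rightarrow> 'b::euclidean_space"
 assumes k: "k absolutely_integrable_on {0<..1}"
 shows "((\<lambda>a. integral {a..1} k) \<longlongrightarrow> integral {0<..1} k) (at_right 0)"
proof -
 have "((\<lambda>a. set_lebesgue_integral lebesgue {a..1} k) \<longlongrightarrow> set_lebesgue_integral lebesgue {0<..1} k) (at_right 0)"
  by (rule tendsto_set_lebesgue_integral_at_right) (use k in auto)
 moreover have "\<forall>\<^sub>F a in at_right 0. set_lebesgue_integral lebesgue {a..1} k = integral {a..1} k"
  using eventually_at_right_less[of 0]
 proof eventually_elim
  case (elim a)
  have "k absolutely_integrable_on {a..1}" by (rule set_integrable_subset[OF k]) (use elim in auto)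
  then show ?case by (rule set_lebesgue_integral_eq_integral(2))
 qed
 ultimately show ?thesis unfolding set_lebesgue_integral_eq_integral(2)[OF k] by (rule Lim_transform_eventually)
qed

lemma tendsto_integral_at_top:
 fixes k :: "real \<Rightarrow> 'b::euclidean_space"
 assumes k: "k absolutely_integrable_on {1..}"
 shows "((\<lambda>b. integral {1..b} k) \<longlongrightarrow> integral {1..} k) at_top"
proof -
 have "((\<lambda>b. set_lebesgue_integral lebesgue {1..b} k) \<longlongrightarrow> set_lebesgue_integral lebesgue {1..} k) at_top"
  by (rule tendsto_set_lebesgue_integral_at_top) (use k in auto)
 moreover have "set_lebesgue_integral lebesgue {1..b} k = integral {1..b} k" for b
  by (rule set_lebesgue_integral_eq_integral(2)) (rule set_integrable_subset[OF k], auto)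
 ultimately show ?thesis by (simp add: set_lebesgue_integral_eq_integral(2)[OF k])
qed

lemma half_line_integral_split:
 fixes k :: "real \<Rightarrow> 'b::euclidean_space"
 assumes k: "k absolutely_integrable_on {0<..}"
 shows "k absolutely_integrable_on {0<..1}" "k absolutely_integrable_on {1..}"
  "integral {0<..} k = integral {0<..1} k + integral {1..} k"
proof -
 have s: "{0<..1} \<subseteq> {0::real<..}" "{1..} \<subseteq> {0::real<..}" by auto
 show *: "k absolutely_integrable_on {0<..1}" "k absolutely_integrable_on {1..}"
  by (rule set_integrable_subset[OF k _ s(1)] set_integrable_subset[OF k _ s(2)], simp)+
 have "integral ({0<..1} \<union> {1..}) k = integral {0<..1} k + integral {1..} k"
 proof (rule Henstock_Kurzweil_Integration.integral_Un)
  show "k integrable_on {0<..1}" "k integrable_on {1..}"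
   using * by (auto simp: absolutely_integrable_on_def)
  show "negligible ({0<..1} \<inter> {1..} :: real set)" by (rule negligible_subset[of "{1}"]) auto
 qed
 moreover have "{0<..1} \<union> {1..} = {0 :: real<..}" by auto
 ultimately show "integral {0<..} k = integral {0<..1} k + integral {1..} k" by simp
qed

text \<open>The integrals over [a, 1] and [1, b] converge, so the primitive \<open>h\<close> has
  limits at both ends. Integration by parts on the half-line is thereby reduced to identifying these
  limits.\<close>

lemma half_line_limits:
 fixes h k :: "real \<Rightarrow> 'b::euclidean_space"
 assumes k: "k absolutely_integrable_on {0<..}"
  and h: "\<And>a b. 0 < a \<Longrightarrow> a \<le> b \<Longrightarrow> (k has_integral h b - h a) {a..b}"
 obtains l0 l1 where "(h \<longlongrightarrow> l0) (at_right 0)" "(h \<longlongrightarrow> l1) at_top" "integral {0<..} k = l1 - l0"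
proof -
 note ks = half_line_integral_split[OF k]
 have Iab: "integral {a..b} k = h b - h a" if "0 < a" "a \<le> b" for a b
  by (rule integral_unique[OF h[OF that]])
 have "((\<lambda>a. h 1 - integral {a..1} k) \<longlongrightarrow> h 1 - integral {0<..1} k) (at_right 0)"
  by (intro tendsto_intros tendsto_integral_at_right ks)
 moreover have "\<forall>\<^sub>F a in at_right 0. h 1 - integral {a..1} k = h a"
  using eventually_at_right_less[of 0] eventually_at_right_real[OF zero_less_one]
  by eventually_elim (simp add: Iab)
 ultimately have l0: "(h \<longlongrightarrow> h 1 - integral {0<..1} k) (at_right 0)"
  by (rule Lim_transform_eventually)
 have "((\<lambda>b. h 1 + integral {1..b} k) \<longlongrightarrow> h 1 + integral {1..} k) at_top"
  by (intro tendsto_intros tendsto_integral_at_top ks)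
 moreover have "\<forall>\<^sub>F b in at_top. h 1 + integral {1..b} k = h b"
  using eventually_ge_at_top[of 1] by eventually_elim (simp add: Iab)
 ultimately have l1: "(h \<longlongrightarrow> h 1 + integral {1..} k) at_top"
  by (rule Lim_transform_eventually)
 show thesis by (rule that[OF l0 l1]) (simp add: ks)
qed

lemma integrable_not_bounded_below:
 fixes F :: "real \<Rightarrow> real"
 assumes F: "F absolutely_integrable_on {a..}" and e: "0 < e" and c: "\<And>x. c \<le> x \<Longrightarrow> e \<le> F x"
 shows False
proof -
 define c' where "c' = max a c"
 define J where "J = integral {a..} (\<lambda>x. \<bar>F x\<bar>)"
 have Fi: "(\<lambda>x. \<bar>F x\<bar>) integrable_on {a..}" using F by (simp add: absolutely_integrable_on_def)
 have "e * (b - c') \<le> J" if "c' \<le> b" for b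
 proof -
  have i: "(\<lambda>x. \<bar>F x\<bar>) integrable_on {c'..b}"
   by (rule integrable_on_subinterval[OF Fi]) (simp add: c'_def subset_iff)
  have "e * (b - c') = integral {c'..b} (\<lambda>x. e)" using that by simp
  also have "\<dots> \<le> integral {c'..b} (\<lambda>x. \<bar>F x\<bar>)"
   by (rule integral_le) (use i c in \<open>force simp: c'_def\<close>)+
  also have "\<dots> \<le> J" unfolding J_def by (rule integral_subset_le) (use i Fi in \<open>auto simp: c'_def\<close>)
  finally show ?thesis .
 qed
 from this[of "c' + (\<bar>J\<bar> + 1) / e"] e have "\<bar>J\<bar> + 1 \<le> J" by simp
 then show False by simp
qed

lemma integrable_limit_zero:
 fixes h :: "real \<Rightarrow> 'b::euclidean_space"
 assumes h: "h absolutely_integrable_on {a..}" and l: "(h \<longlongrightarrow> l) at_top"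
 shows "l = 0"
proof (rule ccontr)
 assume "l \<noteq> 0"
 then have "\<forall>\<^sub>F x in at_top. norm l / 2 < norm (h x)"
  using order_tendstoD(1)[OF tendsto_norm[OF l], of "norm l / 2"] by simp
 then obtain c where "\<And>x. c \<le> x \<Longrightarrow> norm l / 2 < norm (h x)" by (auto simp: eventually_at_top_linorder)
 then show False
  using integrable_not_bounded_below[where F="\<lambda>x. norm (h x)" and a=a and e="norm l / 2" and c=c] set_integrable_norm[OF h] \<open>l \<noteq> 0\<close>
  by (auto simp: less_imp_le)
qed

lemma AC_loc_ae_FTC:
 assumes h: "h \<in> AC_loc" and N: "negligible N" "\<And>t. 0 < t \<Longrightarrow> t \<notin> N \<Longrightarrow> (h has_vector_derivative k t) (at t)"
  and ab: "0 < a" "a \<le> b"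
 shows "k absolutely_integrable_on {a..b}" "(k has_integral h b - h a) {a..b}"
proof -
 have e: "k t = fderiv h t" if "t \<in> {a..b} - N" for t using N(2)[of t] that ab vector_derivative_at by fastforce
 show "k absolutely_integrable_on {a..b}" by (rule absolutely_integrable_spike[OF AC_loc_FTC(1)[OF h ab] N(1) e])
 show "(k has_integral h b - h a) {a..b}" by (rule has_integral_spike[OF N(1) e AC_loc_FTC(2)[OF h ab]])
qed

lemma fderiv2_ae:
 assumes "f \<in> D_halfline"
 obtains N where "negligible N" "\<And>t. 0 < t \<Longrightarrow> t \<notin> N \<Longrightarrow>
  (fderiv f has_vector_derivative of_real ((\<nu>\<^sup>2 - 1 / 4) / t\<^sup>2) * f t - bessel_expr \<nu> f t) (at t)"
 using AC_loc_differentiable_ae[OF D_halflineD(2)[OF assms]] unfolding bessel_expr_def by auto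

text \<open>The potential is real and drops out of the derivative of the bracket.\<close>

lemma lagrange_bracket_FTC:
 assumes f: "f \<in> D_halfline" and g: "g \<in> D_halfline" and ab: "0 < a" "a \<le> b"
 shows "((\<lambda>x. bessel_expr \<nu> f x * cnj (g x) - f x * cnj (bessel_expr \<nu> g x)) has_integral
  lagrange_bracket f g b - lagrange_bracket f g a) {a..b}"
proof -
 obtain N1 where N1: "negligible N1" "\<And>t. 0 < t \<Longrightarrow> t \<notin> N1 \<Longrightarrow>
  (fderiv f has_vector_derivative of_real ((\<nu>\<^sup>2 - 1 / 4) / t\<^sup>2) * f t - bessel_expr \<nu> f t) (at t)" using fderiv2_ae[OF f, of \<nu>] by blast
 obtain N2 where N2: "negligible N2" "\<And>t. 0 < t \<Longrightarrow> t \<notin> N2 \<Longrightarrow>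
  (fderiv g has_vector_derivative of_real ((\<nu>\<^sup>2 - 1 / 4) / t\<^sup>2) * g t - bessel_expr \<nu> g t) (at t)" using fderiv2_ae[OF g, of \<nu>] by blast
 have AC: "lagrange_bracket f g \<in> AC_loc"
 proof -
  have "(\<lambda>x. f x * cnj (fderiv g x) + (-1) * (fderiv f x * cnj (g x))) \<in> AC_loc"
   using D_halflineD[OF f] D_halflineD[OF g] by (intro AC_loc_add AC_loc_cmult AC_loc_mult AC_loc_cnj)
  then show ?thesis by (simp add: lagrange_bracket_def[abs_def])
 qed
 show ?thesis
 proof (rule AC_loc_ae_FTC(2)[OF AC negligible_Un[OF N1(1) N2(1)] _ ab])
  fix t :: real assume t: "0 < t" "t \<notin> N1 \<union> N2"
  have "((\<lambda>x. f x * cnj (fderiv g x) - fderiv f x * cnj (g x)) has_vector_derivative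
    (f t * cnj (of_real ((\<nu>\<^sup>2 - 1 / 4) / t\<^sup>2) * g t - bessel_expr \<nu> g t) + fderiv f t * cnj (fderiv g t))
    - (fderiv f t * cnj (fderiv g t) + (of_real ((\<nu>\<^sup>2 - 1 / 4) / t\<^sup>2) * f t - bessel_expr \<nu> f t) * cnj (g t))) (at t)"
   using t by (intro has_vector_derivative_diff has_vector_derivative_mult has_vector_derivative_cnj N1 N2 D_halflineD(3)[OF f] D_halflineD(3)[OF g]) auto
  then show "(lagrange_bracket f g has_vector_derivative bessel_expr \<nu> f t * cnj (g t) - f t * cnj (bessel_expr \<nu> g t)) (at t)"
   by (simp add: lagrange_bracket_def[abs_def] algebra_simps)
 qed
qed

lemma dom_maxD:
 assumes "f \<in> dom_max \<nu>"
 shows "f \<in> D_halfline" "f \<in> sq_integrable" "bessel_expr \<nu> f \<in> sq_integrable"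
 using assms by (auto simp: dom_max_def)

lemma integral_halfline: "integrable halfline f \<Longrightarrow> integral\<^sup>L halfline f = integral {0<..} f"
 for f :: "real \<Rightarrow> 'b::euclidean_space"
 by (rule lebesgue_integral_eq_integral) auto

lemma absolutely_integrable_mult_cnj:
 assumes "f \<in> sq_integrable" "g \<in> sq_integrable"
 shows "(\<lambda>x. f x * cnj (g x)) absolutely_integrable_on {0<..}"
 using integrable_mult_cnj[OF assms] by (simp add: integrable_halfline_iff)

lemma cmod_mult_le: "cmod (a * b) \<le> (cmod a)\<^sup>2 + (cmod b)\<^sup>2"
proof -
 have "0 \<le> (cmod a - cmod b)\<^sup>2" "0 \<le> cmod a * cmod b" by auto
 then show ?thesis unfolding norm_mult power2_diff by linarith
qed

text \<open>Integrating the derivative of h = f' conj f bounds the integral of |f'|^2 over [1, R] by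
  Re h(R) + K. As 2 Re h is the derivative of the integrable function |f|^2, Re h is at most 1 at
  points arbitrarily far out, and monotonicity in R gives a bound for all R.\<close>

lemma fderiv_square_integrable:
 assumes f: "f \<in> dom_max \<nu>"
 shows "(\<lambda>x. (cmod (fderiv f x))\<^sup>2) absolutely_integrable_on {1..}"
proof -
 note D = dom_maxD[OF f] D_halflineD[OF dom_maxD(1)[OF f]]
 define h where "h x = fderiv f x * cnj (f x)" for x
 define g where "g x = of_real ((\<nu>\<^sup>2 - 1 / 4) / x\<^sup>2) * (f x * cnj (f x)) - bessel_expr \<nu> f x * cnj (f x)" for x
 define F where "F x = (cmod (fderiv f x))\<^sup>2" for x
 obtain N where N: "negligible N" "\<And>t. 0 < t \<Longrightarrow> t \<notin> N \<Longrightarrow>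
  (fderiv f has_vector_derivative of_real ((\<nu>\<^sup>2 - 1 / 4) / t\<^sup>2) * f t - bessel_expr \<nu> f t) (at t)" using fderiv2_ae[OF D(1), of \<nu>] by blast
 have hAC: "h \<in> AC_loc" unfolding h_def using D by (intro AC_loc_mult AC_loc_cnj)
 have hi: "((\<lambda>x. of_real (F x) + g x) has_integral h b - h a) {a..b}" if ab: "0 < a" "a \<le> b" for a b
 proof (rule AC_loc_ae_FTC(2)[OF hAC N(1) _ ab])
  fix t :: real assume t: "0 < t" "t \<notin> N"
  have "((\<lambda>x. fderiv f x * cnj (f x)) has_vector_derivative fderiv f t * cnj (fderiv f t)
    + (of_real ((\<nu>\<^sup>2 - 1 / 4) / t\<^sup>2) * f t - bessel_expr \<nu> f t) * cnj (f t)) (at t)"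
   using t by (intro has_vector_derivative_mult has_vector_derivative_cnj N D) auto
  moreover have "of_real (F t) = fderiv f t * cnj (fderiv f t)" unfolding F_def by (rule complex_norm_square)
  ultimately show "(h has_vector_derivative of_real (F t) + g t) (at t)"
   unfolding h_def[abs_def] g_def by (simp only: left_diff_distrib mult.assoc)
 qed
 have sub: "k absolutely_integrable_on {1..}" if "k absolutely_integrable_on {0<..}" for k :: "real \<Rightarrow> complex"
  by (rule set_integrable_subset[OF that]) auto
 have ff: "(\<lambda>x. f x * cnj (f x)) absolutely_integrable_on {1..}"
  by (rule sub[OF absolutely_integrable_mult_cnj[OF D(2,2)]])
 have gi: "g absolutely_integrable_on {1..}"
  unfolding g_def
 proof (rule set_integral_diff(1))
  show "(\<lambda>x. bessel_expr \<nu> f x * cnj (f x)) absolutely_integrable_on {1..}"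
   by (rule sub[OF absolutely_integrable_mult_cnj[OF D(3,2)]])
  show "(\<lambda>x. of_real ((\<nu>\<^sup>2 - 1 / 4) / x\<^sup>2) * (f x * cnj (f x))) absolutely_integrable_on {1..}"
  proof (rule measurable_bounded_by_integrable_imp_absolutely_integrable)
   have "continuous_on {1..} f" by (rule continuous_on_subset[OF D(7)]) auto
   then have "continuous_on {1..} (\<lambda>x. of_real ((\<nu>\<^sup>2 - 1 / 4) / x\<^sup>2) * (f x * cnj (f x)))"
    by (intro continuous_intros) auto
   then show "(\<lambda>x. of_real ((\<nu>\<^sup>2 - 1 / 4) / x\<^sup>2) * (f x * cnj (f x))) \<in> borel_measurable (lebesgue_on {1..})"
    by (rule continuous_imp_measurable_on_sets_lebesgue) auto
   show "(\<lambda>x. \<bar>\<nu>\<^sup>2 - 1 / 4\<bar> * norm (f x * cnj (f x))) integrable_on {1..}"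
    using ff unfolding absolutely_integrable_on_def by (intro integrable_on_mult_right) blast
   fix x :: real assume x: "x \<in> {1..}"
   then have "\<bar>\<nu>\<^sup>2 - 1 / 4\<bar> / x\<^sup>2 \<le> \<bar>\<nu>\<^sup>2 - 1 / 4\<bar> / 1" by (intro divide_left_mono) auto
   then show "norm (of_real ((\<nu>\<^sup>2 - 1 / 4) / x\<^sup>2) * (f x * cnj (f x))) \<le> \<bar>\<nu>\<^sup>2 - 1 / 4\<bar> * norm (f x * cnj (f x))"
    unfolding norm_mult[of "of_real _"] norm_of_real abs_divide by (intro mult_right_mono) auto
  qed auto
 qed
 define K where "K = cmod (h 1) + integral {1..} (\<lambda>x. cmod (g x))"
 have Fc: "continuous_on {1..} F"
  unfolding F_def by (intro continuous_intros continuous_on_subset[OF D(8)]) auto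
 have Fint: "F integrable_on {1..R}" for R
  by (rule integrable_continuous_interval) (rule continuous_on_subset[OF Fc], auto)
 have bound1: "integral {1..R} F \<le> Re (h R) + K" if R: "1 \<le> R" for R
 proof -
  have gR: "g absolutely_integrable_on {1..R}" by (rule set_integrable_subset[OF gi]) auto
  have "((\<lambda>x. of_real (F x) + g x) has_integral of_real (integral {1..R} F) + integral {1..R} g) {1..R}"
   using gR Fint[of R] by (intro has_integral_add has_integral_of_real integrable_integral) (auto simp: absolutely_integrable_on_def)
  then have "of_real (integral {1..R} F) + integral {1..R} g = h R - h 1"
   by (rule has_integral_unique[OF _ hi[OF zero_less_one R]])
  then have "integral {1..R} F = Re (h R) - Re (h 1) - Re (integral {1..R} g)" by (simp add: complex_eq_iff)
  moreover have "cmod (integral {1..R} g) \<le> integral {1..R} (\<lambda>x. cmod (g x))"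
   using gR by (intro integral_norm_bound_integral) (auto simp: absolutely_integrable_on_def)
  moreover have "integral {1..R} (\<lambda>x. cmod (g x)) \<le> integral {1..} (\<lambda>x. cmod (g x))"
   using gR gi by (intro integral_subset_le) (auto simp: absolutely_integrable_on_def)
  ultimately show ?thesis
   using abs_Re_le_cmod[of "h 1"] abs_Re_le_cmod[of "integral {1..R} g"] unfolding K_def by linarith
 qed
 have "\<exists>R\<ge>c. Re (h R) \<le> 1" for c
 proof (rule ccontr)
  assume "\<not> ?thesis"
  then have big: "1 < Re (h R)" if "c \<le> R" for R using that by force
  define m where "m x = (cmod (f x))\<^sup>2" for x
  define c' where "c' = max c 1"
  have md: "(m has_real_derivative 2 * Re (h x)) (at x)" if "0 < x" for x
  proof -
   have "((\<lambda>x. Re (f x * cnj (f x))) has_vector_derivative Re (f x * cnj (fderiv f x) + fderiv f x * cnj (f x))) (at x)"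
    using D(6)[OF that] by (intro bounded_linear.has_vector_derivative[OF bounded_linear_Re] has_vector_derivative_mult has_vector_derivative_cnj)
   then show ?thesis
    unfolding m_def[abs_def] cmod_power2 h_def has_real_derivative_iff_has_vector_derivative
    by (simp add: power2_eq_square mult.commute)
  qed
  have "1 \<le> m x" if x: "c' + 1 \<le> x" for x
  proof -
   have "\<exists>z>c'. z < x \<and> m x - m c' = (x - c') * (2 * Re (h z))"
    using x by (intro MVT2 md) (auto simp: c'_def)
   then obtain z where z: "c' < z" "m x - m c' = (x - c') * (2 * Re (h z))" by blast
   have "1 * 2 \<le> (x - c') * (2 * Re (h z))" using x big[of z] z(1) by (intro mult_mono) (auto simp: c'_def)
   moreover have "0 \<le> m c'" by (simp add: m_def)
   ultimately show ?thesis using z(2) by linarith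
  qed
  moreover have "m absolutely_integrable_on {1..}"
   using set_integrable_norm[OF ff] by (simp add: m_def[abs_def] norm_mult power2_eq_square)
  ultimately show False using integrable_not_bounded_below[where F=m and a=1 and e=1 and c="c' + 1"] by auto
 qed
 then have bound: "integral {1..R} F \<le> K + 1" for R
 proof -
  obtain R' where R': "max R 1 \<le> R'" "Re (h R') \<le> 1" using \<open>\<And>c. \<exists>R\<ge>c. Re (h R) \<le> 1\<close> by blast
  have "integral {1..R} F \<le> integral {1..R'} F" using R' Fint by (intro integral_subset_le) (auto simp: F_def)
  also have "\<dots> \<le> Re (h R') + K" using R' by (intro bound1) auto
  finally show ?thesis using R' by linarith
 qed
 have "F integrable_on {1..} \<and> (\<lambda>n. integral {1..} (\<lambda>x. if x \<in> {1..real n} then F x else 0)) \<longlonglongrightarrow> integral {1..} F"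
 proof (rule monotone_convergence_increasing)
  have e: "((\<lambda>x. if x \<in> {1..real n} then F x else 0) has_integral integral {1..real n} F) {1..}" for n
   using Fint[of "real n"] by (subst has_integral_restrict) (auto intro: integrable_integral)
  show "(\<lambda>x. if x \<in> {1..real n} then F x else 0) integrable_on {1..}" for n using e by blast
  have "0 \<le> integral {1..real n} F" for n using Fint by (intro integral_nonneg) (auto simp: F_def)
  then show "bounded (range (\<lambda>n. integral {1..} (\<lambda>x. if x \<in> {1..real n} then F x else 0)))"
   unfolding integral_unique[OF e] using bound by (intro boundedI[of _ "K + 1"]) auto
  show "(if x \<in> {1..real n} then F x else 0) \<le> (if x \<in> {1..real (Suc n)} then F x else 0)" for x n by (auto simp: F_def)
  fix x :: real assume "x \<in> {1..}"
  then have "\<forall>\<^sub>F n in sequentially. (if x \<in> {1..real n} then F x else 0) = F x"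
   using eventually_ge_at_top[of "nat \<lceil>x\<rceil>"] by (elim eventually_mono) (auto simp: nat_ceiling_le_eq)
  then show "(\<lambda>n. if x \<in> {1..real n} then F x else 0) \<longlonglongrightarrow> F x" by (rule tendsto_eventually)
 qed
 then show ?thesis unfolding F_def by (subst absolutely_integrable_on_iff_nonneg) auto
qed

lemma mult_fderiv_integrable:
 assumes f: "f \<in> dom_max \<nu>" and g: "g \<in> dom_max \<nu>"
 shows "(\<lambda>x. fderiv f x * cnj (g x)) absolutely_integrable_on {1..}"
proof (rule measurable_bounded_by_integrable_imp_absolutely_integrable)
 note Df = D_halflineD[OF dom_maxD(1)[OF f]] and Dg = D_halflineD[OF dom_maxD(1)[OF g]]
 have "continuous_on {1..} (\<lambda>x. fderiv f x * cnj (g x))"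
  by (intro continuous_intros continuous_on_subset[OF Df(5)] continuous_on_subset[OF Dg(4)]) auto
 then show "(\<lambda>x. fderiv f x * cnj (g x)) \<in> borel_measurable (lebesgue_on {1..})"
  by (rule continuous_imp_measurable_on_sets_lebesgue) auto
 have "(\<lambda>x. (cmod (g x))\<^sup>2) absolutely_integrable_on {1..}"
  by (rule set_integrable_subset[where A="{0<..}"]) (use sq_integrableD(2)[OF dom_maxD(2)[OF g]] in \<open>auto simp: integrable_halfline_iff\<close>)
 then show "(\<lambda>x. (cmod (fderiv f x))\<^sup>2 + (cmod (g x))\<^sup>2) integrable_on {1..}"
  using fderiv_square_integrable[OF f] by (intro integrable_add) (auto simp: absolutely_integrable_on_def)
 show "norm (fderiv f x * cnj (g x)) \<le> (cmod (fderiv f x))\<^sup>2 + (cmod (g x))\<^sup>2" for x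
  using cmod_mult_le[of "fderiv f x" "cnj (g x)"] by simp
qed auto

text \<open>The derivative of the bracket is integrable, so the bracket has limits at both ends.
  Near infinity it is itself integrable, because the functions and their derivatives are square
  integrable there, and so its limit at infinity must be 0.\<close>

lemma lagrange_identity:
 assumes f: "f \<in> dom_max \<nu>" and g: "g \<in> dom_max \<nu>"
 shows "(lagrange_bracket f g \<longlongrightarrow> lagrange_bracket_0 f g) (at_right 0)"
  "cinner (abs_L2 (bessel_expr \<nu> f)) (abs_L2 g) - cinner (abs_L2 f) (abs_L2 (bessel_expr \<nu> g)) = - lagrange_bracket_0 f g"
proof -
 note f' = dom_maxD[OF f] and g' = dom_maxD[OF g]
 let ?k = "\<lambda>x. bessel_expr \<nu> f x * cnj (g x) - f x * cnj (bessel_expr \<nu> g x)"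
 have k: "?k absolutely_integrable_on {0<..}"
  by (intro set_integral_diff(1) absolutely_integrable_mult_cnj f' g')
 obtain l0 l1 where l0: "(lagrange_bracket f g \<longlongrightarrow> l0) (at_right 0)" and l1: "(lagrange_bracket f g \<longlongrightarrow> l1) at_top"
  and i: "integral {0<..} ?k = l1 - l0"
  using half_line_limits[OF k lagrange_bracket_FTC[OF f'(1) g'(1)]] by blast
 have L: "lagrange_bracket_0 f g = l0" unfolding lagrange_bracket_0_def by (rule tendsto_Lim[OF _ l0]) simp
 then show "(lagrange_bracket f g \<longlongrightarrow> lagrange_bracket_0 f g) (at_right 0)" using l0 by simp
 have "(\<lambda>x. cnj (fderiv g x * cnj (f x))) absolutely_integrable_on {1..}"
  using absolutely_integrable_linear[OF mult_fderiv_integrable[OF g f] bounded_linear_cnj] by (simp add: o_def)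
 then have "(\<lambda>x. cnj (fderiv g x * cnj (f x)) - fderiv f x * cnj (g x)) absolutely_integrable_on {1..}"
  by (intro set_integral_diff(1) mult_fderiv_integrable[OF f g])
 then have "lagrange_bracket f g absolutely_integrable_on {1..}"
  by (simp add: lagrange_bracket_def[abs_def] mult.commute)
 from integrable_limit_zero[OF this l1] i have "integral {0<..} ?k = - l0" by simp
 moreover have "integral\<^sup>L halfline ?k = integral {0<..} ?k"
  by (rule integral_halfline) (use k in \<open>simp add: integrable_halfline_iff\<close>)
 ultimately show "cinner (abs_L2 (bessel_expr \<nu> f)) (abs_L2 g) - cinner (abs_L2 f) (abs_L2 (bessel_expr \<nu> g)) = - lagrange_bracket_0 f g"
  unfolding L cinner_abs_L2[OF f'(3) g'(2)] cinner_abs_L2[OF f'(2) g'(3)]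
  using Bochner_Integration.integral_diff[OF integrable_mult_cnj[OF f'(3) g'(2)] integrable_mult_cnj[OF f'(2) g'(3)]] by simp
qed

lemma sq_integrable_cong_ae:
 assumes f: "f \<in> sq_integrable" and N: "negligible N" and e: "\<And>t. 0 < t \<Longrightarrow> t \<notin> N \<Longrightarrow> g t = f t"
 shows "g \<in> sq_integrable" "abs_L2 g = abs_L2 f"
proof -
 have "AE x in lebesgue. x \<notin> N" by (rule AE_not_in) (use N in \<open>simp add: negligible_iff_null_sets\<close>)
 then have ae: "AE x in lebesgue. indicator {0<..} x *\<^sub>R f x = indicator {0<..} x *\<^sub>R g x"
  and ae': "AE x in halfline. f x = g x"
  by (auto simp: e AE_restrict_space_iff indicator_def elim!: eventually_mono)
 have "(\<lambda>x. indicator {0<..} x *\<^sub>R f x) \<in> borel_measurable lebesgue"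
  using sq_integrableD(1)[OF f] by (simp add: borel_measurable_restrict_space_iff)
 from borel_measurable_AE[OF this ae] have gm: "g \<in> borel_measurable halfline"
  by (simp add: borel_measurable_restrict_space_iff)
 have "integrable halfline (\<lambda>x. (cmod (g x))\<^sup>2)"
 proof (rule integrable_cong_AE_imp[OF sq_integrableD(2)[OF f]])
  show "(\<lambda>x. (cmod (g x))\<^sup>2) \<in> borel_measurable halfline" using gm by measurable
  show "AE x in halfline. (cmod (f x))\<^sup>2 = (cmod (g x))\<^sup>2" using ae' by eventually_elim simp
 qed
 with gm show g: "g \<in> sq_integrable" by (simp add: sq_integrable_def)
 show "abs_L2 g = abs_L2 f" unfolding abs_L2_eq_iff[OF g f] using ae' by eventually_elim simp
qed

text \<open>\<tau> f has to be known only off a null set, which determines its class.\<close>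

lemma dom_maxI:
 assumes d: "\<And>x. 0 < x \<Longrightarrow> (f has_vector_derivative f1 x) (at x)" and f1: "f1 \<in> AC_loc"
  and f: "f \<in> sq_integrable" and k: "k \<in> sq_integrable" and N: "negligible N"
  and d2: "\<And>t. 0 < t \<Longrightarrow> t \<notin> N \<Longrightarrow> (f1 has_vector_derivative of_real ((\<nu>\<^sup>2 - 1 / 4) / t\<^sup>2) * f t - k t) (at t)"
 shows "f \<in> dom_max \<nu>" "abs_L2 (bessel_expr \<nu> f) = abs_L2 k"
proof -
 have "bessel_expr \<nu> f t = k t" if "0 < t" "t \<notin> N" for t
  using vector_derivative_at[OF d2[OF that]] D_halflineI(3)[OF d f1 that(1)] by (simp add: bessel_expr_def)
 note s = sq_integrable_cong_ae[OF k N this]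
 show "abs_L2 (bessel_expr \<nu> f) = abs_L2 k" by (rule s(2))
 show "f \<in> dom_max \<nu>" unfolding dom_max_def using D_halflineI(1)[OF d f1] f s(1) by simp
qed

lemma lagrange_bracket_0I: "(lagrange_bracket f g \<longlongrightarrow> l) (at_right 0) \<Longrightarrow> lagrange_bracket_0 f g = l"
 unfolding lagrange_bracket_0_def by (rule tendsto_Lim) simp_all

lemma eventually_at_right_0: "(\<And>x. 0 < x \<Longrightarrow> x < 1 \<Longrightarrow> P x) \<Longrightarrow> \<forall>\<^sub>F x in at_right (0::real). P x"
 using eventually_at_right_real[OF zero_less_one] by (rule eventually_mono) auto

lemma dom_max_add_scaled:
 assumes f: "f \<in> dom_max \<nu>" and g: "g \<in> dom_max \<nu>" and h: "h \<in> dom_max \<nu>"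
 shows "(\<lambda>x. f x + c * g x) \<in> dom_max \<nu>"
  "abs_L2 (bessel_expr \<nu> (\<lambda>x. f x + c * g x)) = abs_L2 (bessel_expr \<nu> f) + c *\<^sub>C abs_L2 (bessel_expr \<nu> g)"
  "lagrange_bracket_0 (\<lambda>x. f x + c * g x) h = lagrange_bracket_0 f h + c * lagrange_bracket_0 g h"
proof -
 note Df = dom_maxD[OF f] D_halflineD[OF dom_maxD(1)[OF f]] and Dg = dom_maxD[OF g] D_halflineD[OF dom_maxD(1)[OF g]]
 obtain N1 where N1: "negligible N1" "\<And>t. 0 < t \<Longrightarrow> t \<notin> N1 \<Longrightarrow>
  (fderiv f has_vector_derivative of_real ((\<nu>\<^sup>2 - 1 / 4) / t\<^sup>2) * f t - bessel_expr \<nu> f t) (at t)" using fderiv2_ae[OF Df(1), of \<nu>] by blast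
 obtain N2 where N2: "negligible N2" "\<And>t. 0 < t \<Longrightarrow> t \<notin> N2 \<Longrightarrow>
  (fderiv g has_vector_derivative of_real ((\<nu>\<^sup>2 - 1 / 4) / t\<^sup>2) * g t - bessel_expr \<nu> g t) (at t)" using fderiv2_ae[OF Dg(1), of \<nu>] by blast
 have d: "((\<lambda>x. f x + c * g x) has_vector_derivative fderiv f x + c * fderiv g x) (at x)" if "0 < x" for x
  using Df(6)[OF that] Dg(6)[OF that] by (intro has_vector_derivative_add has_vector_derivative_mult_right)
 have d2: "((\<lambda>x. fderiv f x + c * fderiv g x) has_vector_derivative of_real ((\<nu>\<^sup>2 - 1 / 4) / t\<^sup>2) * (f t + c * g t) - (bessel_expr \<nu> f t + c * bessel_expr \<nu> g t)) (at t)"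
  if "0 < t" "t \<notin> N1 \<union> N2" for t
 proof -
  have t: "t \<notin> N1" "t \<notin> N2" using that by auto
  from has_vector_derivative_add[OF N1(2)[OF that(1) t(1)] has_vector_derivative_mult_right[OF N2(2)[OF that(1) t(2)], of c]]
  show ?thesis by (rule has_vector_derivative_eq_rhs) (simp only: ring_distribs add_diff_add mult.left_commute[of c])
 qed
 note cg = sq_integrable_scale[OF Dg(2), of c] sq_integrable_scale[OF Dg(3), of c]
 note I = dom_maxI[OF d AC_loc_add[OF Df(5) AC_loc_cmult[OF Dg(5)]] sq_integrable_add[OF Df(2) cg(1)] sq_integrable_add[OF Df(3) cg(2)]
   negligible_Un[OF N1(1) N2(1)] d2]
 show "(\<lambda>x. f x + c * g x) \<in> dom_max \<nu>" by (rule I(1))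
 show "abs_L2 (bessel_expr \<nu> (\<lambda>x. f x + c * g x)) = abs_L2 (bessel_expr \<nu> f) + c *\<^sub>C abs_L2 (bessel_expr \<nu> g)"
  unfolding scaleC_abs_L2[OF Dg(3)] plus_abs_L2[OF Df(3) cg(2)] by (rule I(2))
 have "((\<lambda>x. lagrange_bracket f h x + c * lagrange_bracket g h x) \<longlongrightarrow> lagrange_bracket_0 f h + c * lagrange_bracket_0 g h) (at_right 0)"
  by (intro tendsto_add tendsto_mult_left lagrange_identity(1)[OF f h] lagrange_identity(1)[OF g h])
 moreover have "\<forall>\<^sub>F x in at_right 0. lagrange_bracket f h x + c * lagrange_bracket g h x = lagrange_bracket (\<lambda>x. f x + c * g x) h x"
  by (rule eventually_at_right_0) (simp add: lagrange_bracket_def vector_derivative_at[OF d] algebra_simps)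
 ultimately show "lagrange_bracket_0 (\<lambda>x. f x + c * g x) h = lagrange_bracket_0 f h + c * lagrange_bracket_0 g h"
  by (intro lagrange_bracket_0I) (rule Lim_transform_eventually)
qed

section \<open>Behaviour at 0 of functions in the maximal domain\<close>

locale bessel_boundary =
 fixes \<nu> :: real and \<phi> \<psi> :: "real \<Rightarrow> complex"
 assumes nu: "0 < \<nu>" "\<nu> < 1" and boundary: "boundary_functions \<nu> \<phi> \<psi>"
begin

text \<open>The values of \<phi> on (0, 1), continued as a power to the whole half-line.\<close>

definition w :: "real \<Rightarrow> real" where "w x = x powr (1 / 2 + \<nu>)"

lemma phi: "\<phi> \<in> dom_max \<nu>" and psi: "\<psi> \<in> dom_max \<nu>"
 and phi_eq: "0 < x \<Longrightarrow> x < 1 \<Longrightarrow> \<phi> x = of_real (w x)"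
 and psi_eq: "0 < x \<Longrightarrow> x < 1 \<Longrightarrow> \<psi> x = of_real (1 / (2 * \<nu>) * x powr (1 / 2 - \<nu>))"
 using boundary by (auto simp: boundary_functions_def w_def)

lemma w_pos: "0 < x \<Longrightarrow> 0 < w x" by (simp add: w_def)
lemma w_mono: "0 < x \<Longrightarrow> x \<le> y \<Longrightarrow> w x \<le> w y" unfolding w_def using nu by (intro powr_mono2) auto

lemma powr_derivative:
 "0 < x \<Longrightarrow> ((\<lambda>x. complex_of_real (k * x powr a)) has_vector_derivative of_real (k * (a * x powr (a - 1)))) (at x)"
 by (intro has_vector_derivative_of_real)
  (auto intro!: derivative_eq_intros simp: has_real_derivative_iff_has_vector_derivative[symmetric])

lemma phi_derivative: "0 < x \<Longrightarrow> x < 1 \<Longrightarrow> (\<phi> has_vector_derivative of_real ((1 / 2 + \<nu>) / x * w x)) (at x)"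
 and psi_derivative: "0 < x \<Longrightarrow> x < 1 \<Longrightarrow> (\<psi> has_vector_derivative of_real (1 / (2 * \<nu>) * ((1 / 2 - \<nu>) * x powr (- 1 / 2 - \<nu>)))) (at x)"
proof -
 assume x: "0 < x" "x < 1"
 have "((\<lambda>x. complex_of_real (w x)) has_vector_derivative of_real ((1 / 2 + \<nu>) / x * w x)) (at x)"
 proof -
  have "(1 / 2 + \<nu>) / x * w x = 1 * ((1 / 2 + \<nu>) * x powr (1 / 2 + \<nu> - 1))"
   using x(1) by (simp only: powr_diff) (simp add: w_def)
  then show ?thesis using powr_derivative[OF x(1), of 1 "1 / 2 + \<nu>"] by (simp only: w_def[abs_def] mult_1)
 qed
 then show "(\<phi> has_vector_derivative of_real ((1 / 2 + \<nu>) / x * w x)) (at x)"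
  by (rule has_vector_derivative_transform_within_open[of _ _ _ "{0<..<1}"]) (use x phi_eq in auto)
 have "((\<lambda>x. complex_of_real (1 / (2 * \<nu>) * x powr (1 / 2 - \<nu>))) has_vector_derivative of_real (1 / (2 * \<nu>) * ((1 / 2 - \<nu>) * x powr (- 1 / 2 - \<nu>)))) (at x)"
  using powr_derivative[OF x(1), of "1 / (2 * \<nu>)" "1 / 2 - \<nu>"] by simp
 then show "(\<psi> has_vector_derivative of_real (1 / (2 * \<nu>) * ((1 / 2 - \<nu>) * x powr (- 1 / 2 - \<nu>)))) (at x)"
  by (rule has_vector_derivative_transform_within_open[of _ _ _ "{0<..<1}"]) (use x psi_eq in auto)
qed

lemma bessel_expr_phi: assumes "0 < x" "x < 1" shows "bessel_expr \<nu> \<phi> x = 0"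
proof -
 have "((\<lambda>x. complex_of_real ((1 / 2 + \<nu>) * x powr (\<nu> - 1 / 2))) has_vector_derivative of_real ((1 / 2 + \<nu>) * ((\<nu> - 1 / 2) * x powr (\<nu> - 1 / 2 - 1)))) (at x)"
  by (rule powr_derivative[OF assms(1)])
 then have "(fderiv \<phi> has_vector_derivative of_real ((1 / 2 + \<nu>) * ((\<nu> - 1 / 2) * x powr (\<nu> - 1 / 2 - 1)))) (at x)"
 proof (rule has_vector_derivative_transform_within_open[of _ _ _ "{0<..<1}"])
  fix y :: real assume y: "y \<in> {0<..<1}"
  have "y powr (\<nu> - 1 / 2) = w y / y" using powr_diff[of y "1 / 2 + \<nu>" 1] y by (simp add: w_def algebra_simps)
  then show "complex_of_real ((1 / 2 + \<nu>) * y powr (\<nu> - 1 / 2)) = fderiv \<phi> y"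
   using vector_derivative_at[OF phi_derivative[of y]] y by simp
 qed (use assms in auto)
 moreover have "x powr (\<nu> - 1 / 2 - 1) = w x / x\<^sup>2"
  using powr_diff[of x "1 / 2 + \<nu>" 2] assms by (simp add: w_def algebra_simps)
 moreover have "(1 / 2 + \<nu>) * ((\<nu> - 1 / 2) * (w x / x\<^sup>2)) = (\<nu>\<^sup>2 - 1 / 4) / x\<^sup>2 * w x" by (simp add: field_simps power2_eq_square)
 ultimately have "(fderiv \<phi> has_vector_derivative of_real ((\<nu>\<^sup>2 - 1 / 4) / x\<^sup>2 * w x)) (at x)" by (simp only:)
 from vector_derivative_at[OF this] show ?thesis unfolding bessel_expr_def phi_eq[OF assms] by simp
qed

lemma lagrange_bracket_phi:
 "0 < x \<Longrightarrow> x < 1 \<Longrightarrow> lagrange_bracket f \<phi> x = of_real (w x) * (of_real ((1 / 2 + \<nu>) / x) * f x - fderiv f x)"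
 unfolding lagrange_bracket_def vector_derivative_at[OF phi_derivative] phi_eq by (simp add: algebra_simps)

text \<open>The Wronskian of the two boundary functions is constant near the end-point; the Pluecker identity
 for \<open>2 \<times> 2\<close> determinants then expresses the bracket through the boundary values.\<close>

lemma bracket_boundary_values:
 assumes f: "f \<in> dom_max \<nu>" and g: "g \<in> dom_max \<nu>"
 shows "- lagrange_bracket_0 f g =
  lagrange_bracket_0 f \<phi> * cnj (lagrange_bracket_0 g \<psi>) - lagrange_bracket_0 f \<psi> * cnj (lagrange_bracket_0 g \<phi>)"
proof -
 let ?L = "\<lambda>x. lagrange_bracket f \<phi> x * cnj (lagrange_bracket g \<psi> x) - lagrange_bracket f \<psi> x * cnj (lagrange_bracket g \<phi> x)"
 have l: "(?L \<longlongrightarrow> lagrange_bracket_0 f \<phi> * cnj (lagrange_bracket_0 g \<psi>) - lagrange_bracket_0 f \<psi> * cnj (lagrange_bracket_0 g \<phi>)) (at_right 0)"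
  by (intro tendsto_intros lagrange_identity(1)[of _ \<nu>] f g phi psi)
 have "?L x = - lagrange_bracket f g x" if x: "0 < x" "x < 1" for x
 proof -
  define a b c d where "a = w x" and "b = (1 / 2 + \<nu>) / x * w x" and "c = 1 / (2 * \<nu>) * x powr (1 / 2 - \<nu>)"
   and "d = 1 / (2 * \<nu>) * ((1 / 2 - \<nu>) * x powr (- 1 / 2 - \<nu>))"
  have ac: "a * c = x / (2 * \<nu>)" using x powr_add[of x "1 / 2 + \<nu>" "1 / 2 - \<nu>"] by (simp add: a_def c_def w_def)
  have d: "d = (1 / 2 - \<nu>) / x * c" using x powr_diff[of x "1 / 2 - \<nu>" 1] by (simp add: c_def d_def)
  \<comment> \<open>The normalization 1/(2 \<nu>) of \<psi> is what makes this Wronskian equal to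
    -1.\<close>
  have "a * d - b * c = ((1 / 2 - \<nu>) - (1 / 2 + \<nu>)) / x * (a * c)"
   unfolding d b_def a_def[symmetric] by (simp add: algebra_simps diff_divide_distrib add_divide_distrib)
  also have "\<dots> = - 1" unfolding ac using x nu by (simp add: field_simps)
  finally have "of_real a * of_real d - of_real b * of_real c = (- 1 :: complex)"
   by (simp flip: of_real_mult of_real_diff)
  moreover have "lagrange_bracket h \<phi> x = h x * of_real b - fderiv h x * of_real a"
   "lagrange_bracket h \<psi> x = h x * of_real d - fderiv h x * of_real c" for h
   unfolding lagrange_bracket_def vector_derivative_at[OF phi_derivative[OF x]] vector_derivative_at[OF psi_derivative[OF x]]
    phi_eq[OF x] psi_eq[OF x] a_def b_def c_def d_def complex_cnj_complex_of_real by (rule refl)+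
  moreover have "(f x * b' - f' * a') * (cnj (g x) * d' - g' * c') - (f x * d' - f' * c') * (cnj (g x) * b' - g' * a')
   = (a' * d' - b' * c') * (f x * g' - f' * cnj (g x))" for f' g' a' b' c' d' :: complex by (simp add: algebra_simps)
  ultimately show ?thesis by (simp add: lagrange_bracket_def)
 qed
 then have "\<forall>\<^sub>F x in at_right 0. ?L x = - lagrange_bracket f g x" by (intro eventually_at_right_0)
 from Lim_transform_eventually[OF l this] have "((\<lambda>x. - (- lagrange_bracket f g x)) \<longlongrightarrow> - (lagrange_bracket_0 f \<phi> * cnj (lagrange_bracket_0 g \<psi>) - lagrange_bracket_0 f \<psi> * cnj (lagrange_bracket_0 g \<phi>))) (at_right 0)"
  by (rule tendsto_minus)
 then have "lagrange_bracket_0 f g = - (lagrange_bracket_0 f \<phi> * cnj (lagrange_bracket_0 g \<psi>) - lagrange_bracket_0 f \<psi> * cnj (lagrange_bracket_0 g \<phi>))"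
  by (intro lagrange_bracket_0I) simp
 then show ?thesis by simp
qed

text \<open>By continuity \<open>g\<close> vanishes identically, and with it its derivatives and
  brackets. So the image and the boundary values depend on the class only, not on the
  function.\<close>

lemma dom_max_ae_zero:
 assumes g: "g \<in> dom_max \<nu>" and z: "abs_L2 g = 0"
 shows "abs_L2 (bessel_expr \<nu> g) = 0" "h \<in> dom_max \<nu> \<Longrightarrow> lagrange_bracket_0 g h = 0"
proof -
 have zero: "0 = abs_L2 (\<lambda>x. 0)" by (simp add: zero_L2_def)
 have ae: "AE x in halfline. g x = 0"
  using z unfolding zero abs_L2_eq_iff[OF dom_maxD(2)[OF g] sq_integrable_zero] .
 have g0: "g x = 0" if x: "0 < x" for x
 proof (rule ccontr)
  assume nz: "g x \<noteq> 0"
  have "isCont g x" using D_halflineD(4)[OF dom_maxD(1)[OF g]] x by (simp add: continuous_on_eq_continuous_at)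
  then obtain d where d: "0 < d" "\<And>y. dist x y < d \<Longrightarrow> g y \<noteq> 0" using continuous_at_avoid[of x g 0] nz by blast
  have "AE y in lebesgue. y \<notin> {x<..<x + d}"
   using ae d(2) x
   by (auto simp: AE_restrict_space_iff dist_real_def elim!: eventually_mono)
  then have "{x<..<x + d} \<in> null_sets lebesgue" by (simp add: AE_iff_null_sets)
  then show False using d(1) by (simp add: null_sets_def)
 qed
 have g1: "fderiv g x = 0" if "0 < x" for x using fderiv_cong[of g "\<lambda>_. 0", OF g0 that] by simp
 have g2: "fderiv (fderiv g) x = 0" if "0 < x" for x using fderiv_cong[of "fderiv g" "\<lambda>_. 0", OF g1 that] by simp
 have "abs_L2 (bessel_expr \<nu> g) = abs_L2 (\<lambda>x. 0)"
  by (rule sq_integrable_cong_ae(2)[OF sq_integrable_zero negligible_empty]) (simp add: bessel_expr_def g0 g2)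
 then show "abs_L2 (bessel_expr \<nu> g) = 0" unfolding zero .
 have "((\<lambda>x. 0) \<longlongrightarrow> (0::complex)) (at_right (0::real))" by simp
 moreover have "\<forall>\<^sub>F x in at_right 0. 0 = lagrange_bracket g h x"
  by (rule eventually_at_right_0) (simp add: lagrange_bracket_def g0 g1)
 ultimately show "lagrange_bracket_0 g h = 0" by (intro lagrange_bracket_0I) (rule Lim_transform_eventually)
qed

end

context bessel_boundary
begin

text \<open>\<open>s\<close> is minus the bracket with \<phi>, divided by \<open>w\<close>. The
  bracket starts at 0 and \<open>w\<close> increases, so |s(x)| is at most the integral of |\<tau>
  u| up to x, which tends to 0. Integrating (u/w)' = s/w then bounds \<open>u\<close> near
  0.\<close>

lemma near_zero_estimates:
 assumes u: "u \<in> dom_max \<nu>" and b: "lagrange_bracket_0 u \<phi> = 0"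
 defines "s \<equiv> \<lambda>x. fderiv u x - of_real ((1 / 2 + \<nu>) / x) * u x"
 shows "((\<lambda>x. s x * cnj (u x)) \<longlongrightarrow> 0) (at_right 0)"
proof -
 note Du = dom_maxD[OF u] D_halflineD[OF dom_maxD(1)[OF u]]
 define N where "N x = cmod (bessel_expr \<nu> u x)" for x
 have Ni: "N absolutely_integrable_on {0<..1}"
  unfolding N_def by (rule set_integrable_norm[OF sq_integrable_near_zero[OF Du(3)]])
 have Nint: "N integrable_on {a..b}" if "0 < a" "b \<le> 1" for a b
  by (rule set_lebesgue_integral_eq_integral(1)[OF set_integrable_subset[OF Ni]]) (use that in auto)
 define L where "L = integral {0<..1} N"
 \<comment> \<open>The integral of \<open>N\<close> over (0, x], written so that its limit at 0 is
   immediate.\<close>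
 define J where "J x = L - integral {x..1} N" for x
 have J0: "(J \<longlongrightarrow> 0) (at_right 0)"
 proof -
  have "((\<lambda>x. L - integral {x..1} N) \<longlongrightarrow> L - L) (at_right 0)"
   unfolding L_def by (intro tendsto_intros tendsto_integral_at_right Ni)
  then show ?thesis by (simp add: J_def[abs_def])
 qed
 have le: "cmod (lagrange_bracket u \<phi> x) \<le> w x * J x" if x: "0 < x" "x < 1" for x
 proof -
  have "cmod (lagrange_bracket u \<phi> x - lagrange_bracket u \<phi> a) \<le> w x * J x" if a: "0 < a" "a \<le> x" for a
  proof -
   let ?k = "\<lambda>t. bessel_expr \<nu> u t * cnj (\<phi> t) - u t * cnj (bessel_expr \<nu> \<phi> t)"
   have k: "(?k has_integral lagrange_bracket u \<phi> x - lagrange_bracket u \<phi> a) {a..x}"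
    by (rule lagrange_bracket_FTC[OF Du(1) dom_maxD(1)[OF phi] a])
   have "cmod (integral {a..x} ?k) \<le> integral {a..x} (\<lambda>t. w x * N t)"
   proof (rule integral_norm_bound_integral)
    show "(\<lambda>t. w x * N t) integrable_on {a..x}" using Nint[of a x] a x by (intro integrable_on_mult_right) auto
    fix t assume t: "t \<in> {a..x}"
    then have "0 < t" "t < 1" using a x by auto
    then have "norm (?k t) = N t * w t"
     using bessel_expr_phi[of t] phi_eq[of t] w_pos[of t] by (simp add: N_def norm_mult)
    also have "\<dots> \<le> N t * w x" using t a w_mono[of t x] by (intro mult_left_mono) (auto simp: N_def)
    finally show "norm (?k t) \<le> w x * N t" by (simp add: mult.commute)
   qed (use k in blast)
   also have "\<dots> = w x * integral {a..x} N" by simp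
   also have "\<dots> \<le> w x * J x"
   proof (rule mult_left_mono)
    have "integral {a..x} N + integral {x..1} N = integral {a..1} N"
     using Nint[of a 1] a x by (intro Henstock_Kurzweil_Integration.integral_combine) auto
    moreover have "integral {a..1} N \<le> L"
     unfolding L_def using a Ni Nint[of a 1] by (intro integral_subset_le) (auto simp: N_def absolutely_integrable_on_def)
    ultimately show "integral {a..x} N \<le> J x" unfolding J_def by linarith
    show "0 \<le> w x" using w_pos[OF x(1)] by simp
   qed
   finally show ?thesis unfolding integral_unique[OF k] .
  qed
  then have "\<forall>\<^sub>F a in at_right 0. cmod (lagrange_bracket u \<phi> x - lagrange_bracket u \<phi> a) \<le> w x * J x"
   using eventually_at_right_real[OF x(1)] by (auto elim!: eventually_mono)
  moreover have "((\<lambda>a. cmod (lagrange_bracket u \<phi> x - lagrange_bracket u \<phi> a)) \<longlongrightarrow> cmod (lagrange_bracket u \<phi> x - 0)) (at_right 0)"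
   by (intro tendsto_intros) (use lagrange_identity(1)[OF u phi] b in simp)
  ultimately show ?thesis by (intro tendsto_upperbound[of _ "cmod (lagrange_bracket u \<phi> x)" "at_right 0"]) auto
 qed
 have sJ: "cmod (s x) \<le> J x" if x: "0 < x" "x < 1" for x
 proof -
  have "lagrange_bracket u \<phi> x = - (of_real (w x) * s x)"
   unfolding lagrange_bracket_phi[OF x] s_def by (simp add: algebra_simps)
  then have "w x * cmod (s x) \<le> w x * J x" using le[OF x] w_pos[OF x(1)] by (simp add: norm_mult)
  then show ?thesis using w_pos[OF x(1)] by simp
 qed
 have JL: "J x \<le> L" if "0 < x" for x
  unfolding J_def using Nint[OF that, of 1] by (simp add: Henstock_Kurzweil_Integration.integral_nonneg N_def)
 have L0: "0 \<le> L" using sJ[of "1/2"] JL[of "1/2"] norm_ge_zero[of "s (1/2)"] by linarith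
 have bounded: "cmod (u x) \<le> L + cmod (u (1/2))" if x: "0 < x" "x < 1/2" for x
 proof -
  \<comment> \<open>\<open>w\<close> solves the equation s = 0; dividing by it turns the first-order
    expression into a plain derivative.\<close>
  define r where "r t = u t * of_real (1 / w t)" for t
  have rd: "(r has_vector_derivative s t * of_real (1 / w t)) (at t)" if t: "0 < t" for t
  proof -
   have "((\<lambda>t. 1 / w t) has_real_derivative - ((1 / 2 + \<nu>) * t powr (1 / 2 + \<nu> - 1)) / (w t * w t)) (at t)"
    unfolding w_def using t by (auto intro!: derivative_eq_intros)
   moreover have "(1 / 2 + \<nu>) * t powr (1 / 2 + \<nu> - 1) = (1 / 2 + \<nu>) / t * w t"
    using t by (simp only: powr_diff) (simp add: w_def)
   ultimately have "((\<lambda>t. 1 / w t) has_real_derivative - ((1 / 2 + \<nu>) / t) * (1 / w t)) (at t)"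
    using w_pos[OF t] by simp
   then have "((\<lambda>t. complex_of_real (1 / w t)) has_vector_derivative of_real (- ((1 / 2 + \<nu>) / t) * (1 / w t))) (at t)"
    by (intro has_vector_derivative_of_real) (simp add: has_real_derivative_iff_has_vector_derivative)
   from has_vector_derivative_mult[OF Du(6)[OF t] this] show ?thesis
    unfolding r_def[abs_def] s_def by (rule has_vector_derivative_eq_rhs) (simp add: algebra_simps)
  qed
  have "norm (r (1/2) - r x) \<le> L / w x * (1/2) - L / w x * x"
  proof (rule differentiable_bound_general[where \<phi>="\<lambda>t. L / w x * t" and f'="\<lambda>t. s t * of_real (1 / w t)" and \<phi>'="\<lambda>t. L / w x"])
   show "continuous_on {x..1/2} r"
   proof (rule continuous_at_imp_continuous_on, rule ballI)
    fix t assume "t \<in> {x..1/2}"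
    then show "isCont r t" using x by (intro has_vector_derivative_continuous[OF rd]) auto
   qed
   fix t assume t: "x < t" "t < 1/2"
   show "(r has_vector_derivative s t * of_real (1 / w t)) (at t)" using t x by (intro rd) auto
   have "cmod (s t) * (1 / w t) \<le> L * (1 / w x)"
    using t x sJ[of t] JL[of t] w_pos[of x] w_mono[of x t] L0 w_pos[of t] by (intro mult_mono divide_left_mono mult_pos_pos) auto
   then show "norm (s t * of_real (1 / w t)) \<le> L / w x"
    using w_pos[of t] t x by (simp add: norm_mult norm_divide)
  qed (use x w_pos[OF x(1)] in \<open>auto intro!: continuous_intros derivative_eq_intros simp: has_real_derivative_iff_has_vector_derivative[symmetric]\<close>)
  also have "\<dots> \<le> L / w x" using x L0 w_pos[of x] by (simp add: field_simps mult_left_le)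
  finally have "norm (r (1/2) - r x) \<le> L / w x" .
  then have "norm (r x) \<le> L / w x + norm (r (1/2))"
   using norm_triangle_ineq2[of "r x" "r (1/2)"] by (simp add: norm_minus_commute)
  then have "w x * norm (r x) \<le> w x * (L / w x + norm (r (1/2)))" using w_pos[of x] x by (intro mult_left_mono) auto
  moreover have "w x * norm (r x) = cmod (u x)" using w_pos[of x] x by (simp add: r_def norm_mult norm_divide)
  moreover have "w x * (L / w x + norm (r (1/2))) = L + w x / w (1/2) * cmod (u (1/2))"
   using w_pos[of x] w_pos[of "1/2"] x by (simp add: r_def norm_mult norm_divide algebra_simps)
  moreover have "w x / w (1/2) * cmod (u (1/2)) \<le> 1 * cmod (u (1/2))"
   using w_mono[of x "1/2"] w_pos[of "1/2"] x by (intro mult_right_mono) auto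
  ultimately show ?thesis by linarith
 qed
 have "((\<lambda>x. J x * (L + cmod (u (1/2)))) \<longlongrightarrow> 0 * (L + cmod (u (1/2)))) (at_right 0)" by (intro tendsto_intros J0)
 then have lim: "((\<lambda>x. J x * (L + cmod (u (1/2)))) \<longlongrightarrow> 0) (at_right 0)" by simp
 show ?thesis
 proof (rule Lim_null_comparison[OF _ lim])
  show "\<forall>\<^sub>F x in at_right 0. cmod (s x * cnj (u x)) \<le> J x * (L + cmod (u (1/2)))"
   using eventually_at_right_real[of 0 "1/2"]
  proof (rule eventually_mono)
   fix x :: real assume "x \<in> {0<..<1/2}"
   then have x: "0 < x" "x < 1/2" "x < 1" by auto
   then show "cmod (s x * cnj (u x)) \<le> J x * (L + cmod (u (1/2)))"
    unfolding norm_mult complex_mod_cnj using sJ[OF x(1,3)] order_trans[OF norm_ge_zero sJ[OF x(1,3)]] by (intro mult_mono bounded) auto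
  qed simp
 qed
qed

text \<open>\<tau> factors as the formal adjoint of d/dx - (1/2 + \<nu>)/x times this operator. In
  the integral of H' = |s|^2 - (\<tau> u) conj u the boundary term at 0 vanishes by
  \<open>near_zero_estimates\<close>, and the one at infinity cannot stay away from 0, because
  \<open>H\<close> is integrable there.\<close>

lemma nonneg_zero_boundary_value:
 assumes u: "u \<in> dom_max \<nu>" and b: "lagrange_bracket_0 u \<phi> = 0"
 shows "0 \<le> Re (cinner (abs_L2 (bessel_expr \<nu> u)) (abs_L2 u))"
proof -
 note Du = dom_maxD[OF u] D_halflineD[OF dom_maxD(1)[OF u]]
 define c where "c x = (1 / 2 + \<nu>) / x" for x :: real
 define s where "s x = fderiv u x - of_real (c x) * u x" for x
 define H where "H x = s x * cnj (u x)" for x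
 define T where "T x = bessel_expr \<nu> u x * cnj (u x)" for x
 have Ti: "T absolutely_integrable_on {0<..}" unfolding T_def by (rule absolutely_integrable_mult_cnj[OF Du(3,2)])
 note Ts = half_line_integral_split[OF Ti]
 have Tint: "T integrable_on {a..b}" if "0 < a" for a b
  by (rule set_lebesgue_integral_eq_integral(1)[OF set_integrable_subset[OF Ti]]) (use that in auto)
 obtain N where N: "negligible N" "\<And>t. 0 < t \<Longrightarrow> t \<notin> N \<Longrightarrow>
  (fderiv u has_vector_derivative of_real ((\<nu>\<^sup>2 - 1 / 4) / t\<^sup>2) * u t - bessel_expr \<nu> u t) (at t)" using fderiv2_ae[OF Du(1), of \<nu>] by blast
 have cd: "((\<lambda>x. complex_of_real (c x)) has_vector_derivative of_real (- (1 / 2 + \<nu>) / t\<^sup>2)) (at t)" if "0 < t" for t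
  unfolding c_def using that
  by (intro has_vector_derivative_of_real)
   (auto intro!: derivative_eq_intros simp: has_real_derivative_iff_has_vector_derivative[symmetric] power2_eq_square)
 have cAC: "(\<lambda>x. complex_of_real (c x)) \<in> AC_loc"
  by (rule AC_loc_C1[OF cd]) (auto intro!: continuous_intros)
 have HAC: "H \<in> AC_loc"
 proof -
  have "(\<lambda>x. (fderiv u x + (-1) * (of_real (c x) * u x)) * cnj (u x)) \<in> AC_loc"
   by (intro AC_loc_mult AC_loc_add AC_loc_cmult AC_loc_cnj cAC Du)
  then show ?thesis by (simp add: H_def[abs_def] s_def)
 qed
 have hi: "((\<lambda>x. s x * cnj (s x) - T x) has_integral H b - H a) {a..b}" if ab: "0 < a" "a \<le> b" for a b
 proof (rule AC_loc_ae_FTC(2)[OF HAC N(1) _ ab])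
  fix t :: real assume t: "0 < t" "t \<notin> N"
  let ?q = "complex_of_real ((\<nu>\<^sup>2 - 1 / 4) / t\<^sup>2)" and ?c' = "complex_of_real (- (1 / 2 + \<nu>) / t\<^sup>2)"
  \<comment> \<open>The Riccati equation V = c^2 + c' behind the factorization.\<close>
  have "(\<nu>\<^sup>2 - 1 / 4) / t\<^sup>2 = c t * c t + - (1 / 2 + \<nu>) / t\<^sup>2" using t by (simp add: c_def field_simps power2_eq_square)
  then have q: "?q = of_real (c t) * of_real (c t) + ?c'" by (simp only: of_real_mult of_real_add)
  have "(H has_vector_derivative s t * cnj (fderiv u t)
    + (?q * u t - bessel_expr \<nu> u t - (of_real (c t) * fderiv u t + ?c' * u t)) * cnj (u t)) (at t)"
   unfolding H_def[abs_def] s_def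
   using t by (intro has_vector_derivative_mult has_vector_derivative_diff has_vector_derivative_cnj N cd Du) auto
  then show "(H has_vector_derivative s t * cnj (s t) - T t) (at t)"
   unfolding q s_def T_def by (rule has_vector_derivative_eq_rhs) (simp only: complex_cnj_diff complex_cnj_mult complex_cnj_complex_of_real, algebra)
 qed
 have le: "Re (H a) - Re (H b) \<le> Re (integral {a..b} T)" if ab: "0 < a" "a \<le> b" for a b
 proof -
  have "((\<lambda>x. (s x * cnj (s x) - T x) + T x) has_integral (H b - H a) + integral {a..b} T) {a..b}"
   by (intro has_integral_add hi ab integrable_integral Tint)
  then have "((\<lambda>x. Re (s x * cnj (s x))) has_integral Re ((H b - H a) + integral {a..b} T)) {a..b}"
   by (intro has_integral_Re) simp
  then have "0 \<le> Re ((H b - H a) + integral {a..b} T)" by (rule has_integral_nonneg) simp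
  then show ?thesis by simp
 qed
 have H0: "(H \<longlongrightarrow> 0) (at_right 0)" unfolding H_def s_def c_def by (rule near_zero_estimates[OF u b])
 have low: "- Re (H 1) \<le> Re (integral {0<..1} T)"
 proof (rule tendsto_le[OF _ tendsto_Re[OF tendsto_integral_at_right[OF Ts(1)]]])
  show "((\<lambda>a. Re (H a) - Re (H 1)) \<longlongrightarrow> - Re (H 1)) (at_right 0)"
   using tendsto_diff[OF tendsto_Re[OF H0] tendsto_const[of "Re (H 1)"]] by simp
  show "\<forall>\<^sub>F a in at_right 0. Re (H a) - Re (H 1) \<le> Re (integral {a..1} T)"
   by (rule eventually_at_right_0) (auto intro: le)
 qed simp
 have Hi: "H absolutely_integrable_on {1..}"
 proof -
  have "(\<lambda>x. complex_of_real (c x) * (u x * cnj (u x))) absolutely_integrable_on {1..}"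
  proof (rule absolutely_integrable_bounded_measurable_product[OF bilinear_times])
   have "continuous_on {1..} (\<lambda>x. complex_of_real (c x))" unfolding c_def by (intro continuous_intros) auto
   then show "(\<lambda>x. complex_of_real (c x)) \<in> borel_measurable (lebesgue_on {1..})"
    by (rule continuous_imp_measurable_on_sets_lebesgue) simp
   have "cmod (of_real (c x)) \<le> 1 / 2 + \<nu>" if "1 \<le> x" for x
   proof -
    have "\<bar>c x\<bar> = (1 / 2 + \<nu>) / x" using that nu by (simp add: c_def)
    also have "\<dots> \<le> (1 / 2 + \<nu>) / 1" using that nu by (intro divide_left_mono) auto
    finally show ?thesis by simp
   qed
   then show "bounded ((\<lambda>x. complex_of_real (c x)) ` {1..})" by (intro boundedI[of _ "1 / 2 + \<nu>"]) auto
   show "(\<lambda>x. u x * cnj (u x)) absolutely_integrable_on {1..}"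
    by (rule half_line_integral_split(2)[OF absolutely_integrable_mult_cnj[OF Du(2,2)]])
  qed simp
  from set_integral_diff(1)[OF mult_fderiv_integrable[OF u u] this] show ?thesis
   by (simp add: H_def[abs_def] s_def algebra_simps)
 qed
 have "0 \<le> Re (integral {0<..} T)"
 proof (rule ccontr)
  \<comment> \<open>If the form were negative, Re H would eventually be at least e/2 > 0, against
    the integrability of \<open>H\<close>.\<close>
  define e where "e = Re (H 1) - Re (integral {1..} T)"
  assume "\<not> 0 \<le> Re (integral {0<..} T)"
  then have e: "0 < e" using low unfolding Ts(3) e_def by simp
  have "((\<lambda>b. Re (H 1) - Re (integral {1..b} T)) \<longlongrightarrow> e) at_top"
   unfolding e_def by (intro tendsto_intros tendsto_integral_at_top Ts)
  then have "\<forall>\<^sub>F b in at_top. e / 2 < Re (H 1) - Re (integral {1..b} T)" by (rule order_tendstoD) (use e in simp)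
  then have "\<forall>\<^sub>F b in at_top. e / 2 \<le> cmod (H b)"
   using eventually_ge_at_top[of 1]
  proof eventually_elim
   case (elim b)
   then show ?case using le[of 1 b] complex_Re_le_cmod[of "H b"] by linarith
  qed
  then obtain B where "\<And>b. B \<le> b \<Longrightarrow> e / 2 \<le> cmod (H b)" by (auto simp: eventually_at_top_linorder)
  then show False
   using integrable_not_bounded_below[where F="\<lambda>x. cmod (H x)" and a=1 and e="e / 2" and c=B] set_integrable_norm[OF Hi] e by auto
 qed
 moreover have "cinner (abs_L2 (bessel_expr \<nu> u)) (abs_L2 u) = integral {0<..} T"
  unfolding cinner_abs_L2[OF Du(3,2)] T_def by (rule integral_halfline[OF integrable_mult_cnj[OF Du(3,2)]])
 ultimately show ?thesis by simp
qed

end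

section \<open>Macdonald integrals\<close>

definition mac_kernel :: "real \<Rightarrow> real \<Rightarrow> real \<Rightarrow> real" where
 "mac_kernel \<alpha> y s = exp (- s - y / s) * s powr (\<alpha> - 1)"

text \<open>For y > 0 this is 2 y^(\<alpha>/2) K_\<alpha>(2 sqrt y), with K the Macdonald
  function.\<close>

definition mac :: "real \<Rightarrow> real \<Rightarrow> real" where
 "mac \<alpha> y = integral\<^sup>L halfline (mac_kernel \<alpha> y)"

lemma borel_measurable_halfline: "f \<in> borel_measurable borel \<Longrightarrow> f \<in> borel_measurable halfline"
 by (rule measurable_restrict_space1) (simp add: measurable_completion)

lemma mac_kernel_measurable: "mac_kernel \<alpha> y \<in> borel_measurable halfline"
 unfolding mac_kernel_def by (rule borel_measurable_halfline) measurable

lemma powr_exp_integrable: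
 assumes "0 < \<alpha>" "0 < r"
 shows "integrable halfline (\<lambda>s. exp (- r * s) * s powr (\<alpha> - 1))"
proof -
 have "(\<lambda>t. norm (complex_of_real t powr (of_real \<alpha> - 1) / of_real (exp (r * t)))) absolutely_integrable_on {0<..}"
  using assms by (intro set_integrable_norm absolutely_integrable_Gamma_integral) auto
 then have "(\<lambda>s. exp (- r * s) * s powr (\<alpha> - 1)) absolutely_integrable_on {0<..}"
  by (rule set_integrable_cong[THEN iffD1, rotated -1])
   (auto simp: norm_divide norm_powr_real_powr exp_minus divide_simps)
 then show ?thesis by (simp add: integrable_halfline_iff)
qed

lemma integral_powr_exp: "0 < \<alpha> \<Longrightarrow> integral\<^sup>L halfline (\<lambda>s. exp (- s) * s powr (\<alpha> - 1)) = Gamma \<alpha>"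
proof -
 assume a: "0 < \<alpha>"
 have "integral\<^sup>L halfline (\<lambda>s. exp (- s) * s powr (\<alpha> - 1)) = integral {0<..} (\<lambda>s. exp (- s) * s powr (\<alpha> - 1))"
  using powr_exp_integrable[OF a zero_less_one] by (intro integral_halfline) simp
 also have "\<dots> = integral {0<..} (\<lambda>t. t powr (\<alpha> - 1) / exp t)"
  by (intro integral_cong) (simp add: exp_minus divide_inverse)
 also have "\<dots> = Gamma \<alpha>"
 proof (rule integral_unique)
  show "((\<lambda>t. t powr (\<alpha> - 1) / exp t) has_integral Gamma \<alpha>) {0<..}"
   using Gamma_integral_real[OF a]
   by (rule has_integral_spike_set_eq[THEN iffD1, rotated 2]) (auto intro: negligible_subset[of "{0}"])
 qed
 finally show ?thesis .
qed

lemma exp_minus_le_powr: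
 fixes p z :: real
 assumes "0 < p" "0 < z" shows "exp (- z) \<le> (p / z) powr p"
proof -
 have "z / p \<le> exp (z / p)" using exp_ge_add_one_self[of "z / p"] by linarith
 then have "exp (- (z / p)) \<le> p / z" using assms by (simp add: exp_minus inverse_eq_divide field_simps)
 then have "exp (- (z / p)) powr p \<le> (p / z) powr p" using assms by (intro powr_mono2) auto
 moreover have "exp (- (z / p)) powr p = exp (- z)" using assms by (simp add: powr_def)
 ultimately show ?thesis by simp
qed

text \<open>exp(-y/s) is bounded by a multiple of any positive power of s; taking p > -\<alpha>
  makes the kernel integrable at 0 for every real \<alpha>.\<close>

lemma mac_kernel_le:
 assumes y: "0 < y" and s: "0 < s" and p: "0 < p"
 shows "mac_kernel \<alpha> y s \<le> (p / y) powr p * (exp (- s) * s powr (\<alpha> + p - 1))"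
proof -
 have "exp (- (y / s)) \<le> (p / (y / s)) powr p" by (rule exp_minus_le_powr) (use assms in auto)
 also have "p / (y / s) = p / y * s" by simp
 also have "\<dots> powr p = (p / y) powr p * s powr p" using assms by (intro powr_mult)
 finally have "exp (- s) * exp (- (y / s)) * s powr (\<alpha> - 1) \<le> exp (- s) * ((p / y) powr p * s powr p) * s powr (\<alpha> - 1)"
  by (intro mult_right_mono mult_left_mono) auto
 moreover have "s powr p * s powr (\<alpha> - 1) = s powr (\<alpha> + p - 1)" by (simp add: algebra_simps flip: powr_add)
 ultimately show ?thesis by (simp add: mac_kernel_def exp_diff exp_minus divide_inverse mult.assoc mult.left_commute)
qed

lemma mac_kernel_nonneg: "0 \<le> mac_kernel \<alpha> y s" by (simp add: mac_kernel_def)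

lemma mac_kernel_integrable:
 assumes y: "0 < y" shows "integrable halfline (mac_kernel \<alpha> y)"
proof -
 define p where "p = \<bar>\<alpha>\<bar> + 1"
 have p: "0 < p" "0 < \<alpha> + p" by (auto simp: p_def)
 have "integrable halfline (\<lambda>s. (p / y) powr p * (exp (- 1 * s) * s powr (\<alpha> + p - 1)))"
  using powr_exp_integrable[OF p(2) zero_less_one] by (rule integrable_mult_right)
 then show ?thesis
 proof (rule Bochner_Integration.integrable_bound[OF _ mac_kernel_measurable])
  show "AE s in halfline. norm (mac_kernel \<alpha> y s) \<le> norm ((p / y) powr p * (exp (- 1 * s) * s powr (\<alpha> + p - 1)))"
   using mac_kernel_le[OF y _ p(1), of _ \<alpha>] by (intro AE_I2) (simp add: mac_kernel_nonneg)
 qed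
qed

lemma mac_derivative:
 assumes y: "0 < y" shows "(mac \<alpha> has_real_derivative - mac (\<alpha> - 1) y) (at y)"
proof -
 have "((\<lambda>t. integral\<^sup>L halfline (mac_kernel \<alpha> t)) has_real_derivative integral\<^sup>L halfline (\<lambda>s. - mac_kernel (\<alpha> - 1) y s)) (at y)"
 proof (rule has_derivative_parameter_integral[where a="y/2" and b="2*y" and g="mac_kernel (\<alpha> - 1) (y/2)"])
  fix t s :: real assume t: "y/2 < t" "t < 2*y" and "s \<in> space halfline"
  then have s: "0 < s" by simp
  have "((\<lambda>t. exp (- s - t / s) * s powr (\<alpha> - 1)) has_real_derivative (exp (- s - t / s) * (- (1 / s))) * s powr (\<alpha> - 1)) (at t)"
   using s by (auto intro!: derivative_eq_intros)
  moreover have "s powr (\<alpha> - 1 - 1) = s powr (\<alpha> - 1) / s" using powr_diff[of s "\<alpha> - 1" 1] s by simp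
  then have "exp (- s - t / s) * (- (1 / s)) * s powr (\<alpha> - 1) = - (exp (- s - t / s) * s powr (\<alpha> - 1 - 1))" by simp
  ultimately show "((\<lambda>t. mac_kernel \<alpha> t s) has_real_derivative - mac_kernel (\<alpha> - 1) t s) (at t)"
   unfolding mac_kernel_def by simp
  have "exp (- s - t / s) \<le> exp (- s - y / 2 / s)" using t s y by (simp add: divide_right_mono field_simps)
  then show "\<bar>- mac_kernel (\<alpha> - 1) t s\<bar> \<le> mac_kernel (\<alpha> - 1) (y/2) s"
   unfolding abs_minus abs_of_nonneg[OF mac_kernel_nonneg] unfolding mac_kernel_def by (intro mult_right_mono) auto
 qed (use y mac_kernel_integrable mac_kernel_measurable in auto)
 then show ?thesis by (simp add: mac_def[abs_def])
qed

text \<open>The left-hand side is the integral of the derivative of exp(-s - y/s) s^\<beta>, a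
  function that vanishes at both ends.\<close>

lemma mac_recurrence:
 assumes y: "0 < y" shows "\<beta> * mac \<beta> y - mac (\<beta> + 1) y + y * mac (\<beta> - 1) y = 0"
proof -
 define h where "h = mac_kernel (\<beta> + 1) y"
 define k where "k s = \<beta> * mac_kernel \<beta> y s - mac_kernel (\<beta> + 1) y s + y * mac_kernel (\<beta> - 1) y s" for s
 have ki: "integrable halfline k"
  unfolding k_def using mac_kernel_integrable[OF y] by (intro Bochner_Integration.integrable_add Bochner_Integration.integrable_diff integrable_mult_right)
 have hd: "(h has_real_derivative k s) (at s)" if s: "0 < s" for s
 proof -
  have "((\<lambda>s. exp (- s - y / s) * s powr \<beta>) has_real_derivative exp (- s - y / s) * (- 1 + y / s\<^sup>2) * s powr \<beta> + exp (- s - y / s) * (\<beta> * s powr (\<beta> - 1))) (at s)"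
   using s by (auto intro!: derivative_eq_intros simp: power2_eq_square)
  moreover have P: "s powr (\<beta> - 1 - 1) = s powr \<beta> / s\<^sup>2" using powr_diff[of s \<beta> 2] s by simp
  then have "exp (- s - y / s) * (- 1 + y / s\<^sup>2) * s powr \<beta> + exp (- s - y / s) * (\<beta> * s powr (\<beta> - 1)) = k s"
   unfolding k_def mac_kernel_def P by (simp add: algebra_simps)
  ultimately show ?thesis by (simp add: h_def mac_kernel_def[abs_def])
 qed
 have FTC: "(k has_integral h b - h a) {a..b}" if "0 < a" "a \<le> b" for a b
  by (rule fundamental_theorem_of_calculus) (use that hd in \<open>auto simp flip: has_real_derivative_iff_has_vector_derivative intro: has_field_derivative_at_within\<close>)
 obtain l0 l1 where l0: "(h \<longlongrightarrow> l0) (at_right 0)" and l1: "(h \<longlongrightarrow> l1) at_top" and i: "integral {0<..} k = l1 - l0"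
  using half_line_limits[OF ki[unfolded integrable_halfline_iff] FTC] by blast
 have "h absolutely_integrable_on {1..}"
  using half_line_integral_split(2)[of h] mac_kernel_integrable[OF y, of "\<beta> + 1"] by (simp add: h_def integrable_halfline_iff)
 from integrable_limit_zero[OF this l1] have "l1 = 0" .
 moreover have "l0 = 0"
 proof -
  define p where "p = \<bar>\<beta>\<bar> + 1"
  have "(h \<longlongrightarrow> 0) (at_right 0)"
  proof (rule Lim_null_comparison)
   show "((\<lambda>s. (p / y) powr p * s) \<longlongrightarrow> 0) (at_right 0)" by (auto intro!: tendsto_eq_intros)
   show "\<forall>\<^sub>F s in at_right 0. norm (h s) \<le> (p / y) powr p * s"
   proof (rule eventually_at_right_0)
    fix s :: real assume s: "0 < s" "s < 1"
    have "h s \<le> (p / y) powr p * (exp (- s) * s powr (\<beta> + 1 + p - 1))"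
     unfolding h_def by (rule mac_kernel_le[OF y s(1)]) (simp add: p_def)
    also have "\<dots> \<le> (p / y) powr p * (1 * s powr 1)"
     using s by (intro mult_left_mono mult_mono powr_mono') (auto simp: p_def)
    finally show "norm (h s) \<le> (p / y) powr p * s" using s by (simp add: h_def mac_kernel_nonneg)
   qed
  qed
  then show ?thesis using tendsto_unique[OF _ l0] by simp
 qed
 ultimately have "integral\<^sup>L halfline k = 0" using integral_halfline[OF ki] i by simp
 then show ?thesis unfolding k_def mac_def using mac_kernel_integrable[OF y] by simp
qed

text \<open>The substitution s = y/t; in terms of the Macdonald function it is the symmetry of K in
  its index.\<close>

lemma mac_reflection:
 assumes y: "0 < y" shows "mac \<alpha> y = y powr \<alpha> * mac (- \<alpha>) y"
proof -
 define g where "g t = y / t" for t :: real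
 have img: "g ` {0<..} = {0<..}"
 proof
  show "{0<..} \<subseteq> g ` {0<..}"
  proof
   fix t :: real assume "t \<in> {0<..}"
   then show "t \<in> g ` {0<..}" using y by (intro image_eqI[of _ _ "y / t"]) (auto simp: g_def)
  qed
 qed (use y in \<open>auto simp: g_def\<close>)
 let ?G = "\<lambda>t. \<bar>- y / t\<^sup>2\<bar> * mac_kernel \<alpha> y (g t)"
 have der: "(g has_field_derivative - y / t\<^sup>2) (at t within {0<..})" if "t \<in> {0<..}" for t
  unfolding g_def using that by (auto intro!: derivative_eq_intros simp: power2_eq_square)
 have inj: "inj_on g {0<..}" using y by (auto simp: inj_on_def g_def)
 have "mac_kernel \<alpha> y absolutely_integrable_on g ` {0<..} \<and> integral (g ` {0<..}) (mac_kernel \<alpha> y) = mac \<alpha> y"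
  unfolding img using mac_kernel_integrable[OF y, of \<alpha>] integral_halfline[OF mac_kernel_integrable[OF y, of \<alpha>]]
  by (simp add: mac_def integrable_halfline_iff)
 from has_absolute_integral_change_of_variables_1'[THEN iffD2, OF _ der inj this]
 have "?G absolutely_integrable_on {0<..} \<and> integral {0<..} ?G = mac \<alpha> y" by simp
 then have "mac \<alpha> y = integral {0<..} ?G" by simp
 also have "\<dots> = integral {0<..} (\<lambda>t. y powr \<alpha> * mac_kernel (- \<alpha>) y t)"
 proof (intro integral_cong)
  fix t :: real assume "t \<in> {0<..}"
  then have t: "0 < t" by simp
  have A: "(y / t) powr (\<alpha> - 1) = y powr \<alpha> / y * (t powr (- \<alpha>) * t)"
   using t y by (simp add: powr_divide powr_diff powr_minus field_simps)
  have B: "t powr (- \<alpha> - 1) = t powr (- \<alpha>) / t" using t by (simp add: powr_diff)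
  have E: "- (y / t) - y / (y / t) = - t - y / t" "\<bar>- y / t\<^sup>2\<bar> = y / t\<^sup>2" using t y by simp_all
  show "?G t = y powr \<alpha> * mac_kernel (- \<alpha>) y t"
   unfolding mac_kernel_def g_def A B E using t y by (simp add: power2_eq_square)
 qed
 also have "\<dots> = y powr \<alpha> * mac (- \<alpha>) y"
  unfolding mac_def integral_halfline[OF mac_kernel_integrable[OF y]] by simp
 finally show ?thesis .
qed

text \<open>The kernel increases to the integrand of the Gamma function as y decreases to 0, and for
  positive index this limit is an integrable majorant.\<close>

lemma mac_tendsto_Gamma:
 assumes a: "0 < \<alpha>" shows "(mac \<alpha> \<longlongrightarrow> Gamma \<alpha>) (at_right 0)"
 unfolding filterlim_at_right_to_top mac_def integral_powr_exp[OF a, symmetric]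
proof (rule integral_dominated_convergence_at_top)
 show "(\<lambda>s. exp (- s) * s powr (\<alpha> - 1)) \<in> borel_measurable halfline" by (rule borel_measurable_halfline) measurable
 show "integrable halfline (\<lambda>s. exp (- s) * s powr (\<alpha> - 1))" using powr_exp_integrable[OF a zero_less_one] by simp
 show "\<forall>\<^sub>F t in at_top. AE s in halfline. norm (mac_kernel \<alpha> (inverse t) s) \<le> exp (- s) * s powr (\<alpha> - 1)"
  using eventually_gt_at_top[of 0]
 proof eventually_elim
  case (elim t)
  then show ?case by (intro AE_I2) (auto simp: mac_kernel_def intro!: mult_right_mono)
 qed
 show "AE s in halfline. ((\<lambda>t. mac_kernel \<alpha> (inverse t) s) \<longlongrightarrow> exp (- s) * s powr (\<alpha> - 1)) at_top"
 proof (rule AE_I2)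
  fix s :: real
  have "((\<lambda>t. exp (- s - inverse t / s) * s powr (\<alpha> - 1)) \<longlongrightarrow> exp (- s - 0 / s) * s powr (\<alpha> - 1)) at_top"
   unfolding divide_inverse by (intro tendsto_intros tendsto_inverse_0_at_top filterlim_ident)
  then show "((\<lambda>t. mac_kernel \<alpha> (inverse t) s) \<longlongrightarrow> exp (- s) * s powr (\<alpha> - 1)) at_top" by (simp add: mac_kernel_def)
 qed
qed (rule mac_kernel_measurable)

text \<open>s + y/s is at least s/2 + sqrt y; half of s is kept to make the remaining integral
  converge.\<close>

lemma mac_decay:
 assumes a: "0 < \<alpha>"
 obtains K where "0 < K" "\<And>y. 0 < y \<Longrightarrow> mac \<alpha> y \<le> K * exp (- sqrt y)"
proof -
 define K where "K = integral\<^sup>L halfline (\<lambda>s. exp (- (1/2) * s) * s powr (\<alpha> - 1))"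
 have i: "integrable halfline (\<lambda>s. exp (- (1/2) * s) * s powr (\<alpha> - 1))" using a by (intro powr_exp_integrable) auto
 have "mac \<alpha> y \<le> (\<bar>K\<bar> + 1) * exp (- sqrt y)" if y: "0 < y" for y
 proof -
  have "mac \<alpha> y \<le> integral\<^sup>L halfline (\<lambda>s. exp (- sqrt y) * (exp (- (1/2) * s) * s powr (\<alpha> - 1)))"
   unfolding mac_def
  proof (rule integral_mono[OF mac_kernel_integrable[OF y] integrable_mult_right[OF i]])
   fix s :: real assume "s \<in> space halfline"
   then have s: "0 < s" by simp
   have "0 \<le> ((s - sqrt y)\<^sup>2 + (sqrt y)\<^sup>2) / (2 * s)" using s by simp
   also have "\<dots> = s / 2 + y / s - sqrt y"
    using s y by (simp add: power2_diff field_simps power2_eq_square)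
   finally have "- s - y / s \<le> - sqrt y + - (1/2) * s" by simp
   then have "exp (- s - y / s) \<le> exp (- sqrt y) * exp (- (1/2) * s)" by (simp only: exp_add[symmetric] exp_le_cancel_iff)
   then show "mac_kernel \<alpha> y s \<le> exp (- sqrt y) * (exp (- (1/2) * s) * s powr (\<alpha> - 1))"
    unfolding mac_kernel_def mult.assoc[symmetric] by (rule mult_right_mono) simp
  qed
  also have "\<dots> = exp (- sqrt y) * K" unfolding K_def by (rule integral_mult_right_zero)
  also have "\<dots> \<le> exp (- sqrt y) * (\<bar>K\<bar> + 1)" by (intro mult_left_mono) auto
  finally show ?thesis by (simp add: mult.commute)
 qed
 then show thesis by (intro that[of "\<bar>K\<bar> + 1"]) auto
qed

lemma mac_pos:
 assumes y: "0 < y" shows "0 < mac \<alpha> y"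
proof (rule ccontr)
 assume "\<not> 0 < mac \<alpha> y"
 moreover have "0 \<le> mac \<alpha> y" unfolding mac_def by (rule integral_nonneg_AE) (simp add: mac_kernel_nonneg)
 ultimately have "integral\<^sup>L halfline (mac_kernel \<alpha> y) = 0" by (simp add: mac_def)
 then have "AE s in halfline. mac_kernel \<alpha> y s = 0"
  using integral_nonneg_eq_0_iff_AE[OF mac_kernel_integrable[OF y, of \<alpha>]] by (simp add: mac_kernel_nonneg)
 then have "AE s in lebesgue. 0 < s \<longrightarrow> mac_kernel \<alpha> y s = 0" by (simp add: AE_restrict_space_iff)
 then have "AE s in lebesgue. s \<notin> {0<..<1::real}" by (elim eventually_mono) (auto simp: mac_kernel_def)
 then have "{0<..<1} \<in> null_sets (lebesgue :: real measure)" by (simp add: AE_iff_null_sets)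
 then show False by (simp add: null_sets_def)
qed

lemma mac_antimono:
 assumes y: "0 < y" "y \<le> z" shows "mac \<alpha> z \<le> mac \<alpha> y"
 unfolding mac_def
proof (rule integral_mono)
 show "integrable halfline (mac_kernel \<alpha> z)" "integrable halfline (mac_kernel \<alpha> y)"
  using y by (auto intro: mac_kernel_integrable)
 fix s :: real assume "s \<in> space halfline"
 then have "y / s \<le> z / s" using y by (auto intro: divide_right_mono)
 then show "mac_kernel \<alpha> z s \<le> mac_kernel \<alpha> y s"
  unfolding mac_kernel_def by (intro mult_right_mono) auto
qed

section \<open>The decaying solution at negative energies and its boundary values\<close>

context bessel_boundary
begin

definition weyl_constant :: real where
 "weyl_constant = Gamma (1 - \<nu>) / (Gamma (1 + \<nu>) * 2 powr (2 * \<nu> + 1) * \<nu>)"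

text \<open>The constant that gives the decaying solution first boundary value 1.\<close>

definition norming :: real where "norming = 1 / (2 * Gamma (1 + \<nu>))"

text \<open>For fixed k a constant multiple of sqrt x K_\<nu>(sqrt k x), the decaying solution of
  \<tau> u = -k u.\<close>

definition M :: "real \<Rightarrow> real \<Rightarrow> real" where
 "M k x = norming * (x powr (1 / 2 - \<nu>) * mac \<nu> (k * x\<^sup>2 / 4))"

definition M' :: "real \<Rightarrow> real \<Rightarrow> real" where
 "M' k x = norming * ((1 / 2 - \<nu>) * (x powr (1 / 2 - \<nu>) / x) * mac \<nu> (k * x\<^sup>2 / 4)
   - x powr (1 / 2 - \<nu>) * (mac (\<nu> - 1) (k * x\<^sup>2 / 4) * (k * x / 2)))"

lemma norming_pos: "0 < norming" using nu by (simp add: norming_def)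
lemma weyl_constant_pos: "0 < weyl_constant" using nu by (simp add: weyl_constant_def)

lemma mac_square_derivative:
 assumes "0 < k" "0 < x"
 shows "((\<lambda>x. mac \<alpha> (k * x\<^sup>2 / 4)) has_real_derivative - mac (\<alpha> - 1) (k * x\<^sup>2 / 4) * (k * x / 2)) (at x)"
proof (rule DERIV_chain2[where f="mac \<alpha>" and g="\<lambda>x. k * x\<^sup>2 / 4"])
 show "(mac \<alpha> has_real_derivative - mac (\<alpha> - 1) (k * x\<^sup>2 / 4)) (at (k * x\<^sup>2 / 4))"
  using assms by (intro mac_derivative) simp
 show "((\<lambda>x. k * x\<^sup>2 / 4) has_real_derivative k * x / 2) (at x)"
  by (auto intro!: derivative_eq_intros)
qed

lemma powr_real_derivative: "0 < x \<Longrightarrow> ((\<lambda>x. x powr a) has_real_derivative a * (x powr a / x)) (at x)"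
 by (auto intro!: derivative_eq_intros simp: powr_diff)

lemma M_derivative:
 assumes k: "0 < k" and x: "0 < x" shows "(M k has_real_derivative M' k x) (at x)"
 unfolding M_def[abs_def] M'_def
 by (rule DERIV_cong[OF DERIV_cmult[OF DERIV_mult[OF powr_real_derivative[OF x] mac_square_derivative[OF k x]]]])
  (simp add: algebra_simps)

text \<open>Two differentiations lower the index twice; the recurrence at \<nu> - 1 eliminates the
  index \<nu> - 2, and what remains is a multiple of \<open>M\<close>.\<close>

lemma M'_derivative:
 assumes k: "0 < k" and x: "0 < x"
 shows "(M' k has_real_derivative (k + (\<nu>\<^sup>2 - 1 / 4) / x\<^sup>2) * M k x) (at x)"
proof -
 define F G H P where "F = mac \<nu> (k * x\<^sup>2 / 4)" and "G = mac (\<nu> - 1) (k * x\<^sup>2 / 4)"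
  and "H = mac (\<nu> - 1 - 1) (k * x\<^sup>2 / 4)" and "P = x powr (1 / 2 - \<nu>)"
 have rec: "F = (\<nu> - 1) * G + k * x\<^sup>2 / 4 * H"
  using mac_recurrence[of "k * x\<^sup>2 / 4" "\<nu> - 1"] k x by (simp add: F_def G_def H_def)
 have dP: "((\<lambda>x. x powr (1 / 2 - \<nu>)) has_real_derivative (1 / 2 - \<nu>) * (P / x)) (at x)"
  unfolding P_def by (rule powr_real_derivative[OF x])
 have dF: "((\<lambda>x. mac \<nu> (k * x\<^sup>2 / 4)) has_real_derivative - G * (k * x / 2)) (at x)"
  and dG: "((\<lambda>x. mac (\<nu> - 1) (k * x\<^sup>2 / 4)) has_real_derivative - H * (k * x / 2)) (at x)"
  unfolding G_def H_def by (rule mac_square_derivative[OF k x])+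
 define g Y where "g = 1 / 2 - \<nu>" and "Y = k * x\<^sup>2 / 4 * H"
 have dA: "((\<lambda>x. g * (x powr (1 / 2 - \<nu>) / x)) has_real_derivative (\<nu>\<^sup>2 - 1 / 4) / x\<^sup>2 * P) (at x)"
  by (rule DERIV_cong[OF DERIV_cmult[OF DERIV_divide[OF dP DERIV_ident]]])
   (use x in \<open>simp_all add: P_def g_def field_simps power2_eq_square\<close>)
 have "((\<lambda>x. k * x / 2) has_real_derivative k / 2) (at x)" by (auto intro!: derivative_eq_intros)
 from DERIV_mult[OF dG this]
 have dB: "((\<lambda>x. mac (\<nu> - 1) (k * x\<^sup>2 / 4) * (k * x / 2)) has_real_derivative k * (G / 2 - Y)) (at x)"
  by (rule DERIV_cong) (simp add: G_def Y_def algebra_simps power2_eq_square)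
 have d: "((\<lambda>x. norming * (g * (x powr (1 / 2 - \<nu>) / x) * mac \<nu> (k * x\<^sup>2 / 4)
   - x powr (1 / 2 - \<nu>) * (mac (\<nu> - 1) (k * x\<^sup>2 / 4) * (k * x / 2)))) has_real_derivative
   norming * (((\<nu>\<^sup>2 - 1 / 4) / x\<^sup>2 * P * F + - G * (k * x / 2) * (g * (P / x)))
    - (g * (P / x) * (G * (k * x / 2)) + k * (G / 2 - Y) * P))) (at x)"
  using DERIV_cmult[OF DERIV_diff[OF DERIV_mult[OF dA dF] DERIV_mult[OF dP dB]], of norming]
  unfolding F_def G_def P_def g_def .
 have GP: "- G * (k * x / 2) * (g * (P / x)) = - (k * P * (g / 2 * G))" "g * (P / x) * (G * (k * x / 2)) = k * P * (g / 2 * G)"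
  using x by simp_all
 have "norming * (((\<nu>\<^sup>2 - 1 / 4) / x\<^sup>2 * P * F + - (k * P * (g / 2 * G))) - (k * P * (g / 2 * G) + k * (G / 2 - Y) * P))
   = norming * ((\<nu>\<^sup>2 - 1 / 4) / x\<^sup>2 * P * F + k * P * (- (g / 2 * G) - g / 2 * G - (G / 2 - Y)))"
 proof -
  have "norming * ((q * P * F + - (k * P * a)) - (k * P * a + k * b * P)) = norming * (q * P * F + k * P * (- a - a - b))" for q a b
   by (simp add: algebra_simps)
  then show ?thesis .
 qed
 also have "- (g / 2 * G) - g / 2 * G - (G / 2 - Y) = F" unfolding rec Y_def g_def by (simp add: field_simps)
 also have "norming * ((\<nu>\<^sup>2 - 1 / 4) / x\<^sup>2 * P * F + k * P * F) = (k + (\<nu>\<^sup>2 - 1 / 4) / x\<^sup>2) * M k x"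
  unfolding M_def F_def[symmetric] P_def[symmetric] by (simp only: distrib_right mult.assoc mult.left_commute[of norming] add.commute distrib_left)
 finally show ?thesis using d unfolding GP by (simp only: M'_def[abs_def] g_def)
qed

lemma M_pos: "0 < k \<Longrightarrow> 0 < x \<Longrightarrow> 0 < M k x"
 unfolding M_def using norming_pos mac_pos[of "k * x\<^sup>2 / 4"] by simp

lemma M_continuous: "0 < k \<Longrightarrow> continuous_on {0<..} (M k)" "0 < k \<Longrightarrow> continuous_on {0<..} (M' k)"
 by (auto intro!: continuous_at_imp_continuous_on DERIV_isCont[OF M_derivative] DERIV_isCont[OF M'_derivative])

text \<open>The square is bounded by a multiple of x^(1 - 2 \<nu>) exp(-sqrt k x), which is
  integrable at 0 because \<nu> < 1.\<close>

lemma M_sq_integrable: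
 assumes k: "0 < k" shows "(\<lambda>x. complex_of_real (M k x)) \<in> sq_integrable"
proof -
 obtain K where K: "0 < K" "\<And>y. 0 < y \<Longrightarrow> mac \<nu> y \<le> K * exp (- sqrt y)" using mac_decay[OF nu(1)] by blast
 have "continuous_on {0<..} (\<lambda>x. complex_of_real (M k x))" by (intro continuous_intros M_continuous k)
 then have m: "(\<lambda>x. complex_of_real (M k x)) \<in> borel_measurable halfline"
  by (rule continuous_imp_measurable_on_sets_lebesgue) simp
 have "integrable halfline (\<lambda>x. (norming * K)\<^sup>2 * (exp (- sqrt k * x) * x powr (2 - 2 * \<nu> - 1)))"
  using nu k by (intro integrable_mult_right powr_exp_integrable) auto
 then have "integrable halfline (\<lambda>x. (cmod (complex_of_real (M k x)))\<^sup>2)"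
 proof (rule Bochner_Integration.integrable_bound)
  show "(\<lambda>x. (cmod (complex_of_real (M k x)))\<^sup>2) \<in> borel_measurable halfline" using m by measurable
  have "(M k x)\<^sup>2 \<le> (norming * K)\<^sup>2 * (exp (- sqrt k * x) * x powr (2 - 2 * \<nu> - 1))" if x: "0 < x" for x
  proof -
   have y: "0 < k * x\<^sup>2 / 4" using k x by simp
   have e: "sqrt (k * x\<^sup>2 / 4) = sqrt k * x / 2" using k x by (simp add: real_sqrt_mult real_sqrt_divide)
   then have "M k x \<le> norming * (x powr (1 / 2 - \<nu>) * (K * exp (- (sqrt k * x / 2))))"
    unfolding M_def using K(2)[OF y, unfolded e] norming_pos by (intro mult_left_mono) auto
   then have "(M k x)\<^sup>2 \<le> (norming * (x powr (1 / 2 - \<nu>) * (K * exp (- (sqrt k * x / 2)))))\<^sup>2"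
    using M_pos[OF k x] by (intro power_mono) auto
   also have "\<dots> = (norming * K)\<^sup>2 * ((exp (- (sqrt k * x / 2)))\<^sup>2 * (x powr (1 / 2 - \<nu>))\<^sup>2)"
    by (simp add: power_mult_distrib algebra_simps)
   also have "(exp (- (sqrt k * x / 2)))\<^sup>2 = exp (- sqrt k * x)" by (simp flip: exp_double)
   also have "(x powr (1 / 2 - \<nu>))\<^sup>2 = x powr (2 - 2 * \<nu> - 1)"
    unfolding power2_eq_square powr_add[symmetric] by (rule arg_cong[where f="(powr) x"]) simp
   finally show ?thesis .
  qed
  then show "AE x in halfline. norm ((cmod (complex_of_real (M k x)))\<^sup>2) \<le> norm ((norming * K)\<^sup>2 * (exp (- sqrt k * x) * x powr (2 - 2 * \<nu> - 1)))"
   by (intro AE_I2) simp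
 qed
 with m show ?thesis by (simp add: sq_integrable_def)
qed

lemma M_vector_derivative:
 assumes "0 < k" "0 < x"
 shows "((\<lambda>x. complex_of_real (M k x)) has_vector_derivative of_real (M' k x)) (at x)"
  "((\<lambda>x. complex_of_real (M' k x)) has_vector_derivative of_real ((k + (\<nu>\<^sup>2 - 1 / 4) / x\<^sup>2) * M k x)) (at x)"
 by (intro has_vector_derivative_of_real M_derivative M'_derivative assms)+

lemma M_AC_loc: "0 < k \<Longrightarrow> (\<lambda>x. complex_of_real (M k x)) \<in> AC_loc" "0 < k \<Longrightarrow> (\<lambda>x. complex_of_real (M' k x)) \<in> AC_loc"
 by (rule AC_loc_C1[OF M_vector_derivative(1)] AC_loc_C1[OF M_vector_derivative(2)];
   auto intro!: continuous_intros M_continuous)+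

lemma M_dom_max:
 assumes k: "0 < k"
 shows "(\<lambda>x. complex_of_real (M k x)) \<in> dom_max \<nu>"
  "abs_L2 (bessel_expr \<nu> (\<lambda>x. complex_of_real (M k x))) = - (of_real k *\<^sub>C abs_L2 (\<lambda>x. complex_of_real (M k x)))"
proof -
 have d: "((\<lambda>x. complex_of_real (M' k x)) has_vector_derivative of_real ((\<nu>\<^sup>2 - 1 / 4) / t\<^sup>2) * of_real (M k t) - (- of_real k) * of_real (M k t)) (at t)"
  if "0 < t" "t \<notin> {}" for t
  using M_vector_derivative(2)[OF k that(1)] by (rule has_vector_derivative_eq_rhs) (simp add: algebra_simps)
 note I = dom_maxI[OF M_vector_derivative(1)[OF k] M_AC_loc(2)[OF k] M_sq_integrable[OF k] sq_integrable_scale[OF M_sq_integrable[OF k]] negligible_empty d]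
 show "(\<lambda>x. complex_of_real (M k x)) \<in> dom_max \<nu>" by (rule I(1))
 have "abs_L2 (bessel_expr \<nu> (\<lambda>x. complex_of_real (M k x))) = (- of_real k) *\<^sub>C abs_L2 (\<lambda>x. complex_of_real (M k x))"
  unfolding scaleC_abs_L2[OF M_sq_integrable[OF k]] by (rule I(2))
 then show "abs_L2 (bessel_expr \<nu> (\<lambda>x. complex_of_real (M k x))) = - (of_real k *\<^sub>C abs_L2 (\<lambda>x. complex_of_real (M k x)))"
  by (simp add: L2.scale_minus_left)
qed

lemma square_argument_limit: "0 < k \<Longrightarrow> filterlim (\<lambda>x. k * x\<^sup>2 / 4) (at_right 0) (at_right (0::real))"
proof (rule tendsto_imp_filterlim_at_right)
 show "((\<lambda>x. k * x\<^sup>2 / 4) \<longlongrightarrow> 0) (at_right 0)" by (auto intro!: tendsto_eq_intros)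
 show "0 < k \<Longrightarrow> \<forall>\<^sub>F x in at_right 0. 0 < k * x\<^sup>2 / 4" by (rule eventually_at_right_0) simp
qed

lemma mac_square_limit:
 "0 < k \<Longrightarrow> 0 < \<alpha> \<Longrightarrow> ((\<lambda>x. mac \<alpha> (k * x\<^sup>2 / 4)) \<longlongrightarrow> Gamma \<alpha>) (at_right 0)"
 by (rule filterlim_compose[OF mac_tendsto_Gamma square_argument_limit])

text \<open>The product of \<open>w\<close> with x^(1/2 - \<nu>) is x, which cancels the factor 1/x.
  What remains tends to \<open>norming\<close> times 2 \<nu> \<Gamma>(\<nu>) = 2 \<Gamma>(1 +
  \<nu>); this fixes \<open>norming\<close>.\<close>

lemma M_bracket_phi:
 assumes k: "0 < k"
 shows "((\<lambda>x. w x * ((1 / 2 + \<nu>) / x * M k x - M' k x)) \<longlongrightarrow> 1) (at_right 0)"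
proof -
 have "((\<lambda>x. norming * (2 * \<nu> * mac \<nu> (k * x\<^sup>2 / 4) + 2 * ((k * x\<^sup>2 / 4) powr \<nu> * mac (1 - \<nu>) (k * x\<^sup>2 / 4))))
   \<longlongrightarrow> norming * (2 * \<nu> * Gamma \<nu> + 2 * (0 * Gamma (1 - \<nu>)))) (at_right 0)"
 proof (intro tendsto_intros mac_square_limit k)
  have "((\<lambda>y. y powr \<nu>) \<longlongrightarrow> 0) (at_right 0)"
   using nu by (intro tendsto_zero_powrI[where b=\<nu>] tendsto_intros) (auto intro: eventually_at_right_0)
  then show "((\<lambda>x. (k * x\<^sup>2 / 4) powr \<nu>) \<longlongrightarrow> 0) (at_right 0)"
   by (rule filterlim_compose[OF _ square_argument_limit[OF k]])
 qed (use nu in auto)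
 moreover have "norming * (2 * \<nu> * Gamma \<nu> + 2 * (0 * Gamma (1 - \<nu>))) = 1"
 proof -
  have "Gamma (\<nu> + 1) = \<nu> * Gamma \<nu>" using nu by (intro Gamma_plus1) (auto elim!: nonpos_Ints_cases)
  moreover have "Gamma \<nu> \<noteq> 0" using Gamma_real_pos[OF nu(1)] by simp
  ultimately show ?thesis using nu(1) by (simp add: norming_def add.commute)
 qed
 moreover have "\<forall>\<^sub>F x in at_right 0. norming * (2 * \<nu> * mac \<nu> (k * x\<^sup>2 / 4) + 2 * ((k * x\<^sup>2 / 4) powr \<nu> * mac (1 - \<nu>) (k * x\<^sup>2 / 4)))
   = w x * ((1 / 2 + \<nu>) / x * M k x - M' k x)"
 proof (rule eventually_at_right_0)
  fix x :: real assume x: "0 < x" "x < 1"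
  define y F where "y = k * x\<^sup>2 / 4" and "F = mac \<nu> y"
  define P where "P = x powr (1 / 2 - \<nu>)"
  have y: "0 < y" using k x by (simp add: y_def)
  \<comment> \<open>The reflection replaces the index \<nu> - 1 by the positive index 1 - \<nu>, for
    which the limit at 0 is known, and the power y^\<nu> makes the term vanish.\<close>
  have G: "y * mac (\<nu> - 1) y = y powr \<nu> * mac (1 - \<nu>) y"
   using mac_reflection[OF y, of "\<nu> - 1"] y by (simp add: powr_diff)
  have wP: "w x * P = x" using x powr_add[of x "1 / 2 + \<nu>" "1 / 2 - \<nu>"] by (simp add: w_def P_def)
  have "w x * ((1 / 2 + \<nu>) / x * M k x - M' k x)
    = norming * (w x * P) * ((1 / 2 + \<nu>) / x * F - ((1 / 2 - \<nu>) / x * F - mac (\<nu> - 1) y * (k * x / 2)))"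
   unfolding M_def M'_def y_def[symmetric] F_def[symmetric] P_def[symmetric]
   by (simp add: algebra_simps add_divide_distrib diff_divide_distrib)
  also have "\<dots> = norming * (2 * \<nu> * F + 2 * (y * mac (\<nu> - 1) y))"
   unfolding wP using x by (simp add: y_def field_simps power2_eq_square)
  finally show "norming * (2 * \<nu> * mac \<nu> (k * x\<^sup>2 / 4) + 2 * ((k * x\<^sup>2 / 4) powr \<nu> * mac (1 - \<nu>) (k * x\<^sup>2 / 4)))
   = w x * ((1 / 2 + \<nu>) / x * M k x - M' k x)"
   unfolding G by (simp add: F_def y_def)
 qed
 ultimately show ?thesis by (simp only: Lim_transform_eventually)
qed

text \<open>In the bracket with \<psi> the terms of index \<nu> cancel, and the other one, after
  reflection, tends to a multiple of \<Gamma>(1 - \<nu>) k^\<nu>. The multiple is the product of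
  1/(2 \<Gamma>(1 + \<nu>)), 1/(2 \<nu>) and 2 / 4^\<nu>: this is the origin of
  \<open>weyl_constant\<close>.\<close>

lemma M_boundary_values:
 assumes k: "0 < k"
 shows "lagrange_bracket_0 (\<lambda>x. complex_of_real (M k x)) \<phi> = 1"
  "lagrange_bracket_0 (\<lambda>x. complex_of_real (M k x)) \<psi> = of_real (weyl_constant * k powr \<nu>)"
proof -
 have f: "fderiv (\<lambda>x. complex_of_real (M k x)) x = of_real (M' k x)" if "0 < x" for x
  by (rule vector_derivative_at[OF M_vector_derivative(1)[OF k that]])
 have "((\<lambda>x. complex_of_real (w x * ((1 / 2 + \<nu>) / x * M k x - M' k x))) \<longlongrightarrow> of_real 1) (at_right 0)"
  by (intro tendsto_of_real M_bracket_phi k)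
 moreover have "\<forall>\<^sub>F x in at_right 0. complex_of_real (w x * ((1 / 2 + \<nu>) / x * M k x - M' k x)) = lagrange_bracket (\<lambda>x. complex_of_real (M k x)) \<phi> x"
  by (rule eventually_at_right_0) (simp add: lagrange_bracket_phi f)
 ultimately have "(lagrange_bracket (\<lambda>x. complex_of_real (M k x)) \<phi> \<longlongrightarrow> of_real 1) (at_right 0)"
  by (rule Lim_transform_eventually)
 then show "lagrange_bracket_0 (\<lambda>x. complex_of_real (M k x)) \<phi> = 1" by (simp add: lagrange_bracket_0I)
 define c where "c = k powr \<nu> / (Gamma (1 + \<nu>) * 2 powr (2 * \<nu> + 1) * \<nu>)"
 have "((\<lambda>x. complex_of_real (c * mac (1 - \<nu>) (k * x\<^sup>2 / 4))) \<longlongrightarrow> of_real (c * Gamma (1 - \<nu>))) (at_right 0)"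
  using nu by (intro tendsto_intros mac_square_limit k) auto
 moreover have "\<forall>\<^sub>F x in at_right 0. complex_of_real (c * mac (1 - \<nu>) (k * x\<^sup>2 / 4)) = lagrange_bracket (\<lambda>x. complex_of_real (M k x)) \<psi> x"
 proof (rule eventually_at_right_0)
  fix x :: real assume x: "0 < x" "x < 1"
  define y where "y = k * x\<^sup>2 / 4"
  define P where "P = x powr (1 / 2 - \<nu>)"
  have y: "0 < y" using k x by (simp add: y_def)
  have P': "x powr (- 1 / 2 - \<nu>) = P / x" using powr_diff[of x "1 / 2 - \<nu>" 1] x by (simp add: P_def)
  have "lagrange_bracket (\<lambda>x. complex_of_real (M k x)) \<psi> x
   = of_real (M k x * (1 / (2 * \<nu>) * ((1 / 2 - \<nu>) * (P / x))) - M' k x * (1 / (2 * \<nu>) * P))"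
   unfolding lagrange_bracket_def f[OF x(1)] vector_derivative_at[OF psi_derivative[OF x]] psi_eq[OF x] P' P_def[symmetric]
   by simp
  also have "M k x * (1 / (2 * \<nu>) * ((1 / 2 - \<nu>) * (P / x))) - M' k x * (1 / (2 * \<nu>) * P)
   = norming / (2 * \<nu>) * (P * P * (k * x / 2)) * mac (\<nu> - 1) y"
   unfolding M_def M'_def P_def[symmetric] y_def[symmetric] by (simp add: algebra_simps)
  also have "mac (\<nu> - 1) y = y powr (\<nu> - 1) * mac (1 - \<nu>) y" using mac_reflection[OF y, of "\<nu> - 1"] by simp
  also have "norming / (2 * \<nu>) * (P * P * (k * x / 2)) * (y powr (\<nu> - 1) * mac (1 - \<nu>) y) = c * mac (1 - \<nu>) y"
  proof -
   have "P * P = x / (x powr \<nu> * x powr \<nu>)"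
   proof -
    have "P = x powr (1 / 2) / x powr \<nu>" by (simp add: P_def powr_diff)
    moreover have "x powr (1 / 2) * x powr (1 / 2) = x" using x by (simp flip: powr_add)
    ultimately show ?thesis by simp
   qed
   moreover have "y powr (\<nu> - 1) = k powr \<nu> * (x powr \<nu> * x powr \<nu>) / 4 powr \<nu> / (k * x\<^sup>2 / 4)"
    using y x k by (simp add: powr_diff y_def powr_mult powr_divide power2_eq_square)
   ultimately have "P * P * (k * x / 2) * y powr (\<nu> - 1) = 2 * k powr \<nu> / 4 powr \<nu>"
    using x k by (simp add: power2_eq_square)
   moreover have "2 powr (2 * \<nu> + 1) = 2 * 4 powr \<nu>" by (simp add: powr_add powr_powr[symmetric])
   ultimately show ?thesis
    unfolding mult.assoc[symmetric] using nu by (simp add: c_def norming_def mult.assoc)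
  qed
  finally show "complex_of_real (c * mac (1 - \<nu>) (k * x\<^sup>2 / 4)) = lagrange_bracket (\<lambda>x. complex_of_real (M k x)) \<psi> x"
   by (simp add: y_def)
 qed
 ultimately have "lagrange_bracket_0 (\<lambda>x. complex_of_real (M k x)) \<psi> = of_real (c * Gamma (1 - \<nu>))"
  by (intro lagrange_bracket_0I) (rule Lim_transform_eventually)
 then show "lagrange_bracket_0 (\<lambda>x. complex_of_real (M k x)) \<psi> = of_real (weyl_constant * k powr \<nu>)"
  by (simp add: c_def weyl_constant_def)
qed

end

section \<open>A Green operator for \<tau> + 1 with the Friedrichs condition at 0\<close>

lemma primitive_differentiable_ae:
 fixes h k :: "real \<Rightarrow> complex"
 assumes k: "\<And>a b. 0 < a \<Longrightarrow> a \<le> b \<Longrightarrow> k absolutely_integrable_on {a..b} \<and> (k has_integral h b - h a) {a..b}"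
 shows "\<exists>N. negligible N \<and> (\<forall>t>0. t \<notin> N \<longrightarrow> (h has_vector_derivative k t) (at t))"
proof (rule half_line_ae)
 fix n :: nat
 show "\<exists>N. negligible N \<and> (\<forall>t\<in>{1/(real n + 2)<..<real n + 2} - N. (h has_vector_derivative k t) (at t))"
  using density_imp_FTC[of "1/(real n + 2)" "real n + 2" k h] half_line_exhaustion[of n] k by (meson less_le_trans)
qed

lemma integral_left_primitive:
 fixes k :: "real \<Rightarrow> complex"
 assumes k: "\<And>b. k absolutely_integrable_on {0<..b}" and ab: "0 < a" "a \<le> b"
 shows "k absolutely_integrable_on {a..b}" "(k has_integral integral {0<..b} k - integral {0<..a} k) {a..b}"
proof -
 show kab: "k absolutely_integrable_on {a..b}" by (rule set_integrable_subset[OF k[of b]]) (use ab in auto)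
 have "integral ({0<..a} \<union> {a..b}) k = integral {0<..a} k + integral {a..b} k"
 proof (rule Henstock_Kurzweil_Integration.integral_Un)
  show "k integrable_on {0<..a}" "k integrable_on {a..b}" using k kab by (auto simp: absolutely_integrable_on_def)
  show "negligible ({0<..a} \<inter> {a..b})" by (rule negligible_subset[of "{a}"]) auto
 qed
 moreover have "{0<..a} \<union> {a..b} = {0<..b}" using ab by auto
 ultimately have "integral {a..b} k = integral {0<..b} k - integral {0<..a} k" by simp
 then show "(k has_integral integral {0<..b} k - integral {0<..a} k) {a..b}"
  using integrable_integral[of k "{a..b}"] kab by (simp add: absolutely_integrable_on_def)
qed

lemma integral_left_tendsto_0:
 fixes k :: "real \<Rightarrow> complex"
 assumes k: "\<And>b. k absolutely_integrable_on {0<..b}"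
 shows "((\<lambda>x. integral {0<..x} k) \<longlongrightarrow> 0) (at_right 0)"
proof -
 have "((\<lambda>x. integral {0<..1} k - integral {x..1} k) \<longlongrightarrow> integral {0<..1} k - integral {0<..1} k) (at_right 0)"
  by (intro tendsto_intros tendsto_integral_at_right k)
 moreover have "\<forall>\<^sub>F x in at_right 0. integral {0<..1} k - integral {x..1} k = integral {0<..x} k"
  by (rule eventually_at_right_0) (use integral_unique[OF integral_left_primitive(2)[OF k]] in simp)
 ultimately show ?thesis by (simp only: Lim_transform_eventually diff_self)
qed

lemma integral_left_norm_le:
 fixes k :: "real \<Rightarrow> complex"
 assumes k: "\<And>b. k absolutely_integrable_on {0<..b}" and z: "\<And>t. b < t \<Longrightarrow> k t = 0"
 shows "cmod (integral {0<..x} k) \<le> integral {0<..b} (\<lambda>t. cmod (k t))"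
proof -
 have ki: "k integrable_on {0<..x}" and ni: "(\<lambda>t. cmod (k t)) integrable_on {0<..x}" for x
  using k[of x] by (auto simp: absolutely_integrable_on_def)
 have "cmod (integral {0<..x} k) \<le> integral {0<..x} (\<lambda>t. cmod (k t))"
  by (rule integral_norm_bound_integral[OF ki ni]) simp
 also have "\<dots> = integral {0<..x} (\<lambda>t. if t \<in> {0<..b} then cmod (k t) else 0)"
  using z by (intro integral_cong) force
 also have "\<dots> = integral ({0<..x} \<inter> {0<..b}) (\<lambda>t. cmod (k t))" by (simp only: Henstock_Kurzweil_Integration.integral_restrict_Int Int_commute)
 also have "\<dots> = integral {0<..min x b} (\<lambda>t. cmod (k t))" by (rule arg_cong[where f="\<lambda>S. integral S _"]) auto
 also have "\<dots> \<le> integral {0<..b} (\<lambda>t. cmod (k t))" by (intro integral_subset_le ni) auto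
 finally show ?thesis .
qed

context bessel_boundary
begin

definition q :: "real \<Rightarrow> real" where "q = M 1"
definition q' :: "real \<Rightarrow> real" where "q' = M' 1"
text \<open>Reduction of order: q Q is a second solution, with Wronskian 1. Integrating from 0
  selects the one that satisfies the Friedrichs condition at 0.\<close>

definition Q :: "real \<Rightarrow> real" where "Q x = integral {0..x} (\<lambda>t. 1 / (q t)\<^sup>2)"
definition p :: "real \<Rightarrow> real" where "p x = q x * Q x"
definition p' :: "real \<Rightarrow> real" where "p' x = q' x * Q x + 1 / q x"

lemma q_pos: "0 < x \<Longrightarrow> 0 < q x" unfolding q_def by (rule M_pos) simp_all
lemma q_derivative: "0 < x \<Longrightarrow> (q has_real_derivative q' x) (at x)"
 and q'_derivative: "0 < x \<Longrightarrow> (q' has_real_derivative (1 + (\<nu>\<^sup>2 - 1 / 4) / x\<^sup>2) * q x) (at x)"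
 unfolding q_def q'_def by (rule M_derivative M'_derivative; simp)+
lemma q_continuous: "continuous_on {0<..} q" "continuous_on {0<..} q'"
 unfolding q_def q'_def by (rule M_continuous; simp)+

text \<open>On (0, 1] the argument x^2/4 is at most 1/4, and \<open>mac\<close> is decreasing in its
  argument, so the factor beside the power lies between its value at 1/4 and the constant of
  \<open>mac_decay\<close>.\<close>

lemma q_bounds: "\<exists>m K. 0 < m \<and> 0 < K \<and> (\<forall>x. 0 < x \<longrightarrow> x \<le> 1 \<longrightarrow> m * x powr (1 / 2 - \<nu>) \<le> q x \<and> q x \<le> K * x powr (1 / 2 - \<nu>))"
proof -
 obtain K where K: "0 < K" "\<And>y. 0 < y \<Longrightarrow> mac \<nu> y \<le> K * exp (- sqrt y)" using mac_decay[OF nu(1)] by blast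
 have "norming * mac \<nu> (1 / 4) * x powr (1 / 2 - \<nu>) \<le> q x \<and> q x \<le> norming * K * x powr (1 / 2 - \<nu>)" if x: "0 < x" "x \<le> 1" for x
 proof
  have y: "0 < 1 * x\<^sup>2 / 4" "1 * x\<^sup>2 / 4 \<le> 1 / 4" using x by (auto simp: power_le_one)
  have "mac \<nu> (1 / 4) \<le> mac \<nu> (1 * x\<^sup>2 / 4)" by (rule mac_antimono[OF y])
  then have "norming * (x powr (1 / 2 - \<nu>) * mac \<nu> (1 / 4)) \<le> norming * (x powr (1 / 2 - \<nu>) * mac \<nu> (1 * x\<^sup>2 / 4))"
   using norming_pos by (intro mult_left_mono) auto
  then show "norming * mac \<nu> (1 / 4) * x powr (1 / 2 - \<nu>) \<le> q x" by (simp add: q_def M_def mult.assoc mult.commute[of "mac \<nu> _"])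
  have "K * exp (- sqrt (1 * x\<^sup>2 / 4)) \<le> K * 1" using K(1) y by (intro mult_left_mono) auto
  then have "mac \<nu> (1 * x\<^sup>2 / 4) \<le> K" using K(2)[OF y(1)] by linarith
  then have "norming * (x powr (1 / 2 - \<nu>) * mac \<nu> (1 * x\<^sup>2 / 4)) \<le> norming * (x powr (1 / 2 - \<nu>) * K)"
   using norming_pos by (intro mult_left_mono) auto
  then show "q x \<le> norming * K * x powr (1 / 2 - \<nu>)" by (simp add: q_def M_def mult.assoc mult.commute[of K])
 qed
 then show ?thesis using norming_pos K mac_pos[of "1/4" \<nu>]
  by (intro exI[of _ "norming * mac \<nu> (1 / 4)"] exI[of _ "norming * K"]) auto
qed

text \<open>As q is comparable to x^(1/2 - \<nu>) near 0, 1/q^2 is of order x^(2 \<nu> - 1), which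
  is integrable because \<nu> > 0.\<close>

lemma Q_estimate: "\<exists>c>0. \<forall>x. 0 < x \<longrightarrow> x \<le> 1 \<longrightarrow> (\<lambda>t. 1 / (q t)\<^sup>2) integrable_on {0..x} \<and> 0 \<le> Q x \<and> Q x \<le> c * x powr (2 * \<nu>)"
proof -
 obtain m K where m: "0 < m" and b: "\<forall>x. 0 < x \<longrightarrow> x \<le> 1 \<longrightarrow> m * x powr (1 / 2 - \<nu>) \<le> q x \<and> q x \<le> K * x powr (1 / 2 - \<nu>)"
  using q_bounds by blast
 have le: "1 / (q t)\<^sup>2 \<le> 1 / m\<^sup>2 * t powr (2 * \<nu> - 1)" if t: "0 < t" "t \<le> 1" for t
 proof -
  have "(m * t powr (1 / 2 - \<nu>))\<^sup>2 \<le> (q t)\<^sup>2" using b t m by (intro power_mono) auto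
  then have "1 / (q t)\<^sup>2 \<le> 1 / (m * t powr (1 / 2 - \<nu>))\<^sup>2" using m t by (intro divide_left_mono) (auto intro!: mult_pos_pos q_pos)
  also have "\<dots> = 1 / m\<^sup>2 * (1 / (t powr (1 / 2 - \<nu>) * t powr (1 / 2 - \<nu>)))" by (simp add: power2_eq_square)
  also have "1 / (t powr (1 / 2 - \<nu>) * t powr (1 / 2 - \<nu>)) = t powr (2 * \<nu> - 1)"
   unfolding powr_add[symmetric] using powr_minus_divide[of t "1 - 2 * \<nu>"] by (simp add: algebra_simps)
  finally show ?thesis .
 qed
 have "(\<lambda>t. 1 / (q t)\<^sup>2) integrable_on {0..x} \<and> 0 \<le> Q x \<and> Q x \<le> 1 / m\<^sup>2 / (2 * \<nu>) * x powr (2 * \<nu>)" if x: "0 < x" "x \<le> 1" for x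
 proof -
  have P: "((\<lambda>t. 1 / m\<^sup>2 * t powr (2 * \<nu> - 1)) has_integral 1 / m\<^sup>2 * (x powr (2 * \<nu> - 1 + 1) / (2 * \<nu> - 1 + 1))) {0..x}"
   using nu x by (intro has_integral_mult_right has_integral_powr_from_0) auto
  have "(\<lambda>t. 1 / (q t)\<^sup>2) absolutely_integrable_on {0<..x}"
  proof (rule measurable_bounded_by_integrable_imp_absolutely_integrable)
   have "continuous_on {0<..x} (\<lambda>t. 1 / (q t)\<^sup>2)"
    by (intro continuous_intros continuous_on_subset[OF q_continuous(1)]) (use q_pos in \<open>auto simp: less_imp_neq[symmetric]\<close>)
   then show "(\<lambda>t. 1 / (q t)\<^sup>2) \<in> borel_measurable (lebesgue_on {0<..x})"
    by (rule continuous_imp_measurable_on_sets_lebesgue) simp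
   show "(\<lambda>t. 1 / m\<^sup>2 * t powr (2 * \<nu> - 1)) integrable_on {0<..x}"
    by (rule integrable_spike_set[of _ "{0..x}"]) (use P in \<open>auto intro: negligible_subset[of "{0}"]\<close>)
   show "norm (1 / (q t)\<^sup>2) \<le> 1 / m\<^sup>2 * t powr (2 * \<nu> - 1)" if "t \<in> {0<..x}" for t
    using le[of t] that x by simp
  qed simp
  then have "(\<lambda>t. 1 / (q t)\<^sup>2) integrable_on {0<..x}" by (simp add: absolutely_integrable_on_def)
  then have i: "(\<lambda>t. 1 / (q t)\<^sup>2) integrable_on {0..x}"
   by (rule integrable_spike_set) (auto intro: negligible_subset[of "{0}"])
  moreover have "0 \<le> Q x" unfolding Q_def by (rule Henstock_Kurzweil_Integration.integral_nonneg[OF i]) simp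
  moreover have "Q x \<le> 1 / m\<^sup>2 * (x powr (2 * \<nu> - 1 + 1) / (2 * \<nu> - 1 + 1))"
   unfolding Q_def
  proof (rule has_integral_le[OF integrable_integral[OF i] P])
   \<comment> \<open>At t = 0 both sides are 0, by the conventions for \<open>powr\<close> at 0 and
     for division by 0.\<close>
   fix t assume "t \<in> {0..x}"
   then show "1 / (q t)\<^sup>2 \<le> 1 / m\<^sup>2 * t powr (2 * \<nu> - 1)"
    using le[of t] x by (cases "t = 0") (auto simp: q_def M_def)
  qed
  ultimately show ?thesis by simp
 qed
 then show ?thesis using m nu by (intro exI[of _ "1 / m\<^sup>2 / (2 * \<nu>)"]) auto
qed

lemma Q_derivative: assumes x: "0 < x" shows "(Q has_real_derivative 1 / (q x)\<^sup>2) (at x)"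
proof -
 define b where "b = x + 1"
 have "(\<lambda>t. 1 / (q t)\<^sup>2) integrable_on {0..1}" using Q_estimate by auto
 moreover have "(\<lambda>t. 1 / (q t)\<^sup>2) integrable_on {1..b}"
  by (intro integrable_continuous_interval continuous_intros continuous_on_subset[OF q_continuous(1)]) (use q_pos in \<open>auto simp: less_imp_neq[symmetric]\<close>)
 ultimately have i: "(\<lambda>t. 1 / (q t)\<^sup>2) integrable_on {0..b}"
  using Henstock_Kurzweil_Integration.integrable_combine[of 0 1 b] x by (auto simp: b_def)
 have "isCont (\<lambda>t. 1 / (q t)\<^sup>2) x"
  using DERIV_isCont[OF q_derivative[OF x]] q_pos[OF x] by (intro continuous_intros) auto
 then have "continuous (at x within ({0..b} - {})) (\<lambda>t. 1 / (q t)\<^sup>2)" by (rule continuous_at_imp_continuous_at_within)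
 moreover have "x \<in> {0..b} - {}" using x by (simp add: b_def)
 ultimately have "((\<lambda>u. integral {0..u} (\<lambda>t. 1 / (q t)\<^sup>2)) has_vector_derivative 1 / (q x)\<^sup>2) (at x within ({0..b} - {}))"
  by (intro integral_has_vector_derivative_continuous_at[OF i _ finite.emptyI])
 moreover have "at x within {0..b} = at x" using x by (intro at_within_interior) (auto simp: b_def)
 ultimately show ?thesis by (simp add: has_real_derivative_iff_has_vector_derivative Q_def[abs_def])
qed

lemma p_derivative: assumes x: "0 < x" shows "(p has_real_derivative p' x) (at x)"
 unfolding p_def[abs_def] p'_def
 by (rule DERIV_cong[OF DERIV_mult[OF q_derivative[OF x] Q_derivative[OF x]]])
  (use q_pos[OF x] in \<open>simp add: power2_eq_square\<close>)

lemma p'_derivative: assumes x: "0 < x" shows "(p' has_real_derivative (1 + (\<nu>\<^sup>2 - 1 / 4) / x\<^sup>2) * p x) (at x)"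
proof -
 have "((\<lambda>x. 1 / q x) has_real_derivative - (q' x / (q x)\<^sup>2)) (at x)"
  using q_pos[OF x] by (auto intro!: derivative_eq_intros q_derivative[OF x] simp: power2_eq_square)
 from DERIV_add[OF DERIV_mult[OF q'_derivative[OF x] Q_derivative[OF x]] this] show ?thesis
  unfolding p'_def[abs_def] p_def by (rule DERIV_cong) (simp add: mult.assoc)
qed

lemma wronskian: "0 < x \<Longrightarrow> p' x * q x - p x * q' x = 1"
 using q_pos[of x] by (simp add: p_def p'_def algebra_simps)

lemma p_continuous: "continuous_on {0<..} p" "continuous_on {0<..} p'"
 by (auto intro!: continuous_at_imp_continuous_on DERIV_isCont[OF p_derivative] DERIV_isCont[OF p'_derivative])

text \<open>Near 0 the product q Q is of order x^(1/2 - \<nu>) x^(2 \<nu>) = x^(1/2 + \<nu>); from 1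
  on continuity suffices.\<close>

lemma p_bounded: "\<exists>B\<ge>0. \<forall>x\<in>{0<..b}. \<bar>p x\<bar> \<le> B"
proof -
 obtain m K where K: "0 < K" and qb: "\<forall>x. 0 < x \<longrightarrow> x \<le> 1 \<longrightarrow> m * x powr (1 / 2 - \<nu>) \<le> q x \<and> q x \<le> K * x powr (1 / 2 - \<nu>)"
  using q_bounds by blast
 obtain c where c: "0 < c" and Qb: "\<forall>x. 0 < x \<longrightarrow> x \<le> 1 \<longrightarrow> (\<lambda>t. 1 / (q t)\<^sup>2) integrable_on {0..x} \<and> 0 \<le> Q x \<and> Q x \<le> c * x powr (2 * \<nu>)"
  using Q_estimate by blast
 have "compact (p ` {1..b})" by (intro compact_continuous_image continuous_on_subset[OF p_continuous(1)]) auto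
 then obtain B where B: "\<And>x. x \<in> {1..b} \<Longrightarrow> \<bar>p x\<bar> \<le> B" using compact_imp_bounded bounded_iff by (metis imageI real_norm_def)
 have "\<bar>p x\<bar> \<le> \<bar>B\<bar> + K * c" if x: "x \<in> {0<..b}" for x
 proof (cases "x \<le> 1")
  case True
  have "\<bar>p x\<bar> = q x * Q x" using q_pos[of x] Qb x True by (simp add: p_def)
  also have "\<dots> \<le> K * x powr (1 / 2 - \<nu>) * (c * x powr (2 * \<nu>))" using qb Qb x True q_pos[of x] K by (intro mult_mono) auto
  also have "\<dots> = K * c * x powr (1 / 2 + \<nu>)" by (simp add: algebra_simps flip: powr_add)
  also have "\<dots> \<le> K * c * 1" using x True nu K c by (intro mult_left_mono powr_le1) auto
  finally show ?thesis by simp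
 next
  case False
  then have "\<bar>p x\<bar> \<le> B" using B[of x] x by simp
  then show ?thesis using mult_pos_pos[OF K c] abs_ge_self[of B] by linarith
 qed
 then show ?thesis using K c by (intro exI[of _ "\<bar>B\<bar> + K * c"]) auto
qed

lemma Q_limit: "(Q \<longlongrightarrow> 0) (at_right 0)"
 and w_div_q_limit: "((\<lambda>x. w x / q x) \<longlongrightarrow> 0) (at_right 0)"
proof -
 obtain m K where m: "0 < m" and qb: "\<forall>x. 0 < x \<longrightarrow> x \<le> 1 \<longrightarrow> m * x powr (1 / 2 - \<nu>) \<le> q x \<and> q x \<le> K * x powr (1 / 2 - \<nu>)"
  using q_bounds by blast
 obtain c where c: "0 < c" and Qb: "\<forall>x. 0 < x \<longrightarrow> x \<le> 1 \<longrightarrow> (\<lambda>t. 1 / (q t)\<^sup>2) integrable_on {0..x} \<and> 0 \<le> Q x \<and> Q x \<le> c * x powr (2 * \<nu>)"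
  using Q_estimate by blast
 have l: "((\<lambda>x. a * x powr (2 * \<nu>)) \<longlongrightarrow> 0) (at_right 0)" for a
 proof -
  have "((\<lambda>x. x powr (2 * \<nu>)) \<longlongrightarrow> 0) (at_right 0)"
   using nu by (intro tendsto_zero_powrI[where b="2 * \<nu>"] tendsto_intros) (auto intro: eventually_at_right_0)
  from tendsto_mult_left[OF this, of a] show ?thesis by simp
 qed
 show "(Q \<longlongrightarrow> 0) (at_right 0)"
  by (rule Lim_null_comparison[OF eventually_at_right_0 l[of c]]) (use Qb in auto)
 show "((\<lambda>x. w x / q x) \<longlongrightarrow> 0) (at_right 0)"
 proof (rule Lim_null_comparison[OF eventually_at_right_0 l[of "1 / m"]])
  fix x :: real assume x: "0 < x" "x < 1"
  have "w x = x powr (2 * \<nu>) * x powr (1 / 2 - \<nu>)" by (simp add: w_def add.commute flip: powr_add)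
  moreover have "x powr (2 * \<nu>) * (m * x powr (1 / 2 - \<nu>)) \<le> x powr (2 * \<nu>) * q x" using qb x by (intro mult_left_mono) auto
  ultimately show "norm (w x / q x) \<le> 1 / m * x powr (2 * \<nu>)"
   using q_pos[OF x(1)] w_pos[OF x(1)] m by (simp add: field_simps)
 qed
qed

end

lemma real_C1_AC_loc:
 assumes "\<And>x. 0 < x \<Longrightarrow> (r has_real_derivative r' x) (at x)" "continuous_on {0<..} r'"
 shows "(\<lambda>x. complex_of_real (r x)) \<in> AC_loc"
 by (rule AC_loc_C1[where h'="\<lambda>x. of_real (r' x)"]) (use assms in \<open>auto intro!: has_vector_derivative_of_real continuous_intros\<close>)

context bessel_boundary
begin

text \<open>Variation of parameters: \<open>U f\<close> is q times the integral of p f from 0, plus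
  p times the integral of q f to infinity. The latter, \<open>RI\<close>, is written as the total
  integral minus a left one, so that both can be treated alike.\<close>

definition PI :: "(real \<Rightarrow> complex) \<Rightarrow> real \<Rightarrow> complex" where
 "PI f x = integral {0<..x} (\<lambda>t. of_real (p t) * f t)"
definition RI :: "(real \<Rightarrow> complex) \<Rightarrow> real \<Rightarrow> complex" where
 "RI f x = integral {0<..} (\<lambda>t. of_real (q t) * f t) - integral {0<..x} (\<lambda>t. of_real (q t) * f t)"
definition U :: "(real \<Rightarrow> complex) \<Rightarrow> real \<Rightarrow> complex" where
 "U f x = of_real (q x) * PI f x + of_real (p x) * RI f x"
definition U' :: "(real \<Rightarrow> complex) \<Rightarrow> real \<Rightarrow> complex" where
 "U' f x = of_real (q' x) * PI f x + of_real (p' x) * RI f x"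

lemma AC_loc_pq:
 "(\<lambda>x. complex_of_real (q x)) \<in> AC_loc" "(\<lambda>x. complex_of_real (q' x)) \<in> AC_loc"
 "(\<lambda>x. complex_of_real (p x)) \<in> AC_loc" "(\<lambda>x. complex_of_real (p' x)) \<in> AC_loc"
proof -
 have V: "continuous_on {0<..} (\<lambda>x. (1 + (\<nu>\<^sup>2 - 1 / 4) / x\<^sup>2) * r x)" if "continuous_on {0<..} r" for r :: "real \<Rightarrow> real"
  using that by (intro continuous_intros) auto
 show "(\<lambda>x. complex_of_real (q x)) \<in> AC_loc" by (rule real_C1_AC_loc[OF q_derivative q_continuous(2)])
 show "(\<lambda>x. complex_of_real (q' x)) \<in> AC_loc" by (rule real_C1_AC_loc[OF q'_derivative V[OF q_continuous(1)]])
 show "(\<lambda>x. complex_of_real (p x)) \<in> AC_loc" by (rule real_C1_AC_loc[OF p_derivative p_continuous(2)])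
 show "(\<lambda>x. complex_of_real (p' x)) \<in> AC_loc" by (rule real_C1_AC_loc[OF p'_derivative V[OF p_continuous(1)]])
qed

lemma pf_integrable:
 assumes f: "f \<in> sq_integrable" shows "(\<lambda>t. of_real (p t) * f t) absolutely_integrable_on {0<..b}"
proof (rule absolutely_integrable_bounded_measurable_product[OF bilinear_times])
 have "continuous_on {0<..b} (\<lambda>x. complex_of_real (p x))"
  by (intro continuous_intros continuous_on_subset[OF p_continuous(1)]) auto
 then show "(\<lambda>x. complex_of_real (p x)) \<in> borel_measurable (lebesgue_on {0<..b})"
  by (rule continuous_imp_measurable_on_sets_lebesgue) simp
 obtain B where "\<forall>x\<in>{0<..b}. \<bar>p x\<bar> \<le> B" using p_bounded by blast
 then show "bounded ((\<lambda>x. complex_of_real (p x)) ` {0<..b})" by (intro boundedI[of _ B]) auto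
 show "f absolutely_integrable_on {0<..b}" by (rule sq_integrable_near_zero[OF f])
qed simp

lemma q_sq_integrable: "(\<lambda>x. complex_of_real (q x)) \<in> sq_integrable"
 unfolding q_def by (rule M_sq_integrable) simp

lemma qf_integrable:
 assumes f: "f \<in> sq_integrable"
 shows "(\<lambda>t. of_real (q t) * f t) absolutely_integrable_on {0<..}" "(\<lambda>t. of_real (q t) * f t) absolutely_integrable_on {0<..b}"
proof -
 show *: "(\<lambda>t. of_real (q t) * f t) absolutely_integrable_on {0<..}"
  using absolutely_integrable_mult_cnj[OF f q_sq_integrable] by (simp add: mult.commute)
 show "(\<lambda>t. of_real (q t) * f t) absolutely_integrable_on {0<..b}"
  by (rule set_integrable_subset[OF *]) auto
qed

lemma PI_primitive:
 assumes f: "f \<in> sq_integrable" and ab: "0 < a" "a \<le> b"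
 shows "(\<lambda>t. of_real (p t) * f t) absolutely_integrable_on {a..b} \<and> ((\<lambda>t. of_real (p t) * f t) has_integral PI f b - PI f a) {a..b}"
 unfolding PI_def using integral_left_primitive[OF pf_integrable[OF f] ab] by blast

lemma RI_primitive:
 assumes f: "f \<in> sq_integrable" and ab: "0 < a" "a \<le> b"
 shows "(\<lambda>t. - (of_real (q t) * f t)) absolutely_integrable_on {a..b} \<and> ((\<lambda>t. - (of_real (q t) * f t)) has_integral RI f b - RI f a) {a..b}"
proof -
 note i = integral_left_primitive[OF qf_integrable(2)[OF f] ab]
 have "(\<lambda>t. - 1 * (of_real (q t) * f t)) absolutely_integrable_on {a..b}"
  using i(1) by (rule set_integrable_mult_right)
 moreover have "((\<lambda>t. - (of_real (q t) * f t)) has_integral RI f b - RI f a) {a..b}"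
  using has_integral_neg[OF i(2)] by (simp add: RI_def)
 ultimately show ?thesis by simp
qed

lemma PI_AC: "f \<in> sq_integrable \<Longrightarrow> PI f \<in> AC_loc" and RI_AC: "f \<in> sq_integrable \<Longrightarrow> RI f \<in> AC_loc"
 by (rule AC_loc_integral[OF PI_primitive] AC_loc_integral[OF RI_primitive]; assumption)+

lemma PI_RI_derivative:
 assumes f: "f \<in> sq_integrable"
 obtains N where "negligible N"
  "\<And>t. 0 < t \<Longrightarrow> t \<notin> N \<Longrightarrow> (PI f has_vector_derivative of_real (p t) * f t) (at t)"
  "\<And>t. 0 < t \<Longrightarrow> t \<notin> N \<Longrightarrow> (RI f has_vector_derivative - (of_real (q t) * f t)) (at t)"
proof -
 obtain N1 where N1: "negligible N1" "\<And>t. 0 < t \<Longrightarrow> t \<notin> N1 \<Longrightarrow> (PI f has_vector_derivative of_real (p t) * f t) (at t)"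
  using primitive_differentiable_ae[OF PI_primitive[OF f]] by blast
 obtain N2 where N2: "negligible N2" "\<And>t. 0 < t \<Longrightarrow> t \<notin> N2 \<Longrightarrow> (RI f has_vector_derivative - (of_real (q t) * f t)) (at t)"
  using primitive_differentiable_ae[OF RI_primitive[OF f]] by blast
 show thesis by (rule that[OF negligible_Un[OF N1(1) N2(1)]]) (use N1(2) N2(2) in auto)
qed

lemma U_AC: "f \<in> sq_integrable \<Longrightarrow> U f \<in> AC_loc" "f \<in> sq_integrable \<Longrightarrow> U' f \<in> AC_loc"
 unfolding U_def[abs_def] U'_def[abs_def] by (intro AC_loc_add AC_loc_mult AC_loc_pq PI_AC RI_AC; assumption)+

text \<open>The terms q p f and -p q f cancel, so \<open>U' f\<close> is the derivative off a null
  set; being continuous, it is the derivative everywhere.\<close>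

lemma U_derivative:
 assumes f: "f \<in> sq_integrable" and x: "0 < x"
 shows "(U f has_vector_derivative U' f x) (at x)"
proof -
 obtain N where N: "negligible N"
  "\<And>t. 0 < t \<Longrightarrow> t \<notin> N \<Longrightarrow> (PI f has_vector_derivative of_real (p t) * f t) (at t)"
  "\<And>t. 0 < t \<Longrightarrow> t \<notin> N \<Longrightarrow> (RI f has_vector_derivative - (of_real (q t) * f t)) (at t)" using PI_RI_derivative[OF f] by blast
 show ?thesis
 proof (rule AC_loc_fderiv_continuous[OF U_AC(1)[OF f] N(1) _ AC_loc_continuous_on[OF U_AC(2)[OF f]] x])
  fix t assume t: "0 < t" "t \<notin> N"
  have "((\<lambda>x. of_real (q x) * PI f x + of_real (p x) * RI f x) has_vector_derivative
   (of_real (q t) * (of_real (p t) * f t) + of_real (q' t) * PI f t) + (of_real (p t) * - (of_real (q t) * f t) + of_real (p' t) * RI f t)) (at t)"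
   using t by (intro has_vector_derivative_add has_vector_derivative_mult has_vector_derivative_of_real q_derivative p_derivative N)
  then have "(U f has_vector_derivative U' f t) (at t)"
   unfolding U_def[abs_def] U'_def by (rule has_vector_derivative_eq_rhs) (simp add: algebra_simps)
  then show "fderiv (U f) t = U' f t" by (rule vector_derivative_at)
 qed
qed

text \<open>The differentiated integrals contribute (q' p - p' q) f, which is -f because the
  Wronskian is 1.\<close>

lemma U'_derivative:
 assumes f: "f \<in> sq_integrable"
 obtains N where "negligible N" "\<And>t. 0 < t \<Longrightarrow> t \<notin> N \<Longrightarrow>
  (U' f has_vector_derivative of_real ((\<nu>\<^sup>2 - 1 / 4) / t\<^sup>2) * U f t - (f t - U f t)) (at t)"
proof -
 obtain N where N: "negligible N"
  "\<And>t. 0 < t \<Longrightarrow> t \<notin> N \<Longrightarrow> (PI f has_vector_derivative of_real (p t) * f t) (at t)"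
  "\<And>t. 0 < t \<Longrightarrow> t \<notin> N \<Longrightarrow> (RI f has_vector_derivative - (of_real (q t) * f t)) (at t)" using PI_RI_derivative[OF f] by blast
 show thesis
 proof (rule that[OF N(1)])
  fix t assume t: "0 < t" "t \<notin> N"
  define V where "V = (\<nu>\<^sup>2 - 1 / 4) / t\<^sup>2"
  have "((\<lambda>x. of_real (q' x) * PI f x + of_real (p' x) * RI f x) has_vector_derivative
   (of_real (q' t) * (of_real (p t) * f t) + of_real ((1 + V) * q t) * PI f t) + (of_real (p' t) * - (of_real (q t) * f t) + of_real ((1 + V) * p t) * RI f t)) (at t)"
   unfolding V_def using t by (intro has_vector_derivative_add has_vector_derivative_mult has_vector_derivative_of_real q'_derivative p'_derivative N)
  moreover have "complex_of_real (p' t) * of_real (q t) - of_real (p t) * of_real (q' t) = 1"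
   using wronskian[OF t(1)] by (simp flip: of_real_mult of_real_diff)
  then have "of_real (p' t) * of_real (q t) * f t - of_real (p t) * of_real (q' t) * f t = f t"
   by (simp flip: left_diff_distrib)
  then have "(of_real (q' t) * (of_real (p t) * f t) + of_real ((1 + V) * q t) * PI f t) + (of_real (p' t) * - (of_real (q t) * f t) + of_real ((1 + V) * p t) * RI f t)
   = of_real V * U f t - (f t - U f t)" by (simp add: U_def algebra_simps)
  ultimately show "(U' f has_vector_derivative of_real ((\<nu>\<^sup>2 - 1 / 4) / t\<^sup>2) * U f t - (f t - U f t)) (at t)"
   by (simp add: U'_def[abs_def] V_def)
 qed
qed

text \<open>Both contributions vanish at 0: \<open>PI f\<close> tends to 0 beside the bracket of q,
  which stays bounded, and the bracket of p, namely Q W - w/q, tends to 0 itself.\<close>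

lemma U_bracket:
 assumes f: "f \<in> sq_integrable" shows "lagrange_bracket_0 (U f) \<phi> = 0"
proof -
 define W where "W x = w x * ((1 / 2 + \<nu>) / x * q x - q' x)" for x
 have W: "(W \<longlongrightarrow> 1) (at_right 0)" unfolding W_def q_def q'_def by (rule M_bracket_phi) simp
 define J where "J = integral {0<..} (\<lambda>t. of_real (q t) * f t)"
 have "((\<lambda>x. PI f x * of_real (W x) + RI f x * of_real (Q x * W x - w x / q x)) \<longlongrightarrow> 0 * of_real 1 + (J - 0) * of_real (0 * 1 - 0)) (at_right 0)"
  unfolding PI_def RI_def J_def
  by (intro tendsto_intros integral_left_tendsto_0 pf_integrable[OF f] qf_integrable(2)[OF f] W Q_limit w_div_q_limit)
 moreover have "\<forall>\<^sub>F x in at_right 0. PI f x * of_real (W x) + RI f x * of_real (Q x * W x - w x / q x) = lagrange_bracket (U f) \<phi> x"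
 proof (rule eventually_at_right_0)
  fix x :: real assume x: "0 < x" "x < 1"
  have e: "Q x * W x - w x / q x = w x * ((1 / 2 + \<nu>) / x * p x - p' x)"
   by (simp add: W_def p_def p'_def algebra_simps)
  show "PI f x * of_real (W x) + RI f x * of_real (Q x * W x - w x / q x) = lagrange_bracket (U f) \<phi> x"
   unfolding lagrange_bracket_phi[OF x] vector_derivative_at[OF U_derivative[OF f x(1)]] e
   by (simp add: W_def U_def U'_def algebra_simps)
 qed
 ultimately have "(lagrange_bracket (U f) \<phi> \<longlongrightarrow> 0 * of_real 1 + (J - 0) * of_real (0 * 1 - 0)) (at_right 0)"
  by (rule Lim_transform_eventually)
 then show ?thesis by (simp add: lagrange_bracket_0I)
qed

lemma U_dom_max:
 assumes f: "f \<in> sq_integrable" and U: "U f \<in> sq_integrable"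
 shows "U f \<in> dom_max \<nu>" "abs_L2 (bessel_expr \<nu> (U f)) = abs_L2 f - abs_L2 (U f)"
proof -
 obtain N where N: "negligible N" "\<And>t. 0 < t \<Longrightarrow> t \<notin> N \<Longrightarrow>
  (U' f has_vector_derivative of_real ((\<nu>\<^sup>2 - 1 / 4) / t\<^sup>2) * U f t - (f t - U f t)) (at t)" using U'_derivative[OF f] by blast
 note I = dom_maxI[OF U_derivative[OF f] U_AC(2)[OF f] U sq_integrable_diff[OF f U] N]
 show "U f \<in> dom_max \<nu>" by (rule I(1))
 show "abs_L2 (bessel_expr \<nu> (U f)) = abs_L2 f - abs_L2 (U f)" unfolding minus_abs_L2[OF f U] by (rule I(2))
qed

text \<open>Since \<tau>(U f) = f - U f, nonnegativity bounds |U f|^2 by Re <f, U f>, and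
  Cauchy-Schwarz concludes. The bound does not depend on the support of \<open>f\<close>, which is
  what allows a truncation to be removed.\<close>

lemma U_norm_le:
 assumes f: "f \<in> sq_integrable" and U: "U f \<in> sq_integrable"
 shows "norm (abs_L2 (U f)) \<le> norm (abs_L2 f)"
proof -
 have "0 \<le> inner (abs_L2 f - abs_L2 (U f)) (abs_L2 (U f))"
  using nonneg_zero_boundary_value[OF U_dom_max(1)[OF assms] U_bracket[OF f]]
  unfolding inner_L2_def U_dom_max(2)[OF assms] .
 then have "norm (abs_L2 (U f)) * norm (abs_L2 (U f)) \<le> inner (abs_L2 f) (abs_L2 (U f))"
  by (simp add: inner_diff_left power2_norm_eq_inner[symmetric] power2_eq_square)
 also have "\<dots> \<le> norm (abs_L2 f) * norm (abs_L2 (U f))" by (rule norm_cauchy_schwarz)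
 finally show ?thesis by (cases "norm (abs_L2 (U f)) = 0") (auto simp: mult_le_cancel_right)
qed

lemma U_measurable: "f \<in> sq_integrable \<Longrightarrow> U f \<in> borel_measurable halfline"
 by (rule continuous_imp_measurable_on_sets_lebesgue[OF AC_loc_continuous_on[OF U_AC(1)]]) simp_all

lemma square_sum_le: "(a + b)\<^sup>2 \<le> 2 * a\<^sup>2 + 2 * b\<^sup>2" for a b :: real
 using zero_le_power2[of "a - b"] by (simp add: power2_diff power2_sum)

text \<open>Beyond the support \<open>RI f\<close> vanishes and \<open>U f\<close> is bounded by a
  multiple of q, which is square integrable; on (0, b] the bounds for \<open>p\<close> and
  \<open>RI f\<close> control the other term.\<close>

lemma U_sq_integrable_bounded_support:
 assumes f: "f \<in> sq_integrable" and z: "\<And>t. b < t \<Longrightarrow> f t = 0"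
 shows "U f \<in> sq_integrable"
proof -
 obtain B where B: "0 \<le> B" "\<forall>x\<in>{0<..b}. \<bar>p x\<bar> \<le> B" using p_bounded by blast
 define I where "I = integral {0<..b} (\<lambda>t. cmod (of_real (p t) * f t))"
 define J where "J = cmod (integral {0<..} (\<lambda>t. of_real (q t) * f t)) + integral {0<..b} (\<lambda>t. cmod (of_real (q t) * f t))"
 have PI: "cmod (PI f x) \<le> I" for x
  unfolding PI_def I_def by (rule integral_left_norm_le[OF pf_integrable[OF f]]) (simp add: z)
 have RI: "cmod (RI f x) \<le> J" for x
  unfolding RI_def J_def
  by (rule order_trans[OF norm_triangle_ineq4 add_left_mono[OF integral_left_norm_le[OF qf_integrable(2)[OF f]]]]) (simp add: z)
 have RI0: "RI f x = 0" if "b < x" for x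
 proof -
  have "integral {0<..} (\<lambda>t. of_real (q t) * f t) = integral {0<..} (\<lambda>t. if t \<in> {0<..x} then of_real (q t) * f t else 0)"
   using that z by (intro integral_cong) force
  also have "\<dots> = integral ({0<..} \<inter> {0<..x}) (\<lambda>t. of_real (q t) * f t)" by (simp only: Henstock_Kurzweil_Integration.integral_restrict_Int Int_commute)
  also have "{0<..} \<inter> {0<..x} = {0<..x}" by auto
  finally show ?thesis by (simp add: RI_def)
 qed
 have le: "(cmod (U f x))\<^sup>2 \<le> 2 * I\<^sup>2 * (cmod (of_real (q x)))\<^sup>2 + 2 * (B * J)\<^sup>2 * indicator {0<..b} x" if x: "0 < x" for x
 proof -
  have "cmod (of_real (q x) * PI f x) \<le> I * cmod (of_real (q x))"
   unfolding norm_mult mult.commute[of I] by (intro mult_left_mono PI norm_ge_zero)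
  moreover have "cmod (of_real (p x) * RI f x) \<le> B * J * indicator {0<..b} x"
  proof (cases "x \<le> b")
   case True
   then have "\<bar>p x\<bar> \<le> B" using B x by simp
   then have "\<bar>p x\<bar> * cmod (RI f x) \<le> B * J" using RI[of x] B by (intro mult_mono) auto
   then show ?thesis using True x by (simp add: norm_mult)
  qed (simp add: RI0)
  ultimately have "cmod (U f x) \<le> I * cmod (of_real (q x)) + B * J * indicator {0<..b} x"
   unfolding U_def by (intro order_trans[OF norm_triangle_ineq add_mono])
  then have "(cmod (U f x))\<^sup>2 \<le> (I * cmod (of_real (q x)) + B * J * indicator {0<..b} x)\<^sup>2" by (intro power_mono) auto
  also have "\<dots> \<le> 2 * (I * cmod (of_real (q x)))\<^sup>2 + 2 * (B * J * indicator {0<..b} x)\<^sup>2" by (rule square_sum_le)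
  also have "(B * J * indicator {0<..b} x)\<^sup>2 = (B * J)\<^sup>2 * indicator {0<..b} x" by (simp add: indicator_def)
  finally show ?thesis by (simp only: power_mult_distrib[of I] mult.assoc)
 qed
 have "integrable halfline (\<lambda>x. 2 * I\<^sup>2 * (cmod (complex_of_real (q x)))\<^sup>2 + 2 * (B * J)\<^sup>2 * indicator {0<..b} x)"
 proof (intro Bochner_Integration.integrable_add integrable_mult_right sq_integrableD(2) q_sq_integrable)
  have "(\<lambda>x. 1 :: real) integrable_on {0<..b}"
   by (rule integrable_spike_set[OF integrable_const_ivl[of _ 0 b]]) (auto intro: negligible_subset[of "{0}"])
  then have "(\<lambda>x. 1 :: real) absolutely_integrable_on {0<..b}" by (subst absolutely_integrable_on_iff_nonneg) auto
  moreover have "(\<lambda>x. indicat_real {0<..} x * indicat_real {0<..b} x) = indicat_real {0<..b}" by (auto simp: indicator_def)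
  ultimately show "integrable halfline (indicat_real {0<..b})"
   by (simp add: integrable_restrict_space set_integrable_def del: mult_eq_0_iff)
 qed
 then have "integrable halfline (\<lambda>x. (cmod (U f x))\<^sup>2)"
 proof (rule Bochner_Integration.integrable_bound)
  show "(\<lambda>x. (cmod (U f x))\<^sup>2) \<in> borel_measurable halfline" using U_measurable[OF f] by measurable
  show "AE x in halfline. norm ((cmod (U f x))\<^sup>2) \<le> norm (2 * I\<^sup>2 * (cmod (complex_of_real (q x)))\<^sup>2 + 2 * (B * J)\<^sup>2 * indicator {0<..b} x)"
   by (intro AE_I2) (use le in \<open>auto intro: order_trans[OF _ abs_ge_self]\<close>)
 qed
 then show ?thesis using U_measurable[OF f] by (simp add: sq_integrable_def)
qed

text \<open>Truncating the data at infinity keeps the solution square integrable, and its norm is then controlled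
 by nonnegativity; Fatou's lemma removes the truncation.\<close>

lemma U_sq_integrable:
 assumes f: "f \<in> sq_integrable" shows "U f \<in> sq_integrable"
proof -
 define g where "g n t = (if t \<le> real n then f t else 0)" for n t
 have gm: "g n \<in> borel_measurable halfline" for n
 proof -
  have "(\<lambda>t. t) \<in> borel_measurable halfline" by (rule borel_measurable_halfline) simp
  then show ?thesis unfolding g_def using sq_integrableD(1)[OF f] by measurable
 qed
 have gs: "g n \<in> sq_integrable" for n
 proof -
  have "integrable halfline (\<lambda>x. (cmod (g n x))\<^sup>2)"
  proof (rule Bochner_Integration.integrable_bound[OF sq_integrableD(2)[OF f]])
   show "(\<lambda>x. (cmod (g n x))\<^sup>2) \<in> borel_measurable halfline" using gm[of n] by measurable
  qed (simp add: g_def)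
  then show ?thesis using gm by (simp add: sq_integrable_def)
 qed
 have Ug: "U (g n) \<in> sq_integrable" for n
  by (rule U_sq_integrable_bounded_support[OF gs, of "real n"]) (simp add: g_def)
 have bound: "(\<integral>\<^sup>+ x. ennreal ((cmod (U (g n) x))\<^sup>2) \<partial>halfline) \<le> ennreal ((norm (abs_L2 f))\<^sup>2)" for n
 proof -
  have "(\<integral>\<^sup>+ x. ennreal ((cmod (U (g n) x))\<^sup>2) \<partial>halfline) = ennreal ((norm (abs_L2 (U (g n))))\<^sup>2)"
   by (rule nn_integral_abs_L2[OF Ug])
  also have "\<dots> \<le> ennreal ((norm (abs_L2 (g n)))\<^sup>2)" using U_norm_le[OF gs Ug] by (intro ennreal_leI power_mono) auto
  also have "\<dots> = (\<integral>\<^sup>+ x. ennreal ((cmod (g n x))\<^sup>2) \<partial>halfline)" by (rule nn_integral_abs_L2[OF gs, symmetric])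
  also have "\<dots> \<le> (\<integral>\<^sup>+ x. ennreal ((cmod (f x))\<^sup>2) \<partial>halfline)" by (intro nn_integral_mono ennreal_leI) (simp add: g_def)
  also have "\<dots> = ennreal ((norm (abs_L2 f))\<^sup>2)" by (rule nn_integral_abs_L2[OF f])
  finally show ?thesis .
 qed
 have J: "(\<lambda>n. integral {0<..} (\<lambda>t. of_real (q t) * g n t)) \<longlonglongrightarrow> integral {0<..} (\<lambda>t. of_real (q t) * f t)"
 proof -
  have i: "integrable halfline (\<lambda>t. of_real (q t) * h t)" if "h \<in> sq_integrable" for h
   using qf_integrable(1)[OF that] by (simp add: integrable_halfline_iff)
  have "(\<lambda>n. integral\<^sup>L halfline (\<lambda>t. of_real (q t) * g n t)) \<longlonglongrightarrow> integral\<^sup>L halfline (\<lambda>t. of_real (q t) * f t)"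
  proof (rule integral_dominated_convergence)
   show "integrable halfline (\<lambda>t. cmod (of_real (q t) * f t))" by (rule Bochner_Integration.integrable_norm[OF i[OF f]])
   show "AE t in halfline. (\<lambda>n. of_real (q t) * g n t) \<longlonglongrightarrow> of_real (q t) * f t"
   proof (intro AE_I2 tendsto_eventually)
    fix t :: real
    show "\<forall>\<^sub>F n in sequentially. of_real (q t) * g n t = of_real (q t) * f t"
     using eventually_ge_at_top[of "nat \<lceil>t\<rceil>"] by (rule eventually_mono) (simp add: g_def nat_ceiling_le_eq)
   qed
   show "AE t in halfline. norm (of_real (q t) * g n t) \<le> cmod (of_real (q t) * f t)" for n
    by (intro AE_I2) (simp add: g_def)
  qed (use borel_measurable_integrable[OF i] f gs in auto)
  then show ?thesis by (simp only: integral_halfline[OF i[OF f]] integral_halfline[OF i[OF gs]])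
 qed
 \<comment> \<open>For n \<ge> x the truncation changes no integral over (0, x], so only the total
   integral of q g varies with n.\<close>
 have lim: "(\<lambda>n. U (g n) x) \<longlonglongrightarrow> U f x" for x
 proof -
  have e: "\<forall>\<^sub>F n in sequentially. of_real (q x) * PI f x + of_real (p x) * (integral {0<..} (\<lambda>t. of_real (q t) * g n t) - integral {0<..x} (\<lambda>t. of_real (q t) * f t)) = U (g n) x"
   using eventually_ge_at_top[of "nat \<lceil>x\<rceil>"]
  proof (rule eventually_mono)
   fix n assume "nat \<lceil>x\<rceil> \<le> n"
   then have "x \<le> real n" by (simp add: nat_ceiling_le_eq)
   then have "integral {0<..x} (\<lambda>t. of_real (r t) * g n t) = integral {0<..x} (\<lambda>t. of_real (r t) * f t)" for r :: "real \<Rightarrow> real"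
    by (intro integral_cong) (simp add: g_def)
   then show "of_real (q x) * PI f x + of_real (p x) * (integral {0<..} (\<lambda>t. of_real (q t) * g n t) - integral {0<..x} (\<lambda>t. of_real (q t) * f t)) = U (g n) x"
    by (simp add: U_def PI_def RI_def)
  qed
  have "(\<lambda>n. of_real (q x) * PI f x + of_real (p x) * (integral {0<..} (\<lambda>t. of_real (q t) * g n t) - integral {0<..x} (\<lambda>t. of_real (q t) * f t))) \<longlonglongrightarrow> U f x"
   unfolding U_def RI_def by (intro tendsto_intros J)
  then show ?thesis using e by (rule Lim_transform_eventually)
 qed
 have "(\<integral>\<^sup>+ x. ennreal ((cmod (U f x))\<^sup>2) \<partial>halfline) = (\<integral>\<^sup>+ x. liminf (\<lambda>n. ennreal ((cmod (U (g n) x))\<^sup>2)) \<partial>halfline)"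
  by (intro nn_integral_cong lim_imp_Liminf[symmetric] tendsto_ennrealI tendsto_intros lim) simp
 also have "\<dots> \<le> liminf (\<lambda>n. \<integral>\<^sup>+ x. ennreal ((cmod (U (g n) x))\<^sup>2) \<partial>halfline)"
  by (rule nn_integral_liminf) (use U_measurable[OF gs] in measurable)
 also have "\<dots> \<le> ennreal ((norm (abs_L2 f))\<^sup>2)"
  using bound by (intro Liminf_le) auto
 finally have fin: "(\<integral>\<^sup>+ x. ennreal ((cmod (U f x))\<^sup>2) \<partial>halfline) < \<infinity>" by (simp add: le_less_trans)
 have "integrable halfline (\<lambda>x. (cmod (U f x))\<^sup>2)"
  by (rule integrableI_nonneg) (use fin U_measurable[OF f] in auto)
 then show ?thesis using U_measurable[OF f] by (simp add: sq_integrable_def)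
qed

end

section \<open>Negative eigenvalues and the signs of the boundary values\<close>

context boundary_triple
begin

lemma powr_less_iff_less_powr:
 fixes s t :: real
 assumes "0 \<le> s" "0 \<le> t" shows "s powr \<nu> < t \<longleftrightarrow> s < t powr (1 / \<nu>)"
proof -
 have t: "(t powr (1 / \<nu>)) powr \<nu> = t" using nu assms by (simp add: powr_powr)
 have "s powr \<nu> < (t powr (1 / \<nu>)) powr \<nu> \<longleftrightarrow> s < t powr (1 / \<nu>)"
  using powr_less_mono2[OF nu(1) assms(1), of "t powr (1 / \<nu>)"] powr_mono2[of \<nu> "t powr (1 / \<nu>)" s] nu by force
 then show ?thesis unfolding t .
qed

lemma powr_eq_iff_eq_powr:
 fixes s t :: real
 assumes "0 \<le> s" "0 \<le> t" shows "s powr \<nu> = t \<longleftrightarrow> s = t powr (1 / \<nu>)"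
 using nu assms by (auto simp: powr_powr)

lemma negative_eigenvalues_nonneg: "0 \<le> \<kappa> \<Longrightarrow> negative_eigenvalues (Tk \<kappa>) = {}"
proof -
 assume k: "0 \<le> \<kappa>"
 have "\<not> is_eigenvalue (Tk \<kappa>) (complex_of_real \<mu>)" if "\<mu> < 0" for \<mu>
 proof -
  have "0 < C * (- \<mu>) powr \<nu>" using C that by simp
  then show ?thesis using negative_eigenvalue_iff[of "- \<mu>" \<kappa>] k that by simp
 qed
 then show ?thesis by (auto simp: negative_eigenvalues_def)
qed

lemma negative_eigenvalues_neg:
 assumes k: "\<kappa> < 0" defines "e \<equiv> - ((\<bar>\<kappa>\<bar> / C) powr (1 / \<nu>))"
 shows "negative_eigenvalues (Tk \<kappa>) = {e}" "eigen_multiplicity (Tk \<kappa>) (complex_of_real e) = 1"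
proof -
 have a: "0 < \<bar>\<kappa>\<bar> / C" using k C by (intro divide_pos_pos) auto
 have e: "e < 0" using k C by (simp add: e_def)
 have *: "\<kappa> + C * (- \<mu>) powr \<nu> = 0 \<longleftrightarrow> \<mu> = e" if "\<mu> < 0" for \<mu>
 proof -
  have "\<kappa> + C * (- \<mu>) powr \<nu> = 0 \<longleftrightarrow> (- \<mu>) powr \<nu> = \<bar>\<kappa>\<bar> / C" using k C by (auto simp: field_simps)
  also have "\<dots> \<longleftrightarrow> - \<mu> = (\<bar>\<kappa>\<bar> / C) powr (1 / \<nu>)" using that a by (intro powr_eq_iff_eq_powr) auto
  finally show ?thesis by (auto simp: e_def)
 qed
 show "negative_eigenvalues (Tk \<kappa>) = {e}"
 proof (intro set_eqI)
  fix \<mu>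
  show "\<mu> \<in> negative_eigenvalues (Tk \<kappa>) \<longleftrightarrow> \<mu> \<in> {e}"
   using negative_eigenvalue_iff[of "- \<mu>" \<kappa>] *[of \<mu>] e by (auto simp: negative_eigenvalues_def)
 qed
 show "eigen_multiplicity (Tk \<kappa>) (complex_of_real e) = 1"
  using eigen_multiplicity_one[of "- e" \<kappa>] *[OF e] e by simp
qed

text \<open>For x > 0 this is \<open>Xi_fun\<close> with the common positive factor of numerator and
  denominator cancelled.\<close>

definition X :: "real \<Rightarrow> real \<Rightarrow> real" where
 "X \<kappa> x = (if Rp \<kappa> x = 0 then 0 else - (1 / pi) * arctan (Ip x / Rp \<kappa> x))"

text \<open>Where the real part is negative, minus the arctangent exceeds the argument of
  \<open>D\<close> by \<pi>, whence the -1 after division by \<pi>.\<close>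

lemma \<xi>_positive: "0 < x \<Longrightarrow> 0 < Rp \<kappa> x \<Longrightarrow> \<xi> \<kappa> x = X \<kappa> x"
 "0 < x \<Longrightarrow> Rp \<kappa> x < 0 \<Longrightarrow> \<xi> \<kappa> x = - 1 + X \<kappa> x"
 "0 < x \<Longrightarrow> Rp \<kappa> x = 0 \<Longrightarrow> \<xi> \<kappa> x = - (1 / 2)"
 by (simp_all add: \<xi>_def v_def X_def diff_divide_distrib)

lemma \<xi>_nonpositive: "x \<le> 0 \<Longrightarrow> 0 \<le> \<kappa> \<Longrightarrow> \<xi> \<kappa> x = 0"
 "x \<le> 0 \<Longrightarrow> \<kappa> < 0 \<Longrightarrow> \<xi> \<kappa> x = - indicator {- ((\<bar>\<kappa>\<bar> / C) powr (1 / \<nu>))<..} x"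
proof -
 assume x: "x \<le> 0"
 show "\<xi> \<kappa> x = 0" if "0 \<le> \<kappa>" using x that C by (simp add: \<xi>_def v_def not_less)
 assume k: "\<kappa> < 0"
 have "\<kappa> + C * \<bar>x\<bar> powr \<nu> < 0 \<longleftrightarrow> \<bar>x\<bar> powr \<nu> < \<bar>\<kappa>\<bar> / C" using k C by (auto simp: field_simps)
 also have "\<dots> \<longleftrightarrow> \<bar>x\<bar> < (\<bar>\<kappa>\<bar> / C) powr (1 / \<nu>)" using C by (intro powr_less_iff_less_powr) auto
 finally show "\<xi> \<kappa> x = - indicator {- ((\<bar>\<kappa>\<bar> / C) powr (1 / \<nu>))<..} x"
  using x by (auto simp: \<xi>_def v_def indicator_def)
qed

lemma cos_sign:
 "\<nu> < 1 / 2 \<Longrightarrow> 0 < cos (\<nu> * pi)" "\<nu> = 1 / 2 \<Longrightarrow> cos (\<nu> * pi) = 0" "1 / 2 < \<nu> \<Longrightarrow> cos (\<nu> * pi) < 0"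
proof -
 show "\<nu> < 1 / 2 \<Longrightarrow> 0 < cos (\<nu> * pi)" using nu by (intro cos_gt_zero) auto
 show "cos (\<nu> * pi) = 0" if h: "\<nu> = 1 / 2" unfolding h by simp
 assume n: "1 / 2 < \<nu>"
 have "0 < sin (\<nu> * pi - pi / 2)" using nu n by (intro sin_gt_zero) (auto simp: field_simps)
 moreover have "sin (\<nu> * pi - pi / 2) = - cos (\<nu> * pi)" by (simp add: sin_diff)
 ultimately show "cos (\<nu> * pi) < 0" by simp
qed

text \<open>Multiplying by the cosine treats both of its signs at once: when \<kappa> is zero or of
  opposite sign, the product is C cos^2(\<nu> \<pi>) times x^\<nu> - |\<kappa>| / (C |cos(\<nu>
  \<pi>)|), which changes sign at the threshold.\<close>

lemma Rp_sign:
 assumes x: "0 < x" and c: "cos (\<nu> * pi) \<noteq> 0" and s: "\<kappa> * cos (\<nu> * pi) \<le> 0"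
 defines "l \<equiv> (\<bar>\<kappa>\<bar> / (C * \<bar>cos (\<nu> * pi)\<bar>)) powr (1 / \<nu>)"
 shows "x < l \<Longrightarrow> Rp \<kappa> x * cos (\<nu> * pi) < 0" "l < x \<Longrightarrow> 0 < Rp \<kappa> x * cos (\<nu> * pi)"
proof -
 let ?c = "cos (\<nu> * pi)"
 have c2: "0 < C * ?c\<^sup>2" using C c by simp
 have "\<bar>\<kappa>\<bar> * \<bar>?c\<bar> = - (\<kappa> * ?c)" using s by (simp flip: abs_mult)
 then have e: "Rp \<kappa> x * ?c = C * ?c\<^sup>2 * (x powr \<nu> - \<bar>\<kappa>\<bar> / (C * \<bar>?c\<bar>))"
  using C c by (simp add: Rp_def power2_eq_square field_simps abs_if split: if_splits)
 have a: "0 \<le> \<bar>\<kappa>\<bar> / (C * \<bar>?c\<bar>)" using C by simp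
 show "x < l \<Longrightarrow> Rp \<kappa> x * ?c < 0"
  unfolding e l_def using powr_less_iff_less_powr[OF less_imp_le[OF x] a] c2 by (intro mult_pos_neg) auto
 assume l: "l < x"
 then have "\<not> x powr \<nu> < \<bar>\<kappa>\<bar> / (C * \<bar>?c\<bar>)" "x powr \<nu> \<noteq> \<bar>\<kappa>\<bar> / (C * \<bar>?c\<bar>)"
  using powr_less_iff_less_powr[OF less_imp_le[OF x] a] powr_eq_iff_eq_powr[OF less_imp_le[OF x] a] by (auto simp: l_def)
 then have "0 < x powr \<nu> - \<bar>\<kappa>\<bar> / (C * \<bar>?c\<bar>)" by linarith
 then show "0 < Rp \<kappa> x * ?c" unfolding e by (rule mult_pos_pos[OF c2])
qed

end

section \<open>The boundary triple of the Bessel expression, and the theorem\<close>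

context bessel_boundary
begin

definition bessel_triple :: "(L2 \<times> L2 \<times> complex \<times> complex) set" where
 "bessel_triple = {(abs_L2 g, abs_L2 (bessel_expr \<nu> g), lagrange_bracket_0 g \<phi>, lagrange_bracket_0 g \<psi>) | g. g \<in> dom_max \<nu>}"

lemma bessel_tripleI:
 "g \<in> dom_max \<nu> \<Longrightarrow> (abs_L2 g, abs_L2 (bessel_expr \<nu> g), lagrange_bracket_0 g \<phi>, lagrange_bracket_0 g \<psi>) \<in> bessel_triple"
 by (auto simp: bessel_triple_def)

lemma bessel_tripleE:
 assumes "(u, v, a, b) \<in> bessel_triple"
 obtains g where "g \<in> dom_max \<nu>" "u = abs_L2 g" "v = abs_L2 (bessel_expr \<nu> g)"
  "a = lagrange_bracket_0 g \<phi>" "b = lagrange_bracket_0 g \<psi>"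
 using assms by (auto simp: bessel_triple_def)

lemma bessel_triple_add_scaled:
 assumes "(u, v, a, b) \<in> bessel_triple" "(u', v', a', b') \<in> bessel_triple"
 shows "(u + c *\<^sub>C u', v + c *\<^sub>C v', a + c * a', b + c * b') \<in> bessel_triple"
proof -
 obtain g where g: "g \<in> dom_max \<nu>" "u = abs_L2 g" "v = abs_L2 (bessel_expr \<nu> g)"
  "a = lagrange_bracket_0 g \<phi>" "b = lagrange_bracket_0 g \<psi>" by (rule bessel_tripleE[OF assms(1)])
 obtain h where h: "h \<in> dom_max \<nu>" "u' = abs_L2 h" "v' = abs_L2 (bessel_expr \<nu> h)"
  "a' = lagrange_bracket_0 h \<phi>" "b' = lagrange_bracket_0 h \<psi>" by (rule bessel_tripleE[OF assms(2)])
 note gs = dom_maxD(2)[OF g(1)] and hs = dom_maxD(2)[OF h(1)]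
 have "abs_L2 g + c *\<^sub>C abs_L2 h = abs_L2 (\<lambda>x. g x + c * h x)"
  unfolding scaleC_abs_L2[OF hs] by (rule plus_abs_L2[OF gs sq_integrable_scale[OF hs]])
 then show ?thesis
  using bessel_tripleI[OF dom_max_add_scaled(1)[OF g(1) h(1) phi, of c]]
  by (simp only: g h dom_max_add_scaled(2,3)[OF g(1) h(1) phi] dom_max_add_scaled(3)[OF g(1) h(1) psi])
qed

lemma boundary_triple: "boundary_triple bessel_triple weyl_constant \<nu>"
proof
 fix u v a b u' v' a' b'
 assume A: "(u, v, a, b) \<in> bessel_triple"
 then obtain g where g: "g \<in> dom_max \<nu>" "u = abs_L2 g" "v = abs_L2 (bessel_expr \<nu> g)"
  "a = lagrange_bracket_0 g \<phi>" "b = lagrange_bracket_0 g \<psi>" by (rule bessel_tripleE)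
 \<comment> \<open>A multiple is the element itself plus (c - 1) times it.\<close>
 show "(c *\<^sub>C u, c *\<^sub>C v, c * a, c * b) \<in> bessel_triple" for c
  using bessel_triple_add_scaled[OF A A, of "c - 1"] by (simp add: L2.scale_left_diff_distrib left_diff_distrib)
 assume A': "(u', v', a', b') \<in> bessel_triple"
 then obtain h where h: "h \<in> dom_max \<nu>" "u' = abs_L2 h" "v' = abs_L2 (bessel_expr \<nu> h)"
  "a' = lagrange_bracket_0 h \<phi>" "b' = lagrange_bracket_0 h \<psi>" by (rule bessel_tripleE)
 show "(u + u', v + v', a + a', b + b') \<in> bessel_triple"
  using bessel_triple_add_scaled[OF A A', of 1] by simp
 show "cinner v u' - cinner u v' = a * cnj b' - b * cnj a'"
  unfolding g h lagrange_identity(2)[OF g(1) h(1)] by (rule bracket_boundary_values[OF g(1) h(1)])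
next
 fix v a b assume "(0, v, a, b) \<in> bessel_triple"
 then obtain g where g: "g \<in> dom_max \<nu>" "0 = abs_L2 g" "v = abs_L2 (bessel_expr \<nu> g)"
  "a = lagrange_bracket_0 g \<phi>" "b = lagrange_bracket_0 g \<psi>" by (rule bessel_tripleE)
 show "v = 0 \<and> a = 0 \<and> b = 0"
  unfolding g(3-5) using dom_max_ae_zero[OF g(1) g(2)[symmetric]] phi psi by simp
next
 \<comment> \<open>The zero function is obtained as \<phi> - \<phi>.\<close>
 have z: "(\<lambda>x. 0 :: complex) \<in> dom_max \<nu>" using dom_max_add_scaled(1)[OF phi phi phi, of "-1"] by simp
 have "abs_L2 (\<lambda>x. 0) = 0" by (simp add: zero_L2_def)
 then show "(0, 0, 0, 0) \<in> bessel_triple"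
  using bessel_tripleI[OF z] dom_max_ae_zero[OF z] phi psi by simp
next
 fix u v b assume "(u, v, 0, b) \<in> bessel_triple"
 then obtain g where g: "g \<in> dom_max \<nu>" "u = abs_L2 g" "v = abs_L2 (bessel_expr \<nu> g)" "0 = lagrange_bracket_0 g \<phi>"
  by (rule bessel_tripleE)
 show "0 \<le> Re (cinner v u)" unfolding g by (rule nonneg_zero_boundary_value[OF g(1) g(4)[symmetric]])
next
 fix f0 :: L2
 obtain f where f: "f \<in> sq_integrable" "f0 = abs_L2 f" using L2_rep by blast
 note U = U_dom_max[OF f(1) U_sq_integrable[OF f(1)]]
 have "(abs_L2 (U f), abs_L2 f - abs_L2 (U f), 0, lagrange_bracket_0 (U f) \<psi>) \<in> bessel_triple"
  using bessel_tripleI[OF U(1)] unfolding U(2) U_bracket[OF f(1)] .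
 then show "\<exists>u v b. (u, v, 0, b) \<in> bessel_triple \<and> v + u = f0"
  unfolding f by (intro exI conjI) (assumption, simp)
next
 fix k :: real assume k: "0 < k"
 show "\<exists>e. (e, - (complex_of_real k *\<^sub>C e), 1, complex_of_real (weyl_constant * k powr \<nu>)) \<in> bessel_triple"
  using bessel_tripleI[OF M_dom_max(1)[OF k]] unfolding M_dom_max(2)[OF k] M_boundary_values[OF k] by blast
qed (use weyl_constant_pos nu in auto)

lemma bessel_op_0: "bessel_op \<phi> \<psi> \<nu> 0 = boundary_triple.T0 bessel_triple"
proof -
 have "boundary_triple.T0 bessel_triple = {(u, v). \<exists>b. (u, v, 0, b) \<in> bessel_triple}"
  by (rule boundary_triple.T0_def[OF boundary_triple])
 then show ?thesis by (auto simp: bessel_op_def bessel_triple_def)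
qed

text \<open>The sine is positive on (0, \<pi>), and dividing by it puts the boundary condition into
  the form b = -\<kappa> a.\<close>

lemma bessel_op_eq:
 assumes "0 < \<theta>" "\<theta> < pi"
 shows "bessel_op \<phi> \<psi> \<nu> \<theta> = boundary_triple.Tk bessel_triple (cot \<theta>)"
proof -
 have s: "complex_of_real (sin \<theta>) \<noteq> 0" using sin_gt_zero[OF assms] by simp
 have iff: "complex_of_real (cos \<theta>) * a + complex_of_real (sin \<theta>) * b = 0 \<longleftrightarrow> b = - of_real (cot \<theta>) * a" for a b
 proof -
  have "cos \<theta> = cot \<theta> * sin \<theta>" using s by (simp add: cot_def)
  then have "complex_of_real (cos \<theta>) = of_real (cot \<theta>) * of_real (sin \<theta>)" by (simp only: of_real_mult)
  then have "complex_of_real (cos \<theta>) * a + complex_of_real (sin \<theta>) * b = of_real (sin \<theta>) * (of_real (cot \<theta>) * a + b)"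
   by (simp add: algebra_simps)
  then show ?thesis using s by (auto simp: add_eq_0_iff)
 qed
 have "bessel_op \<phi> \<psi> \<nu> \<theta> = {(u, v). \<exists>a. (u, v, a, - of_real (cot \<theta>) * a) \<in> bessel_triple}"
 proof (intro subset_antisym subrelI)
  fix u v assume "(u, v) \<in> bessel_op \<phi> \<psi> \<nu> \<theta>"
  then obtain g where g: "g \<in> dom_max \<nu>" "u = abs_L2 g" "v = abs_L2 (bessel_expr \<nu> g)"
   "lagrange_bracket_0 g \<psi> = - of_real (cot \<theta>) * lagrange_bracket_0 g \<phi>"
   unfolding bessel_op_def iff by blast
  show "(u, v) \<in> {(u, v). \<exists>a. (u, v, a, - of_real (cot \<theta>) * a) \<in> bessel_triple}"
   using bessel_tripleI[OF g(1)] unfolding g(2-4) by blast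
 next
  fix u v assume "(u, v) \<in> {(u, v). \<exists>a. (u, v, a, - of_real (cot \<theta>) * a) \<in> bessel_triple}"
  then obtain a where "(u, v, a, - of_real (cot \<theta>) * a) \<in> bessel_triple" by blast
  then obtain g where "g \<in> dom_max \<nu>" "u = abs_L2 g" "v = abs_L2 (bessel_expr \<nu> g)"
   "a = lagrange_bracket_0 g \<phi>" "- of_real (cot \<theta>) * a = lagrange_bracket_0 g \<psi>" by (rule bessel_tripleE)
  then show "(u, v) \<in> bessel_op \<phi> \<psi> \<nu> \<theta>" unfolding bessel_op_def iff by force
 qed
 then show ?thesis by (simp only: boundary_triple.Tk_def[OF boundary_triple])
qed

end

theorem proposition5p3:
 fixes \<theta> \<nu> :: real and \<phi> \<psi> :: "real \<Rightarrow> complex"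
 assumes "0 < \<theta>" "\<theta> < pi" and "0 < \<nu>" "\<nu> < 1"
  and "boundary_functions \<nu> \<phi> \<psi>"
 shows
  "(\<theta> \<le> pi / 2 \<and> \<nu> \<le> 1 / 2 \<and> (\<theta>, \<nu>) \<noteq> (pi / 2, 1 / 2) \<longrightarrow>
    (AE x in lborel. spectral_shift (bessel_op \<phi> \<psi> \<nu> \<theta>) (bessel_op \<phi> \<psi> \<nu> 0) x =
     indicator {0<..} x * Xi_fun \<theta> \<nu> x) \<and>
    negative_eigenvalues (bessel_op \<phi> \<psi> \<nu> \<theta>) = {}) \<and>
  (\<theta> \<le> pi / 2 \<and> 1 / 2 < \<nu> \<longrightarrow>
    (AE x in lborel. spectral_shift (bessel_op \<phi> \<psi> \<nu> \<theta>) (bessel_op \<phi> \<psi> \<nu> 0) x =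
     - indicator {lambda_val \<theta> \<nu><..} x + indicator {0<..} x * Xi_fun \<theta> \<nu> x) \<and>
    negative_eigenvalues (bessel_op \<phi> \<psi> \<nu> \<theta>) = {}) \<and>
  (pi / 2 < \<theta> \<and> \<nu> < 1 / 2 \<longrightarrow>
    (AE x in lborel. spectral_shift (bessel_op \<phi> \<psi> \<nu> \<theta>) (bessel_op \<phi> \<psi> \<nu> 0) x =
     - indicator {e_val \<theta> \<nu><..<lambda_val \<theta> \<nu>} x + indicator {0<..} x * Xi_fun \<theta> \<nu> x) \<and>
    negative_eigenvalues (bessel_op \<phi> \<psi> \<nu> \<theta>) = {e_val \<theta> \<nu>} \<and>
    eigen_multiplicity (bessel_op \<phi> \<psi> \<nu> \<theta>) (complex_of_real (e_val \<theta> \<nu>)) = 1) \<and>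
  (pi / 2 < \<theta> \<and> 1 / 2 \<le> \<nu> \<longrightarrow>
    (AE x in lborel. spectral_shift (bessel_op \<phi> \<psi> \<nu> \<theta>) (bessel_op \<phi> \<psi> \<nu> 0) x =
     - indicator {e_val \<theta> \<nu><..} x + indicator {0<..} x * Xi_fun \<theta> \<nu> x) \<and>
    negative_eigenvalues (bessel_op \<phi> \<psi> \<nu> \<theta>) = {e_val \<theta> \<nu>} \<and>
    eigen_multiplicity (bessel_op \<phi> \<psi> \<nu> \<theta>) (complex_of_real (e_val \<theta> \<nu>)) = 1) \<and>
  (\<theta> = pi / 2 \<and> \<nu> = 1 / 2 \<longrightarrow>
    (AE x in lborel. spectral_shift (bessel_op \<phi> \<psi> \<nu> \<theta>) (bessel_op \<phi> \<psi> \<nu> 0) x =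
     - (1 / 2) * indicator {0<..} x) \<and>
    negative_eigenvalues (bessel_op \<phi> \<psi> \<nu> \<theta>) = {})"
proof -
 interpret B: bessel_boundary \<nu> \<phi> \<psi> by standard (fact assms)+
 interpret T: boundary_triple B.bessel_triple B.weyl_constant \<nu> by (rule B.boundary_triple)
 let ?C = B.weyl_constant
 define \<kappa> c where "\<kappa> = cot \<theta>" and "c = cos (\<nu> * pi)"
 \<comment> \<open>The denominator of \<open>weyl_constant\<close>; multiplying \<open>Rp\<close>
   and \<open>Ip\<close> by it gives the quantities in \<open>D_fun\<close> and
   \<open>Xi_fun\<close>.\<close>
 define K where "K = Gamma (1 + \<nu>) * 2 powr (2 * \<nu> + 1) * \<nu>"
 have K: "0 < K" using assms by (simp add: K_def)
 have G: "0 < Gamma (1 - \<nu>)" using assms by simp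
 have C: "?C = Gamma (1 - \<nu>) / K" by (simp add: B.weyl_constant_def K_def)
 have C0: "0 < ?C" unfolding C using K G by simp
 have op: "bessel_op \<phi> \<psi> \<nu> \<theta> = T.Tk \<kappa>" "bessel_op \<phi> \<psi> \<nu> 0 = T.T0"
  unfolding \<kappa>_def by (rule B.bessel_op_eq[OF assms(1,2)], rule B.bessel_op_0)
 have e: "e_val \<theta> \<nu> = - ((\<bar>\<kappa>\<bar> / ?C) powr (1 / \<nu>))"
  unfolding e_val_def \<kappa>_def C K_def by (simp add: mult.commute)
 have l: "lambda_val \<theta> \<nu> = (\<bar>\<kappa>\<bar> / (?C * \<bar>c\<bar>)) powr (1 / \<nu>)"
  unfolding lambda_val_def \<kappa>_def C K_def c_def by (simp add: mult.commute mult.left_commute)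
 have l0: "0 \<le> lambda_val \<theta> \<nu>" unfolding l by simp
 have e0: "e_val \<theta> \<nu> \<le> 0" unfolding e by simp
 have X: "Xi_fun \<theta> \<nu> x = T.X \<kappa> x" if x: "0 < x" for x
 proof -
  have KC: "K * ?C = Gamma (1 - \<nu>)" unfolding C using K by simp
  have "D_fun \<theta> \<nu> x = K * \<kappa> + (K * ?C) * cos (\<nu> * pi) * \<bar>x\<bar> powr \<nu>"
   unfolding KC by (simp add: D_fun_def K_def \<kappa>_def)
  then have "D_fun \<theta> \<nu> x = K * T.Rp \<kappa> x"
   using x unfolding T.Rp_def by (simp add: algebra_simps)
  moreover have "Gamma (1 - \<nu>) * sin (\<nu> * pi) * \<bar>x\<bar> powr \<nu> = K * T.Ip x"
   unfolding KC[symmetric] T.Ip_def using x by simp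
  ultimately show ?thesis using K by (simp add: Xi_fun_def T.X_def)
 qed
 \<comment> \<open>Where the real part changes sign at \<lambda> > 0 the claimed formula differs
   from \<xi> at that point, where \<xi> is -1/2; a single point is negligible.\<close>
 have shift: "AE x in lborel. spectral_shift (T.Tk \<kappa>) T.T0 x = g x"
  if g: "\<And>x. x \<noteq> lambda_val \<theta> \<nu> \<Longrightarrow> T.\<xi> \<kappa> x = g x" for g
 proof -
  have "AE x in lborel. x \<notin> {lambda_val \<theta> \<nu>}" by (rule AE_not_in) (auto intro: finite_imp_null_set_lborel)
  with T.spectral_shift_eq[of \<kappa>] show ?thesis by eventually_elim (simp add: g)
 qed
 have k_pos: "0 \<le> \<kappa>" if "\<theta> \<le> pi / 2"
  using that assms sin_gt_zero[OF assms(1,2)] cos_ge_zero[of \<theta>] by (simp add: \<kappa>_def cot_def)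
 have k_pos': "0 < \<kappa>" if "\<theta> < pi / 2"
  using that assms sin_gt_zero[OF assms(1,2)] cos_gt_zero[of \<theta>] by (simp add: \<kappa>_def cot_def)
 have k_neg: "\<kappa> < 0" if "pi / 2 < \<theta>"
 proof -
  have "cos \<theta> < 0" using that assms cos_gt_zero[of "pi - \<theta>"] by simp
  then show ?thesis using sin_gt_zero[OF assms(1,2)] by (simp add: \<kappa>_def cot_def divide_neg_pos)
 qed
 have c_nonneg: "0 \<le> c" if n: "\<nu> \<le> 1 / 2"
 proof (cases "\<nu> = 1 / 2")
  case False
  then have "\<nu> < 1 / 2" using n by linarith
  from T.cos_sign(1)[OF this] show ?thesis by (simp add: c_def)
 qed (unfold c_def, rule eq_refl[OF T.cos_sign(2)[symmetric]])
 have c_nonpos: "c \<le> 0" if n: "1 / 2 \<le> \<nu>"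
 proof (cases "\<nu> = 1 / 2")
  case False
  then have "1 / 2 < \<nu>" using n by linarith
  from T.cos_sign(3)[OF this] show ?thesis by (simp add: c_def)
 qed (unfold c_def, rule eq_refl[OF T.cos_sign(2)])
 note R = T.Rp_sign[of _ \<kappa>, folded c_def, folded l]
 note neg = T.\<xi>_nonpositive[of _ \<kappa>, folded e]
 note eig = T.negative_eigenvalues_neg[of \<kappa>, folded e]
 show ?thesis
  unfolding op
 proof (intro conjI impI)
  assume h: "\<theta> \<le> pi / 2 \<and> \<nu> \<le> 1 / 2 \<and> (\<theta>, \<nu>) \<noteq> (pi / 2, 1 / 2)"
  have c: "0 \<le> c" using h c_nonneg by simp
  \<comment> \<open>Excluding the pair (\<pi>/2, 1/2) leaves at least one of the two terms of
    \<open>Rp\<close> positive.\<close>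
  have pos: "0 < \<kappa> \<or> 0 < c" using h k_pos' T.cos_sign(1) by (auto simp: c_def less_le)
  show "AE x in lborel. spectral_shift (T.Tk \<kappa>) T.T0 x = indicator {0<..} x * Xi_fun \<theta> \<nu> x"
  proof (rule shift)
   fix x
   show "T.\<xi> \<kappa> x = indicator {0<..} x * Xi_fun \<theta> \<nu> x"
   proof (cases "0 < x")
    case True
    have "0 < ?C * x powr \<nu>" using C0 True by simp
    then have "0 < T.Rp \<kappa> x"
     using pos c k_pos h unfolding T.Rp_def c_def[symmetric]
     by (auto intro: add_pos_nonneg add_nonneg_pos)
    then show ?thesis using True by (simp add: T.\<xi>_positive X)
   qed (use neg k_pos h in simp)
  qed
  show "negative_eigenvalues (T.Tk \<kappa>) = {}" using T.negative_eigenvalues_nonneg k_pos h by simp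
 next
  assume h: "\<theta> \<le> pi / 2 \<and> 1 / 2 < \<nu>"
  have c: "c < 0" using h T.cos_sign by (auto simp: c_def)
  have s: "\<kappa> * c \<le> 0" using c k_pos h by (simp add: mult_nonneg_nonpos)
  show "AE x in lborel. spectral_shift (T.Tk \<kappa>) T.T0 x = - indicator {lambda_val \<theta> \<nu><..} x + indicator {0<..} x * Xi_fun \<theta> \<nu> x"
  proof (rule shift)
   fix x assume x: "x \<noteq> lambda_val \<theta> \<nu>"
   show "T.\<xi> \<kappa> x = - indicator {lambda_val \<theta> \<nu><..} x + indicator {0<..} x * Xi_fun \<theta> \<nu> x"
   proof (cases "0 < x")
    case True
    show ?thesis
    \<comment> \<open>For \<theta> = \<pi>/2 the threshold \<lambda> is 0 and only the second case
      occurs.\<close>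
    proof (cases "x < lambda_val \<theta> \<nu>")
     case l: True
     have "0 < T.Rp \<kappa> x" using R(1)[OF True _ s l] c by (simp add: mult_less_0_iff)
     then show ?thesis using True l by (simp add: T.\<xi>_positive X)
    next
     case False
     then have l: "lambda_val \<theta> \<nu> < x" using x by simp
     have "T.Rp \<kappa> x < 0" using R(2)[OF True _ s l] c by (simp add: zero_less_mult_iff)
     then show ?thesis using True l by (simp add: T.\<xi>_positive X)
    qed
   qed (use neg k_pos h l0 in simp)
  qed
  show "negative_eigenvalues (T.Tk \<kappa>) = {}" using T.negative_eigenvalues_nonneg k_pos h by simp
 next
  assume h: "pi / 2 < \<theta> \<and> \<nu> < 1 / 2"
  have c: "0 < c" using h T.cos_sign by (auto simp: c_def)
  have k: "\<kappa> < 0" using k_neg h by simp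
  have s: "\<kappa> * c \<le> 0" using c k by (simp add: mult_nonpos_nonneg)
  \<comment> \<open>On x \<le> 0 the indicator of (e, \<lambda>) then agrees with that of (e,
    \<infinity>).\<close>
  have l1: "0 < lambda_val \<theta> \<nu>" unfolding l using k c C0 by simp
  show "AE x in lborel. spectral_shift (T.Tk \<kappa>) T.T0 x = - indicator {e_val \<theta> \<nu><..<lambda_val \<theta> \<nu>} x + indicator {0<..} x * Xi_fun \<theta> \<nu> x"
  proof (rule shift)
   fix x assume x: "x \<noteq> lambda_val \<theta> \<nu>"
   show "T.\<xi> \<kappa> x = - indicator {e_val \<theta> \<nu><..<lambda_val \<theta> \<nu>} x + indicator {0<..} x * Xi_fun \<theta> \<nu> x"
   proof (cases "0 < x")
    case True
    show ?thesis
    proof (cases "x < lambda_val \<theta> \<nu>")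
     case l: True
     have "T.Rp \<kappa> x < 0" using R(1)[OF True _ s l] c by (simp add: mult_less_0_iff)
     then show ?thesis using True l e0 by (simp add: T.\<xi>_positive X)
    next
     case False
     then have l: "lambda_val \<theta> \<nu> < x" using x by simp
     have "0 < T.Rp \<kappa> x" using R(2)[OF True _ s l] c by (simp add: zero_less_mult_iff)
     then show ?thesis using True l by (simp add: T.\<xi>_positive X)
    qed
   qed (use neg k l1 in \<open>simp add: indicator_def\<close>)
  qed
  show "negative_eigenvalues (T.Tk \<kappa>) = {e_val \<theta> \<nu>}" "eigen_multiplicity (T.Tk \<kappa>) (complex_of_real (e_val \<theta> \<nu>)) = 1"
   by (rule eig[OF k])+
 next
  assume h: "pi / 2 < \<theta> \<and> 1 / 2 \<le> \<nu>"
  have c: "c \<le> 0" using h c_nonpos by simp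
  have k: "\<kappa> < 0" using k_neg h by simp
  show "AE x in lborel. spectral_shift (T.Tk \<kappa>) T.T0 x = - indicator {e_val \<theta> \<nu><..} x + indicator {0<..} x * Xi_fun \<theta> \<nu> x"
  proof (rule shift)
   fix x
   show "T.\<xi> \<kappa> x = - indicator {e_val \<theta> \<nu><..} x + indicator {0<..} x * Xi_fun \<theta> \<nu> x"
   proof (cases "0 < x")
    case True
    \<comment> \<open>Here both terms of the real part are nonpositive and \<kappa> is negative, so
      the step that begins at the eigenvalue never ends.\<close>
    have "T.Rp \<kappa> x < 0"
     using k c C0 unfolding T.Rp_def c_def[symmetric]
     by (intro add_neg_nonpos mult_nonneg_nonpos) auto
    then show ?thesis using True e0 by (simp add: T.\<xi>_positive X)
   qed (use neg k in simp)
  qed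
  show "negative_eigenvalues (T.Tk \<kappa>) = {e_val \<theta> \<nu>}" "eigen_multiplicity (T.Tk \<kappa>) (complex_of_real (e_val \<theta> \<nu>)) = 1"
   by (rule eig[OF k])+
 next
  assume h: "\<theta> = pi / 2 \<and> \<nu> = 1 / 2"
  then have "\<theta> = pi / 2" and c: "c = 0" using c_nonneg c_nonpos by (auto intro: antisym)
  then have k: "\<kappa> = 0" by (simp only: \<kappa>_def cot_def cos_pi_half div_0)
  show "AE x in lborel. spectral_shift (T.Tk \<kappa>) T.T0 x = - (1 / 2) * indicator {0<..} x"
  proof (rule shift)
   fix x
   show "T.\<xi> \<kappa> x = - (1 / 2) * indicator {0<..} x"
   proof (cases "0 < x")
    case True
    \<comment> \<open>Both terms vanish: the boundary value of \<open>D\<close> is purely imaginary,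
      with argument -\<pi>/2.\<close>
    have "T.Rp \<kappa> x = 0" unfolding T.Rp_def c_def[symmetric] using k c by simp
    then show ?thesis using True by (simp add: T.\<xi>_positive)
   qed (use neg k in simp)
  qed
  show "negative_eigenvalues (T.Tk \<kappa>) = {}" using T.negative_eigenvalues_nonneg k by simp
 qed
qed

end
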